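(* Let $\Gamma$ denote the graded $S$-algebra $T\oplus\mathcal N$ where $\Lambda\to S$ and $S\to T$ are (ungraded) ring homomorphisms and $\mathcal N$ is a $T$-module. Consider the transitivity long exact sequence of $S\to T\xrightarrow{i}\Gamma$: $$\cdots\xrightarrow{\partial}\mathrm{Ext}^1_T(\mathcal N,\Omega_{S/\Lambda}\otimes_S\mathcal N)\xrightarrow{u}{}_0\mathrm H^1(S,\Gamma,\Omega_{S/\Lambda}\otimes_S\Gamma)\xrightarrow{i^*}\mathrm H^1(S,T,\Omega_{S/\Lambda}\otimes_ST)\xrightarrow{\partial}\cdots$$ (i) The map $i^*$ takes the Kodaira-Spencer class $\kappa(\Gamma/S/\Lambda)$ to $\kappa(T/S/\Lambda)$. (ii) Assume $\kappa(T/S/\Lambda)=0$ and choose an $S$-algebra splitting $\sigma:T\to\mathcal P_{S/\Lambda}\otimes_ST$. There is an element $$\kappa(\sigma,\mathcal N)\in\mathrm{Ext}^1_T(\mathcal N,\Omega_{S/\Lambda}\otimes_S\mathcal N),$$ appropriately natural in $(T/S/\Lambda,\sigma,\mathcal N)$, which $u$ maps to $\kappa(\Gamma/S/\Lambda)$. Moreover, $\kappa(\sigma,\mathcal N)$ is represented by the degree $1$ part $$0\to\Omega_{S/\Lambda}\otimes_S\mathcal N\to\mathcal P_{S/\Lambda}\otimes_S\mathcal N\to\mathcal N\to0$$ of the algebra extension $0\to\Omega_{S/\Lambda}\otimes_S\Gamma\to\mathcal P_{S/\Lambda}\otimes_S\Gamma\to\Gamma\to0$, considered as a short exact sequence of $T$-modules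 via $\sigma$. (iii) Let $D(\sigma)$ in $\mathrm{Der}_\Lambda(T,\Omega_{S/\Lambda}\otimes_ST)$ be the derivation induced by $\sigma$ and $f^{D(\sigma)}$ in $\mathrm{Hom}_T(\Omega_{T/\Lambda},\Omega_{S/\Lambda}\otimes_ST)$ the corresponding homomorphism. Then $$\kappa(\sigma,\mathcal N)=(f^{D(\sigma)}\otimes\mathrm{id}_{\mathcal N})_*\,\mathrm{at}_{T/\Lambda}(\mathcal N).$$ For each $Y\in\mathrm{Der}_\Lambda(S)$ let $X_\sigma(Y)$ denote $(f^Y\otimes\mathrm{id}_T)_*D(\sigma)\in\mathrm{Der}_\Lambda(T)$. Then $$(f^Y\otimes\mathrm{id}_{\mathcal N})_*\kappa(\sigma,\mathcal N)=(f^{X_\sigma(Y)}\otimes\mathrm{id}_{\mathcal N})_*\,\mathrm{at}_{T/\Lambda}(\mathcal N)\quad\text{in }\mathrm{Ext}^1_T(\mathcal N,\mathcal N).$$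
   Context: Rings are commutative. $\Gamma=T\oplus\mathcal N$ has $T$ in degree $0$, $\mathcal N$ in degree $1$ and $\mathcal N^2=0$. ${}_0\mathrm H^i(S,\Gamma,J)=\mathrm H^i\,\mathrm{Hom}^{\mathrm{gr}}_\Gamma(L^{\mathrm{gr}}_{\Gamma/S},J)$ is graded André-Quillen cohomology (degree $0$ homomorphisms from the graded cotangent complex $L^{\mathrm{gr}}_{\Gamma/S}=\Omega_{P/S}\otimes_P\Gamma$, $P$ a graded simplicial degree-wise free $S$-algebra resolution of $\Gamma$); $\mathrm H^i(S,T,-)$ is the ungraded version. ${}_0\mathrm H^1(S,\Gamma,J)$ classifies graded square-zero $S$-algebra extensions of $\Gamma$ by $J$. The long exact sequence is the one associated with the triangle $L^{\mathrm{gr}}_{T/S}\otimes_T\Gamma\to L^{\mathrm{gr}}_{\Gamma/S}\to L^{\mathrm{gr}}_{\Gamma/T}\to$, using for a graded $\Gamma$-module $J=J_0\oplus J_1$ the identifications of the cohomology of $\mathrm{Hom}^{\mathrm{gr}}_\Gamma(L^{\mathrm{gr}}_{\Gamma/T},J)$ with $\mathrm{Ext}^*_T(\mathcal N,J_1)$ and of $\mathrm{Hom}^{\mathrm{gr}}_\Gamma(L^{\mathrm{gr}}_{T/S}\otimes_T\Gamma,J)$ with $\mathrm H^*(S,T,J_0)$. Principal parts. $\mathcal P_{S/\Lambda}=S\otimes_\Lambda S/I^2$ where $I$ is the kernel of multiplication $S\otimes_\Lambda S\to S$; $j_1(s)=s\otimes1$, $j_2(s)=1\otimes s$; $\Omega_{S/\Lambda}=I/I^2$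 with universal derivation $d_{S/\Lambda}$ induced by $j_2-j_1$; $\gamma_{S/\Lambda}:\Omega_{S/\Lambda}\to\mathcal P_{S/\Lambda}$ is the inclusion. In $\mathcal P_{S/\Lambda}\otimes_S\Gamma$ the tensor product is formed via $j_2$ and the $S$-algebra structure is via $j_1$. The Kodaira-Spencer class $\kappa(\Gamma/S/\Lambda)\in{}_0\mathrm H^1(S,\Gamma,\Omega_{S/\Lambda}\otimes_S\Gamma)$ is the class of the $S$-algebra extension $$0\to\Omega_{S/\Lambda}\otimes_S\Gamma\xrightarrow{\gamma_{S/\Lambda}\otimes\mathrm{id}}\mathcal P_{S/\Lambda}\otimes_S\Gamma\to\Gamma\to0$$ (equivalently, it is induced by the transitivity map $L^{\mathrm{gr}}_{\Gamma/S}\to L_{S/\Lambda}\otimes_S\Gamma[1]$ followed by the augmentation to $\Omega_{S/\Lambda}\otimes_S\Gamma[1]$). $\kappa(T/S/\Lambda)\in\mathrm H^1(S,T,\Omega_{S/\Lambda}\otimes_ST)$ is the class of the analogous extension with $T$ in place of $\Gamma$; it vanishes iff $\mathcal P_{S/\Lambda}\otimes_ST\to T$ has an $S$-algebra section $\sigma$ (an $S$-algebra splitting). The derivation $D(\sigma)$ induced by $\sigma$ is determined by $(\gamma_{S/\Lambda}\otimes\mathrm{id}_T)D(\sigma)(t)=1\otimes t-\sigma(t)$. The Atiyah class $\mathrm{at}_{T/\Lambda}(\mathcal N)\in\mathrm{Ext}^1_T(\mathcal N,\Omega_{T/\Lambda}\otimes_T\mathcal N)$ is the class of $0\to\Omega_{T/\Lambda}\otimes_T\mathcal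 N\to\mathcal P_{T/\Lambda}\otimes_T\mathcal N\to\mathcal N\to0$, with $\mathcal P_{T/\Lambda}\otimes_T\mathcal N$ formed via $j_2$ and a $T$-module via $j_1$. For a derivation $D$, $f^D$ denotes the corresponding linear map from the module of Kähler differentials; e.g. $f^Y:\Omega_{S/\Lambda}\to S$ for $Y\in\mathrm{Der}_\Lambda(S)=\mathrm{Der}_\Lambda(S,S)$. *)

theory Defs
  imports "HOL-Library.Multiset" "HOL-Algebra.Module" "HOL-Algebra.QuotRing" "HOL-Algebra.Ideal_Product"
    "HOL-Algebra.Generated_Groups" "HOL-Algebra.Free_Abelian_Groups"
begin

section \<open>Modules, algebras and gradings\<close>

text \<open>
  A graded algebra or graded module is a \<open>module\<close> record together with its homogeneous parts
  \<open>dpart\<close>, indexed by the integers. Ungraded objects are graded ones concentrated in degree 0.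
\<close>

record ('r, 'a) galg = "('r, 'a) module" +
  dpart :: "int \<Rightarrow> 'a set"

definition modl :: "('b, 'z) ring_scheme \<Rightarrow> ('a \<Rightarrow> 'b \<Rightarrow> 'b) \<Rightarrow> ('a, 'b) module" where
  "modl M act = \<lparr>carrier = carrier M, monoid.mult = monoid.mult M, one = one M, ring.zero = ring.zero M, add = add M,
     smult = act\<rparr>"

definition gmodl ::
  "('b, 'z) ring_scheme \<Rightarrow> ('a \<Rightarrow> 'b \<Rightarrow> 'b) \<Rightarrow> (int \<Rightarrow> 'b set) \<Rightarrow> ('a, 'b) galg" where
  "gmodl M act gr = \<lparr>carrier = carrier M, monoid.mult = monoid.mult M, one = one M, ring.zero = ring.zero M, add = add M,
     smult = act, dpart = gr\<rparr>"

definition restr_scalars :: "('r \<Rightarrow> 'a) \<Rightarrow> ('a, 'b, 'z) module_scheme \<Rightarrow> ('r, 'b) module" where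
  "restr_scalars h M = modl M (\<lambda>r x. h r \<odot>\<^bsub>M\<^esub> x)"

text \<open>The ring \<open>A\<close> as an algebra via the ring homomorphism \<open>h\<close>.\<close>

definition alg :: "('r \<Rightarrow> 'a) \<Rightarrow> ('a, 'z) ring_scheme \<Rightarrow> ('r, 'a) module" where
  "alg h A = modl A (\<lambda>r x. h r \<otimes>\<^bsub>A\<^esub> x)"

definition ungr :: "('r, 'a, 'z) module_scheme \<Rightarrow> ('r, 'a) galg" where
  "ungr A = gmodl A (smult A) (\<lambda>k. if k = 0 then carrier A else {\<zero>\<^bsub>A\<^esub>})"

definition aspan :: "('a, 'z) ring_scheme \<Rightarrow> 'a set \<Rightarrow> 'a set" where
  "aspan M X = generate (add_monoid M) X"

definition is_grading :: "('a, 'z) ring_scheme \<Rightarrow> (int \<Rightarrow> 'a set) \<Rightarrow> bool" where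
  "is_grading M gr \<longleftrightarrow>
     (\<forall>k. subgroup (gr k) (add_monoid M)) \<and>
     (\<forall>x\<in>carrier M. \<exists>!c :: int \<Rightarrow> 'a. (\<forall>k. c k \<in> gr k) \<and> finite {k. c k \<noteq> \<zero>\<^bsub>M\<^esub>} \<and>
        x = (\<Oplus>\<^bsub>M\<^esub>k\<in>{k. c k \<noteq> \<zero>\<^bsub>M\<^esub>}. c k))"

definition graded_algebra :: "('r, 'y) ring_scheme \<Rightarrow> ('r, 'a) galg \<Rightarrow> bool" where
  "graded_algebra R A \<longleftrightarrow> algebra R A \<and> is_grading A (dpart A) \<and> \<one>\<^bsub>A\<^esub> \<in> dpart A 0 \<and>
     (\<forall>k m. \<forall>x\<in>dpart A k. \<forall>y\<in>dpart A m. x \<otimes>\<^bsub>A\<^esub> y \<in> dpart A (k + m)) \<and>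
     (\<forall>k. \<forall>r\<in>carrier R. \<forall>x\<in>dpart A k. r \<odot>\<^bsub>A\<^esub> x \<in> dpart A k)"

definition linear ::
  "('r, 'y) ring_scheme \<Rightarrow> ('r, 'a, 'u) module_scheme \<Rightarrow> ('r, 'b, 'v) module_scheme \<Rightarrow>
   ('a \<Rightarrow> 'b) \<Rightarrow> bool" where
  "linear R M N f \<longleftrightarrow> f \<in> carrier M \<rightarrow> carrier N \<and>
     (\<forall>x\<in>carrier M. \<forall>y\<in>carrier M. f (x \<oplus>\<^bsub>M\<^esub> y) = f x \<oplus>\<^bsub>N\<^esub> f y) \<and>
     (\<forall>r\<in>carrier R. \<forall>x\<in>carrier M. f (r \<odot>\<^bsub>M\<^esub> x) = r \<odot>\<^bsub>N\<^esub> f x)"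

text \<open>Elements of Hom are extensional functions, so that equality of functions is equality in Hom.\<close>

definition linmaps ::
  "('r, 'y) ring_scheme \<Rightarrow> ('r, 'a, 'u) module_scheme \<Rightarrow> ('r, 'b, 'v) module_scheme \<Rightarrow>
   ('a \<Rightarrow> 'b) set" where
  "linmaps R M N = {f \<in> extensional (carrier M). linear R M N f}"

definition glinmaps ::
  "('r, 'y) ring_scheme \<Rightarrow> ('r, 'a) galg \<Rightarrow> ('r, 'b) galg \<Rightarrow> ('a \<Rightarrow> 'b) set" where
  "glinmaps R M N = {f \<in> linmaps R M N. \<forall>k. f ` dpart M k \<subseteq> dpart N k}"

definition alg_hom ::
  "('r, 'y) ring_scheme \<Rightarrow> ('r, 'a, 'u) module_scheme \<Rightarrow> ('r, 'b, 'v) module_scheme \<Rightarrow>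
   ('a \<Rightarrow> 'b) \<Rightarrow> bool" where
  "alg_hom R A B f \<longleftrightarrow> f \<in> ring_hom A B \<and> linear R A B f"

definition galg_hom ::
  "('r, 'y) ring_scheme \<Rightarrow> ('r, 'a) galg \<Rightarrow> ('r, 'b) galg \<Rightarrow> ('a \<Rightarrow> 'b) \<Rightarrow> bool" where
  "galg_hom R A B f \<longleftrightarrow> alg_hom R A B f \<and> (\<forall>k. f ` dpart A k \<subseteq> dpart B k)"

definition short_exact ::
  "('r, 'y) ring_scheme \<Rightarrow> ('r, 'a, 'u) module_scheme \<Rightarrow> ('r, 'b, 'v) module_scheme \<Rightarrow>
   ('r, 'c, 'w) module_scheme \<Rightarrow> ('a \<Rightarrow> 'b) \<Rightarrow> ('b \<Rightarrow> 'c) \<Rightarrow> bool" where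
  "short_exact R M E N i p \<longleftrightarrow> module R M \<and> module R E \<and> module R N \<and>
     linear R M E i \<and> linear R E N p \<and> inj_on i (carrier M) \<and>
     i ` carrier M = {x \<in> carrier E. p x = \<zero>\<^bsub>N\<^esub>} \<and> p ` carrier E = carrier N"

definition is_basis ::
  "('r, 'y) ring_scheme \<Rightarrow> ('r, 'a, 'u) module_scheme \<Rightarrow> 'i set \<Rightarrow> ('i \<Rightarrow> 'a) \<Rightarrow> bool" where
  "is_basis R M I v \<longleftrightarrow> v \<in> I \<rightarrow> carrier M \<and>
     (\<forall>x\<in>carrier M. \<exists>!c. c \<in> I \<rightarrow> carrier R \<and> (\<forall>i. i \<notin> I \<longrightarrow> c i = \<zero>\<^bsub>R\<^esub>) \<and>
        finite {i. c i \<noteq> \<zero>\<^bsub>R\<^esub>} \<and> x = (\<Oplus>\<^bsub>M\<^esub>i\<in>{i. c i \<noteq> \<zero>\<^bsub>R\<^esub>}. c i \<odot>\<^bsub>M\<^esub> v i))"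

text \<open>
  \<open>A\<close> is the polynomial algebra over \<open>R\<close> in the variables \<open>X\<close>: the monomials in \<open>X\<close>, given as
  multisets, form an \<open>R\<close>-basis.
\<close>

definition monomial :: "('a, 'z) ring_scheme \<Rightarrow> 'a multiset \<Rightarrow> 'a" where
  "monomial A m = (\<Otimes>\<^bsub>A\<^esub>x\<in>set_mset m. x [^]\<^bsub>A\<^esub> (count m x))"

definition free_algebra_on ::
  "('r, 'y) ring_scheme \<Rightarrow> ('r, 'a, 'u) module_scheme \<Rightarrow> 'a set \<Rightarrow> bool" where
  "free_algebra_on R A X \<longleftrightarrow> X \<subseteq> carrier A \<and> is_basis R A {m. set_mset m \<subseteq> X} (monomial A)"


section \<open>Tensor products\<close>

text \<open>
  The tensor product over \<open>R\<close> is the free abelian group on pairs modulo the bilinearity relations;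
  its elements are the cosets. The product below is meaningful when both factors are algebras.
  Module structures are added afterwards, since different actions are used on the same tensor
  product.
\<close>

definition tensor_rels ::
  "('r, 'y) ring_scheme \<Rightarrow> ('r, 'm, 'u) module_scheme \<Rightarrow> ('r, 'n, 'v) module_scheme \<Rightarrow>
   ('m \<times> 'n \<Rightarrow>\<^sub>0 int) set" where
  "tensor_rels R M N =
     {frag_of (x \<oplus>\<^bsub>M\<^esub> x', y) - frag_of (x, y) - frag_of (x', y) | x x' y.
        x \<in> carrier M \<and> x' \<in> carrier M \<and> y \<in> carrier N} \<union>
     {frag_of (x, y \<oplus>\<^bsub>N\<^esub> y') - frag_of (x, y) - frag_of (x, y') | x y y'.
        x \<in> carrier M \<and> y \<in> carrier N \<and> y' \<in> carrier N} \<union>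
     {frag_of (r \<odot>\<^bsub>M\<^esub> x, y) - frag_of (x, r \<odot>\<^bsub>N\<^esub> y) | r x y.
        r \<in> carrier R \<and> x \<in> carrier M \<and> y \<in> carrier N}"

definition tensor_free ::
  "('r, 'm, 'u) module_scheme \<Rightarrow> ('r, 'n, 'v) module_scheme \<Rightarrow> ('m \<times> 'n \<Rightarrow>\<^sub>0 int) monoid" where
  "tensor_free M N = free_Abelian_group (carrier M \<times> carrier N)"

definition tensor_ker ::
  "('r, 'y) ring_scheme \<Rightarrow> ('r, 'm, 'u) module_scheme \<Rightarrow> ('r, 'n, 'v) module_scheme \<Rightarrow>
   ('m \<times> 'n \<Rightarrow>\<^sub>0 int) set" where
  "tensor_ker R M N = generate (tensor_free M N) (tensor_rels R M N)"

definition tensor_cls ::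
  "('r, 'y) ring_scheme \<Rightarrow> ('r, 'm, 'u) module_scheme \<Rightarrow> ('r, 'n, 'v) module_scheme \<Rightarrow>
   ('m \<times> 'n \<Rightarrow>\<^sub>0 int) \<Rightarrow> ('m \<times> 'n \<Rightarrow>\<^sub>0 int) set" where
  "tensor_cls R M N x = tensor_ker R M N #>\<^bsub>tensor_free M N\<^esub> x"

definition tens ::
  "('r, 'y) ring_scheme \<Rightarrow> ('r, 'm, 'u) module_scheme \<Rightarrow> ('r, 'n, 'v) module_scheme \<Rightarrow>
   'm \<Rightarrow> 'n \<Rightarrow> ('m \<times> 'n \<Rightarrow>\<^sub>0 int) set" where
  "tens R M N x y = tensor_cls R M N (frag_of (x, y))"

definition tensor ::
  "('r, 'y) ring_scheme \<Rightarrow> ('r, 'm, 'u) module_scheme \<Rightarrow> ('r, 'n, 'v) module_scheme \<Rightarrow>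
   ('m \<times> 'n \<Rightarrow>\<^sub>0 int) set ring" where
  "tensor R M N =
     \<lparr>carrier = carrier (tensor_free M N Mod tensor_ker R M N),
      monoid.mult = (\<lambda>X Y. \<Union>x\<in>X. \<Union>y\<in>Y. tensor_cls R M N
        (frag_extend (\<lambda>(m, n). frag_extend (\<lambda>(m', n'). frag_of (m \<otimes>\<^bsub>M\<^esub> m', n \<otimes>\<^bsub>N\<^esub> n')) y) x)),
      one = tens R M N \<one>\<^bsub>M\<^esub> \<one>\<^bsub>N\<^esub>,
      ring.zero = tensor_ker R M N,
      add = monoid.mult (tensor_free M N Mod tensor_ker R M N)\<rparr>"

text \<open>
  \<open>tlift A b\<close> is the additive map from a tensor product to \<open>A\<close> with \<open>m \<otimes> n \<mapsto> b m n\<close>, for a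
  balanced biadditive \<open>b\<close>; the choice of a representative is then irrelevant.
  \<open>tmap R M N u v\<close> is \<open>u \<otimes> v\<close>, where \<open>M\<close> and \<open>N\<close> are the targets of \<open>u\<close> and \<open>v\<close>.
\<close>

definition tlift ::
  "('a, 'z) ring_scheme \<Rightarrow> ('m \<Rightarrow> 'n \<Rightarrow> 'a) \<Rightarrow> ('m \<times> 'n \<Rightarrow>\<^sub>0 int) set \<Rightarrow> 'a" where
  "tlift A b X = (let x = (SOME x. x \<in> X) in
     \<Oplus>\<^bsub>A\<^esub>p\<in>Poly_Mapping.keys x. add_pow A (Poly_Mapping.lookup x p) (b (fst p) (snd p)))"

definition tmap ::
  "('r, 'y) ring_scheme \<Rightarrow> ('r, 'm, 'u) module_scheme \<Rightarrow> ('r, 'n, 'v) module_scheme \<Rightarrow>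
   ('m0 \<Rightarrow> 'm) \<Rightarrow> ('n0 \<Rightarrow> 'n) \<Rightarrow> ('m0 \<times> 'n0 \<Rightarrow>\<^sub>0 int) set \<Rightarrow> ('m \<times> 'n \<Rightarrow>\<^sub>0 int) set" where
  "tmap R M N u v = tlift (tensor R M N) (\<lambda>x y. tens R M N (u x) (v y))"

definition tensor_left ::
  "('r, 'y) ring_scheme \<Rightarrow> ('r, 'm, 'u) module_scheme \<Rightarrow> ('r, 'n, 'v) module_scheme \<Rightarrow>
   ('c \<Rightarrow> 'm \<Rightarrow> 'm) \<Rightarrow> ('c, ('m \<times> 'n \<Rightarrow>\<^sub>0 int) set) module" where
  "tensor_left R M N act = modl (tensor R M N) (\<lambda>c. tmap R M N (act c) (\<lambda>y. y))"

definition tensor_right ::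
  "('r, 'y) ring_scheme \<Rightarrow> ('r, 'm, 'u) module_scheme \<Rightarrow> ('r, 'n, 'v) module_scheme \<Rightarrow>
   ('c \<Rightarrow> 'n \<Rightarrow> 'n) \<Rightarrow> ('c, ('m \<times> 'n \<Rightarrow>\<^sub>0 int) set) module" where
  "tensor_right R M N act = modl (tensor R M N) (\<lambda>c. tmap R M N (\<lambda>x. x) (act c))"


section \<open>Principal parts and derivations\<close>

text \<open>Throughout this section \<open>A\<close> is an \<open>R\<close>-algebra.\<close>

definition diag_ideal ::
  "('r, 'y) ring_scheme \<Rightarrow> ('r, 'a, 'u) module_scheme \<Rightarrow> ('a \<times> 'a \<Rightarrow>\<^sub>0 int) set set" where
  "diag_ideal R A = {x \<in> carrier (tensor R A A). tlift A (monoid.mult A) x = \<zero>\<^bsub>A\<^esub>}"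

definition diag_square ::
  "('r, 'y) ring_scheme \<Rightarrow> ('r, 'a, 'u) module_scheme \<Rightarrow> ('a \<times> 'a \<Rightarrow>\<^sub>0 int) set set" where
  "diag_square R A = ideal_prod (tensor R A A) (diag_ideal R A) (diag_ideal R A)"

definition pparts ::
  "('r, 'y) ring_scheme \<Rightarrow> ('r, 'a, 'u) module_scheme \<Rightarrow>
   ('a \<times> 'a \<Rightarrow>\<^sub>0 int) set set ring" where
  "pparts R A = tensor R A A Quot diag_square R A"

definition pp_cls ::
  "('r, 'y) ring_scheme \<Rightarrow> ('r, 'a, 'u) module_scheme \<Rightarrow>
   ('a \<times> 'a \<Rightarrow>\<^sub>0 int) set \<Rightarrow> ('a \<times> 'a \<Rightarrow>\<^sub>0 int) set set" where
  "pp_cls R A x = diag_square R A +>\<^bsub>tensor R A A\<^esub> x"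

definition j1 ::
  "('r, 'y) ring_scheme \<Rightarrow> ('r, 'a, 'u) module_scheme \<Rightarrow> 'a \<Rightarrow>
   ('a \<times> 'a \<Rightarrow>\<^sub>0 int) set set" where
  "j1 R A a = pp_cls R A (tens R A A a \<one>\<^bsub>A\<^esub>)"

definition j2 ::
  "('r, 'y) ring_scheme \<Rightarrow> ('r, 'a, 'u) module_scheme \<Rightarrow> 'a \<Rightarrow>
   ('a \<times> 'a \<Rightarrow>\<^sub>0 int) set set" where
  "j2 R A a = pp_cls R A (tens R A A \<one>\<^bsub>A\<^esub> a)"

definition pp_aug :: "('a, 'u) ring_scheme \<Rightarrow> ('a \<times> 'a \<Rightarrow>\<^sub>0 int) set set \<Rightarrow> 'a" where
  "pp_aug A X = tlift A (monoid.mult A) (SOME x. x \<in> X)"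

definition pp_map ::
  "('r, 'y) ring_scheme \<Rightarrow> ('r, 'b, 'u) module_scheme \<Rightarrow> ('a \<Rightarrow> 'b) \<Rightarrow>
   ('a \<times> 'a \<Rightarrow>\<^sub>0 int) set set \<Rightarrow> ('b \<times> 'b \<Rightarrow>\<^sub>0 int) set set" where
  "pp_map R B h X = pp_cls R B (tmap R B B h h (SOME x. x \<in> X))"

definition pp_left ::
  "('r, 'y) ring_scheme \<Rightarrow> ('r, 'a, 'u) module_scheme \<Rightarrow>
   'a \<Rightarrow> ('a \<times> 'a \<Rightarrow>\<^sub>0 int) set set \<Rightarrow> ('a \<times> 'a \<Rightarrow>\<^sub>0 int) set set" where
  "pp_left R A a p = j1 R A a \<otimes>\<^bsub>pparts R A\<^esub> p"

text \<open>Principal parts as an \<open>A\<close>-algebra via \<open>j2\<close>; tensor products are formed with this structure.\<close>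

definition pp_right ::
  "('r, 'y) ring_scheme \<Rightarrow> ('r, 'a, 'u) module_scheme \<Rightarrow>
   ('a, ('a \<times> 'a \<Rightarrow>\<^sub>0 int) set set) module" where
  "pp_right R A = alg (j2 R A) (pparts R A)"

text \<open>
  \<open>\<Omega>\<close> is the subset \<open>I / I\<^sup>2\<close> of the principal parts, so the inclusion \<open>\<gamma>\<close> is the identity on
  elements. The \<open>A\<close>-module structures on \<open>\<Omega>\<close> via \<open>j1\<close> and \<open>j2\<close> agree.
\<close>

definition Omega ::
  "('r, 'y) ring_scheme \<Rightarrow> ('r, 'a, 'u) module_scheme \<Rightarrow>
   ('a, ('a \<times> 'a \<Rightarrow>\<^sub>0 int) set set) module" where
  "Omega R A = modl (pparts R A\<lparr>carrier := pp_cls R A ` diag_ideal R A\<rparr>) (pp_left R A)"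

definition univ_der ::
  "('r, 'y) ring_scheme \<Rightarrow> ('r, 'a, 'u) module_scheme \<Rightarrow> 'a \<Rightarrow>
   ('a \<times> 'a \<Rightarrow>\<^sub>0 int) set set" where
  "univ_der R A a = j2 R A a \<ominus>\<^bsub>pparts R A\<^esub> j1 R A a"

definition Der ::
  "('r, 'y) ring_scheme \<Rightarrow> ('r, 'a, 'u) module_scheme \<Rightarrow> ('a, 'm, 'v) module_scheme \<Rightarrow>
   ('a \<Rightarrow> 'm) set" where
  "Der R A M = {D \<in> carrier A \<rightarrow>\<^sub>E carrier M.
     (\<forall>a\<in>carrier A. \<forall>b\<in>carrier A. D (a \<oplus>\<^bsub>A\<^esub> b) = D a \<oplus>\<^bsub>M\<^esub> D b) \<and>
     (\<forall>a\<in>carrier A. \<forall>b\<in>carrier A. D (a \<otimes>\<^bsub>A\<^esub> b) = a \<odot>\<^bsub>M\<^esub> D b \<oplus>\<^bsub>M\<^esub> b \<odot>\<^bsub>M\<^esub> D a) \<and>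
     (\<forall>r\<in>carrier R. D (r \<odot>\<^bsub>A\<^esub> \<one>\<^bsub>A\<^esub>) = \<zero>\<^bsub>M\<^esub>)}"

text \<open>The linear map \<open>f\<^sup>D\<close> with \<open>f\<^sup>D \<circ> d = D\<close>.\<close>

definition lin_of_der ::
  "('r, 'y) ring_scheme \<Rightarrow> ('r, 'a, 'u) module_scheme \<Rightarrow> ('a, 'm, 'v) module_scheme \<Rightarrow>
   ('a \<Rightarrow> 'm) \<Rightarrow> (('a \<times> 'a \<Rightarrow>\<^sub>0 int) set set \<Rightarrow> 'm)" where
  "lin_of_der R A M D =
     (THE f. f \<in> linmaps A (Omega R A) M \<and> (\<forall>a\<in>carrier A. f (univ_der R A a) = D a))"


section \<open>Cohomology of cochain complexes of Hom groups\<close>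

definition hom_group ::
  "('a \<Rightarrow> 'b) set \<Rightarrow> ('a, 'u) ring_scheme \<Rightarrow> ('b, 'v) ring_scheme \<Rightarrow> ('a \<Rightarrow> 'b) monoid" where
  "hom_group H M N = \<lparr>carrier = H, monoid.mult = (\<lambda>f g. \<lambda>x\<in>carrier M. f x \<oplus>\<^bsub>N\<^esub> g x),
     one = (\<lambda>x\<in>carrier M. \<zero>\<^bsub>N\<^esub>)\<rparr>"

definition cobd :: "(nat \<Rightarrow> 'c monoid) \<Rightarrow> (nat \<Rightarrow> 'c \<Rightarrow> 'c) \<Rightarrow> nat \<Rightarrow> 'c set" where
  "cobd C \<delta> i = (case i of 0 \<Rightarrow> {\<one>\<^bsub>C 0\<^esub>} | Suc n \<Rightarrow> \<delta> n ` carrier (C n))"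

definition cohomology ::
  "(nat \<Rightarrow> 'c monoid) \<Rightarrow> (nat \<Rightarrow> 'c \<Rightarrow> 'c) \<Rightarrow> nat \<Rightarrow> 'c set monoid" where
  "cohomology C \<delta> i =
     (C i\<lparr>carrier := {f \<in> carrier (C i). \<delta> i f = \<one>\<^bsub>C (Suc i)\<^esub>}\<rparr>) Mod cobd C \<delta> i"

text \<open>
  \<open>coh_class C \<delta> i Z = B\<^sup>i + Z\<close>. It is used for nonempty sets \<open>Z\<close> of cocycles all of which are
  cohomologous (the cocycles arising from the possible choices in a construction), and then it is
  the cohomology class of any element of \<open>Z\<close>.
\<close>

definition coh_class ::
  "(nat \<Rightarrow> 'c monoid) \<Rightarrow> (nat \<Rightarrow> 'c \<Rightarrow> 'c) \<Rightarrow> nat \<Rightarrow> 'c set \<Rightarrow> 'c set" where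
  "coh_class C \<delta> i Z = cobd C \<delta> i <#>\<^bsub>C i\<^esub> Z"


section \<open>Ext groups\<close>

text \<open>\<open>fbd F n\<close> is the boundary \<open>F\<^sub>n\<^sub>+\<^sub>1 \<rightarrow> F\<^sub>n\<close>.\<close>

record ('t, 'f, 'n) fres =
  fobj :: "nat \<Rightarrow> ('t, 'f) module"
  fbd :: "nat \<Rightarrow> 'f \<Rightarrow> 'f"
  faug :: "'f \<Rightarrow> 'n"

definition free_resolution ::
  "('t, 'y) ring_scheme \<Rightarrow> ('t, 'n, 'u) module_scheme \<Rightarrow> ('t, 'f, 'n) fres \<Rightarrow> bool" where
  "free_resolution T N F \<longleftrightarrow>
     (\<forall>n. module T (fobj F n) \<and> (\<exists>B. is_basis T (fobj F n) B (\<lambda>x. x))) \<and>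
     (\<forall>n. linear T (fobj F (Suc n)) (fobj F n) (fbd F n)) \<and>
     linear T (fobj F 0) N (faug F) \<and>
     faug F ` carrier (fobj F 0) = carrier N \<and>
     fbd F 0 ` carrier (fobj F (Suc 0)) = {x \<in> carrier (fobj F 0). faug F x = \<zero>\<^bsub>N\<^esub>} \<and>
     (\<forall>n. fbd F (Suc n) ` carrier (fobj F (Suc (Suc n))) =
        {x \<in> carrier (fobj F (Suc n)). fbd F n x = \<zero>\<^bsub>fobj F n\<^esub>})"

definition ext_C ::
  "('t, 'y) ring_scheme \<Rightarrow> ('t, 'f, 'n) fres \<Rightarrow> ('t, 'm, 'u) module_scheme \<Rightarrow>
   nat \<Rightarrow> ('f \<Rightarrow> 'm) monoid" where
  "ext_C T F M n = hom_group (linmaps T (fobj F n) M) (fobj F n) M"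

definition ext_d :: "('t, 'f, 'n) fres \<Rightarrow> nat \<Rightarrow> ('f \<Rightarrow> 'm) \<Rightarrow> ('f \<Rightarrow> 'm)" where
  "ext_d F n f = (\<lambda>x\<in>carrier (fobj F (Suc n)). f (fbd F n x))"

text \<open>\<open>Ext\<^sup>i\<^sub>T(N, M)\<close>, computed with a free resolution \<open>F\<close> of \<open>N\<close>.\<close>

definition Ext ::
  "nat \<Rightarrow> ('t, 'y) ring_scheme \<Rightarrow> ('t, 'f, 'n) fres \<Rightarrow> ('t, 'm, 'u) module_scheme \<Rightarrow>
   ('f \<Rightarrow> 'm) set monoid" where
  "Ext i T F M = cohomology (ext_C T F M) (ext_d F) i"

definition ext_cls ::
  "nat \<Rightarrow> ('t, 'y) ring_scheme \<Rightarrow> ('t, 'f, 'n) fres \<Rightarrow> ('t, 'm, 'u) module_scheme \<Rightarrow>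
   ('f \<Rightarrow> 'm) set \<Rightarrow> ('f \<Rightarrow> 'm) set" where
  "ext_cls i T F M Z = coh_class (ext_C T F M) (ext_d F) i Z"

text \<open>The class of the extension \<open>0 \<rightarrow> M \<rightarrow> E \<rightarrow> N \<rightarrow> 0\<close> (maps \<open>i\<close>, \<open>p\<close>): lift \<open>F\<^sub>0 \<rightarrow> N\<close> to \<open>E\<close>.\<close>

definition ses_class ::
  "('t, 'y) ring_scheme \<Rightarrow> ('t, 'f, 'n) fres \<Rightarrow> ('t, 'm, 'u) module_scheme \<Rightarrow>
   ('t, 'e, 'v) module_scheme \<Rightarrow> ('m \<Rightarrow> 'e) \<Rightarrow> ('e \<Rightarrow> 'n) \<Rightarrow> ('f \<Rightarrow> 'm) set" where
  "ses_class T F M E i p = ext_cls 1 T F M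
     {z \<in> linmaps T (fobj F 1) M. \<exists>\<phi>. linear T (fobj F 0) E \<phi> \<and>
        (\<forall>x\<in>carrier (fobj F 0). p (\<phi> x) = faug F x) \<and>
        (\<forall>y\<in>carrier (fobj F 1). i (z y) = \<phi> (fbd F 0 y))}"

definition ext_push ::
  "nat \<Rightarrow> ('t, 'y) ring_scheme \<Rightarrow> ('t, 'f, 'n) fres \<Rightarrow> ('t, 'm1, 'v) module_scheme \<Rightarrow>
   ('m \<Rightarrow> 'm1) \<Rightarrow> ('f \<Rightarrow> 'm) set \<Rightarrow> ('f \<Rightarrow> 'm1) set" where
  "ext_push i T F M1 g c =
     ext_cls i T F M1 {\<lambda>x\<in>carrier (fobj F i). g (z x) | z. z \<in> c}"

text \<open>
  Pullback from \<open>Ext\<^sup>i\<close> over \<open>T'\<close> to \<open>Ext\<^sup>i\<close> over \<open>T\<close>, along a homomorphism \<open>k : T \<rightarrow> T'\<close> and a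
  \<open>k\<close>-semilinear map \<open>g : N \<rightarrow> N'\<close>; \<open>\<psi>\<close> is a lift of \<open>g\<close> to the resolutions.
\<close>

definition ext_pull ::
  "nat \<Rightarrow> ('t, 'y) ring_scheme \<Rightarrow> ('t, 'f, 'n) fres \<Rightarrow> ('t1, 'f1, 'n1) fres \<Rightarrow>
   ('t1, 'm1, 'v) module_scheme \<Rightarrow> ('t \<Rightarrow> 't1) \<Rightarrow> ('n \<Rightarrow> 'n1) \<Rightarrow>
   ('f1 \<Rightarrow> 'm1) set \<Rightarrow> ('f \<Rightarrow> 'm1) set" where
  "ext_pull i T F F1 M1 k g c = ext_cls i T F (restr_scalars k M1)
     {\<lambda>x\<in>carrier (fobj F i). z (\<psi> i x) | z \<psi>. z \<in> c \<and>
        (\<forall>n. linear T (fobj F n) (restr_scalars k (fobj F1 n)) (\<psi> n)) \<and>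
        (\<forall>n. \<forall>x\<in>carrier (fobj F (Suc n)). \<psi> n (fbd F n x) = fbd F1 n (\<psi> (Suc n) x)) \<and>
        (\<forall>x\<in>carrier (fobj F 0). faug F1 (\<psi> 0 x) = g (faug F x))}"


section \<open>Simplicial resolutions and graded Andre-Quillen cohomology\<close>

record ('r, 'p, 'g) sres =
  obj :: "nat \<Rightarrow> ('r, 'p) galg"
  face :: "nat \<Rightarrow> nat \<Rightarrow> 'p \<Rightarrow> 'p"
  degen :: "nat \<Rightarrow> nat \<Rightarrow> 'p \<Rightarrow> 'p"
  aug :: "'p \<Rightarrow> 'g"

text \<open>
  \<open>face P n i\<close> is \<open>d\<^sub>i : P\<^sub>n\<^sub>+\<^sub>1 \<rightarrow> P\<^sub>n\<close> for \<open>i \<le> n + 1\<close> and \<open>degen P n j\<close> is \<open>s\<^sub>j : P\<^sub>n \<rightarrow> P\<^sub>n\<^sub>+\<^sub>1\<close> for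
  \<open>j \<le> n\<close>.
\<close>

definition simplicial_algebra ::
  "('r, 'y) ring_scheme \<Rightarrow> ('r, 'p, 'g) sres \<Rightarrow> bool" where
  "simplicial_algebra R P \<longleftrightarrow>
     (\<forall>n. graded_algebra R (obj P n)) \<and>
     (\<forall>n. \<forall>i\<le>Suc n. galg_hom R (obj P (Suc n)) (obj P n) (face P n i)) \<and>
     (\<forall>n. \<forall>j\<le>n. galg_hom R (obj P n) (obj P (Suc n)) (degen P n j)) \<and>
     (\<forall>n i j. i < j \<and> j \<le> n + 2 \<longrightarrow> (\<forall>x\<in>carrier (obj P (n + 2)).
        face P n i (face P (Suc n) j x) = face P n (j - 1) (face P (Suc n) i x))) \<and>
     (\<forall>n i j. i \<le> j \<and> j \<le> n \<longrightarrow> (\<forall>x\<in>carrier (obj P n).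
        degen P (Suc n) i (degen P n j x) = degen P (Suc n) (Suc j) (degen P n i x))) \<and>
     (\<forall>n j. j \<le> n \<longrightarrow> (\<forall>x\<in>carrier (obj P n).
        face P n j (degen P n j x) = x \<and> face P n (Suc j) (degen P n j x) = x)) \<and>
     (\<forall>n i j. i < j \<and> j \<le> Suc n \<longrightarrow> (\<forall>x\<in>carrier (obj P (Suc n)).
        face P (Suc n) i (degen P (Suc n) j x) = degen P n (j - 1) (face P n i x))) \<and>
     (\<forall>n i j. Suc j < i \<and> i \<le> n + 2 \<longrightarrow> (\<forall>x\<in>carrier (obj P (Suc n)).
        face P (Suc n) i (degen P (Suc n) j x) = degen P n j (face P n (i - 1) x)))"

definition alt_bd :: "('r, 'p, 'g) sres \<Rightarrow> nat \<Rightarrow> 'p \<Rightarrow> 'p" where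
  "alt_bd P n x = (\<Oplus>\<^bsub>obj P n\<^esub>i\<in>{..Suc n}. add_pow (obj P n) ((-1::int) ^ i) (face P n i x))"

definition sres_of ::
  "('r, 'y) ring_scheme \<Rightarrow> ('r, 'g) galg \<Rightarrow> ('r, 'p, 'g) sres \<Rightarrow> bool" where
  "sres_of R G P \<longleftrightarrow> simplicial_algebra R P \<and>
     (\<forall>n. \<exists>X. X \<subseteq> (\<Union>k. dpart (obj P n) k) \<and> free_algebra_on R (obj P n) X) \<and>
     galg_hom R (obj P 0) G (aug P) \<and>
     aug P ` carrier (obj P 0) = carrier G \<and>
     alt_bd P 0 ` carrier (obj P (Suc 0)) = {x \<in> carrier (obj P 0). aug P x = \<zero>\<^bsub>G\<^esub>} \<and>
     (\<forall>n. alt_bd P (Suc n) ` carrier (obj P (Suc (Suc n))) =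
        {x \<in> carrier (obj P (Suc n)). alt_bd P n x = \<zero>\<^bsub>obj P n\<^esub>})"

definition concentrated :: "('r, 'p, 'g) sres \<Rightarrow> bool" where
  "concentrated P \<longleftrightarrow> (\<forall>n. dpart (obj P n) 0 = carrier (obj P n))"

text \<open>Maps of augmented simplicial algebras over the ring map \<open>s\<close> and the map \<open>g\<close> of targets.\<close>

definition sres_map ::
  "('r, 'y) ring_scheme \<Rightarrow> ('r, 'p, 'g) sres \<Rightarrow> ('r1, 'p1, 'g1) sres \<Rightarrow>
   ('r \<Rightarrow> 'r1) \<Rightarrow> ('g \<Rightarrow> 'g1) \<Rightarrow> (nat \<Rightarrow> 'p \<Rightarrow> 'p1) \<Rightarrow> bool" where
  "sres_map R P P1 s g a \<longleftrightarrow>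
     (\<forall>n. a n \<in> ring_hom (obj P n) (obj P1 n) \<and>
        (\<forall>r\<in>carrier R. \<forall>x\<in>carrier (obj P n). a n (r \<odot>\<^bsub>obj P n\<^esub> x) = s r \<odot>\<^bsub>obj P1 n\<^esub> a n x) \<and>
        (\<forall>k. a n ` dpart (obj P n) k \<subseteq> dpart (obj P1 n) k)) \<and>
     (\<forall>n. \<forall>i\<le>Suc n. \<forall>x\<in>carrier (obj P (Suc n)). a n (face P n i x) = face P1 n i (a (Suc n) x)) \<and>
     (\<forall>n. \<forall>j\<le>n. \<forall>x\<in>carrier (obj P n). a (Suc n) (degen P n j x) = degen P1 n j (a n x)) \<and>
     (\<forall>x\<in>carrier (obj P 0). aug P1 (a 0 x) = g (aug P x))"

primrec augn :: "('r, 'p, 'g) sres \<Rightarrow> nat \<Rightarrow> 'p \<Rightarrow> 'g" where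
  "augn P 0 = aug P"
| "augn P (Suc n) = augn P n \<circ> face P n 0"

text \<open>
  The \<open>n\<close>-th term \<open>\<Omega>\<^bsub>P\<^sub>n/S\<^esub> \<otimes>\<^bsub>P\<^sub>n\<^esub> \<Gamma>\<close> of the cotangent complex, a graded \<open>\<Gamma>\<close>-module: the degree of
  \<open>a db \<otimes> \<gamma>\<close> is the sum of those of \<open>a\<close>, \<open>b\<close>, \<open>\<gamma>\<close>.
\<close>

definition cot_tens ::
  "('r, 'y) ring_scheme \<Rightarrow> ('r, 'p, 'g) sres \<Rightarrow> ('r, 'g) galg \<Rightarrow> nat \<Rightarrow>
   ('p \<times> 'p \<Rightarrow>\<^sub>0 int) set set \<Rightarrow> 'g \<Rightarrow> (('p \<times> 'p \<Rightarrow>\<^sub>0 int) set set \<times> 'g \<Rightarrow>\<^sub>0 int) set" where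
  "cot_tens R P G n = tens (obj P n) (Omega R (obj P n)) (alg (augn P n) G)"

definition cot ::
  "('r, 'y) ring_scheme \<Rightarrow> ('r, 'p, 'g) sres \<Rightarrow> ('r, 'g) galg \<Rightarrow> nat \<Rightarrow>
   ('g, (('p \<times> 'p \<Rightarrow>\<^sub>0 int) set set \<times> 'g \<Rightarrow>\<^sub>0 int) set) galg" where
  "cot R P G n = (let A = obj P n; L = tensor A (Omega R A) (alg (augn P n) G) in
     gmodl L (smult (tensor_right A (Omega R A) (alg (augn P n) G) (monoid.mult G)))
       (\<lambda>k. aspan L {cot_tens R P G n (a \<odot>\<^bsub>Omega R A\<^esub> univ_der R A b) g | a b g i j m.
          a \<in> dpart A i \<and> b \<in> dpart A j \<and> g \<in> dpart G m \<and> i + j + m = k}))"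

definition cot_map ::
  "('r1, 'y) ring_scheme \<Rightarrow> ('r1, 'p1, 'g1) sres \<Rightarrow> ('r1, 'g1) galg \<Rightarrow> nat \<Rightarrow>
   ('p \<Rightarrow> 'p1) \<Rightarrow> ('g \<Rightarrow> 'g1) \<Rightarrow>
   (('p \<times> 'p \<Rightarrow>\<^sub>0 int) set set \<times> 'g \<Rightarrow>\<^sub>0 int) set \<Rightarrow>
   (('p1 \<times> 'p1 \<Rightarrow>\<^sub>0 int) set set \<times> 'g1 \<Rightarrow>\<^sub>0 int) set" where
  "cot_map R1 P1 G1 n a g =
     tmap (obj P1 n) (Omega R1 (obj P1 n)) (alg (augn P1 n) G1) (pp_map R1 (obj P1 n) a) g"

definition cot_bd ::
  "('r, 'y) ring_scheme \<Rightarrow> ('r, 'p, 'g) sres \<Rightarrow> ('r, 'g) galg \<Rightarrow> nat \<Rightarrow>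
   (('p \<times> 'p \<Rightarrow>\<^sub>0 int) set set \<times> 'g \<Rightarrow>\<^sub>0 int) set \<Rightarrow>
   (('p \<times> 'p \<Rightarrow>\<^sub>0 int) set set \<times> 'g \<Rightarrow>\<^sub>0 int) set" where
  "cot_bd R P G n x = (\<Oplus>\<^bsub>cot R P G n\<^esub>i\<in>{..Suc n}.
     add_pow (cot R P G n) ((-1::int) ^ i) (cot_map R P G n (face P n i) (\<lambda>g. g) x))"

definition aq_C ::
  "('r, 'y) ring_scheme \<Rightarrow> ('r, 'p, 'g) sres \<Rightarrow> ('r, 'g) galg \<Rightarrow> ('g, 'j) galg \<Rightarrow> nat \<Rightarrow>
   ((('p \<times> 'p \<Rightarrow>\<^sub>0 int) set set \<times> 'g \<Rightarrow>\<^sub>0 int) set \<Rightarrow> 'j) monoid" where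
  "aq_C R P G J n = hom_group (glinmaps G (cot R P G n) J) (cot R P G n) J"

definition aq_d ::
  "('r, 'y) ring_scheme \<Rightarrow> ('r, 'p, 'g) sres \<Rightarrow> ('r, 'g) galg \<Rightarrow> nat \<Rightarrow>
   ((('p \<times> 'p \<Rightarrow>\<^sub>0 int) set set \<times> 'g \<Rightarrow>\<^sub>0 int) set \<Rightarrow> 'j) \<Rightarrow>
   ((('p \<times> 'p \<Rightarrow>\<^sub>0 int) set set \<times> 'g \<Rightarrow>\<^sub>0 int) set \<Rightarrow> 'j)" where
  "aq_d R P G n f = (\<lambda>x\<in>carrier (cot R P G (Suc n)). f (cot_bd R P G n x))"

text \<open>\<open>\<^sub>0H\<^sup>i(R, G, J)\<close>, computed with a simplicial resolution \<open>P\<close> of \<open>G\<close>.\<close>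

definition AQ ::
  "nat \<Rightarrow> ('r, 'y) ring_scheme \<Rightarrow> ('r, 'p, 'g) sres \<Rightarrow> ('r, 'g) galg \<Rightarrow> ('g, 'j) galg \<Rightarrow>
   ((('p \<times> 'p \<Rightarrow>\<^sub>0 int) set set \<times> 'g \<Rightarrow>\<^sub>0 int) set \<Rightarrow> 'j) set monoid" where
  "AQ i R P G J = cohomology (aq_C R P G J) (aq_d R P G) i"

definition aq_cls ::
  "nat \<Rightarrow> ('r, 'y) ring_scheme \<Rightarrow> ('r, 'p, 'g) sres \<Rightarrow> ('r, 'g) galg \<Rightarrow> ('g, 'j) galg \<Rightarrow>
   ((('p \<times> 'p \<Rightarrow>\<^sub>0 int) set set \<times> 'g \<Rightarrow>\<^sub>0 int) set \<Rightarrow> 'j) set \<Rightarrow>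
   ((('p \<times> 'p \<Rightarrow>\<^sub>0 int) set set \<times> 'g \<Rightarrow>\<^sub>0 int) set \<Rightarrow> 'j) set" where
  "aq_cls i R P G J Z = coh_class (aq_C R P G J) (aq_d R P G) i Z"

text \<open>
  The class of a graded square-zero extension \<open>0 \<rightarrow> J \<rightarrow> E \<rightarrow> G \<rightarrow> 0\<close> of \<open>R\<close>-algebras (maps \<open>i\<close>, \<open>p\<close>)
  under the classification of such extensions: lift the augmentation to a homomorphism
  \<open>\<phi> : P\<^sub>0 \<rightarrow> E\<close>; then \<open>\<phi> d\<^sub>0 - \<phi> d\<^sub>1\<close> is a derivation of \<open>P\<^sub>1\<close> with values in \<open>J\<close>, that is, a
  1-cochain \<open>f\<close>. The sign agrees with that of \<open>ses_class\<close>, as the boundary is \<open>d\<^sub>0 - d\<^sub>1\<close>.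
\<close>

definition alg_ext_class ::
  "('r, 'y) ring_scheme \<Rightarrow> ('r, 'p, 'g) sres \<Rightarrow> ('r, 'g) galg \<Rightarrow> ('g, 'j) galg \<Rightarrow>
   ('r, 'e) galg \<Rightarrow> ('j \<Rightarrow> 'e) \<Rightarrow> ('e \<Rightarrow> 'g) \<Rightarrow>
   ((('p \<times> 'p \<Rightarrow>\<^sub>0 int) set set \<times> 'g \<Rightarrow>\<^sub>0 int) set \<Rightarrow> 'j) set" where
  "alg_ext_class R P G J E i p = aq_cls 1 R P G J
     {f \<in> glinmaps G (cot R P G 1) J. \<exists>\<phi>. galg_hom R (obj P 0) E \<phi> \<and>
        (\<forall>x\<in>carrier (obj P 0). p (\<phi> x) = aug P x) \<and>
        (\<forall>x\<in>carrier (obj P 1).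
           i (f (cot_tens R P G 1 (univ_der R (obj P 1) x) \<one>\<^bsub>G\<^esub>)) =
             \<phi> (face P 0 0 x) \<ominus>\<^bsub>E\<^esub> \<phi> (face P 0 1 x))}"


section \<open>The transitivity sequence of \<open>S \<rightarrow> T \<rightarrow> \<Gamma>\<close>\<close>

text \<open>The graded ring \<open>\<Gamma> = T \<oplus> N\<close> as an algebra via a ring homomorphism \<open>h\<close> to \<open>T\<close>.\<close>

definition Gam ::
  "('r \<Rightarrow> 't) \<Rightarrow> ('t, 'y) ring_scheme \<Rightarrow> ('t, 'n, 'u) module_scheme \<Rightarrow> ('r, 't \<times> 'n) galg" where
  "Gam h T N = \<lparr>carrier = carrier T \<times> carrier N,
     monoid.mult = (\<lambda>(t, x) (t', x'). (t \<otimes>\<^bsub>T\<^esub> t', t \<odot>\<^bsub>N\<^esub> x' \<oplus>\<^bsub>N\<^esub> t' \<odot>\<^bsub>N\<^esub> x)),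
     one = (\<one>\<^bsub>T\<^esub>, \<zero>\<^bsub>N\<^esub>), ring.zero = (\<zero>\<^bsub>T\<^esub>, \<zero>\<^bsub>N\<^esub>),
     add = (\<lambda>(t, x) (t', x'). (t \<oplus>\<^bsub>T\<^esub> t', x \<oplus>\<^bsub>N\<^esub> x')),
     smult = (\<lambda>r (t, x). (h r \<otimes>\<^bsub>T\<^esub> t, h r \<odot>\<^bsub>N\<^esub> x)),
     dpart = (\<lambda>k. if k = 0 then carrier T \<times> {\<zero>\<^bsub>N\<^esub>}
                  else if k = 1 then {\<zero>\<^bsub>T\<^esub>} \<times> carrier N else {(\<zero>\<^bsub>T\<^esub>, \<zero>\<^bsub>N\<^esub>)})\<rparr>"

definition in0 :: "('t, 'n, 'u) module_scheme \<Rightarrow> 't \<Rightarrow> 't \<times> 'n" where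
  "in0 N t = (t, \<zero>\<^bsub>N\<^esub>)"

definition in1 :: "('t, 'y) ring_scheme \<Rightarrow> 'n \<Rightarrow> 't \<times> 'n" where
  "in1 T x = (\<zero>\<^bsub>T\<^esub>, x)"

text \<open>
  \<open>i\<^sup>*\<close>, restriction along \<open>L\<^bsub>T/S\<^esub> \<rightarrow> L\<^bsub>\<Gamma>/S\<^esub>\<close>. Here \<open>Q\<close> and \<open>P\<close> resolve \<open>T\<close> and \<open>\<Gamma>\<close> over \<open>S\<close>, \<open>a\<close> is a map
  \<open>Q \<rightarrow> P\<close> over \<open>T \<rightarrow> \<Gamma>\<close>, and \<open>\<theta> : J0 \<rightarrow> J\<close> identifies \<open>J0\<close> with the degree 0 part of \<open>J\<close>. Graded
  \<open>\<Gamma>\<close>-linear maps from \<open>L\<^bsub>T/S\<^esub> \<otimes>\<^sub>T \<Gamma>\<close> to \<open>J\<close> are the same as \<open>T\<close>-linear maps from \<open>L\<^bsub>T/S\<^esub>\<close> to \<open>J0\<close>.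
\<close>

definition trans_i ::
  "nat \<Rightarrow> ('s, 'y) ring_scheme \<Rightarrow> ('t, 'w) ring_scheme \<Rightarrow> ('t, 'n, 'u) module_scheme \<Rightarrow>
   ('s \<Rightarrow> 't) \<Rightarrow> ('s, 'q, 't) sres \<Rightarrow> ('s, 'p, 't \<times> 'n) sres \<Rightarrow> (nat \<Rightarrow> 'q \<Rightarrow> 'p) \<Rightarrow>
   ('t, 'j0) galg \<Rightarrow> ('j0 \<Rightarrow> 'j) \<Rightarrow>
   ((('p \<times> 'p \<Rightarrow>\<^sub>0 int) set set \<times> ('t \<times> 'n) \<Rightarrow>\<^sub>0 int) set \<Rightarrow> 'j) set \<Rightarrow>
   ((('q \<times> 'q \<Rightarrow>\<^sub>0 int) set set \<times> 't \<Rightarrow>\<^sub>0 int) set \<Rightarrow> 'j0) set" where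
  "trans_i i S T N h Q P a J0 \<theta> c = (let T' = ungr (alg h T) in aq_cls i S Q T' J0
     {g \<in> glinmaps T' (cot S Q T' i) J0. \<exists>f\<in>c. \<forall>x\<in>carrier (cot S Q T' i).
        \<theta> (g x) = f (cot_map S P (Gam h T N) i (a i) (in0 N) x)})"

text \<open>
  The identification of \<open>Ext\<^sup>i\<^sub>T(N, J\<^sub>1)\<close> with the cohomology of Hom from \<open>L\<^bsub>\<Gamma>/T\<^esub>\<close>. The complex \<open>L\<^bsub>\<Gamma>/T\<^esub>\<close> of
  graded \<open>\<Gamma>\<close>-modules maps quasi-isomorphically onto \<open>N\<close> in degree 1 of the grading, by
  \<open>dr \<otimes> \<gamma> \<mapsto> \<gamma> \<cdot> pr\<^sub>N(\<epsilon>(r))\<close>; this lifts to a chain map \<open>\<psi>\<close> to the free resolution \<open>F\<close>, with \<open>F\<close> placed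
  in degree 1 of the grading and regarded as a complex of \<open>\<Gamma>\<close>-modules via \<open>\<Gamma> \<rightarrow> T\<close>.
  Cochains on \<open>F\<close> are pulled back along \<open>\<psi>\<close>; \<open>\<theta> : M \<rightarrow> J\<close> identifies \<open>M\<close> with the degree 1 part of \<open>J\<close>.
\<close>

definition shift1 :: "('t, 'f, 'u) module_scheme \<Rightarrow> ('t \<times> 'n, 'f) galg" where
  "shift1 M = gmodl M (\<lambda>g x. fst g \<odot>\<^bsub>M\<^esub> x) (\<lambda>k. if k = 1 then carrier M else {\<zero>\<^bsub>M\<^esub>})"

definition comparison ::
  "('t, 'y) ring_scheme \<Rightarrow> ('t, 'n, 'u) module_scheme \<Rightarrow> ('t, 'f, 'n) fres \<Rightarrow>
   ('t, 'r, 't \<times> 'n) sres \<Rightarrow>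
   (nat \<Rightarrow> (('r \<times> 'r \<Rightarrow>\<^sub>0 int) set set \<times> ('t \<times> 'n) \<Rightarrow>\<^sub>0 int) set \<Rightarrow> 'f) \<Rightarrow> bool" where
  "comparison T N F R \<psi> \<longleftrightarrow> (let G = Gam (\<lambda>t. t) T N in
     (\<forall>n. \<psi> n \<in> glinmaps G (cot T R G n) (shift1 (fobj F n))) \<and>
     (\<forall>n. \<forall>x\<in>carrier (cot T R G (Suc n)). \<psi> n (cot_bd T R G n x) = fbd F n (\<psi> (Suc n) x)) \<and>
     (\<forall>r\<in>carrier (obj R 0). \<forall>g\<in>carrier G.
        faug F (\<psi> 0 (cot_tens T R G 0 (univ_der T (obj R 0) r) g)) = fst g \<odot>\<^bsub>N\<^esub> snd (aug R r)))"

definition ext_to_cot ::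
  "nat \<Rightarrow> ('t, 'y) ring_scheme \<Rightarrow> ('t, 'n, 'u) module_scheme \<Rightarrow> ('t, 'f, 'n) fres \<Rightarrow>
   ('t, 'r, 't \<times> 'n) sres \<Rightarrow> ('t \<times> 'n, 'j) galg \<Rightarrow> ('m \<Rightarrow> 'j) \<Rightarrow>
   ('f \<Rightarrow> 'm) set \<Rightarrow>
   ((('r \<times> 'r \<Rightarrow>\<^sub>0 int) set set \<times> ('t \<times> 'n) \<Rightarrow>\<^sub>0 int) set \<Rightarrow> 'j) set" where
  "ext_to_cot i T N F R J \<theta> c = (let G = Gam (\<lambda>t. t) T N in aq_cls i T R G J
     {\<lambda>x\<in>carrier (cot T R G i). \<theta> (z (\<psi> i x)) | z \<psi>. z \<in> c \<and> comparison T N F R \<psi>})"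

text \<open>\<open>u\<close>: the identification followed by restriction along \<open>L\<^bsub>\<Gamma>/S\<^esub> \<rightarrow> L\<^bsub>\<Gamma>/T\<^esub>\<close>, for a map \<open>b : P \<rightarrow> R\<close>.\<close>

definition trans_u ::
  "nat \<Rightarrow> ('s, 'y) ring_scheme \<Rightarrow> ('t, 'w) ring_scheme \<Rightarrow> ('t, 'n, 'u) module_scheme \<Rightarrow>
   ('s \<Rightarrow> 't) \<Rightarrow> ('t, 'f, 'n) fres \<Rightarrow> ('s, 'p, 't \<times> 'n) sres \<Rightarrow> ('t, 'r, 't \<times> 'n) sres \<Rightarrow>
   (nat \<Rightarrow> 'p \<Rightarrow> 'r) \<Rightarrow> ('t \<times> 'n, 'j) galg \<Rightarrow> ('m \<Rightarrow> 'j) \<Rightarrow> ('f \<Rightarrow> 'm) set \<Rightarrow>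
   ((('p \<times> 'p \<Rightarrow>\<^sub>0 int) set set \<times> ('t \<times> 'n) \<Rightarrow>\<^sub>0 int) set \<Rightarrow> 'j) set" where
  "trans_u i S T N h F P R b J \<theta> c = aq_cls i S P (Gam h T N) J
     {\<lambda>x\<in>carrier (cot S P (Gam h T N) i). f (cot_map T R (Gam (\<lambda>t. t) T N) i (b i) (\<lambda>g. g) x) | f.
        f \<in> ext_to_cot i T N F R J \<theta> c}"


section \<open>Kodaira-Spencer and Atiyah classes\<close>

text \<open>
  In this section \<open>l : \<Lambda> \<rightarrow> S\<close> is a ring homomorphism and \<open>G\<close> a graded \<open>S\<close>-algebra.
  \<open>ks_ext\<close> is \<open>P\<^bsub>S/\<Lambda>\<^esub> \<otimes>\<^sub>S G\<close>, the tensor product being formed via \<open>j2\<close> and the \<open>S\<close>-algebra structure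
  being via \<open>j1\<close>; \<open>ks_ker\<close> is the graded \<open>G\<close>-module \<open>\<Omega>\<^bsub>S/\<Lambda>\<^esub> \<otimes>\<^sub>S G\<close>. Here \<open>S\<close> is in degree 0.
\<close>

definition ks_ext ::
  "('l, 'y) ring_scheme \<Rightarrow> ('s, 'w) ring_scheme \<Rightarrow> ('l \<Rightarrow> 's) \<Rightarrow> ('s, 'g) galg \<Rightarrow>
   ('s, (('s \<times> 's \<Rightarrow>\<^sub>0 int) set set \<times> 'g \<Rightarrow>\<^sub>0 int) set) galg" where
  "ks_ext \<Lambda> S l G = (let A = alg l S; E = tensor S (pp_right \<Lambda> A) G in
     gmodl E (smult (tensor_left S (pp_right \<Lambda> A) G (pp_left \<Lambda> A)))
       (\<lambda>k. aspan E {tens S (pp_right \<Lambda> A) G p g | p g.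
          p \<in> carrier (pparts \<Lambda> A) \<and> g \<in> dpart G k}))"

definition ks_ker ::
  "('l, 'y) ring_scheme \<Rightarrow> ('s, 'w) ring_scheme \<Rightarrow> ('l \<Rightarrow> 's) \<Rightarrow> ('s, 'g) galg \<Rightarrow>
   ('g, (('s \<times> 's \<Rightarrow>\<^sub>0 int) set set \<times> 'g \<Rightarrow>\<^sub>0 int) set) galg" where
  "ks_ker \<Lambda> S l G = (let W = Omega \<Lambda> (alg l S); E = tensor S W G in
     gmodl E (smult (tensor_right S W G (monoid.mult G)))
       (\<lambda>k. aspan E {tens S W G w g | w g. w \<in> carrier W \<and> g \<in> dpart G k}))"

definition ks_incl ::
  "('l, 'y) ring_scheme \<Rightarrow> ('s, 'w) ring_scheme \<Rightarrow> ('l \<Rightarrow> 's) \<Rightarrow> ('s, 'g) galg \<Rightarrow>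
   (('s \<times> 's \<Rightarrow>\<^sub>0 int) set set \<times> 'g \<Rightarrow>\<^sub>0 int) set \<Rightarrow>
   (('s \<times> 's \<Rightarrow>\<^sub>0 int) set set \<times> 'g \<Rightarrow>\<^sub>0 int) set" where
  "ks_incl \<Lambda> S l G = tmap S (pp_right \<Lambda> (alg l S)) G (\<lambda>w. w) (\<lambda>g. g)"

definition ks_proj ::
  "('s, 'w) ring_scheme \<Rightarrow> ('s, 'g) galg \<Rightarrow>
   (('s \<times> 's \<Rightarrow>\<^sub>0 int) set set \<times> 'g \<Rightarrow>\<^sub>0 int) set \<Rightarrow> 'g" where
  "ks_proj S G = tlift G (\<lambda>p g. pp_aug S p \<odot>\<^bsub>G\<^esub> g)"

text \<open>\<open>\<kappa>(G/S/\<Lambda>)\<close>, computed with a resolution \<open>P\<close> of \<open>G\<close> over \<open>S\<close>.\<close>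

definition KS_class ::
  "('l, 'y) ring_scheme \<Rightarrow> ('s, 'w) ring_scheme \<Rightarrow> ('l \<Rightarrow> 's) \<Rightarrow> ('s, 'g) galg \<Rightarrow>
   ('s, 'p, 'g) sres \<Rightarrow>
   ((('p \<times> 'p \<Rightarrow>\<^sub>0 int) set set \<times> 'g \<Rightarrow>\<^sub>0 int) set \<Rightarrow>
    (('s \<times> 's \<Rightarrow>\<^sub>0 int) set set \<times> 'g \<Rightarrow>\<^sub>0 int) set) set" where
  "KS_class \<Lambda> S l G P = alg_ext_class S P G (ks_ker \<Lambda> S l G) (ks_ext \<Lambda> S l G)
     (ks_incl \<Lambda> S l G) (ks_proj S G)"

definition is_splitting ::
  "('l, 'y) ring_scheme \<Rightarrow> ('s, 'w) ring_scheme \<Rightarrow> ('t, 'v) ring_scheme \<Rightarrow>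
   ('l \<Rightarrow> 's) \<Rightarrow> ('s \<Rightarrow> 't) \<Rightarrow>
   ('t \<Rightarrow> (('s \<times> 's \<Rightarrow>\<^sub>0 int) set set \<times> 't \<Rightarrow>\<^sub>0 int) set) \<Rightarrow> bool" where
  "is_splitting \<Lambda> S T l h \<sigma> \<longleftrightarrow>
     alg_hom S (alg h T) (ks_ext \<Lambda> S l (ungr (alg h T))) \<sigma> \<and>
     (\<forall>t\<in>carrier T. ks_proj S (ungr (alg h T)) (\<sigma> t) = t)"

definition split_der ::
  "('l, 'y) ring_scheme \<Rightarrow> ('s, 'w) ring_scheme \<Rightarrow> ('t, 'v) ring_scheme \<Rightarrow>
   ('l \<Rightarrow> 's) \<Rightarrow> ('s \<Rightarrow> 't) \<Rightarrow>
   ('t \<Rightarrow> (('s \<times> 's \<Rightarrow>\<^sub>0 int) set set \<times> 't \<Rightarrow>\<^sub>0 int) set) \<Rightarrow>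
   't \<Rightarrow> (('s \<times> 's \<Rightarrow>\<^sub>0 int) set set \<times> 't \<Rightarrow>\<^sub>0 int) set" where
  "split_der \<Lambda> S T l h \<sigma> = (let T' = ungr (alg h T); PP = pp_right \<Lambda> (alg l S) in
     (\<lambda>t\<in>carrier T. THE w. w \<in> carrier (ks_ker \<Lambda> S l T') \<and>
        ks_incl \<Lambda> S l T' w =
          tens S PP T' \<one>\<^bsub>PP\<^esub> t \<ominus>\<^bsub>ks_ext \<Lambda> S l T'\<^esub> \<sigma> t))"

text \<open>\<open>\<Omega>\<^bsub>S/\<Lambda>\<^esub> \<otimes>\<^sub>S N\<close> as a \<open>T\<close>-module, for a \<open>T\<close>-module \<open>N\<close>, and its identification with the degree 1
  part of \<open>\<Omega>\<^bsub>S/\<Lambda>\<^esub> \<otimes>\<^sub>S \<Gamma>\<close>.\<close>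

definition Omega_mod ::
  "('l, 'y) ring_scheme \<Rightarrow> ('s, 'w) ring_scheme \<Rightarrow> ('l \<Rightarrow> 's) \<Rightarrow> ('s \<Rightarrow> 't) \<Rightarrow>
   ('t, 'n, 'v) module_scheme \<Rightarrow> ('t, (('s \<times> 's \<Rightarrow>\<^sub>0 int) set set \<times> 'n \<Rightarrow>\<^sub>0 int) set) module" where
  "Omega_mod \<Lambda> S l h N = tensor_right S (Omega \<Lambda> (alg l S)) (restr_scalars h N) (smult N)"

definition Omega_in1 ::
  "('l, 'y) ring_scheme \<Rightarrow> ('s, 'w) ring_scheme \<Rightarrow> ('l \<Rightarrow> 's) \<Rightarrow> ('s \<Rightarrow> 't) \<Rightarrow>
   ('t, 'u) ring_scheme \<Rightarrow> ('t, 'n, 'v) module_scheme \<Rightarrow>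
   (('s \<times> 's \<Rightarrow>\<^sub>0 int) set set \<times> 'n \<Rightarrow>\<^sub>0 int) set \<Rightarrow>
   (('s \<times> 's \<Rightarrow>\<^sub>0 int) set set \<times> ('t \<times> 'n) \<Rightarrow>\<^sub>0 int) set" where
  "Omega_in1 \<Lambda> S l h T N = tmap S (Omega \<Lambda> (alg l S)) (Gam h T N) (\<lambda>w. w) (in1 T)"

definition Omega_in0 ::
  "('l, 'y) ring_scheme \<Rightarrow> ('s, 'w) ring_scheme \<Rightarrow> ('l \<Rightarrow> 's) \<Rightarrow> ('s \<Rightarrow> 't) \<Rightarrow>
   ('t, 'u) ring_scheme \<Rightarrow> ('t, 'n, 'v) module_scheme \<Rightarrow>
   (('s \<times> 's \<Rightarrow>\<^sub>0 int) set set \<times> 't \<Rightarrow>\<^sub>0 int) set \<Rightarrow>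
   (('s \<times> 's \<Rightarrow>\<^sub>0 int) set set \<times> ('t \<times> 'n) \<Rightarrow>\<^sub>0 int) set" where
  "Omega_in0 \<Lambda> S l h T N = tmap S (Omega \<Lambda> (alg l S)) (Gam h T N) (\<lambda>w. w) (in0 N)"

text \<open>
  The degree 1 part of \<open>P\<^bsub>S/\<Lambda>\<^esub> \<otimes>\<^sub>S \<Gamma>\<close> as a \<open>T\<close>-module via \<open>\<sigma>\<close>: an element \<open>t\<close> acts as multiplication by
  the image of \<open>\<sigma>(t)\<close> under \<open>P\<^bsub>S/\<Lambda>\<^esub> \<otimes>\<^sub>S T \<rightarrow> P\<^bsub>S/\<Lambda>\<^esub> \<otimes>\<^sub>S \<Gamma>\<close>.
\<close>

definition deg1_mod ::
  "('l, 'y) ring_scheme \<Rightarrow> ('s, 'w) ring_scheme \<Rightarrow> ('t, 'u) ring_scheme \<Rightarrow>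
   ('t, 'n, 'v) module_scheme \<Rightarrow> ('l \<Rightarrow> 's) \<Rightarrow> ('s \<Rightarrow> 't) \<Rightarrow>
   ('t \<Rightarrow> (('s \<times> 's \<Rightarrow>\<^sub>0 int) set set \<times> 't \<Rightarrow>\<^sub>0 int) set) \<Rightarrow>
   ('t, (('s \<times> 's \<Rightarrow>\<^sub>0 int) set set \<times> ('t \<times> 'n) \<Rightarrow>\<^sub>0 int) set) module" where
  "deg1_mod \<Lambda> S T N l h \<sigma> = (let G = Gam h T N; E = ks_ext \<Lambda> S l G in
     modl (E\<lparr>carrier := dpart E 1\<rparr>)
       (\<lambda>t x. tmap S (pp_right \<Lambda> (alg l S)) G (\<lambda>p. p) (in0 N) (\<sigma> t) \<otimes>\<^bsub>E\<^esub> x))"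

definition deg1_incl ::
  "('l, 'y) ring_scheme \<Rightarrow> ('s, 'w) ring_scheme \<Rightarrow> ('t, 'u) ring_scheme \<Rightarrow>
   ('t, 'n, 'v) module_scheme \<Rightarrow> ('l \<Rightarrow> 's) \<Rightarrow> ('s \<Rightarrow> 't) \<Rightarrow>
   (('s \<times> 's \<Rightarrow>\<^sub>0 int) set set \<times> 'n \<Rightarrow>\<^sub>0 int) set \<Rightarrow>
   (('s \<times> 's \<Rightarrow>\<^sub>0 int) set set \<times> ('t \<times> 'n) \<Rightarrow>\<^sub>0 int) set" where
  "deg1_incl \<Lambda> S T N l h x = ks_incl \<Lambda> S l (Gam h T N) (Omega_in1 \<Lambda> S l h T N x)"

definition deg1_proj ::
  "('s, 'w) ring_scheme \<Rightarrow> ('t, 'u) ring_scheme \<Rightarrow> ('t, 'n, 'v) module_scheme \<Rightarrow> ('s \<Rightarrow> 't) \<Rightarrow>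
   (('s \<times> 's \<Rightarrow>\<^sub>0 int) set set \<times> ('t \<times> 'n) \<Rightarrow>\<^sub>0 int) set \<Rightarrow> 'n" where
  "deg1_proj S T N h x = snd (ks_proj S (Gam h T N) x)"

definition kappa ::
  "('l, 'y) ring_scheme \<Rightarrow> ('s, 'w) ring_scheme \<Rightarrow> ('t, 'u) ring_scheme \<Rightarrow>
   ('t, 'n, 'v) module_scheme \<Rightarrow> ('l \<Rightarrow> 's) \<Rightarrow> ('s \<Rightarrow> 't) \<Rightarrow>
   ('t \<Rightarrow> (('s \<times> 's \<Rightarrow>\<^sub>0 int) set set \<times> 't \<Rightarrow>\<^sub>0 int) set) \<Rightarrow> ('t, 'f, 'n) fres \<Rightarrow>
   ('f \<Rightarrow> (('s \<times> 's \<Rightarrow>\<^sub>0 int) set set \<times> 'n \<Rightarrow>\<^sub>0 int) set) set" where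
  "kappa \<Lambda> S T N l h \<sigma> F = ses_class T F (Omega_mod \<Lambda> S l h N)
     (deg1_mod \<Lambda> S T N l h \<sigma>) (deg1_incl \<Lambda> S T N l h) (deg1_proj S T N h)"

text \<open>
  The Atiyah class \<open>at\<^bsub>T/\<Lambda>\<^esub>(N)\<close>, where \<open>k : \<Lambda> \<rightarrow> T\<close>. The coefficient module \<open>\<Omega>\<^bsub>T/\<Lambda>\<^esub> \<otimes>\<^sub>T N\<close> is
  \<open>Omega_mod \<Lambda> T k (\<lambda>t. t) N\<close>.
\<close>

definition atiyah ::
  "('l, 'y) ring_scheme \<Rightarrow> ('t, 'u) ring_scheme \<Rightarrow> ('t, 'n, 'v) module_scheme \<Rightarrow>
   ('l \<Rightarrow> 't) \<Rightarrow> ('t, 'f, 'n) fres \<Rightarrow>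
   ('f \<Rightarrow> (('t \<times> 't \<Rightarrow>\<^sub>0 int) set set \<times> 'n \<Rightarrow>\<^sub>0 int) set) set" where
  "atiyah \<Lambda> T N k F = (let A = alg k T in ses_class T F
     (Omega_mod \<Lambda> T k (\<lambda>t. t) N)
     (tensor_left T (pp_right \<Lambda> A) N (pp_left \<Lambda> A))
     (tmap T (pp_right \<Lambda> A) N (\<lambda>w. w) (\<lambda>x. x))
     (tlift N (\<lambda>p x. pp_aug T p \<odot>\<^bsub>N\<^esub> x)))"

text \<open>
  The maps \<open>f \<otimes> id\<close> of the statement use the canonical isomorphisms \<open>(W \<otimes>\<^sub>S T) \<otimes>\<^sub>T N \<cong> W \<otimes>\<^sub>S N\<close> and
  \<open>S \<otimes>\<^sub>S M \<cong> M\<close>, here for \<open>W = \<Omega>\<^bsub>S/\<Lambda>\<^esub>\<close>.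
\<close>

definition tensor_cancel ::
  "('l, 'y) ring_scheme \<Rightarrow> ('s, 'w) ring_scheme \<Rightarrow> ('l \<Rightarrow> 's) \<Rightarrow> ('s \<Rightarrow> 't) \<Rightarrow>
   ('t, 'n, 'v) module_scheme \<Rightarrow>
   ((('s \<times> 's \<Rightarrow>\<^sub>0 int) set set \<times> 't \<Rightarrow>\<^sub>0 int) set \<times> 'n \<Rightarrow>\<^sub>0 int) set \<Rightarrow>
   (('s \<times> 's \<Rightarrow>\<^sub>0 int) set set \<times> 'n \<Rightarrow>\<^sub>0 int) set" where
  "tensor_cancel \<Lambda> S l h N = (let W = Omega \<Lambda> (alg l S); N' = restr_scalars h N in
     tlift (tensor S W N') (\<lambda>y x. tlift (tensor S W N') (\<lambda>w t. tens S W N' w (t \<odot>\<^bsub>N\<^esub> x)) y))"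

definition tensor_unit :: "('s, 'm, 'v) module_scheme \<Rightarrow> ('s \<times> 'm \<Rightarrow>\<^sub>0 int) set \<Rightarrow> 'm" where
  "tensor_unit M = tlift M (\<lambda>s x. s \<odot>\<^bsub>M\<^esub> x)"

text \<open>\<open>f \<otimes> id : \<Omega>\<^bsub>T/\<Lambda>\<^esub> \<otimes>\<^sub>T N \<rightarrow> \<Omega>\<^bsub>S/\<Lambda>\<^esub> \<otimes>\<^sub>S N\<close> for \<open>f : \<Omega>\<^bsub>T/\<Lambda>\<^esub> \<rightarrow> \<Omega>\<^bsub>S/\<Lambda>\<^esub> \<otimes>\<^sub>S T\<close>\<close>

definition tensor_der_map ::
  "('l, 'y) ring_scheme \<Rightarrow> ('s, 'w) ring_scheme \<Rightarrow> ('t, 'u) ring_scheme \<Rightarrow>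
   ('t, 'n, 'v) module_scheme \<Rightarrow> ('l \<Rightarrow> 's) \<Rightarrow> ('s \<Rightarrow> 't) \<Rightarrow>
   (('t \<times> 't \<Rightarrow>\<^sub>0 int) set set \<Rightarrow> (('s \<times> 's \<Rightarrow>\<^sub>0 int) set set \<times> 't \<Rightarrow>\<^sub>0 int) set) \<Rightarrow>
   (('t \<times> 't \<Rightarrow>\<^sub>0 int) set set \<times> 'n \<Rightarrow>\<^sub>0 int) set \<Rightarrow>
   (('s \<times> 's \<Rightarrow>\<^sub>0 int) set set \<times> 'n \<Rightarrow>\<^sub>0 int) set" where
  "tensor_der_map \<Lambda> S T N l h f x = tensor_cancel \<Lambda> S l h N
     (tmap T (ks_ker \<Lambda> S l (ungr (alg h T))) N f (\<lambda>y. y) x)"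

text \<open>\<open>f \<otimes> id : \<Omega> \<otimes>\<^sub>S M \<rightarrow> S \<otimes>\<^sub>S M \<cong> M\<close> for \<open>f : \<Omega> \<rightarrow> S\<close>\<close>

definition contract ::
  "('s, 'w) ring_scheme \<Rightarrow> ('s, 'm, 'v) module_scheme \<Rightarrow> ('w0 \<Rightarrow> 's) \<Rightarrow>
   ('w0 \<times> 'm \<Rightarrow>\<^sub>0 int) set \<Rightarrow> 'm" where
  "contract S M f x = tensor_unit M (tmap S (alg (\<lambda>s. s) S) M f (\<lambda>y. y) x)"

definition X_der ::
  "('l, 'y) ring_scheme \<Rightarrow> ('s, 'w) ring_scheme \<Rightarrow> ('t, 'u) ring_scheme \<Rightarrow>
   ('l \<Rightarrow> 's) \<Rightarrow> ('s \<Rightarrow> 't) \<Rightarrow>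
   ('t \<Rightarrow> (('s \<times> 's \<Rightarrow>\<^sub>0 int) set set \<times> 't \<Rightarrow>\<^sub>0 int) set) \<Rightarrow> ('s \<Rightarrow> 's) \<Rightarrow> 't \<Rightarrow> 't" where
  "X_der \<Lambda> S T l h \<sigma> Y = (\<lambda>t\<in>carrier T.
     contract S (alg h T) (lin_of_der \<Lambda> (alg l S) (alg (\<lambda>s. s) S) Y)
       (split_der \<Lambda> S T l h \<sigma> t))"


section \<open>Standing data and naturality\<close>

definition ks_data ::
  "('l, 'y) ring_scheme \<Rightarrow> ('s, 'w) ring_scheme \<Rightarrow> ('t, 'u) ring_scheme \<Rightarrow>
   ('t, 'n, 'v) module_scheme \<Rightarrow> ('l \<Rightarrow> 's) \<Rightarrow> ('s \<Rightarrow> 't) \<Rightarrow> bool" where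
  "ks_data \<Lambda> S T N l h \<longleftrightarrow> cring \<Lambda> \<and> cring S \<and> cring T \<and> module T N \<and>
     l \<in> ring_hom \<Lambda> S \<and> h \<in> ring_hom S T"

text \<open>A morphism \<open>(T/S/\<Lambda>, \<sigma>, N) \<rightarrow> (T'/S'/\<Lambda>', \<sigma>', N')\<close> of rings with splitting and module.\<close>

definition ks_morphism ::
  "('l, 'y) ring_scheme \<Rightarrow> ('s, 'w) ring_scheme \<Rightarrow> ('t, 'u) ring_scheme \<Rightarrow>
   ('t, 'n, 'v) module_scheme \<Rightarrow> ('l \<Rightarrow> 's) \<Rightarrow> ('s \<Rightarrow> 't) \<Rightarrow>
   ('t \<Rightarrow> (('s \<times> 's \<Rightarrow>\<^sub>0 int) set set \<times> 't \<Rightarrow>\<^sub>0 int) set) \<Rightarrow>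
   ('l1, 'y1) ring_scheme \<Rightarrow> ('s1, 'w1) ring_scheme \<Rightarrow> ('t1, 'u1) ring_scheme \<Rightarrow>
   ('t1, 'n1, 'v1) module_scheme \<Rightarrow> ('l1 \<Rightarrow> 's1) \<Rightarrow> ('s1 \<Rightarrow> 't1) \<Rightarrow>
   ('t1 \<Rightarrow> (('s1 \<times> 's1 \<Rightarrow>\<^sub>0 int) set set \<times> 't1 \<Rightarrow>\<^sub>0 int) set) \<Rightarrow>
   ('l \<Rightarrow> 'l1) \<Rightarrow> ('s \<Rightarrow> 's1) \<Rightarrow> ('t \<Rightarrow> 't1) \<Rightarrow> ('n \<Rightarrow> 'n1) \<Rightarrow> bool" where
  "ks_morphism \<Lambda> S T N l h \<sigma> \<Lambda>' S' T' N' l' h' \<sigma>' m\<Lambda> mS mT mN \<longleftrightarrow>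
     m\<Lambda> \<in> ring_hom \<Lambda> \<Lambda>' \<and> mS \<in> ring_hom S S' \<and> mT \<in> ring_hom T T' \<and>
     (\<forall>x\<in>carrier \<Lambda>. mS (l x) = l' (m\<Lambda> x)) \<and>
     (\<forall>s\<in>carrier S. mT (h s) = h' (mS s)) \<and>
     linear T N (restr_scalars mT N') mN \<and>
     (\<forall>t\<in>carrier T. \<sigma>' (mT t) =
        tmap S' (pp_right \<Lambda>' (alg l' S')) (ungr (alg h' T')) (pp_map \<Lambda>' (alg l' S') mS) mT (\<sigma> t))"

end

theory Submission
  imports Defs
begin

text \<open>
  The section \<open>g \<mapsto> 1 \<otimes> g\<close> splits \<open>\<P> \<otimes> G \<rightarrow> G\<close> as a map of rings but not of \<open>S\<close>-algebras. Subtracting it turns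
  \<open>S\<close>-algebra lifts into derivations \<open>D\<close> on the free algebra \<open>P\<^sub>0\<close> with \<open>D(s) = -ds \<otimes> 1\<close>, so the Kodaira-Spencer class is
  the set of the cocycles \<open>D \<circ> \<partial>\<close>, and the extension splits iff some \<open>D\<close> kills the boundaries. Restricting \<open>D\<close> to degree
  0 gives (i).

  For an extension of the module \<open>N\<close> with an additive splitting, the linear lifts become connections
  \<open>\<nabla>(t x) = t \<nabla>(x) - c(t, \<epsilon> x)\<close> on a free resolution of \<open>N\<close>, and the class is the set of the cocycles \<open>\<nabla> \<circ> \<partial>\<close>. The
  degree 1 part twisted by \<open>\<sigma>\<close> has \<open>c(t, n) = D(\<sigma>)(t) n\<close> and the Atiyah extension has \<open>c(t, n) = dt \<otimes> n\<close>; comparing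
  the two gives (iii), and naturality follows in the same way. For (ii), a connection composed with the comparison map
  from the cotangent complex, together with \<open>-D(\<sigma>)\<close> in degree 0, is one of the derivations \<open>D\<close>.
\<close>

section \<open>Additive maps\<close>

text \<open>Tensor products, principal parts and cotangent terms have cosets as elements, and maps
  out of them evaluate chosen representatives. Maps are therefore compared additively, on pure
  tensors or other generators, and the actions enter separately: one additive group carries actions
  through j1 and j2, of S, of T and of \<Gamma>. A second obstacle is that every class is defined by
  a choice of lift or chain map. The choices are absorbed by sets of cocycles indexed by one datum
  c, the values of a lift on scalars or the failure of a section to be linear. Lifts with the same c
  differ exactly by derivations or linear maps, so their cocycles, once there is one, fill a single
  coset of the coboundaries, and this coset is the class. Two classes agree as soon as their data c
  agree; no isomorphism of extensions is constructed. The signs come from j1(s) = j2(s) - ds: the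
  section 1 \<otimes> g is linear for j2 while scalars act through j1, and D(\<sigma>)(t) = 1
  \<otimes> t - \<sigma>(t) has the sign opposite to that of the lift \<sigma>.\<close>

definition addhom :: "('a, 'u) ring_scheme \<Rightarrow> ('b, 'v) ring_scheme \<Rightarrow> ('a \<Rightarrow> 'b) \<Rightarrow> bool" where
  "addhom A B f \<longleftrightarrow> f \<in> carrier A \<rightarrow> carrier B \<and>
     (\<forall>x\<in>carrier A. \<forall>y\<in>carrier A. f (x \<oplus>\<^bsub>A\<^esub> y) = f x \<oplus>\<^bsub>B\<^esub> f y)"

lemma addhomI:
  assumes "\<And>x. x \<in> carrier A ==> f x \<in> carrier B"
    and "\<And>x y. x \<in> carrier A ==> y \<in> carrier A ==> f (x \<oplus>\<^bsub>A\<^esub> y) = f x \<oplus>\<^bsub>B\<^esub> f y"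
  shows "addhom A B f"
  using assms by (auto simp: addhom_def)

lemma addhom_closed: "addhom A B f ==> x \<in> carrier A ==> f x \<in> carrier B"
  by (auto simp: addhom_def)

lemma addhom_add:
  "addhom A B f ==> x \<in> carrier A ==> y \<in> carrier A ==> f (x \<oplus>\<^bsub>A\<^esub> y) = f x \<oplus>\<^bsub>B\<^esub> f y"
  by (auto simp: addhom_def)

lemma addhom_group_hom:
  assumes "abelian_group A" "abelian_group B" "addhom A B f"
  shows "group_hom (add_monoid A) (add_monoid B) f"
  using assms by (auto simp: group_hom_def group_hom_axioms_def hom_def addhom_def
      intro: abelian_group.a_group)

lemma addhom_zero:
  assumes "abelian_group A" "abelian_group B" "addhom A B f"
  shows "f \<zero>\<^bsub>A\<^esub> = \<zero>\<^bsub>B\<^esub>"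
  using group_hom.hom_one[OF addhom_group_hom[OF assms]] by simp

lemma addhom_neg:
  assumes "abelian_group A" "abelian_group B" "addhom A B f" "x \<in> carrier A"
  shows "f (\<ominus>\<^bsub>A\<^esub> x) = \<ominus>\<^bsub>B\<^esub> f x"
  using group_hom.hom_inv[OF addhom_group_hom[OF assms(1-3)]] assms(4) by (simp add: a_inv_def)

lemma addhom_minus:
  assumes "abelian_group A" "abelian_group B" "addhom A B f" "x \<in> carrier A" "y \<in> carrier A"
  shows "f (x \<ominus>\<^bsub>A\<^esub> y) = f x \<ominus>\<^bsub>B\<^esub> f y"
  using assms by (simp add: a_minus_def addhom_add[OF assms(3)] addhom_neg abelian_group.a_inv_closed)

lemma addhom_add_pow:
  assumes "abelian_group A" "abelian_group B" "addhom A B f" "x \<in> carrier A"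
  shows "f (add_pow A (k::int) x) = add_pow B k (f x)"
  using group_hom.hom_int_pow[OF addhom_group_hom[OF assms(1-3)]] assms(4)
  by (simp add: add_pow_def)

lemma addhom_finsum:
  assumes "abelian_group A" "abelian_group B" "addhom A B f" "g \<in> I \<rightarrow> carrier A" "finite I"
  shows "f (\<Oplus>\<^bsub>A\<^esub>i\<in>I. g i) = (\<Oplus>\<^bsub>B\<^esub>i\<in>I. f (g i))"
proof -
  interpret A: abelian_group A by fact
  interpret B: abelian_group B by fact
  show ?thesis using assms(5,4)
  proof (induction rule: finite_induct)
    case empty then show ?case using addhom_zero[OF assms(1-3)] by simp
  next
    case (insert i I)
    have "g \<in> I \<rightarrow> carrier A" "g i \<in> carrier A" using insert by auto
    moreover have "(\<lambda>i. f (g i)) \<in> I \<rightarrow> carrier B" "f (g i) \<in> carrier B"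
      using insert addhom_closed[OF assms(3)] by (auto simp: Pi_iff)
    ultimately show ?case using insert by (simp add: addhom_add[OF assms(3)])
  qed
qed

lemma addhom_comp: "addhom A B f ==> addhom B C g ==> addhom A C (\<lambda>x. g (f x))"
  by (auto simp: addhom_def Pi_iff)

lemma addhom_sum:
  assumes "abelian_group B" "addhom A B f" "addhom A B g"
  shows "addhom A B (\<lambda>x. f x \<oplus>\<^bsub>B\<^esub> g x)"
proof -
  interpret B: abelian_group B by fact
  show ?thesis using assms(2,3)
    by (auto simp: addhom_def Pi_iff B.a_ac)
qed

lemma addhom_uminus:
  assumes "abelian_group B" "addhom A B f"
  shows "addhom A B (\<lambda>x. \<ominus>\<^bsub>B\<^esub> f x)"
proof -
  interpret B: abelian_group B by fact
  show ?thesis using assms(2)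
    by (auto simp: addhom_def Pi_iff B.minus_add B.a_ac)
qed

lemma addhom_diff:
  assumes "abelian_group B" "addhom A B f" "addhom A B g"
  shows "addhom A B (\<lambda>x. f x \<ominus>\<^bsub>B\<^esub> g x)"
  using addhom_sum[OF assms(1,2) addhom_uminus[OF assms(1,3)]] by (simp add: a_minus_def)

lemma addhom_const_zero: "abelian_group B ==> addhom A B (\<lambda>x. \<zero>\<^bsub>B\<^esub>)"
  by (auto simp: addhom_def abelian_group_def abelian_monoid.zero_closed abelian_monoid.l_zero)

lemma addhom_id: "addhom A A (\<lambda>x. x)"
  by (simp add: addhom_def)

lemma addhom_cong:
  assumes "addhom A B f" "\<And>x. x \<in> carrier A ==> g x = f x" "abelian_group A"
  shows "addhom A B g"
proof -
  interpret A: abelian_group A by fact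
  show ?thesis using assms(1,2) by (auto simp: addhom_def Pi_iff)
qed

lemma ring_hom_addhom: "f \<in> ring_hom A B ==> addhom A B f"
  by (auto simp: addhom_def ring_hom_def)

lemma linear_addhom: "linear R M N f ==> addhom M N f"
  by (auto simp: addhom_def linear_def)

lemma linear_smult:
  "linear R M N f ==> r \<in> carrier R ==> x \<in> carrier M ==> f (r \<odot>\<^bsub>M\<^esub> x) = r \<odot>\<^bsub>N\<^esub> f x"
  by (auto simp: linear_def)

lemma linearI:
  assumes "addhom M N f"
    and "\<And>r x. r \<in> carrier R ==> x \<in> carrier M ==> f (r \<odot>\<^bsub>M\<^esub> x) = r \<odot>\<^bsub>N\<^esub> f x"
  shows "linear R M N f"
  using assms by (auto simp: linear_def addhom_def)

text \<open>Integer multiples occur as coefficients of formal sums and as signs of alternating sums;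
  the signs only require the multiples by 1 and -1.\<close>

lemma add_pow_int:
  assumes "abelian_group A" "x \<in> carrier A"
  shows "add_pow A (k::int) x \<in> carrier A"
    and "add_pow A (j + k) x = add_pow A j x \<oplus>\<^bsub>A\<^esub> add_pow A k x"
    and "add_pow A (0::int) x = \<zero>\<^bsub>A\<^esub>"
    and "add_pow A (1::int) x = x"
    and "add_pow A (-1::int) x = \<ominus>\<^bsub>A\<^esub> x"
proof -
  have g: "group (add_monoid A)" using assms(1) by (rule abelian_group.a_group)
  show "add_pow A (k::int) x \<in> carrier A"
    and "add_pow A (j + k) x = add_pow A j x \<oplus>\<^bsub>A\<^esub> add_pow A k x"
    and "add_pow A (0::int) x = \<zero>\<^bsub>A\<^esub>"
    and "add_pow A (1::int) x = x"
    and "add_pow A (-1::int) x = \<ominus>\<^bsub>A\<^esub> x"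
    using group.int_pow_closed[OF g, of x k] group.int_pow_mult[OF g, of x j k] group.int_pow_mult[OF g, of x 1 "-1"]
      group.int_pow_1[OF g, of x] group.int_pow_neg[OF g, of x 1] assms(2)
    by (simp_all add: add_pow_def a_inv_def int_pow_def2)
qed

text \<open>These are the maps whose extension to formal sums kills \<open>tensor_rels\<close>. The
  target is a bare additive group, so that one lift can be compared with several actions.\<close>

definition balanced ::
  "('r, 'y) ring_scheme \<Rightarrow> ('r, 'm, 'u) module_scheme \<Rightarrow> ('r, 'n, 'v) module_scheme \<Rightarrow>
   ('a, 'z) ring_scheme \<Rightarrow> ('m \<Rightarrow> 'n \<Rightarrow> 'a) \<Rightarrow> bool" where
  "balanced R M N A b \<longleftrightarrow>
     (\<forall>x\<in>carrier M. addhom N A (b x)) \<and> (\<forall>y\<in>carrier N. addhom M A (\<lambda>x. b x y)) \<and>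
     (\<forall>r\<in>carrier R. \<forall>x\<in>carrier M. \<forall>y\<in>carrier N. b (r \<odot>\<^bsub>M\<^esub> x) y = b x (r \<odot>\<^bsub>N\<^esub> y))"

lemma balancedI:
  assumes "\<And>x y. x \<in> carrier M ==> y \<in> carrier N ==> b x y \<in> carrier A"
    and "\<And>x y y'. x \<in> carrier M ==> y \<in> carrier N ==> y' \<in> carrier N ==> b x (y \<oplus>\<^bsub>N\<^esub> y') = b x y \<oplus>\<^bsub>A\<^esub> b x y'"
    and "\<And>x x' y. x \<in> carrier M ==> x' \<in> carrier M ==> y \<in> carrier N ==> b (x \<oplus>\<^bsub>M\<^esub> x') y = b x y \<oplus>\<^bsub>A\<^esub> b x' y"
    and "\<And>r x y. r \<in> carrier R ==> x \<in> carrier M ==> y \<in> carrier N ==> b (r \<odot>\<^bsub>M\<^esub> x) y = b x (r \<odot>\<^bsub>N\<^esub> y)"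
  shows "balanced R M N A b"
  using assms by (auto simp: balanced_def addhom_def)

section \<open>Tensor products\<close>

locale two_modules = M: module R M + N: module R N
  for R :: "('r, 'y) ring_scheme" and M :: "('r, 'm, 'u) module_scheme"
    and N :: "('r, 'n, 'v) module_scheme"
begin

abbreviation "TT \<equiv> tensor R M N"
abbreviation "FF \<equiv> tensor_free M N"
abbreviation "KK \<equiv> tensor_ker R M N"
abbreviation "cls \<equiv> tensor_cls R M N"
abbreviation tns (infixl "\<star>" 70) where "x \<star> y \<equiv> tens R M N x y"

lemma free_comm_group: "comm_group FF"
  by (simp add: tensor_free_def abelian_free_Abelian_group)

lemma free_carrier: "x \<in> carrier FF \<longleftrightarrow> Poly_Mapping.keys x \<subseteq> carrier M \<times> carrier N"
  by (simp add: tensor_free_def)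

lemma free_simps: "x \<otimes>\<^bsub>FF\<^esub> y = x + y" "\<one>\<^bsub>FF\<^esub> = 0" "x \<in> carrier FF ==> inv\<^bsub>FF\<^esub> x = - x"
  by (auto simp: tensor_free_def)

lemma keys_sub:
  assumes "Poly_Mapping.keys x \<subseteq> X" "Poly_Mapping.keys y \<subseteq> X" shows "Poly_Mapping.keys (x - y) \<subseteq> X"
  using assms keys_diff[of x y] by blast

lemma free_diff_closed: "x \<in> carrier FF ==> y \<in> carrier FF ==> x - y \<in> carrier FF"
  by (auto simp: free_carrier keys_sub)

lemma frag_carrier: "x \<in> carrier M ==> y \<in> carrier N ==> frag_of (x, y) \<in> carrier FF"
  by (simp add: free_carrier)

lemma rels_carrier: "tensor_rels R M N \<subseteq> carrier FF"
  unfolding tensor_rels_def by (auto intro!: free_diff_closed frag_carrier)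

lemma ker_subgroup: "subgroup KK FF"
  unfolding tensor_ker_def using rels_carrier free_comm_group
  by (simp add: comm_group.axioms(2) group.generate_is_subgroup)

lemma ker_normal: "KK \<lhd> FF"
  using ker_subgroup free_comm_group comm_group.subgroup_imp_normal by blast

lemma tensor_carrier: "carrier TT = cls ` carrier FF"
  by (simp add: tensor_def carrier_FactGroup tensor_cls_def[abs_def])

lemma cls_closed: "x \<in> carrier FF ==> cls x \<in> carrier TT"
  by (simp add: tensor_carrier)

lemma tensor_zero: "\<zero>\<^bsub>TT\<^esub> = KK"
  by (simp add: tensor_def)

lemma cls_add:
  assumes "x \<in> carrier FF" "y \<in> carrier FF"
  shows "cls x \<oplus>\<^bsub>TT\<^esub> cls y = cls (x + y)"
  using normal.rcos_sum[OF ker_normal assms] by (simp add: tensor_def tensor_cls_def free_simps)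

lemma tensor_abelian_group [simp]: "abelian_group TT"
proof (rule comm_group_abelian_groupI)
  have "comm_group (FF Mod KK)"
    using comm_group.abelian_FactGroup[OF free_comm_group ker_subgroup] .
  moreover have "add_monoid TT = FF Mod KK"
    by (simp add: tensor_def FactGroup_def)
  ultimately show "comm_group (add_monoid TT)" by simp
qed

lemma cls_eqI:
  assumes "x \<in> carrier FF" "y \<in> carrier FF" "x - y \<in> KK"
  shows "cls x = cls y"
proof -
  interpret F: comm_group FF by (rule free_comm_group)
  have "x \<in> KK #>\<^bsub>FF\<^esub> y" using assms(3) unfolding r_coset_def
    by (force simp: free_simps)
  then show ?thesis unfolding tensor_cls_def using F.repr_independence[OF _ assms(2) ker_subgroup] by simp
qed

lemma rels_ker: "x \<in> tensor_rels R M N ==> x \<in> KK"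
  by (simp add: tensor_ker_def generate.incl)

lemma tens_closed [simp, intro]: "x \<in> carrier M ==> y \<in> carrier N ==> x \<star> y \<in> carrier TT"
  by (simp add: tens_def cls_closed frag_carrier)

lemma free_add_closed: "x \<in> carrier FF ==> y \<in> carrier FF ==> x + y \<in> carrier FF"
  by (metis comm_group.axioms(2) free_comm_group free_simps(1) group.subgroup_self subgroup.m_closed)

lemma tens_add_left:
  assumes "x \<in> carrier M" "x' \<in> carrier M" "y \<in> carrier N"
  shows "(x \<oplus>\<^bsub>M\<^esub> x') \<star> y = (x \<star> y) \<oplus>\<^bsub>TT\<^esub> (x' \<star> y)"
proof -
  have "frag_of (x \<oplus>\<^bsub>M\<^esub> x', y) - (frag_of (x, y) + frag_of (x', y)) \<in> tensor_rels R M N"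
    unfolding tensor_rels_def using assms by (auto simp: diff_diff_add[symmetric])
  then show ?thesis using assms
    by (simp add: tens_def cls_add frag_carrier cls_eqI[OF _ _ rels_ker] free_add_closed)
qed

lemma tens_add_right:
  assumes "x \<in> carrier M" "y \<in> carrier N" "y' \<in> carrier N"
  shows "x \<star> (y \<oplus>\<^bsub>N\<^esub> y') = (x \<star> y) \<oplus>\<^bsub>TT\<^esub> (x \<star> y')"
proof -
  have "frag_of (x, y \<oplus>\<^bsub>N\<^esub> y') - (frag_of (x, y) + frag_of (x, y')) \<in> tensor_rels R M N"
    unfolding tensor_rels_def using assms by (auto simp: diff_diff_add[symmetric])
  then show ?thesis using assms
    by (simp add: tens_def cls_add frag_carrier cls_eqI[OF _ _ rels_ker] free_add_closed)
qed

lemma tens_smult: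
  assumes "r \<in> carrier R" "x \<in> carrier M" "y \<in> carrier N"
  shows "(r \<odot>\<^bsub>M\<^esub> x) \<star> y = x \<star> (r \<odot>\<^bsub>N\<^esub> y)"
proof -
  have "frag_of (r \<odot>\<^bsub>M\<^esub> x, y) - frag_of (x, r \<odot>\<^bsub>N\<^esub> y) \<in> tensor_rels R M N"
    unfolding tensor_rels_def using assms by blast
  then show ?thesis using assms
    by (simp add: tens_def frag_carrier cls_eqI[OF _ _ rels_ker])
qed

lemma tens_balanced: "balanced R M N TT (tens R M N)"
  by (rule balancedI) (auto simp: tens_add_left tens_add_right tens_smult)

lemma tens_addhom_left: "y \<in> carrier N ==> addhom M TT (\<lambda>x. x \<star> y)"
  and tens_addhom_right: "x \<in> carrier M ==> addhom N TT (\<lambda>y. x \<star> y)"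
  using tens_balanced by (auto simp: balanced_def)

lemma tens_zero_left: "y \<in> carrier N ==> \<zero>\<^bsub>M\<^esub> \<star> y = \<zero>\<^bsub>TT\<^esub>"
  using addhom_zero[OF M.abelian_group_axioms tensor_abelian_group tens_addhom_left] .

lemma tens_zero_right: "x \<in> carrier M ==> x \<star> \<zero>\<^bsub>N\<^esub> = \<zero>\<^bsub>TT\<^esub>"
  using addhom_zero[OF N.abelian_group_axioms tensor_abelian_group tens_addhom_right] .

lemma tens_neg_left: "x \<in> carrier M ==> y \<in> carrier N ==> (\<ominus>\<^bsub>M\<^esub> x) \<star> y = \<ominus>\<^bsub>TT\<^esub> (x \<star> y)"
  using addhom_neg[OF M.abelian_group_axioms tensor_abelian_group tens_addhom_left] .

text \<open>Sums suffice although the free group also has negatives: the negative of a pure tensor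
  is a pure tensor, with the left factor negated.\<close>

lemma tensor_induct [consumes 1, case_names tens add]:
  assumes "x \<in> carrier TT"
    and tens: "\<And>m n. m \<in> carrier M ==> n \<in> carrier N ==> P (m \<star> n)"
    and add: "\<And>x y. x \<in> carrier TT ==> y \<in> carrier TT ==> P x ==> P y ==> P (x \<oplus>\<^bsub>TT\<^esub> y)"
  shows "P x"
proof -
  interpret T: abelian_group TT by simp
  obtain f where f: "Poly_Mapping.keys f \<subseteq> carrier M \<times> carrier N" "x = cls f"
    using assms(1) by (auto simp: tensor_carrier free_carrier)
  \<comment> \<open>The induction on formal sums has differences as its step; carrying the negative
    along closes it.\<close>
  have "P (cls f) \<and> P (\<ominus>\<^bsub>TT\<^esub> cls f)"
  proof (rule free_Abelian_group_induct[OF f(1)])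
    have "cls 0 = \<zero>\<^bsub>TT\<^esub>"
    proof -
      interpret F: comm_group FF by (rule free_comm_group)
      show ?thesis using F.coset_join2[OF _ ker_subgroup, of 0] subgroup.one_closed[OF ker_subgroup]
        by (simp add: tensor_cls_def tensor_zero free_simps free_carrier)
    qed
    moreover have "P \<zero>\<^bsub>TT\<^esub>" using tens[of "\<zero>\<^bsub>M\<^esub>" "\<zero>\<^bsub>N\<^esub>"] by (simp add: tens_zero_left)
    ultimately show "P (cls 0) \<and> P (\<ominus>\<^bsub>TT\<^esub> cls 0)" using T.minus_equality[OF T.l_zero[OF T.zero_closed] T.zero_closed T.zero_closed] by metis
  next
    fix f g assume 2: "Poly_Mapping.keys f \<subseteq> carrier M \<times> carrier N" "Poly_Mapping.keys g \<subseteq> carrier M \<times> carrier N"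
      "P (cls f) \<and> P (\<ominus>\<^bsub>TT\<^esub> cls f)" "P (cls g) \<and> P (\<ominus>\<^bsub>TT\<^esub> cls g)"
    have fg: "f \<in> carrier FF" "g \<in> carrier FF" "f - g \<in> carrier FF" using 2 by (auto simp: free_carrier keys_sub)
    have "cls f = cls (f - g) \<oplus>\<^bsub>TT\<^esub> cls g" using fg by (simp add: cls_add)
    then have e: "cls (f - g) = cls f \<oplus>\<^bsub>TT\<^esub> \<ominus>\<^bsub>TT\<^esub> cls g"
      using fg cls_closed by (simp add: T.a_assoc T.r_neg)
    then have "\<ominus>\<^bsub>TT\<^esub> cls (f - g) = \<ominus>\<^bsub>TT\<^esub> cls f \<oplus>\<^bsub>TT\<^esub> cls g"
      using fg cls_closed by (simp add: T.minus_add)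
    with e show "P (cls (f - g)) \<and> P (\<ominus>\<^bsub>TT\<^esub> cls (f - g))" using 2 fg cls_closed by (simp add: add)
  next
    fix p assume "p \<in> carrier M \<times> carrier N"
    then obtain m n where p: "p = (m, n)" "m \<in> carrier M" "n \<in> carrier N" by auto
    show "P (cls (frag_of p)) \<and> P (\<ominus>\<^bsub>TT\<^esub> cls (frag_of p))" using tens[OF p(2,3)] tens[of "\<ominus>\<^bsub>M\<^esub> m" n] p by (simp add: tens_def[symmetric] tens_neg_left)
  qed
  then show ?thesis using f by simp
qed

text \<open>The standard way below to compare two composites out of a tensor product.\<close>

lemma addhom_tensor_eqI:
  assumes "addhom TT A f" "addhom TT A g" "x \<in> carrier TT"
    and "\<And>m n. m \<in> carrier M ==> n \<in> carrier N ==> f (m \<star> n) = g (m \<star> n)"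
  shows "f x = g x"
  using assms(3) by (induction x rule: tensor_induct) (auto simp: assms(4) addhom_add[OF assms(1)] addhom_add[OF assms(2)])

context
  fixes A :: "('a, 'z) ring_scheme" and b
  assumes A: "abelian_group A" and b: "balanced R M N A b"
begin

lemma b_closed: "m \<in> carrier M ==> n \<in> carrier N ==> b m n \<in> carrier A"
  using b by (auto simp: balanced_def addhom_def)

text \<open>The sum inside \<open>tlift\<close> for a given representative, before passing to the
  quotient.\<close>

definition "frag_ev (x :: 'm \<times> 'n \<Rightarrow>\<^sub>0 int) = (\<Oplus>\<^bsub>A\<^esub>p\<in>Poly_Mapping.keys x. add_pow A (Poly_Mapping.lookup x p) (b (fst p) (snd p)))"

text \<open>Two formal sums have different supports. Adding termwise needs a common finite index
  set, where the extra terms have coefficient 0.\<close>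

lemma frag_ev_superset:
  assumes "finite U" "Poly_Mapping.keys x \<subseteq> U" "U \<subseteq> carrier M \<times> carrier N"
  shows "frag_ev x = (\<Oplus>\<^bsub>A\<^esub>p\<in>U. add_pow A (Poly_Mapping.lookup x p) (b (fst p) (snd p)))"
proof -
  interpret A: abelian_group A by (rule A)
  have bU: "b (fst p) (snd p) \<in> carrier A" if "p \<in> U" for p using b_closed assms(3) that by (cases p) auto
  show ?thesis unfolding frag_ev_def
    by (rule A.add.finprod_mono_neutral_cong_left)
      (use assms bU in \<open>auto simp: in_keys_iff add_pow_int[OF A] simp del: split_paired_All\<close>)
qed

lemma frag_ev_add:
  assumes "x \<in> carrier FF" "y \<in> carrier FF"
  shows "frag_ev (x + y) = frag_ev x \<oplus>\<^bsub>A\<^esub> frag_ev y"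
proof -
  interpret A: abelian_group A by (rule A)
  let ?U = "Poly_Mapping.keys x \<union> Poly_Mapping.keys y"
  have U: "finite ?U" "?U \<subseteq> carrier M \<times> carrier N" using assms by (auto simp: free_carrier)
  have k: "Poly_Mapping.keys (x + y) \<subseteq> ?U" by (rule keys_add)
  show ?thesis
    unfolding frag_ev_superset[OF U(1) k U(2)] frag_ev_superset[OF U(1) _ U(2), of x, simplified]
      frag_ev_superset[OF U(1) _ U(2), of y, simplified]
    by (subst A.finsum_addf[symmetric])
      (use U b_closed in \<open>auto simp: Poly_Mapping.lookup_add add_pow_int[OF A] intro!: A.finsum_cong' A.finsum_closed\<close>)
qed

lemma frag_ev_closed: "x \<in> carrier FF ==> frag_ev x \<in> carrier A"
proof -
  interpret A: abelian_group A by (rule A)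
  show "x \<in> carrier FF ==> frag_ev x \<in> carrier A" unfolding frag_ev_def
    by (rule A.finsum_closed) (use b_closed in \<open>auto simp: free_carrier add_pow_int[OF A]\<close>)
qed

lemma frag_ev_of: "m \<in> carrier M ==> n \<in> carrier N ==> frag_ev (frag_of (m, n)) = b m n"
proof -
  interpret A: abelian_group A by (rule A)
  show "m \<in> carrier M ==> n \<in> carrier N ==> frag_ev (frag_of (m, n)) = b m n"
    using b_closed[of m n] by (simp add: frag_ev_def add_pow_int[OF A])
qed

lemma frag_ev_hom: "group_hom FF (add_monoid A) frag_ev"
  using free_comm_group A by (auto simp: group_hom_def group_hom_axioms_def hom_def frag_ev_closed frag_ev_add free_simps
      intro: comm_group.axioms abelian_group.a_group)

lemma frag_ev_ker: "x \<in> KK ==> frag_ev x = \<zero>\<^bsub>A\<^esub>"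
proof -
  interpret A: abelian_group A by (rule A)
  interpret h: group_hom FF "add_monoid A" frag_ev by (rule frag_ev_hom)
  have sub: "frag_ev (x - y) = frag_ev x \<ominus>\<^bsub>A\<^esub> frag_ev y" if "x \<in> carrier FF" "y \<in> carrier FF" for x y
  proof -
    have c: "x - y \<in> carrier FF" using that by (rule free_diff_closed)
    have "frag_ev x = frag_ev (x - y) \<oplus>\<^bsub>A\<^esub> frag_ev y" using frag_ev_add[OF c that(2)] by simp
    then show ?thesis using that c frag_ev_closed by (simp add: A.a_assoc A.r_neg a_minus_def)
  qed
  have z: "a \<oplus>\<^bsub>A\<^esub> c \<ominus>\<^bsub>A\<^esub> a \<ominus>\<^bsub>A\<^esub> c = \<zero>\<^bsub>A\<^esub>" if "a \<in> carrier A" "c \<in> carrier A" for a c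
  proof -
    have "a \<oplus>\<^bsub>A\<^esub> c \<ominus>\<^bsub>A\<^esub> a \<ominus>\<^bsub>A\<^esub> c = (a \<oplus>\<^bsub>A\<^esub> c) \<oplus>\<^bsub>A\<^esub> \<ominus>\<^bsub>A\<^esub> (a \<oplus>\<^bsub>A\<^esub> c)"
      using that by (simp only: a_minus_def A.minus_add A.a_assoc A.a_closed A.a_inv_closed)
    also have "\<dots> = \<zero>\<^bsub>A\<^esub>" using that by (simp add: A.r_neg)
    finally show ?thesis .
  qed
  have z2: "a \<ominus>\<^bsub>A\<^esub> a = \<zero>\<^bsub>A\<^esub>" if "a \<in> carrier A" for a
    using that by (simp add: a_minus_def A.r_neg)
  \<comment> \<open>The two additivity relations reduce to \<open>z\<close>, the relation that moves
    a scalar reduces to \<open>z2\<close>.\<close>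
  have r: "frag_ev x = \<zero>\<^bsub>A\<^esub>" if "x \<in> tensor_rels R M N" for x
    using that b unfolding tensor_rels_def balanced_def
    by (auto simp: sub free_diff_closed frag_carrier frag_ev_of addhom_add b_closed z z2 addhom_add[of M A "\<lambda>x. b x _"])
  show "x \<in> KK ==> frag_ev x = \<zero>\<^bsub>A\<^esub>" unfolding tensor_ker_def
  proof (induction x rule: generate.induct)
    case one then show ?case using h.hom_one by simp
  next
    case (incl x) then show ?case by (rule r)
  next
    case (inv x) then show ?case using h.hom_inv[of x] r[of x] rels_carrier
      by (auto simp: a_inv_def[symmetric])
  next
    case (eng x y)
    then have "x \<in> carrier FF" "y \<in> carrier FF" using subgroup.subset[OF ker_subgroup] by (auto simp: tensor_ker_def)
    then show ?case using eng h.hom_mult by simp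
  qed
qed

text \<open>The representative chosen by \<open>tlift\<close> differs from x by an element of the
  kernel, where the evaluation vanishes.\<close>

lemma tlift_cls: "x \<in> carrier FF ==> tlift A b (cls x) = frag_ev x"
proof -
  assume x: "x \<in> carrier FF"
  interpret A: abelian_group A by (rule A)
  interpret F: comm_group FF by (rule free_comm_group)
  let ?y = "SOME y. y \<in> cls x"
  have "x \<in> cls x" unfolding tensor_cls_def by (rule F.rcos_self[OF x ker_subgroup])
  then have "?y \<in> cls x" by (rule someI)
  then obtain k where k: "k \<in> KK" "?y = k + x" by (auto simp: tensor_cls_def r_coset_def free_simps)
  have "k \<in> carrier FF" using k subgroup.subset[OF ker_subgroup] by auto
  then have "frag_ev ?y = frag_ev x" using k x by (simp add: frag_ev_add frag_ev_ker frag_ev_closed)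
  then show ?thesis by (simp add: tlift_def frag_ev_def)
qed

lemma tlift_addhom: "addhom TT A (tlift A b)"
  by (rule addhomI) (auto simp: tensor_carrier cls_add tlift_cls free_add_closed frag_ev_add frag_ev_closed)

lemma tlift_tens: "m \<in> carrier M ==> n \<in> carrier N ==> tlift A b (m \<star> n) = b m n"
  by (simp add: tens_def tlift_cls frag_carrier frag_ev_of)

end

end

section \<open>Records with replaced actions, and the modules and algebras obtained from
  them\<close>

lemma modl_simps [simp]:
  "carrier (modl M act) = carrier M" "monoid.mult (modl M act) = monoid.mult M"
  "one (modl M act) = one M" "ring.zero (modl M act) = ring.zero M" "add (modl M act) = add M"
  "smult (modl M act) = act"
  by (simp_all add: modl_def)

lemma gmodl_simps [simp]:
  "carrier (gmodl M act gr) = carrier M" "monoid.mult (gmodl M act gr) = monoid.mult M"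
  "one (gmodl M act gr) = one M" "ring.zero (gmodl M act gr) = ring.zero M"
  "add (gmodl M act gr) = add M" "smult (gmodl M act gr) = act" "dpart (gmodl M act gr) = gr"
  by (simp_all add: gmodl_def)

text \<open>Negatives, differences, finite sums and integer multiples depend on these three fields
  only, so they transfer between records that differ in their products or actions.\<close>

definition same_add :: "('a, 'u) ring_scheme \<Rightarrow> ('a, 'v) ring_scheme \<Rightarrow> bool" where
  "same_add A B \<longleftrightarrow> carrier A = carrier B \<and> add A = add B \<and> ring.zero A = ring.zero B"

lemma same_add_modl [simp]: "same_add (modl M act) M" "same_add M (modl M act)"
  "same_add (gmodl M act gr) M" "same_add M (gmodl M act gr)"
  by (simp_all add: same_add_def)

lemma same_add_abelian_group:
  assumes "same_add A B" "abelian_group A" shows "abelian_group B"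
proof -
  interpret A: abelian_group A by fact
  have e: "carrier B = carrier A" "add B = add A" "ring.zero B = ring.zero A"
    using assms(1) by (auto simp: same_add_def)
  show ?thesis
    by (rule abelian_groupI) (auto simp: e A.a_ac intro: A.l_neg)
qed

lemma same_add_ops:
  assumes "same_add A B"
  shows "a_inv A = a_inv B" "a_minus A = a_minus B" "finsum A f I = finsum B f I"
    "add_pow A (k::int) = add_pow B k"
proof -
  have e: "carrier B = carrier A" "add B = add A" "ring.zero B = ring.zero A"
    using assms(1) by (auto simp: same_add_def)
  show i: "a_inv A = a_inv B" by (simp add: a_inv_def m_inv_def[abs_def] e)
  then show "a_minus A = a_minus B" by (simp add: a_minus_def[abs_def] e)
  show "finsum A f I = finsum B f I" by (simp add: finsum_def finprod_def e)
  show "add_pow A (k::int) = add_pow B k"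
    using i[unfolded a_inv_def] by (intro ext) (simp only: add_pow_def int_pow_def nat_pow_def e monoid.simps partial_object.simps)
qed

lemma modl_ops [simp]:
  "a_inv (modl M act) = a_inv M" "a_minus (modl M act) = a_minus M"
  "finsum (modl M act) = finsum M" "add_pow (modl M act) (k::int) = add_pow M k"
  "a_inv (gmodl M act gr) = a_inv M" "a_minus (gmodl M act gr) = a_minus M"
  "finsum (gmodl M act gr) = finsum M" "add_pow (gmodl M act gr) (k::int) = add_pow M k"
  by (auto simp: same_add_ops(1,2,4)[OF same_add_modl(1)] same_add_ops(3)[OF same_add_modl(1)]
    same_add_ops(1,2,4)[OF same_add_modl(3)] same_add_ops(3)[OF same_add_modl(3)] fun_eq_iff)

lemma abelian_group_modl [simp]:
  "abelian_group (modl M act) \<longleftrightarrow> abelian_group M" "abelian_group (gmodl M act gr) \<longleftrightarrow> abelian_group M"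
  by (meson same_add_abelian_group same_add_modl)+

lemma same_ring_cring:
  assumes "same_add A B" "monoid.mult A = monoid.mult B" "one A = one B" "cring A"
  shows "cring B"
proof -
  interpret A: cring A by fact
  have e: "carrier B = carrier A" "add B = add A" "ring.zero B = ring.zero A"
    "monoid.mult B = monoid.mult A" "one B = one A"
    using assms(1-3) by (auto simp: same_add_def)
  show ?thesis
    by (rule cringI[OF same_add_abelian_group[OF assms(1)]])
      (auto simp: e A.is_abelian_group A.l_distr A.r_distr A.m_ac intro!: comm_monoidI)
qed

lemma cring_modl [simp]:
  "cring (modl M act) \<longleftrightarrow> cring M" "cring (gmodl M act gr) \<longleftrightarrow> cring M"
  by (rule iffI; erule same_ring_cring[rotated 3]; simp)+

lemma restr_scalars_simps [simp]:
  "carrier (restr_scalars h M) = carrier M" "monoid.mult (restr_scalars h M) = monoid.mult M"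
  "one (restr_scalars h M) = one M" "ring.zero (restr_scalars h M) = ring.zero M"
  "add (restr_scalars h M) = add M" "smult (restr_scalars h M) = (\<lambda>r x. h r \<odot>\<^bsub>M\<^esub> x)"
  "a_inv (restr_scalars h M) = a_inv M" "a_minus (restr_scalars h M) = a_minus M"
  "finsum (restr_scalars h M) = finsum M" "add_pow (restr_scalars h M) (k::int) = add_pow M k"
  "abelian_group (restr_scalars h M) \<longleftrightarrow> abelian_group M" "cring (restr_scalars h M) \<longleftrightarrow> cring M"
  by (simp_all add: restr_scalars_def)

lemma alg_simps [simp]:
  "carrier (alg h A) = carrier A" "monoid.mult (alg h A) = monoid.mult A"
  "one (alg h A) = one A" "ring.zero (alg h A) = ring.zero A"
  "add (alg h A) = add A" "smult (alg h A) = (\<lambda>r x. h r \<otimes>\<^bsub>A\<^esub> x)"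
  "a_inv (alg h A) = a_inv A" "a_minus (alg h A) = a_minus A"
  "finsum (alg h A) = finsum A" "add_pow (alg h A) (k::int) = add_pow A k"
  "abelian_group (alg h A) \<longleftrightarrow> abelian_group A" "cring (alg h A) \<longleftrightarrow> cring A"
  by (simp_all add: alg_def)

lemma ungr_simps [simp]:
  "carrier (ungr A) = carrier A" "monoid.mult (ungr A) = monoid.mult A"
  "one (ungr A) = one A" "ring.zero (ungr A) = ring.zero A"
  "add (ungr A) = add A" "smult (ungr A) = smult A"
  "a_inv (ungr A) = a_inv A" "a_minus (ungr A) = a_minus A"
  "finsum (ungr A) = finsum A" "add_pow (ungr A) (k::int) = add_pow A k"
  "abelian_group (ungr A) \<longleftrightarrow> abelian_group A" "cring (ungr A) \<longleftrightarrow> cring A"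
  by (simp_all add: ungr_def)

lemma addhom_source [simp]:
  "addhom (modl A act) B f \<longleftrightarrow> addhom A B f"
  "addhom (gmodl A act gr) B f \<longleftrightarrow> addhom A B f"
  "addhom (restr_scalars h A') B f \<longleftrightarrow> addhom A' B f"
  "addhom (alg k A) B f \<longleftrightarrow> addhom A B f"
  "addhom (ungr A') B f \<longleftrightarrow> addhom A' B f"
  by (simp_all add: addhom_def)

lemma addhom_target [simp]:
  "addhom A (modl B act) f \<longleftrightarrow> addhom A B f"
  "addhom A (gmodl B act gr) f \<longleftrightarrow> addhom A B f"
  "addhom A (restr_scalars h B') f \<longleftrightarrow> addhom A B' f"
  "addhom A (alg k B) f \<longleftrightarrow> addhom A B f"
  "addhom A (ungr B') f \<longleftrightarrow> addhom A B' f"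
  by (simp_all add: addhom_def)

lemma alg_algebra:
  assumes "cring R" "cring A" "h \<in> ring_hom R A" shows "algebra R (alg h A)"
proof -
  interpret R: cring R by fact
  interpret A: cring A by fact
  have [simp]: "h r \<in> carrier A" if "r \<in> carrier R" for r using assms(3) that by (rule ring_hom_closed)
  show ?thesis
    by (rule algebraI) (auto simp: assms ring_hom_add[OF assms(3)] ring_hom_mult[OF assms(3)]
      ring_hom_one[OF assms(3)] A.l_distr A.r_distr A.m_assoc)
qed

lemma alg_module:
  assumes "cring R" "cring A" "h \<in> ring_hom R A" shows "module R (alg h A)"
  using algebra.module[OF alg_algebra[OF assms]] .

lemma restr_scalars_module:
  assumes "cring R" "module A M" "h \<in> ring_hom R A" shows "module R (restr_scalars h M)"
proof -
  interpret R: cring R by fact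
  interpret M: module A M by fact
  have [simp]: "h r \<in> carrier A" if "r \<in> carrier R" for r using assms(3) that by (rule ring_hom_closed)
  show ?thesis
    by (rule moduleI) (auto simp: assms(1) M.abelian_group_axioms ring_hom_add[OF assms(3)] ring_hom_mult[OF assms(3)]
      ring_hom_one[OF assms(3)] M.smult_l_distr M.smult_r_distr M.smult_assoc1)
qed

lemma ungr_algebra: "algebra R A ==> algebra R (ungr A)"
proof -
  assume "algebra R A"
  then interpret A: algebra R A .
  show ?thesis by (rule algebraI) (auto simp: A.R_cring A.M_cring A.smult_l_distr A.smult_r_distr A.smult_assoc1 A.smult_assoc2)
qed

text \<open>Scalars act through their multiples of 1. This turns scalar multiplication into a
  product, to which a Leibniz rule applies.\<close>

lemma algebra_smult_one:
  assumes "algebra R A"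
  shows "(\<lambda>r. r \<odot>\<^bsub>A\<^esub> \<one>\<^bsub>A\<^esub>) \<in> ring_hom R A" (is "PROP ?g1")
    and "r \<in> carrier R ==> x \<in> carrier A ==> r \<odot>\<^bsub>A\<^esub> x = (r \<odot>\<^bsub>A\<^esub> \<one>\<^bsub>A\<^esub>) \<otimes>\<^bsub>A\<^esub> x"
    and "r \<in> carrier R ==> x \<in> carrier A ==> y \<in> carrier A ==> x \<otimes>\<^bsub>A\<^esub> (r \<odot>\<^bsub>A\<^esub> y) = r \<odot>\<^bsub>A\<^esub> (x \<otimes>\<^bsub>A\<^esub> y)" (is "PROP ?g2")
proof -
  interpret A: algebra R A by fact
  show 1: "r \<in> carrier R ==> x \<in> carrier A ==> r \<odot>\<^bsub>A\<^esub> x = (r \<odot>\<^bsub>A\<^esub> \<one>\<^bsub>A\<^esub>) \<otimes>\<^bsub>A\<^esub> x" for r x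
    by (simp add: A.smult_assoc2)
  show "PROP ?g1"
    by (rule ring_hom_memI) (auto simp: A.smult_assoc1 A.smult_l_distr 1[symmetric])
  show "PROP ?g2"
    using A.smult_assoc2[of r y x] by (simp add: A.m_comm)
qed

text \<open>The base rings of source and target may differ, so one rule covers base change as well
  as maps of a single factor. The last hypothesis is the balance condition for u \<otimes>
  v.\<close>

lemma tmap_addhom:
  assumes "two_modules R M N" "two_modules R0 M0 N0" "addhom M0 M u" "addhom N0 N v"
    and "\<And>r m n. r \<in> carrier R0 ==> m \<in> carrier M0 ==> n \<in> carrier N0 ==>
      tens R M N (u (r \<odot>\<^bsub>M0\<^esub> m)) (v n) = tens R M N (u m) (v (r \<odot>\<^bsub>N0\<^esub> n))"
  shows "addhom (tensor R0 M0 N0) (tensor R M N) (tmap R M N u v)"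
    and "m \<in> carrier M0 ==> n \<in> carrier N0 ==> tmap R M N u v (tens R0 M0 N0 m n) = tens R M N (u m) (v n)"
proof -
  interpret t: two_modules R M N by fact
  interpret t0: two_modules R0 M0 N0 by fact
  have b: "balanced R0 M0 N0 (tensor R M N) (\<lambda>x y. tens R M N (u x) (v y))"
    by (rule balancedI) (auto simp: addhom_closed[OF assms(3)] addhom_closed[OF assms(4)]
      addhom_add[OF assms(3)] addhom_add[OF assms(4)] t.tens_add_left t.tens_add_right assms(5))
  show "addhom (tensor R0 M0 N0) (tensor R M N) (tmap R M N u v)"
    and "m \<in> carrier M0 ==> n \<in> carrier N0 ==> tmap R M N u v (tens R0 M0 N0 m n) = tens R M N (u m) (v n)"
    unfolding tmap_def using t0.tlift_addhom[OF _ b] t0.tlift_tens[OF _ b] by auto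
qed

context two_modules
begin

text \<open>Uniqueness on formal sums themselves: the product of the tensor ring is given by a
  formula on representatives and has to be compared there.\<close>

lemma free_eqI:
  assumes A: "abelian_group A" and x: "x \<in> carrier FF"
    and f: "\<And>x y. x \<in> carrier FF ==> y \<in> carrier FF ==> f (x + y) = f x \<oplus>\<^bsub>A\<^esub> f y" "\<And>x. x \<in> carrier FF ==> f x \<in> carrier A"
    and g: "\<And>x y. x \<in> carrier FF ==> y \<in> carrier FF ==> g (x + y) = g x \<oplus>\<^bsub>A\<^esub> g y" "\<And>x. x \<in> carrier FF ==> g x \<in> carrier A"
    and eq: "\<And>m n. m \<in> carrier M ==> n \<in> carrier N ==> f (frag_of (m, n)) = g (frag_of (m, n))"
  shows "f x = g x"
proof -
  interpret A: abelian_group A by fact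
  have z: "0 \<in> carrier FF" by (simp add: free_carrier)
  have sub: "k (x - y) = k x \<ominus>\<^bsub>A\<^esub> k y"
    if k: "\<And>x y. x \<in> carrier FF ==> y \<in> carrier FF ==> k (x + y) = k x \<oplus>\<^bsub>A\<^esub> k y" "\<And>x. x \<in> carrier FF ==> k x \<in> carrier A"
      and xy: "x \<in> carrier FF" "y \<in> carrier FF" for k x y
    using k(1)[OF free_diff_closed[OF xy] xy(2)] k(2)[OF xy(1)] k(2)[OF xy(2)] k(2)[OF free_diff_closed[OF xy]]
    by (simp add: A.a_assoc A.r_neg a_minus_def)
  show ?thesis
  proof (rule free_Abelian_group_induct[OF x[unfolded free_carrier]])
    show "f 0 = g 0" using sub[OF f z z] sub[OF g z z] f(2)[OF z] g(2)[OF z] by (simp add: a_minus_def A.r_neg)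
    show "f (a - b) = g (a - b)" if "Poly_Mapping.keys a \<subseteq> carrier M \<times> carrier N" "Poly_Mapping.keys b \<subseteq> carrier M \<times> carrier N"
      "f a = g a" "f b = g b" for a b
      using that sub[OF f, of a b] sub[OF g, of a b] by (simp add: free_carrier)
  qed (auto simp: eq)
qed

lemma tensor_act_module:
  assumes C: "cring C" and ah: "\<And>c. c \<in> carrier C ==> addhom TT TT (F c)"
    and gen: "\<And>a b m n. a \<in> carrier C ==> b \<in> carrier C ==> m \<in> carrier M ==> n \<in> carrier N ==>
        F (a \<oplus>\<^bsub>C\<^esub> b) (m \<star> n) = F a (m \<star> n) \<oplus>\<^bsub>TT\<^esub> F b (m \<star> n)"
      "\<And>a b m n. a \<in> carrier C ==> b \<in> carrier C ==> m \<in> carrier M ==> n \<in> carrier N ==>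
        F (a \<otimes>\<^bsub>C\<^esub> b) (m \<star> n) = F a (F b (m \<star> n))"
      "\<And>m n. m \<in> carrier M ==> n \<in> carrier N ==> F \<one>\<^bsub>C\<^esub> (m \<star> n) = m \<star> n"
  shows "module C (modl TT F)"
proof -
  interpret C: cring C by fact
  interpret T: abelian_group TT by simp
  show ?thesis
  proof (rule moduleI, goal_cases)
    case (4 a b x)
    have "addhom TT TT (F (a \<oplus>\<^bsub>C\<^esub> b))" "addhom TT TT (\<lambda>x. F a x \<oplus>\<^bsub>TT\<^esub> F b x)"
      using ah[of "a \<oplus>\<^bsub>C\<^esub> b"] addhom_sum[OF tensor_abelian_group ah[of a] ah[of b]] 4 by simp_all
    from addhom_tensor_eqI[OF this, of x] show ?case using gen(1) 4 by simp
  next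
    case (6 a b x)
    have "addhom TT TT (F (a \<otimes>\<^bsub>C\<^esub> b))" "addhom TT TT (\<lambda>x. F a (F b x))"
      using ah[of "a \<otimes>\<^bsub>C\<^esub> b"] addhom_comp[OF ah[of b] ah[of a]] 6 by simp_all
    from addhom_tensor_eqI[OF this, of x] show ?case using gen(2) 6 by simp
  next
    case (7 x)
    from addhom_tensor_eqI[OF ah[OF C.one_closed] addhom_id, of x] show ?case using gen(3) 7 by simp
  qed (auto simp: C addhom_closed[OF ah] addhom_add[OF ah])
qed

text \<open>An action on one factor respects the balance relation because it commutes with
  R.\<close>

lemma tensor_right_module:
  assumes "module C (modl N act)"
    and "\<And>c r n. c \<in> carrier C ==> r \<in> carrier R ==> n \<in> carrier N ==> act c (r \<odot>\<^bsub>N\<^esub> n) = r \<odot>\<^bsub>N\<^esub> act c n"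
  shows "module C (tensor_right R M N act)"
    and "c \<in> carrier C ==> m \<in> carrier M ==> n \<in> carrier N ==>
      c \<odot>\<^bsub>tensor_right R M N act\<^esub> (m \<star> n) = m \<star> act c n" (is "PROP ?g1")
proof -
  interpret C: module C "modl N act" by fact
  have ac: "act c n \<in> carrier N" if "c \<in> carrier C" "n \<in> carrier N" for c n
    using C.smult_closed that by simp
  have h: "addhom N N (act c)" if "c \<in> carrier C" for c
    using C.smult_closed C.smult_r_distr that by (auto intro!: addhomI)
  have b: "(r \<odot>\<^bsub>M\<^esub> m) \<star> act c n = m \<star> act c (r \<odot>\<^bsub>N\<^esub> n)"
    if "c \<in> carrier C" "r \<in> carrier R" "m \<in> carrier M" "n \<in> carrier N" for r m n c
    using that by (simp add: assms(2) tens_smult ac)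
  note tm = tmap_addhom[OF two_modules_axioms two_modules_axioms addhom_id h b]
  have at: "tmap R M N (\<lambda>x. x) (act c) (m \<star> n) = m \<star> act c n" if "c \<in> carrier C" "m \<in> carrier M" "n \<in> carrier N" for c m n
    using tm(2) that by blast
  have ah: "addhom TT TT (tmap R M N (\<lambda>x. x) (act c))" if "c \<in> carrier C" for c
    using tm(1) that by blast
  show "PROP ?g1"
    by (simp add: tensor_right_def at)
  show "module C (tensor_right R M N act)" unfolding tensor_right_def
    by (rule tensor_act_module[OF C.R.is_cring])
      (use ah C.smult_l_distr C.smult_assoc1 C.smult_one in \<open>simp_all add: at ac tens_add_right\<close>)
qed

lemma tensor_left_module:
  assumes "module C (modl M act)"
    and "\<And>c r n. c \<in> carrier C ==> r \<in> carrier R ==> n \<in> carrier M ==> act c (r \<odot>\<^bsub>M\<^esub> n) = r \<odot>\<^bsub>M\<^esub> act c n"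
  shows "module C (tensor_left R M N act)"
    and "c \<in> carrier C ==> m \<in> carrier M ==> n \<in> carrier N ==>
      c \<odot>\<^bsub>tensor_left R M N act\<^esub> (m \<star> n) = act c m \<star> n" (is "PROP ?g1")
proof -
  interpret C: module C "modl M act" by fact
  have ac: "act c n \<in> carrier M" if "c \<in> carrier C" "n \<in> carrier M" for c n
    using C.smult_closed that by simp
  have h: "addhom M M (act c)" if "c \<in> carrier C" for c
    using C.smult_closed C.smult_r_distr that by (auto intro!: addhomI)
  have b: "act c (r \<odot>\<^bsub>M\<^esub> m) \<star> n = act c m \<star> (r \<odot>\<^bsub>N\<^esub> n)"
    if "c \<in> carrier C" "r \<in> carrier R" "m \<in> carrier M" "n \<in> carrier N" for r m n c
    using that by (simp add: assms(2) tens_smult ac)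
  note tm = tmap_addhom[OF two_modules_axioms two_modules_axioms h addhom_id b]
  have at: "tmap R M N (act c) (\<lambda>x. x) (m \<star> n) = act c m \<star> n" if "c \<in> carrier C" "m \<in> carrier M" "n \<in> carrier N" for c m n
    using tm(2) that by blast
  have ah: "addhom TT TT (tmap R M N (act c) (\<lambda>x. x))" if "c \<in> carrier C" for c
    using tm(1) that by blast
  show "PROP ?g1"
    by (simp add: tensor_left_def at)
  show "module C (tensor_left R M N act)" unfolding tensor_left_def
    by (rule tensor_act_module[OF C.R.is_cring])
      (use ah C.smult_l_distr C.smult_assoc1 C.smult_one in \<open>simp_all add: at ac tens_add_left\<close>)
qed

end

section \<open>The ring structure on the tensor product of two algebras\<close>

locale two_algebras = two_modules R M N + MA: algebra R M + NA: algebra R N for R M N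
begin

text \<open>The product obtained by lifting twice; \<open>tensor_mult\<close> identifies it with the
  formula on representatives in the record.\<close>

definition tmul where
  "tmul X Y = tlift TT (\<lambda>m n. tlift TT (\<lambda>m' n'. (m \<otimes>\<^bsub>M\<^esub> m') \<star> (n \<otimes>\<^bsub>N\<^esub> n')) Y) X"

lemma tmul_inner:
  assumes "m \<in> carrier M" "n \<in> carrier N"
  shows "addhom TT TT (tlift TT (\<lambda>m' n'. (m \<otimes>\<^bsub>M\<^esub> m') \<star> (n \<otimes>\<^bsub>N\<^esub> n')))" (is "PROP ?g1")
    and "m' \<in> carrier M ==> n' \<in> carrier N ==>
      tlift TT (\<lambda>m' n'. (m \<otimes>\<^bsub>M\<^esub> m') \<star> (n \<otimes>\<^bsub>N\<^esub> n')) (m' \<star> n') = (m \<otimes>\<^bsub>M\<^esub> m') \<star> (n \<otimes>\<^bsub>N\<^esub> n')" (is "PROP ?g2")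
proof -
  have b: "balanced R M N TT (\<lambda>m' n'. (m \<otimes>\<^bsub>M\<^esub> m') \<star> (n \<otimes>\<^bsub>N\<^esub> n'))"
    using assms by (intro balancedI) (auto simp: MA.r_distr NA.r_distr tens_add_left tens_add_right
      algebra_smult_one(3)[OF MA.algebra_axioms] algebra_smult_one(3)[OF NA.algebra_axioms] tens_smult)
  show "PROP ?g1"
    by (rule tlift_addhom[OF _ b]) simp
  show "PROP ?g2"
    by (rule tlift_tens[OF _ b]) simp
qed

lemma tmul_left:
  assumes Y: "Y \<in> carrier TT"
  shows "addhom TT TT (\<lambda>X. tmul X Y)"
    and "m \<in> carrier M ==> n \<in> carrier N ==> tmul (m \<star> n) Y = tlift TT (\<lambda>m' n'. (m \<otimes>\<^bsub>M\<^esub> m') \<star> (n \<otimes>\<^bsub>N\<^esub> n')) Y" (is "PROP ?g1")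
proof -
  let ?f = "\<lambda>m n. tlift TT (\<lambda>m' n'. (m \<otimes>\<^bsub>M\<^esub> m') \<star> (n \<otimes>\<^bsub>N\<^esub> n'))"
  have b: "balanced R M N TT (\<lambda>m n. ?f m n Y)"
  proof (rule balancedI)
    show "?f x y Y \<in> carrier TT" if "x \<in> carrier M" "y \<in> carrier N" for x y
      using tmul_inner(1)[OF that] Y by (rule addhom_closed)
    show "?f x (y \<oplus>\<^bsub>N\<^esub> y') Y = ?f x y Y \<oplus>\<^bsub>TT\<^esub> ?f x y' Y" if "x \<in> carrier M" "y \<in> carrier N" "y' \<in> carrier N" for x y y'
    proof (rule addhom_tensor_eqI[OF _ addhom_sum Y])
    qed (use that in \<open>auto intro!: tmul_inner(1) simp: tmul_inner NA.l_distr tens_add_right\<close>)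
    show "?f (x \<oplus>\<^bsub>M\<^esub> x') y Y = ?f x y Y \<oplus>\<^bsub>TT\<^esub> ?f x' y Y" if "x \<in> carrier M" "x' \<in> carrier M" "y \<in> carrier N" for x y x'
    proof (rule addhom_tensor_eqI[OF _ addhom_sum Y])
    qed (use that in \<open>auto intro!: tmul_inner(1) simp: tmul_inner MA.l_distr tens_add_left\<close>)
    show "?f (r \<odot>\<^bsub>M\<^esub> x) y Y = ?f x (r \<odot>\<^bsub>N\<^esub> y) Y" if "r \<in> carrier R" "x \<in> carrier M" "y \<in> carrier N" for r x y
    proof (rule addhom_tensor_eqI[OF _ _ Y])
    qed (use that in \<open>auto intro!: tmul_inner(1) simp: tmul_inner MA.smult_assoc2 NA.smult_assoc2 tens_smult\<close>)
  qed
  show "addhom TT TT (\<lambda>X. tmul X Y)" unfolding tmul_def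
    by (rule tlift_addhom[OF _ b]) simp
  show "PROP ?g1"
    unfolding tmul_def by (rule tlift_tens[OF _ b]) simp
qed

lemma tmul_tens:
  "m \<in> carrier M ==> n \<in> carrier N ==> m' \<in> carrier M ==> n' \<in> carrier N ==>
   tmul (m \<star> n) (m' \<star> n') = (m \<otimes>\<^bsub>M\<^esub> m') \<star> (n \<otimes>\<^bsub>N\<^esub> n')"
  by (simp add: tmul_left tmul_inner)

text \<open>The definition gives additivity in the left factor; commutativity carries it over to the
  right one in \<open>tmul_right\<close>.\<close>

lemma tmul_comm:
  assumes "X \<in> carrier TT" "Y \<in> carrier TT" shows "tmul X Y = tmul Y X"
  using assms(1)
proof (induction rule: tensor_induct)
  case (tens m n)
  interpret T: abelian_group TT by simp
  show ?case using assms(2)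
  proof (induction rule: tensor_induct)
    case (tens m' n')
    then show ?case using \<open>m \<in> _\<close> \<open>n \<in> _\<close> by (simp add: tmul_tens MA.m_comm NA.m_comm)
  next
    case (add x y)
    then show ?case using tens
      by (simp add: tmul_left(2) addhom_add[OF tmul_inner(1)] addhom_add[OF tmul_left(1)])
  qed
next
  case (add x y)
  interpret T: abelian_group TT by simp
  have i: "tmul Y (x \<oplus>\<^bsub>TT\<^esub> y) = tmul Y x \<oplus>\<^bsub>TT\<^esub> tmul Y y" using assms(2)
  proof (induction rule: tensor_induct)
    case (tens m' n')
    then show ?case using add by (simp add: tmul_left(2) addhom_add[OF tmul_inner(1)])
  next
    case (add x' y')
    interpret T: abelian_group TT by simp
    have c: "tmul u v \<in> carrier TT" if "u \<in> carrier TT" "v \<in> carrier TT" for u v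
      using tmul_left(1)[OF that(2)] that(1) by (rule addhom_closed)
    show ?case using add \<open>x \<in> _\<close> \<open>y \<in> _\<close> by (simp add: addhom_add[OF tmul_left(1)] c T.a_ac)
  qed
  then show ?case using add assms(2) by (simp add: addhom_add[OF tmul_left(1)])
qed

lemma tmul_right: "X \<in> carrier TT ==> addhom TT TT (tmul X)"
  by (rule addhom_cong[OF tmul_left(1)]) (auto simp: tmul_comm)

text \<open>The record takes a union over all pairs of representatives. Every pair gives the same
  class, so this is the union of a nonempty constant family.\<close>

lemma tensor_mult:
  assumes "X \<in> carrier TT" "Y \<in> carrier TT" shows "X \<otimes>\<^bsub>TT\<^esub> Y = tmul X Y"
proof -
  interpret T: abelian_group TT by simp
  interpret F: comm_group FF by (rule free_comm_group)
  \<comment> \<open>The product of two representatives, biadditive on formal sums.\<close>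
  define fm where "fm = (\<lambda>x y. frag_extend (\<lambda>(m, n). frag_extend (\<lambda>(m', n'). frag_of (m \<otimes>\<^bsub>M\<^esub> m', n \<otimes>\<^bsub>N\<^esub> n')) y) x)"
  have fm_left: "fm (x + x') y = fm x y + fm x' y" for x x' y by (simp add: fm_def frag_extend_add)
  have fm_right: "fm x (y + y') = fm x y + fm x y'" for x y y'
    by (simp add: fm_def frag_extend_add case_prod_unfold frag_extend_def[of _ x] sum.distrib frag_cmul_distrib2)
  have fm_closed: "fm x y \<in> carrier FF" if "x \<in> carrier FF" "y \<in> carrier FF" for x y
  proof -
    have "Poly_Mapping.keys (fm x y) \<subseteq> (\<Union>p\<in>Poly_Mapping.keys x. \<Union>q\<in>Poly_Mapping.keys y. {(fst p \<otimes>\<^bsub>M\<^esub> fst q, snd p \<otimes>\<^bsub>N\<^esub> snd q)})"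
      unfolding fm_def
      by (rule order_trans[OF keys_frag_extend], rule UN_mono[OF order_refl], unfold case_prod_unfold,
        rule order_trans[OF keys_frag_extend], auto)
    then show ?thesis using that unfolding free_carrier by (fastforce simp: subset_iff)
  qed
  have eq: "cls (fm x y) = tmul (cls x) (cls y)" if x: "x \<in> carrier FF" and y: "y \<in> carrier FF" for x y
  proof (rule free_eqI[OF T.abelian_group_axioms x])
    fix m n assume mn: "m \<in> carrier M" "n \<in> carrier N"
    show "cls (fm (frag_of (m, n)) y) = tmul (cls (frag_of (m, n))) (cls y)"
    proof (rule free_eqI[OF T.abelian_group_axioms y])
      fix m' n' assume mn': "m' \<in> carrier M" "n' \<in> carrier N"
      have "fm (frag_of (m, n)) (frag_of (m', n')) = frag_of (m \<otimes>\<^bsub>M\<^esub> m', n \<otimes>\<^bsub>N\<^esub> n')" by (simp add: fm_def)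
      then show "cls (fm (frag_of (m, n)) (frag_of (m', n'))) = tmul (cls (frag_of (m, n))) (cls (frag_of (m', n')))"
        using tmul_tens[OF mn mn'] by (simp add: tens_def)
    qed (use mn in \<open>auto simp: fm_right fm_closed frag_carrier cls_add[symmetric] cls_closed addhom_add[OF tmul_right] addhom_closed[OF tmul_right]\<close>)
  qed (use y in \<open>auto simp: fm_left fm_closed cls_add[symmetric] cls_closed addhom_add[OF tmul_left(1)] addhom_closed[OF tmul_left(1)]\<close>)
  have rep: "Z \<subseteq> carrier FF" "z \<in> Z ==> cls z = Z" "Z \<noteq> {}" if Z: "Z \<in> carrier TT" for z Z
  proof -
    obtain w where w: "w \<in> carrier FF" "Z = cls w" using Z by (auto simp: tensor_carrier)
    show "Z \<subseteq> carrier FF" using F.r_coset_subset_G[OF subgroup.subset[OF ker_subgroup] w(1)] w(2) by (simp add: tensor_cls_def)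
    show "z \<in> Z ==> cls z = Z" using F.repr_independence[OF _ w(1) ker_subgroup] w by (simp add: tensor_cls_def)
    show "Z \<noteq> {}" using F.rcos_self[OF w(1) ker_subgroup] w by (auto simp: tensor_cls_def)
  qed
  have "X \<otimes>\<^bsub>TT\<^esub> Y = (\<Union>x\<in>X. \<Union>y\<in>Y. cls (fm x y))" by (simp add: tensor_def fm_def)
  also have "\<dots> = (\<Union>x\<in>X. \<Union>y\<in>Y. tmul X Y)"
  proof (intro SUP_cong refl)
    fix x y assume xy: "x \<in> X" "y \<in> Y"
    then have "x \<in> carrier FF" "y \<in> carrier FF" using rep(1) assms by auto
    then show "cls (fm x y) = tmul X Y" using eq rep(2) assms xy by metis
  qed
  also have "\<dots> = tmul X Y" using rep(3) assms by auto
  finally show ?thesis .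
qed

lemma tens_mult:
  "m \<in> carrier M ==> n \<in> carrier N ==> m' \<in> carrier M ==> n' \<in> carrier N ==>
   (m \<star> n) \<otimes>\<^bsub>TT\<^esub> (m' \<star> n') = (m \<otimes>\<^bsub>M\<^esub> m') \<star> (n \<otimes>\<^bsub>N\<^esub> n')"
  by (simp add: tensor_mult tmul_tens)

lemma tensor_one: "\<one>\<^bsub>TT\<^esub> = \<one>\<^bsub>M\<^esub> \<star> \<one>\<^bsub>N\<^esub>"
  by (simp add: tensor_def)

lemma tensor_cring: "cring TT"
proof -
  interpret T: abelian_group TT by simp
  have c: "tmul u v \<in> carrier TT" if "u \<in> carrier TT" "v \<in> carrier TT" for u v
    using tmul_left(1)[OF that(2)] that(1) by (rule addhom_closed)
  have assoc: "tmul (tmul x y) z = tmul x (tmul y z)" if x: "x \<in> carrier TT" and y: "y \<in> carrier TT" and z: "z \<in> carrier TT" for x y z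
    using x
  proof (induction rule: tensor_induct)
    case (tens m n)
    show ?case using y
    proof (induction rule: tensor_induct)
      case (tens m' n')
      show ?case using z
      proof (induction rule: tensor_induct)
        case (tens m'' n'')
        then show ?case using \<open>m \<in> _\<close> \<open>n \<in> _\<close> \<open>m' \<in> _\<close> \<open>n' \<in> _\<close> by (simp add: tmul_tens MA.m_assoc NA.m_assoc)
      next
        case (add u v)
        then show ?case using \<open>m \<in> _\<close> \<open>n \<in> _\<close> tens by (simp add: addhom_add[OF tmul_right] c)
      qed
    next
      case (add u v)
      then show ?case using tens z by (simp add: addhom_add[OF tmul_right] addhom_add[OF tmul_left(1)] c)
    qed
  next
    case (add u v)
    then show ?case using y z by (simp add: addhom_add[OF tmul_left(1)] c)
  qed
  have l1: "tmul (\<one>\<^bsub>M\<^esub> \<star> \<one>\<^bsub>N\<^esub>) x = x" if x: "x \<in> carrier TT" for x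
    using x by (induction rule: tensor_induct) (auto simp: tmul_tens addhom_add[OF tmul_right])
  show ?thesis
  proof (rule cringI)
    show "abelian_group TT" by simp
    show "comm_monoid TT"
      by (rule comm_monoidI) (simp_all add: tensor_mult tensor_one c assoc l1, rule tmul_comm)
    show "(x \<oplus>\<^bsub>TT\<^esub> y) \<otimes>\<^bsub>TT\<^esub> z = x \<otimes>\<^bsub>TT\<^esub> z \<oplus>\<^bsub>TT\<^esub> y \<otimes>\<^bsub>TT\<^esub> z"
      if "x \<in> carrier TT" "y \<in> carrier TT" "z \<in> carrier TT" for x y z
      using that by (simp add: tensor_mult addhom_add[OF tmul_left(1)])
  qed
qed

end

lemma tlift_same_add:
  assumes "same_add A B" shows "tlift A b = tlift B b"
  by (intro ext) (simp add: tlift_def Let_def same_add_ops[OF assms])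

lemma pp_aug_alg [simp]: "pp_aug (alg l S) = pp_aug S"
  by (simp add: pp_aug_def fun_eq_iff tlift_same_add[of "alg l S" S] same_add_def)

lemma abelian_minus_eq:
  assumes "abelian_group A" "x \<in> carrier A" "y \<in> carrier A" "z \<in> carrier A"
  shows "x \<ominus>\<^bsub>A\<^esub> y = z \<longleftrightarrow> x = z \<oplus>\<^bsub>A\<^esub> y"
proof -
  interpret A: abelian_group A by fact
  show ?thesis using assms(2-4)
    by (metis A.a_assoc A.a_inv_closed A.l_neg A.minus_eq A.r_neg A.r_zero)
qed

lemma ring_hom_ring_of:
  assumes "cring A" "cring B" "f \<in> ring_hom A B" shows "ring_hom_ring A B f"
  using assms by (auto intro!: ring_hom_ringI2 cring.axioms(1))

section \<open>Principal parts, differentials and their universal property\<close>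

locale kahler = MA: algebra R A for R :: "('r, 'y) ring_scheme" and A :: "('r, 'a, 'u) module_scheme"
begin

lemma two_algebras: "two_algebras R A A"
  by (simp add: two_algebras_def two_modules_def MA.module MA.algebra_axioms)

sublocale AA: two_algebras R A A by (rule two_algebras)

abbreviation "TA \<equiv> tensor R A A"
abbreviation "mu \<equiv> tlift A (monoid.mult A)"
abbreviation "DI \<equiv> diag_ideal R A"
abbreviation "DS \<equiv> diag_square R A"
abbreviation "PP \<equiv> pparts R A"
abbreviation "cl \<equiv> pp_cls R A"
abbreviation "W \<equiv> Omega R A"
abbreviation "eps \<equiv> pp_aug A"
abbreviation "J1 \<equiv> j1 R A"
abbreviation "J2 \<equiv> j2 R A"
abbreviation "dd \<equiv> univ_der R A"

lemma mult_balanced: "balanced R A A A (monoid.mult A)"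
  by (rule balancedI) (auto simp: MA.l_distr MA.r_distr MA.smult_assoc2 algebra_smult_one(3)[OF MA.algebra_axioms])

lemma mu_addhom: "addhom TA A mu"
  by (rule AA.tlift_addhom[OF _ mult_balanced]) (rule MA.is_abelian_group)

lemma mu_tens: "a \<in> carrier A ==> b \<in> carrier A ==> mu (tens R A A a b) = a \<otimes>\<^bsub>A\<^esub> b"
  by (rule AA.tlift_tens[OF _ mult_balanced]) (rule MA.is_abelian_group)

lemma mu_ring_hom: "mu \<in> ring_hom TA A"
proof (rule ring_hom_memI)
  interpret T: cring TA by (rule AA.tensor_cring)
  show "mu x \<in> carrier A" if "x \<in> carrier TA" for x using mu_addhom that by (rule addhom_closed)
  show "mu (x \<oplus>\<^bsub>TA\<^esub> y) = mu x \<oplus>\<^bsub>A\<^esub> mu y" if "x \<in> carrier TA" "y \<in> carrier TA" for x y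
    using mu_addhom that by (rule addhom_add)
  show "mu \<one>\<^bsub>TA\<^esub> = \<one>\<^bsub>A\<^esub>" by (simp add: AA.tensor_one mu_tens)
  show "mu (x \<otimes>\<^bsub>TA\<^esub> y) = mu x \<otimes>\<^bsub>A\<^esub> mu y" if x: "x \<in> carrier TA" and y: "y \<in> carrier TA" for x y
    using x
  proof (induction rule: AA.tensor_induct)
    case (tens m n)
    show ?case using y
    proof (induction rule: AA.tensor_induct)
      case (tens m' n')
      then show ?case using \<open>m \<in> _\<close> \<open>n \<in> _\<close> by (simp add: AA.tens_mult mu_tens MA.m_ac)
    next
      case (add x y)
      then show ?case using tens
        by (simp add: T.r_distr addhom_add[OF mu_addhom] addhom_closed[OF mu_addhom] MA.r_distr)
    qed
  next
    case (add u v)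
    then show ?case using y
      by (simp add: T.l_distr addhom_add[OF mu_addhom] addhom_closed[OF mu_addhom] MA.l_distr)
  qed
qed

lemma DI_ideal: "ideal DI TA"
proof -
  have h: "ring_hom_ring TA A mu"
    by (rule ring_hom_ring_of[OF AA.tensor_cring MA.M_cring mu_ring_hom])
  have "DI = a_kernel TA A mu" by (simp add: diag_ideal_def a_kernel_def kernel_def)
  then show ?thesis using ring_hom_ring.kernel_is_ideal[OF h] by simp
qed

lemma DS_ideal: "ideal DS TA"
  unfolding diag_square_def
  using ring.ideal_prod_is_ideal[OF _ DI_ideal DI_ideal] cring.axioms(1)[OF AA.tensor_cring] by blast

lemma DS_subset: "DS \<subseteq> DI"
  unfolding diag_square_def
  using ring.ideal_prod_inter[OF _ DI_ideal DI_ideal] cring.axioms(1)[OF AA.tensor_cring] by blast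

lemma pp_cring: "cring PP"
  unfolding pparts_def by (rule ideal.quotient_is_cring[OF DS_ideal AA.tensor_cring])

lemma pp_cls_hom: "cl \<in> ring_hom TA PP"
  using ideal.rcos_ring_hom[OF DS_ideal] by (simp add: pparts_def pp_cls_def[abs_def])

lemma pp_carrier: "carrier PP = cl ` carrier TA"
  by (auto simp: pparts_def FactRing_def A_RCOSETS_def' pp_cls_def)

lemma pp_cls_closed: "x \<in> carrier TA ==> cl x \<in> carrier PP"
  by (simp add: pp_carrier)

lemma pp_cls_some:
  assumes "x \<in> carrier TA" obtains k where "k \<in> DS" "(SOME y. y \<in> cl x) = k \<oplus>\<^bsub>TA\<^esub> x"
proof -
  interpret I: ideal DS TA by (rule DS_ideal)
  have "x \<in> cl x" unfolding pp_cls_def by (rule I.a_rcos_self[OF assms])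
  then have "(SOME y. y \<in> cl x) \<in> cl x" by (rule someI)
  then show thesis using that by (auto simp: pp_cls_def a_r_coset_def')
qed

text \<open>\<open>pp_aug\<close> and \<open>pp_map\<close> pick an element of a coset of I^2. An
  additive map that vanishes on I^2 does not see the choice.\<close>

lemma pp_descend:
  assumes C: "abelian_group C" and f: "addhom TA C f" and van: "\<And>x. x \<in> DS ==> f x = \<zero>\<^bsub>C\<^esub>"
  shows "addhom PP C (\<lambda>p. f (SOME x. x \<in> p))"
    and "x \<in> carrier TA ==> f (SOME y. y \<in> cl x) = f x"
proof -
  interpret C: abelian_group C by fact
  interpret I: ideal DS TA by (rule DS_ideal)
  show e: "f (SOME y. y \<in> cl x) = f x" if x: "x \<in> carrier TA" for x
  proof -
    obtain k where k: "k \<in> DS" "(SOME y. y \<in> cl x) = k \<oplus>\<^bsub>TA\<^esub> x" using pp_cls_some[OF x] .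
    have "k \<in> carrier TA" using k I.a_subset by auto
    then show ?thesis using k x by (simp add: addhom_add[OF f] van addhom_closed[OF f])
  qed
  show "addhom PP C (\<lambda>p. f (SOME x. x \<in> p))"
  proof (rule addhomI)
    show "f (SOME y. y \<in> x) \<in> carrier C" if "x \<in> carrier PP" for x
      using that by (auto simp: pp_carrier e addhom_closed[OF f])
    show "f (SOME z. z \<in> x \<oplus>\<^bsub>PP\<^esub> y) = f (SOME z. z \<in> x) \<oplus>\<^bsub>C\<^esub> f (SOME z. z \<in> y)"
      if xy: "x \<in> carrier PP" "y \<in> carrier PP" for x y
    proof -
      interpret T: cring TA by (rule AA.tensor_cring)
      obtain u v where uv: "u \<in> carrier TA" "v \<in> carrier TA" "x = cl u" "y = cl v"
        using xy by (auto simp: pp_carrier)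
      then have "x \<oplus>\<^bsub>PP\<^esub> y = cl (u \<oplus>\<^bsub>TA\<^esub> v)" using ring_hom_add[OF pp_cls_hom uv(1,2)] by simp
      then show ?thesis using uv by (simp add: e addhom_add[OF f])
    qed
  qed
qed

lemma mu_DS: "x \<in> DS ==> mu x = \<zero>\<^bsub>A\<^esub>"
  using DS_subset by (auto simp: diag_ideal_def)

lemma aug_cls: "x \<in> carrier TA ==> eps (cl x) = mu x"
  unfolding pp_aug_def by (rule pp_descend(2)[OF MA.is_abelian_group mu_addhom mu_DS])

lemma aug_addhom: "addhom PP A eps"
  unfolding pp_aug_def[abs_def] by (rule pp_descend(1)[OF MA.is_abelian_group mu_addhom mu_DS])

lemma aug_ring_hom: "eps \<in> ring_hom PP A"
proof (rule ring_hom_memI)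
  interpret T: cring TA by (rule AA.tensor_cring)
  show "eps x \<in> carrier A" if "x \<in> carrier PP" for x using aug_addhom that by (rule addhom_closed)
  show "eps (x \<oplus>\<^bsub>PP\<^esub> y) = eps x \<oplus>\<^bsub>A\<^esub> eps y" if "x \<in> carrier PP" "y \<in> carrier PP" for x y
    using aug_addhom that by (rule addhom_add)
  show "eps \<one>\<^bsub>PP\<^esub> = \<one>\<^bsub>A\<^esub>" using aug_cls[of "\<one>\<^bsub>TA\<^esub>"] ring_hom_one[OF pp_cls_hom] ring_hom_one[OF mu_ring_hom] by simp
  show "eps (x \<otimes>\<^bsub>PP\<^esub> y) = eps x \<otimes>\<^bsub>A\<^esub> eps y" if xy: "x \<in> carrier PP" "y \<in> carrier PP" for x y
  proof -
    obtain u v where "u \<in> carrier TA" "v \<in> carrier TA" "x = cl u" "y = cl v"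
      using xy by (auto simp: pp_carrier)
    then show ?thesis using ring_hom_mult[OF pp_cls_hom, of u v] by (simp add: ring_hom_mult[OF mu_ring_hom] aug_cls flip: ring_hom_mult[OF pp_cls_hom])
  qed
qed

sublocale P: cring PP by (rule pp_cring)

lemma aug_closed [simp]: "p \<in> carrier PP ==> eps p \<in> carrier A"
  using aug_ring_hom by (rule ring_hom_closed)

lemma J1_hom: "J1 \<in> ring_hom A PP" and J2_hom: "J2 \<in> ring_hom A PP"
proof -
  show "J1 \<in> ring_hom A PP"
    by (rule ring_hom_memI) (auto simp: j1_def pp_cls_closed AA.tens_add_left ring_hom_add[OF pp_cls_hom, symmetric]
      ring_hom_mult[OF pp_cls_hom, symmetric] AA.tens_mult AA.tensor_one[symmetric] ring_hom_one[OF pp_cls_hom])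
  show "J2 \<in> ring_hom A PP"
    by (rule ring_hom_memI) (auto simp: j2_def pp_cls_closed AA.tens_add_right ring_hom_add[OF pp_cls_hom, symmetric]
      ring_hom_mult[OF pp_cls_hom, symmetric] AA.tens_mult AA.tensor_one[symmetric] ring_hom_one[OF pp_cls_hom])
qed

lemmas J1_simps = ring_hom_add[OF J1_hom] ring_hom_mult[OF J1_hom] ring_hom_one[OF J1_hom]
  and J2_simps = ring_hom_add[OF J2_hom] ring_hom_mult[OF J2_hom] ring_hom_one[OF J2_hom]
  and aug_simps = ring_hom_add[OF aug_ring_hom] ring_hom_mult[OF aug_ring_hom] ring_hom_one[OF aug_ring_hom]

lemma J_closed [simp]: "a \<in> carrier A ==> J1 a \<in> carrier PP" "a \<in> carrier A ==> J2 a \<in> carrier PP"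
  using ring_hom_closed[OF J1_hom] ring_hom_closed[OF J2_hom] by auto

lemma aug_J [simp]: "a \<in> carrier A ==> eps (J1 a) = a" "a \<in> carrier A ==> eps (J2 a) = a"
  by (simp_all add: j1_def j2_def aug_cls mu_tens)

lemma J_smult_one: "r \<in> carrier R ==> J1 (r \<odot>\<^bsub>A\<^esub> \<one>\<^bsub>A\<^esub>) = J2 (r \<odot>\<^bsub>A\<^esub> \<one>\<^bsub>A\<^esub>)"
  by (simp add: j1_def j2_def AA.tens_smult)

lemma pp_cls_tens: "a \<in> carrier A ==> b \<in> carrier A ==> cl (tens R A A a b) = J1 a \<otimes>\<^bsub>PP\<^esub> J2 b"
  by (simp add: j1_def j2_def ring_hom_mult[OF pp_cls_hom, symmetric] AA.tens_mult)

text \<open>The class of a \<otimes> b is j1(a) j2(b), and pure tensors generate additively.\<close>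

lemma pp_induct [consumes 1, case_names gen add]:
  assumes "p \<in> carrier PP"
    and gen: "\<And>a b. a \<in> carrier A ==> b \<in> carrier A ==> Q (J1 a \<otimes>\<^bsub>PP\<^esub> J2 b)"
    and add: "\<And>x y. x \<in> carrier PP ==> y \<in> carrier PP ==> Q x ==> Q y ==> Q (x \<oplus>\<^bsub>PP\<^esub> y)"
  shows "Q p"
proof -
  obtain x where x: "x \<in> carrier TA" "p = cl x" using assms(1) by (auto simp: pp_carrier)
  from x(1) have "Q (cl x)"
  proof (induction rule: AA.tensor_induct)
    case (tens m n) then show ?case using gen by (simp add: pp_cls_tens)
  next
    case (add x y) then show ?case using assms(3) by (simp add: ring_hom_add[OF pp_cls_hom] pp_cls_closed)
  qed
  then show ?thesis using x by simp
qed

lemma W_carrier: "carrier W = {p \<in> carrier PP. eps p = \<zero>\<^bsub>A\<^esub>}"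
  by (auto simp: Omega_def diag_ideal_def pp_carrier aug_cls)

lemma W_simps: "add W = add PP" "ring.zero W = ring.zero PP" "smult W = pp_left R A"
  by (simp_all add: Omega_def)

lemma W_sub: "w \<in> carrier W ==> w \<in> carrier PP" and W_aug: "w \<in> carrier W ==> eps w = \<zero>\<^bsub>A\<^esub>"
  by (auto simp: W_carrier)

text \<open>A product of two elements of I lies in I^2, which is zero in the principal
  parts.\<close>

lemma W_mult_zero:
  assumes "v \<in> carrier W" "w \<in> carrier W" shows "v \<otimes>\<^bsub>PP\<^esub> w = \<zero>\<^bsub>PP\<^esub>"
proof -
  interpret I: ideal DS TA by (rule DS_ideal)
  obtain x y where xy: "x \<in> DI" "y \<in> DI" "v = cl x" "w = cl y" using assms by (auto simp: Omega_def)
  then have c: "x \<in> carrier TA" "y \<in> carrier TA" by (auto simp: diag_ideal_def)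
  have "x \<otimes>\<^bsub>TA\<^esub> y \<in> DS" using xy by (simp add: diag_square_def ideal_prod.prod)
  then have "cl (x \<otimes>\<^bsub>TA\<^esub> y) = DS" unfolding pp_cls_def by (rule I.a_rcos_const)
  then show ?thesis using xy c by (simp add: ring_hom_mult[OF pp_cls_hom] pparts_def FactRing_def)
qed

lemma aug_neg: "p \<in> carrier PP ==> eps (\<ominus>\<^bsub>PP\<^esub> p) = \<ominus>\<^bsub>A\<^esub> eps p"
  using addhom_neg[OF P.is_abelian_group MA.is_abelian_group aug_addhom] .

lemma aug_minus: "p \<in> carrier PP ==> q \<in> carrier PP ==> eps (p \<ominus>\<^bsub>PP\<^esub> q) = eps p \<ominus>\<^bsub>A\<^esub> eps q"
  using addhom_minus[OF P.is_abelian_group MA.is_abelian_group aug_addhom] .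

lemma aug_zero [simp]: "eps \<zero>\<^bsub>PP\<^esub> = \<zero>\<^bsub>A\<^esub>"
  using addhom_zero[OF P.is_abelian_group MA.is_abelian_group aug_addhom] .

lemma W_module: "module A W"
proof (rule moduleI)
  show "cring A" by (rule MA.M_cring)
  show "abelian_group W"
  proof (rule abelian_groupI)
    fix x assume "x \<in> carrier W"
    then show "\<exists>y\<in>carrier W. y \<oplus>\<^bsub>W\<^esub> x = \<zero>\<^bsub>W\<^esub>"
      by (intro bexI[of _ "\<ominus>\<^bsub>PP\<^esub> x"]) (auto simp: W_carrier W_simps aug_neg P.l_neg)
  qed (auto simp: W_carrier W_simps aug_simps P.a_ac)
qed (auto simp: W_carrier W_simps aug_simps pp_left_def J1_simps P.l_distr P.r_distr P.m_assoc)

sublocale W: module A W by (rule W_module)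

lemma W_neg: "w \<in> carrier W ==> \<ominus>\<^bsub>W\<^esub> w = \<ominus>\<^bsub>PP\<^esub> w"
  by (rule W.M.minus_equality) (auto simp: W_carrier W_simps aug_neg P.l_neg)

text \<open>The element j2(a) - j1(a) lies in \<Omega>, and products within \<Omega> vanish.\<close>

lemma W_right: "a \<in> carrier A ==> w \<in> carrier W ==> J2 a \<otimes>\<^bsub>PP\<^esub> w = a \<odot>\<^bsub>W\<^esub> w"
proof -
  assume a: "a \<in> carrier A" and w: "w \<in> carrier W"
  have "(J2 a \<ominus>\<^bsub>PP\<^esub> J1 a) \<otimes>\<^bsub>PP\<^esub> w = \<zero>\<^bsub>PP\<^esub>"
    by (rule W_mult_zero[OF _ w]) (use a in \<open>auto simp: W_carrier aug_minus MA.r_neg a_minus_def[of A]\<close>)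
  then have "J2 a \<otimes>\<^bsub>PP\<^esub> w \<ominus>\<^bsub>PP\<^esub> J1 a \<otimes>\<^bsub>PP\<^esub> w = \<zero>\<^bsub>PP\<^esub>" using a W_sub[OF w]
    by (simp add: a_minus_def P.l_distr P.l_minus)
  then show ?thesis using a W_sub[OF w] by (simp add: abelian_minus_eq[OF P.is_abelian_group] W_simps pp_left_def)
qed

lemma dd_closed [simp]: "a \<in> carrier A ==> dd a \<in> carrier W"
  by (auto simp: W_carrier univ_der_def aug_minus MA.r_neg a_minus_def[of A])

lemma dd_addhom: "addhom A W dd"
proof (rule addhomI)
  fix x y assume xy: "x \<in> carrier A" "y \<in> carrier A"
  have "addhom A PP (\<lambda>a. J2 a \<ominus>\<^bsub>PP\<^esub> J1 a)"
    by (rule addhom_diff[OF P.is_abelian_group ring_hom_addhom[OF J2_hom] ring_hom_addhom[OF J1_hom]])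
  from addhom_add[OF this xy] show "dd (x \<oplus>\<^bsub>A\<^esub> y) = dd x \<oplus>\<^bsub>W\<^esub> dd y" by (simp add: univ_der_def W_simps)
qed simp

lemma J2_eq: "a \<in> carrier A ==> J2 a = dd a \<oplus>\<^bsub>PP\<^esub> J1 a"
  by (simp add: univ_der_def P.a_assoc a_minus_def P.l_neg)

lemma dd_mult:
  assumes a: "a \<in> carrier A" and b: "b \<in> carrier A"
  shows "dd (a \<otimes>\<^bsub>A\<^esub> b) = a \<odot>\<^bsub>W\<^esub> dd b \<oplus>\<^bsub>W\<^esub> b \<odot>\<^bsub>W\<^esub> dd a"
proof -
  \<comment> \<open>Letting b act through j2 instead of j1 makes the right-hand side
    telescope.\<close>
  have "a \<odot>\<^bsub>W\<^esub> dd b \<oplus>\<^bsub>W\<^esub> b \<odot>\<^bsub>W\<^esub> dd a = J1 a \<otimes>\<^bsub>PP\<^esub> (J2 b \<ominus>\<^bsub>PP\<^esub> J1 b) \<oplus>\<^bsub>PP\<^esub> J2 b \<otimes>\<^bsub>PP\<^esub> (J2 a \<ominus>\<^bsub>PP\<^esub> J1 a)"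
    using W_right[OF b dd_closed[OF a], symmetric] by (simp add: W_simps pp_left_def univ_der_def)
  also have "\<dots> = J2 a \<otimes>\<^bsub>PP\<^esub> J2 b \<ominus>\<^bsub>PP\<^esub> J1 a \<otimes>\<^bsub>PP\<^esub> J1 b"
    using J_closed[OF a] J_closed[OF b] by algebra
  finally show ?thesis using a b by (simp add: univ_der_def J1_simps J2_simps)
qed

lemma dd_smult_one: "r \<in> carrier R ==> dd (r \<odot>\<^bsub>A\<^esub> \<one>\<^bsub>A\<^esub>) = \<zero>\<^bsub>W\<^esub>"
  by (simp add: univ_der_def J_smult_one W_simps a_minus_def P.r_neg)

lemma pp_decomp: "p \<in> carrier PP ==> p \<ominus>\<^bsub>PP\<^esub> J2 (eps p) \<in> carrier W"
  by (simp add: W_carrier aug_minus MA.r_neg a_minus_def[of A])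

lemma W_induct [consumes 1, case_names gen add]:
  assumes w: "w \<in> carrier W"
    and gen: "\<And>a b. a \<in> carrier A ==> b \<in> carrier A ==> Q (a \<odot>\<^bsub>W\<^esub> dd b)"
    and add: "\<And>x y. x \<in> carrier W ==> y \<in> carrier W ==> Q x ==> Q y ==> Q (x \<oplus>\<^bsub>W\<^esub> y)"
  shows "Q w"
proof -
  \<comment> \<open>Subtracting j1 of the augmentation, not j2, is a projection onto \<Omega> that
    sends j1(a) j2(b) to a db. It is the identity on \<Omega>, where the augmentation is 0.\<close>
  have c: "p \<ominus>\<^bsub>PP\<^esub> J1 (eps p) \<in> carrier W" if "p \<in> carrier PP" for p
    using that by (simp add: W_carrier aug_minus MA.r_neg a_minus_def[of A])
  have "Q (p \<ominus>\<^bsub>PP\<^esub> J1 (eps p))" if "p \<in> carrier PP" for p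
    using that
  proof (induction rule: pp_induct)
    case (gen a b)
    have "J1 a \<otimes>\<^bsub>PP\<^esub> J2 b \<ominus>\<^bsub>PP\<^esub> J1 (eps (J1 a \<otimes>\<^bsub>PP\<^esub> J2 b)) = a \<odot>\<^bsub>W\<^esub> dd b"
      using gen by (simp add: aug_simps J1_simps W_simps pp_left_def univ_der_def P.r_distr a_minus_def P.r_minus)
    then show ?case using assms(2)[OF gen] by simp
  next
    case (add x y)
    have "(x \<oplus>\<^bsub>PP\<^esub> y) \<ominus>\<^bsub>PP\<^esub> J1 (eps (x \<oplus>\<^bsub>PP\<^esub> y)) = (x \<ominus>\<^bsub>PP\<^esub> J1 (eps x)) \<oplus>\<^bsub>W\<^esub> (y \<ominus>\<^bsub>PP\<^esub> J1 (eps y))"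
      using add(1,2) by (simp add: aug_simps J1_simps W_simps a_minus_def P.minus_add P.a_ac)
    then show ?case using assms(3) add c by simp
  qed
  from this[OF W_sub[OF w]] show ?thesis
    using w W_sub[OF w] ring_hom_zero[OF J1_hom MA.ring_axioms P.ring_axioms]
    by (simp add: W_aug a_minus_def P.minus_zero)
qed

text \<open>The map a \<otimes> b -> a D(b) satisfies a Leibniz rule over the multiplication map.
  Both terms of that rule vanish on a product of two elements of I, so the map descends modulo
  I^2.\<close>

lemma der_lift:
  assumes M: "module A M" and D: "D \<in> Der R A M"
  obtains f where "f \<in> linmaps A W M" "\<And>a. a \<in> carrier A ==> f (dd a) = D a"
proof -
  interpret M: module A M by fact
  have Dc: "D a \<in> carrier M" if "a \<in> carrier A" for a using D that by (auto simp: Der_def)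
  have Da: "D (a \<oplus>\<^bsub>A\<^esub> b) = D a \<oplus>\<^bsub>M\<^esub> D b" and Dm: "D (a \<otimes>\<^bsub>A\<^esub> b) = a \<odot>\<^bsub>M\<^esub> D b \<oplus>\<^bsub>M\<^esub> b \<odot>\<^bsub>M\<^esub> D a"
    if "a \<in> carrier A" "b \<in> carrier A" for a b using D that by (auto simp: Der_def)
  have Dr: "D (r \<odot>\<^bsub>A\<^esub> \<one>\<^bsub>A\<^esub>) = \<zero>\<^bsub>M\<^esub>" if "r \<in> carrier R" for r using D that by (auto simp: Der_def)
  have Ds: "D (r \<odot>\<^bsub>A\<^esub> a) = (r \<odot>\<^bsub>A\<^esub> \<one>\<^bsub>A\<^esub>) \<odot>\<^bsub>M\<^esub> D a" if "r \<in> carrier R" "a \<in> carrier A" for r a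
    using that Dm[of "r \<odot>\<^bsub>A\<^esub> \<one>\<^bsub>A\<^esub>" a] algebra_smult_one(2)[OF MA.algebra_axioms that]
    by (simp add: Dr Dc)
  have D1: "D \<one>\<^bsub>A\<^esub> = \<zero>\<^bsub>M\<^esub>" using Dr[of "\<one>\<^bsub>R\<^esub>"] by simp
  let ?b = "\<lambda>a b. a \<odot>\<^bsub>M\<^esub> D b"
  have b: "balanced R A A M ?b"
  proof (rule balancedI)
    fix r x y assume "r \<in> carrier R" "x \<in> carrier A" "y \<in> carrier A"
    then show "(r \<odot>\<^bsub>A\<^esub> x) \<odot>\<^bsub>M\<^esub> D y = x \<odot>\<^bsub>M\<^esub> D (r \<odot>\<^bsub>A\<^esub> y)"
      using algebra_smult_one(2)[OF MA.algebra_axioms, of r x]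
      by (simp add: Ds M.smult_assoc1[symmetric] Dc MA.m_comm)
  qed (auto simp: Dc Da M.smult_l_distr M.smult_r_distr)
  let ?F = "tlift M ?b"
  have F: "addhom TA M ?F" by (rule AA.tlift_addhom[OF _ b]) (rule M.abelian_group_axioms)
  have Ft: "?F (tens R A A a c) = a \<odot>\<^bsub>M\<^esub> D c" if "a \<in> carrier A" "c \<in> carrier A" for a c
    by (rule AA.tlift_tens[OF _ b that]) (rule M.abelian_group_axioms)
  interpret T: cring TA by (rule AA.tensor_cring)
  have muc: "x \<in> carrier TA ==> mu x \<in> carrier A" for x by (rule addhom_closed[OF mu_addhom])
  have Fc: "x \<in> carrier TA ==> ?F x \<in> carrier M" for x by (rule addhom_closed[OF F])
  have Fm: "?F (x \<otimes>\<^bsub>TA\<^esub> y) = mu x \<odot>\<^bsub>M\<^esub> ?F y \<oplus>\<^bsub>M\<^esub> mu y \<odot>\<^bsub>M\<^esub> ?F x" if x: "x \<in> carrier TA" and y: "y \<in> carrier TA" for x y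
    using x
  proof (induction rule: AA.tensor_induct)
    case (tens m n)
    show ?case using y
    proof (induction rule: AA.tensor_induct)
      case (tens m' n')
      then show ?case using \<open>m \<in> _\<close> \<open>n \<in> _\<close>
        by (simp add: AA.tens_mult Ft mu_tens Dm Dc M.smult_r_distr M.smult_assoc1[symmetric] MA.m_ac M.M.a_ac)
    next
      case (add x y)
      then show ?case using tens
        by (simp add: T.r_distr addhom_add[OF F] addhom_add[OF mu_addhom] muc Fc M.smult_r_distr M.smult_l_distr M.a_ac)
    qed
  next
    case (add u v)
    then show ?case using y
      by (simp add: T.l_distr addhom_add[OF F] addhom_add[OF mu_addhom] muc Fc M.smult_r_distr M.smult_l_distr M.a_ac)
  qed
  have van: "x \<in> carrier TA \<and> ?F x = \<zero>\<^bsub>M\<^esub>" if "x \<in> DS" for x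
    using that unfolding diag_square_def
  proof (induction rule: ideal_prod.induct)
    case (prod i j) then show ?case by (auto simp: diag_ideal_def Fm Fc)
  next
    case (sum s t) then show ?case by (simp add: addhom_add[OF F])
  qed
  let ?G = "\<lambda>p. ?F (SOME x. x \<in> p)"
  have G: "addhom PP M ?G" and Gc: "\<And>x. x \<in> carrier TA ==> ?G (cl x) = ?F x"
    using pp_descend[OF M.abelian_group_axioms F] van by auto
  have GJ: "?G (J1 a \<otimes>\<^bsub>PP\<^esub> J2 c) = a \<odot>\<^bsub>M\<^esub> D c" if "a \<in> carrier A" "c \<in> carrier A" for a c
    using that Gc[of "tens R A A a c"] by (simp add: pp_cls_tens Ft)
  have Gl: "?G (J1 a \<otimes>\<^bsub>PP\<^esub> p) = a \<odot>\<^bsub>M\<^esub> ?G p" if a: "a \<in> carrier A" and p: "p \<in> carrier PP" for a p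
    using p
  proof (induction rule: pp_induct)
    case (gen x y)
    have "J1 a \<otimes>\<^bsub>PP\<^esub> (J1 x \<otimes>\<^bsub>PP\<^esub> J2 y) = J1 (a \<otimes>\<^bsub>A\<^esub> x) \<otimes>\<^bsub>PP\<^esub> J2 y" using gen a by (simp add: J1_simps P.m_assoc)
    then show ?case using gen a by (simp add: GJ M.smult_assoc1 Dc)
  next
    case (add x y)
    then show ?case using a by (simp add: P.r_distr addhom_add[OF G] M.smult_r_distr addhom_closed[OF G])
  qed
  \<comment> \<open>Since D(1) = 0, \<open>J1\<close> is killed and \<open>J2\<close> goes to D;
    hence their difference, the universal derivation, goes to D.\<close>
  have GJ1: "?G (J1 a) = \<zero>\<^bsub>M\<^esub>" "?G (J2 a) = D a" if "a \<in> carrier A" for a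
    using GJ[of a "\<one>\<^bsub>A\<^esub>"] GJ[of "\<one>\<^bsub>A\<^esub>" a] that by (auto simp: J1_simps J2_simps D1 Dc)
  show thesis
  proof
    show "restrict ?G (carrier W) \<in> linmaps A W M"
      unfolding linmaps_def
      by (auto intro!: linearI addhomI simp: W_sub addhom_closed[OF G] W_simps addhom_add[OF G] Gl pp_left_def)
        (auto simp: W_simps[symmetric] pp_left_def[symmetric] W_sub Gl[unfolded pp_left_def])
    show "restrict ?G (carrier W) (dd a) = D a" if "a \<in> carrier A" for a
    proof -
      have "?G (dd a) = D a \<ominus>\<^bsub>M\<^esub> \<zero>\<^bsub>M\<^esub>"
        using that addhom_minus[OF P.is_abelian_group M.abelian_group_axioms G, of "J2 a" "J1 a"]
        by (simp add: univ_der_def GJ1)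
      also have "\<dots> = D a"
        using Dc[OF that] by (simp add: abelian_minus_eq[OF M.abelian_group_axioms])
      finally show ?thesis using that by simp
    qed
  qed
qed

lemma linmaps_W_eqI:
  assumes "abelian_group M" "f \<in> linmaps A W M" "g \<in> linmaps A W M" "\<And>a. a \<in> carrier A ==> f (dd a) = g (dd a)"
  shows "f = g"
proof (rule extensionalityI[of _ "carrier W"])
  have l: "linear A W M f" "linear A W M g" using assms by (auto simp: linmaps_def)
  show "f w = g w" if "w \<in> carrier W" for w using that
    by (induction rule: W_induct) (simp_all add: linear_smult[OF l(1)] linear_smult[OF l(2)] assms(4)
      addhom_add[OF linear_addhom[OF l(1)]] addhom_add[OF linear_addhom[OF l(2)]])
qed (use assms in \<open>auto simp: linmaps_def\<close>)

text \<open>The definite description is justified by \<open>der_lift\<close> and by the fact that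
  differentials generate \<Omega>.\<close>

lemma lin_of_der:
  assumes M: "module A M" and D: "D \<in> Der R A M"
  shows "lin_of_der R A M D \<in> linmaps A W M" "a \<in> carrier A ==> lin_of_der R A M D (dd a) = D a"
proof -
  obtain f where f: "f \<in> linmaps A W M" "\<And>a. a \<in> carrier A ==> f (dd a) = D a"
    using der_lift[OF M D] by blast
  have "f \<in> linmaps A W M \<and> (\<forall>a\<in>carrier A. f (dd a) = D a)" using f by auto
  moreover have "\<And>g. g \<in> linmaps A W M \<and> (\<forall>a\<in>carrier A. g (dd a) = D a) ==> g = f"
    using linmaps_W_eqI[OF module.axioms(2)[OF M]] f by auto
  ultimately have "lin_of_der R A M D \<in> linmaps A W M \<and> (\<forall>a\<in>carrier A. lin_of_der R A M D (dd a) = D a)"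
    unfolding lin_of_der_def by (rule theI)
  then show "lin_of_der R A M D \<in> linmaps A W M" "a \<in> carrier A ==> lin_of_der R A M D (dd a) = D a" by auto
qed

lemma pp_right_algebra: "algebra A (pp_right R A)"
  unfolding pp_right_def by (rule alg_algebra[OF MA.M_cring pp_cring J2_hom])

end

lemma pp_right_simps [simp]:
  "carrier (pp_right R A) = carrier (pparts R A)" "add (pp_right R A) = add (pparts R A)"
  "monoid.mult (pp_right R A) = monoid.mult (pparts R A)" "one (pp_right R A) = one (pparts R A)"
  "ring.zero (pp_right R A) = ring.zero (pparts R A)" "smult (pp_right R A) = (\<lambda>a p. j2 R A a \<otimes>\<^bsub>pparts R A\<^esub> p)"
  "a_inv (pp_right R A) = a_inv (pparts R A)" "a_minus (pp_right R A) = a_minus (pparts R A)"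
  "addhom (pp_right R A) B f \<longleftrightarrow> addhom (pparts R A) B f" "addhom C (pp_right R A) g \<longleftrightarrow> addhom C (pparts R A) g"
  by (simp_all add: pp_right_def)

text \<open>h \<otimes> h commutes with the multiplication maps, so it carries I into I' and I^2
  into the square of I'.\<close>

lemma pp_map:
  assumes "kahler R A" "kahler R' A'" "h \<in> ring_hom A A'"
    and sc: "\<And>r a. r \<in> carrier R ==> a \<in> carrier A ==> \<rho> r \<in> carrier R' \<and> h (r \<odot>\<^bsub>A\<^esub> a) = \<rho> r \<odot>\<^bsub>A'\<^esub> h a"
  shows "pp_map R' A' h \<in> ring_hom (pparts R A) (pparts R' A')"
    and "a \<in> carrier A ==> pp_map R' A' h (j1 R A a) = j1 R' A' (h a)"
    and "a \<in> carrier A ==> pp_map R' A' h (j2 R A a) = j2 R' A' (h a)"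
    and "p \<in> carrier (pparts R A) ==> pp_aug A' (pp_map R' A' h p) = h (pp_aug A p)"
proof -
  interpret K: kahler R A by fact
  interpret K': kahler R' A' by fact
  have hc [simp]: "a \<in> carrier A ==> h a \<in> carrier A'" for a using assms(3) by (rule ring_hom_closed)
  note hs = ring_hom_add[OF assms(3)] ring_hom_mult[OF assms(3)] ring_hom_one[OF assms(3)]
  let ?t = "tmap R' A' A' h h"
  have t: "addhom K.TA K'.TA ?t" and tt: "\<And>a b. a \<in> carrier A ==> b \<in> carrier A ==> ?t (tens R A A a b) = tens R' A' A' (h a) (h b)"
    using tmap_addhom[OF K'.AA.two_modules_axioms K.AA.two_modules_axioms ring_hom_addhom[OF assms(3)] ring_hom_addhom[OF assms(3)]]
      sc by (auto simp: K'.AA.tens_smult)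
  interpret T: cring K.TA by (rule K.AA.tensor_cring)
  interpret T': cring K'.TA by (rule K'.AA.tensor_cring)
  have tm: "?t (x \<otimes>\<^bsub>K.TA\<^esub> y) = ?t x \<otimes>\<^bsub>K'.TA\<^esub> ?t y" if x: "x \<in> carrier K.TA" and y: "y \<in> carrier K.TA" for x y
    using x
  proof (induction rule: K.AA.tensor_induct)
    case (tens m n)
    show ?case using y
    proof (induction rule: K.AA.tensor_induct)
      case (tens m' n')
      then show ?case using \<open>m \<in> _\<close> \<open>n \<in> _\<close> by (simp add: K.AA.tens_mult K'.AA.tens_mult tt hs)
    next
      case (add x y)
      then show ?case using tens by (simp add: T.r_distr T'.r_distr addhom_add[OF t] addhom_closed[OF t])
    qed
  next
    case (add u v)
    then show ?case using y by (simp add: T.l_distr T'.l_distr addhom_add[OF t] addhom_closed[OF t])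
  qed
  have tmu: "K'.mu (?t x) = h (K.mu x)" if "x \<in> carrier K.TA" for x
    by (rule K.AA.addhom_tensor_eqI[OF addhom_comp[OF t K'.mu_addhom] addhom_comp[OF K.mu_addhom ring_hom_addhom[OF assms(3)]] that])
      (simp add: tt K.mu_tens K'.mu_tens hs)
  have h0: "h \<zero>\<^bsub>A\<^esub> = \<zero>\<^bsub>A'\<^esub>" using ring_hom_zero[OF assms(3) K.MA.ring_axioms K'.MA.ring_axioms] .
  have tI: "?t x \<in> K'.DI" if "x \<in> K.DI" for x
    using that tmu[of x] by (auto simp: diag_ideal_def addhom_closed[OF t] h0)
  have tS: "x \<in> carrier K.TA \<and> ?t x \<in> K'.DS" if "x \<in> K.DS" for x
    using that unfolding diag_square_def
  proof (induction rule: ideal_prod.induct)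
    case (prod i j)
    then have "i \<in> carrier K.TA" "j \<in> carrier K.TA" by (auto simp: diag_ideal_def)
    then show ?case using prod tI by (auto simp: tm intro: ideal_prod.prod)
  next
    case (sum s t') then show ?case by (simp add: addhom_add[OF t] ideal_prod.sum)
  qed
  have cz: "K'.cl y = \<zero>\<^bsub>K'.PP\<^esub>" if "y \<in> K'.DS" for y
  proof -
    interpret I: ideal K'.DS K'.TA by (rule K'.DS_ideal)
    show ?thesis using I.a_rcos_const[OF that] by (simp add: pp_cls_def pparts_def FactRing_def)
  qed
  have ct: "addhom K.TA K'.PP (\<lambda>x. K'.cl (?t x))"
    by (rule addhom_comp[OF t ring_hom_addhom[OF K'.pp_cls_hom]])
  have q: "addhom K.PP K'.PP (pp_map R' A' h)" "\<And>x. x \<in> carrier K.TA ==> pp_map R' A' h (K.cl x) = K'.cl (?t x)"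
    using K.pp_descend[OF K'.P.is_abelian_group ct] cz tS by (auto simp: pp_map_def[abs_def])
  show 1: "pp_map R' A' h (K.J1 a) = K'.J1 (h a)" if "a \<in> carrier A" for a
    using that by (simp add: j1_def q tt hs)
  show 2: "pp_map R' A' h (K.J2 a) = K'.J2 (h a)" if "a \<in> carrier A" for a
    using that by (simp add: j2_def q tt hs)
  show "pp_map R' A' h \<in> ring_hom K.PP K'.PP"
  proof (rule ring_hom_memI)
    show "pp_map R' A' h (x \<otimes>\<^bsub>K.PP\<^esub> y) = pp_map R' A' h x \<otimes>\<^bsub>K'.PP\<^esub> pp_map R' A' h y"
      if xy: "x \<in> carrier K.PP" "y \<in> carrier K.PP" for x y
    proof -
      obtain u v where uv: "u \<in> carrier K.TA" "v \<in> carrier K.TA" "x = K.cl u" "y = K.cl v"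
        using xy by (auto simp: K.pp_carrier)
      then show ?thesis by (simp add: ring_hom_mult[OF K.pp_cls_hom, symmetric] q tm
         ring_hom_mult[OF K'.pp_cls_hom] addhom_closed[OF t])
    qed
    show "pp_map R' A' h \<one>\<^bsub>K.PP\<^esub> = \<one>\<^bsub>K'.PP\<^esub>"
      using 1[of "\<one>\<^bsub>A\<^esub>"] by (simp add: K.J1_simps K'.J1_simps hs)
  qed (auto simp: addhom_add[OF q(1)] addhom_closed[OF q(1)])
  show "pp_aug A' (pp_map R' A' h p) = h (pp_aug A p)" if p: "p \<in> carrier K.PP" for p
  proof -
    obtain u where "u \<in> carrier K.TA" "p = K.cl u" using p by (auto simp: K.pp_carrier)
    then show ?thesis by (simp add: q K.aug_cls K'.aug_cls addhom_closed[OF t] tmu)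
  qed
qed

lemma pp_map_Omega:
  assumes "kahler R A" "kahler R' A'" "h \<in> ring_hom A A'"
    and sc: "\<And>r a. r \<in> carrier R ==> a \<in> carrier A ==> \<rho> r \<in> carrier R' \<and> h (r \<odot>\<^bsub>A\<^esub> a) = \<rho> r \<odot>\<^bsub>A'\<^esub> h a"
  shows "addhom (Omega R A) (Omega R' A') (pp_map R' A' h)"
    and "a \<in> carrier A ==> w \<in> carrier (Omega R A) ==>
      pp_map R' A' h (a \<odot>\<^bsub>Omega R A\<^esub> w) = h a \<odot>\<^bsub>Omega R' A'\<^esub> pp_map R' A' h w" (is "PROP ?g1")
    and "a \<in> carrier A ==> pp_map R' A' h (univ_der R A a) = univ_der R' A' (h a)" (is "PROP ?g2")
proof -
  interpret K: kahler R A by fact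
  interpret K': kahler R' A' by fact
  note p = pp_map[OF assms]
  have h0: "h \<zero>\<^bsub>A\<^esub> = \<zero>\<^bsub>A'\<^esub>" using ring_hom_zero[OF assms(3) K.MA.ring_axioms K'.MA.ring_axioms] .
  show "addhom (Omega R A) (Omega R' A') (pp_map R' A' h)"
    by (rule addhomI) (auto simp: K.W_carrier K'.W_carrier ring_hom_closed[OF p(1)] p(4) h0 K.W_simps K'.W_simps ring_hom_add[OF p(1)])
  show "PROP ?g1"
    by (simp add: K.W_simps K'.W_simps pp_left_def ring_hom_mult[OF p(1)] K.W_sub p(2))
  show "PROP ?g2"
    using addhom_minus[OF K.P.is_abelian_group K'.P.is_abelian_group ring_hom_addhom[OF p(1)]]
    by (simp add: univ_der_def p(2,3))
qed

section \<open>Bases and free algebras\<close>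

text \<open>Coefficients are zero outside the index set, so that uniqueness of coordinates can be
  stated for total functions.\<close>

definition coeffs_on :: "('r, 'y) ring_scheme \<Rightarrow> 'i set \<Rightarrow> ('i \<Rightarrow> 'r) set" where
  "coeffs_on R I = {c. c \<in> I \<rightarrow> carrier R \<and> (\<forall>i. i \<notin> I \<longrightarrow> c i = \<zero>\<^bsub>R\<^esub>) \<and> finite {i. c i \<noteq> \<zero>\<^bsub>R\<^esub>}}"

definition lincomb ::
  "('r, 'y) ring_scheme \<Rightarrow> ('r, 'a, 'u) module_scheme \<Rightarrow> ('i \<Rightarrow> 'a) \<Rightarrow> ('i \<Rightarrow> 'r) \<Rightarrow> 'a" where
  "lincomb R M v c = (\<Oplus>\<^bsub>M\<^esub>i\<in>{i. c i \<noteq> \<zero>\<^bsub>R\<^esub>}. c i \<odot>\<^bsub>M\<^esub> v i)"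

lemma is_basis_iff:
  "is_basis R M I v \<longleftrightarrow> v \<in> I \<rightarrow> carrier M \<and> (\<forall>x\<in>carrier M. \<exists>!c. c \<in> coeffs_on R I \<and> x = lincomb R M v c)"
  by (simp add: is_basis_def coeffs_on_def lincomb_def conj_assoc)

context module
begin

lemma coeffs_on_carrier: "c \<in> coeffs_on R I ==> c i \<in> carrier R"
  by (cases "i \<in> I") (auto simp: coeffs_on_def)

lemma lincomb_superset:
  assumes "c \<in> coeffs_on R I" "v \<in> I \<rightarrow> carrier M" "finite U" "{i. c i \<noteq> \<zero>} \<subseteq> U" "U \<subseteq> I"
  shows "lincomb R M v c = (\<Oplus>\<^bsub>M\<^esub>i\<in>U. c i \<odot>\<^bsub>M\<^esub> v i)"
  unfolding lincomb_def
  by (rule M.add.finprod_mono_neutral_cong_left) (use assms in \<open>auto simp: Pi_iff coeffs_on_carrier subset_iff\<close>)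

lemma coeffs_on_supp: "c \<in> coeffs_on R I ==> finite {i. c i \<noteq> \<zero>} \<and> {i. c i \<noteq> \<zero>} \<subseteq> I"
  by (auto simp: coeffs_on_def)

lemma coeffs_on_add: "c \<in> coeffs_on R I ==> d \<in> coeffs_on R I ==> (\<lambda>i. c i \<oplus> d i) \<in> coeffs_on R I"
  by (auto simp: coeffs_on_def Pi_iff intro: finite_subset[of _ "{i. c i \<noteq> \<zero>} \<union> {i. d i \<noteq> \<zero>}"])

lemma coeffs_on_smult: "r \<in> carrier R ==> c \<in> coeffs_on R I ==> (\<lambda>i. r \<otimes> c i) \<in> coeffs_on R I"
  by (auto simp: coeffs_on_def Pi_iff intro: finite_subset[of _ "{i. c i \<noteq> \<zero>}"])

lemma coeffs_on_unit: "i \<in> I ==> (\<lambda>j. if j = i then \<one> else \<zero>) \<in> coeffs_on R I"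
  by (auto simp: coeffs_on_def intro: finite_subset[of _ "{i}"])

lemma lincomb_closed: "c \<in> coeffs_on R I ==> v \<in> I \<rightarrow> carrier M ==> lincomb R M v c \<in> carrier M"
  unfolding lincomb_def by (rule M.finsum_closed) (auto simp: coeffs_on_def Pi_iff)

lemma lincomb_add:
  assumes "c \<in> coeffs_on R I" "d \<in> coeffs_on R I" "v \<in> I \<rightarrow> carrier M"
  shows "lincomb R M v (\<lambda>i. c i \<oplus> d i) = lincomb R M v c \<oplus>\<^bsub>M\<^esub> lincomb R M v d"
proof -
  let ?U = "{i. c i \<noteq> \<zero>} \<union> {i. d i \<noteq> \<zero>}"
  have U: "finite ?U" "?U \<subseteq> I" using assms(1,2)[THEN coeffs_on_supp] by auto
  have cd: "c i \<in> carrier R" "d i \<in> carrier R" for i using coeffs_on_carrier[OF assms(1)] coeffs_on_carrier[OF assms(2)] by auto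
  have v: "v i \<in> carrier M" if "i \<in> ?U" for i using that U assms(3) by auto
  have s: "{i. c i \<oplus> d i \<noteq> \<zero>} \<subseteq> ?U" by auto
  have "lincomb R M v (\<lambda>i. c i \<oplus> d i) = (\<Oplus>\<^bsub>M\<^esub>i\<in>?U. (c i \<oplus> d i) \<odot>\<^bsub>M\<^esub> v i)"
    by (rule lincomb_superset[OF coeffs_on_add[OF assms(1,2)] assms(3) U(1) s U(2)])
  also have "\<dots> = (\<Oplus>\<^bsub>M\<^esub>i\<in>?U. c i \<odot>\<^bsub>M\<^esub> v i \<oplus>\<^bsub>M\<^esub> d i \<odot>\<^bsub>M\<^esub> v i)"
    by (rule M.finsum_cong') (use cd v in \<open>auto simp: smult_l_distr Pi_iff\<close>)
  also have "\<dots> = (\<Oplus>\<^bsub>M\<^esub>i\<in>?U. c i \<odot>\<^bsub>M\<^esub> v i) \<oplus>\<^bsub>M\<^esub> (\<Oplus>\<^bsub>M\<^esub>i\<in>?U. d i \<odot>\<^bsub>M\<^esub> v i)"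
    by (rule M.finsum_addf) (use cd v in \<open>auto simp: Pi_iff\<close>)
  finally show ?thesis
    using lincomb_superset[OF assms(1,3) U(1) _ U(2)] lincomb_superset[OF assms(2,3) U(1) _ U(2)] by simp
qed

lemma lincomb_smult:
  assumes "r \<in> carrier R" "c \<in> coeffs_on R I" "v \<in> I \<rightarrow> carrier M"
  shows "lincomb R M v (\<lambda>i. r \<otimes> c i) = r \<odot>\<^bsub>M\<^esub> lincomb R M v c"
proof -
  let ?U = "{i. c i \<noteq> \<zero>}"
  have U: "finite ?U" "?U \<subseteq> I" using assms(2)[THEN coeffs_on_supp] by auto
  have c: "c i \<in> carrier R" for i using coeffs_on_carrier[OF assms(2)] by auto
  have v: "v i \<in> carrier M" if "i \<in> ?U" for i using that U assms(3) by auto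
  have s: "{i. r \<otimes> c i \<noteq> \<zero>} \<subseteq> ?U" using assms(1) by auto
  have "lincomb R M v (\<lambda>i. r \<otimes> c i) = (\<Oplus>\<^bsub>M\<^esub>i\<in>?U. (r \<otimes> c i) \<odot>\<^bsub>M\<^esub> v i)"
    by (rule lincomb_superset[OF coeffs_on_smult[OF assms(1,2)] assms(3) U(1) s U(2)])
  also have "\<dots> = (\<Oplus>\<^bsub>M\<^esub>i\<in>?U. r \<odot>\<^bsub>M\<^esub> (c i \<odot>\<^bsub>M\<^esub> v i))"
    by (rule M.finsum_cong') (use c v assms(1) in \<open>auto simp: smult_assoc1 Pi_iff\<close>)
  also have "\<dots> = r \<odot>\<^bsub>M\<^esub> lincomb R M v c"
    unfolding lincomb_def by (rule finsum_smult_ldistr[symmetric]) (use U c v assms(1) in \<open>auto simp: Pi_iff\<close>)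
  finally show ?thesis .
qed

lemma lincomb_unit:
  assumes "i \<in> I" "v \<in> I \<rightarrow> carrier M"
  shows "lincomb R M v (\<lambda>j. if j = i then \<one> else \<zero>) = v i"
proof -
  have vi: "v i \<in> carrier M" using assms by auto
  have "lincomb R M v (\<lambda>j. if j = i then \<one> else \<zero>) = (\<Oplus>\<^bsub>M\<^esub>j\<in>{i}. (if j = i then \<one> else \<zero>) \<odot>\<^bsub>M\<^esub> v j)"
    by (rule lincomb_superset[OF coeffs_on_unit[OF assms(1)] assms(2)]) (use assms in auto)
  also have "\<dots> = v i" using vi by (simp add: M.finsum_insert)
  finally show ?thesis .
qed

lemma basis_obtain:
  assumes "is_basis R M I v" "x \<in> carrier M"
  obtains c where "c \<in> coeffs_on R I" "x = lincomb R M v c"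
  using assms unfolding is_basis_iff by blast

lemma basis_induct:
  assumes b: "is_basis R M I v" and x: "x \<in> carrier M"
    and z: "P \<zero>\<^bsub>M\<^esub>" and add: "\<And>x y. x \<in> carrier M ==> y \<in> carrier M ==> P x ==> P y ==> P (x \<oplus>\<^bsub>M\<^esub> y)"
    and gen: "\<And>r i. r \<in> carrier R ==> i \<in> I ==> P (r \<odot>\<^bsub>M\<^esub> v i)"
  shows "P x"
proof -
  have v: "v \<in> I \<rightarrow> carrier M" using b by (simp add: is_basis_iff)
  obtain c where c: "c \<in> coeffs_on R I" "x = lincomb R M v c" using basis_obtain[OF b x] .
  have "(\<Oplus>\<^bsub>M\<^esub>i\<in>U. c i \<odot>\<^bsub>M\<^esub> v i) \<in> carrier M \<and> P (\<Oplus>\<^bsub>M\<^esub>i\<in>U. c i \<odot>\<^bsub>M\<^esub> v i)" if "finite U" "U \<subseteq> I" for U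
    using that
  proof (induction rule: finite_induct)
    case empty then show ?case by (simp add: z)
  next
    case (insert i U)
    have "c j \<odot>\<^bsub>M\<^esub> v j \<in> carrier M" if "j \<in> insert i U" for j
      using that insert.prems v coeffs_on_carrier[OF c(1)] by auto
    then show ?case using insert gen[OF coeffs_on_carrier[OF c(1)], of i] by (simp add: M.finsum_insert add Pi_iff)
  qed
  then show ?thesis using coeffs_on_supp[OF c(1)] c(2) by (simp add: lincomb_def)
qed

end

text \<open>Uniqueness makes the coordinates linear: coordinatewise sums and multiples are
  coordinates again. The map recombines them with the prescribed values.\<close>

lemma basis_linear:
  assumes "module R M" "module R N" and b: "is_basis R M I v" and w: "w \<in> I \<rightarrow> carrier N"
  obtains f where "linear R M N f" "\<And>i. i \<in> I ==> f (v i) = w i"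
proof -
  interpret M: module R M by fact
  interpret N: module R N by fact
  have v: "v \<in> I \<rightarrow> carrier M" using b by (simp add: is_basis_iff)
  define co where "co x = (THE c. c \<in> coeffs_on R I \<and> x = lincomb R M v c)" for x
  have co: "co x \<in> coeffs_on R I" "x = lincomb R M v (co x)" if "x \<in> carrier M" for x
    using theI'[of "\<lambda>c. c \<in> coeffs_on R I \<and> x = lincomb R M v c"] b that unfolding is_basis_iff co_def by auto
  have cou: "co (lincomb R M v c) = c" if "c \<in> coeffs_on R I" for c
  proof -
    have m: "lincomb R M v c \<in> carrier M" using M.lincomb_closed[OF that v] .
    show ?thesis using b m co[OF m] that unfolding is_basis_iff by blast
  qed
  define f where "f x = lincomb R N w (co x)" for x
  show thesis
  proof
    show "linear R M N f"
    proof (rule linearI[OF addhomI])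
      show "f x \<in> carrier N" if "x \<in> carrier M" for x
        using N.lincomb_closed[OF co(1)[OF that] w] by (simp add: f_def)
      show "f (x \<oplus>\<^bsub>M\<^esub> y) = f x \<oplus>\<^bsub>N\<^esub> f y" if xy: "x \<in> carrier M" "y \<in> carrier M" for x y
      proof -
        have "x \<oplus>\<^bsub>M\<^esub> y = lincomb R M v (\<lambda>i. co x i \<oplus>\<^bsub>R\<^esub> co y i)"
          using co(2)[OF xy(1)] co(2)[OF xy(2)] M.lincomb_add[OF co(1)[OF xy(1)] co(1)[OF xy(2)] v] by simp
        then have "co (x \<oplus>\<^bsub>M\<^esub> y) = (\<lambda>i. co x i \<oplus>\<^bsub>R\<^esub> co y i)"
          using cou[OF M.coeffs_on_add[OF co(1)[OF xy(1)] co(1)[OF xy(2)]]] by simp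
        then show ?thesis using N.lincomb_add[OF co(1)[OF xy(1)] co(1)[OF xy(2)] w] by (simp add: f_def)
      qed
      show "f (r \<odot>\<^bsub>M\<^esub> x) = r \<odot>\<^bsub>N\<^esub> f x" if r: "r \<in> carrier R" and x: "x \<in> carrier M" for r x
      proof -
        have "r \<odot>\<^bsub>M\<^esub> x = lincomb R M v (\<lambda>i. r \<otimes>\<^bsub>R\<^esub> co x i)"
          using co(2)[OF x] M.lincomb_smult[OF r co(1)[OF x] v] by simp
        then have "co (r \<odot>\<^bsub>M\<^esub> x) = (\<lambda>i. r \<otimes>\<^bsub>R\<^esub> co x i)"
          using cou[OF M.coeffs_on_smult[OF r co(1)[OF x]]] by simp
        then show ?thesis using N.lincomb_smult[OF r co(1)[OF x] w] by (simp add: f_def)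
      qed
    qed
    show "f (v i) = w i" if "i \<in> I" for i
      using cou[OF M.coeffs_on_unit[OF that]] M.lincomb_unit[OF that v] N.lincomb_unit[OF that w] by (simp add: f_def)
  qed
qed

text \<open>Projectivity of free modules, with preimages asked for only at the images of basis
  elements; this fits maps that land in the boundaries of an exact complex.\<close>

lemma basis_lift:
  assumes "module R F" "module R M" "module R M2" "is_basis R F B v" "linear R M M2 q" "linear R F M2 g"
    and "\<And>b. b \<in> B ==> g (v b) \<in> q ` carrier M"
  obtains \<psi> where "linear R F M \<psi>" "\<And>x. x \<in> carrier F ==> q (\<psi> x) = g x"
proof -
  interpret F: module R F by fact
  interpret M: module R M by fact
  interpret M2: module R M2 by fact
  define w where "w b = (SOME y. y \<in> carrier M \<and> q y = g (v b))" for b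
  have w: "w b \<in> carrier M \<and> q (w b) = g (v b)" if "b \<in> B" for b
    unfolding w_def by (rule someI_ex) (use assms(7)[OF that] in force)
  then have "w \<in> B \<rightarrow> carrier M" by auto
  then obtain \<psi> where p: "linear R F M \<psi>" "\<And>i. i \<in> B ==> \<psi> (v i) = w i"
    using basis_linear[OF assms(1,2,4)] by blast
  have v: "v \<in> B \<rightarrow> carrier F" using assms(4) by (simp add: is_basis_iff)
  show thesis
  proof
    show "linear R F M \<psi>" by (rule p)
    show "q (\<psi> x) = g x" if "x \<in> carrier F" for x
    proof (rule F.basis_induct[OF assms(4) that])
      show "q (\<psi> \<zero>\<^bsub>F\<^esub>) = g \<zero>\<^bsub>F\<^esub>"
        using addhom_zero[OF F.abelian_group_axioms M.abelian_group_axioms linear_addhom[OF p(1)]]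
          addhom_zero[OF M.abelian_group_axioms M2.abelian_group_axioms linear_addhom[OF assms(5)]]
          addhom_zero[OF F.abelian_group_axioms M2.abelian_group_axioms linear_addhom[OF assms(6)]] by simp
    qed (use v w in \<open>auto simp: addhom_add[OF linear_addhom[OF p(1)]] addhom_add[OF linear_addhom[OF assms(5)]]
       addhom_add[OF linear_addhom[OF assms(6)]] addhom_closed[OF linear_addhom[OF p(1)]] linear_smult[OF p(1)]
       linear_smult[OF assms(5)] linear_smult[OF assms(6)] p(2) Pi_iff\<close>)
  qed
qed

text \<open>The value of a monomial when each variable x is replaced by \<open>u x\<close>.\<close>

definition mprod :: "('b, 'z) ring_scheme \<Rightarrow> ('x \<Rightarrow> 'b) \<Rightarrow> 'x multiset \<Rightarrow> 'b" where
  "mprod B u m = (\<Otimes>\<^bsub>B\<^esub>x\<in>set_mset m. u x [^]\<^bsub>B\<^esub> (count m x))"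

lemma monomial_mprod: "monomial A = mprod A (\<lambda>x. x)"
  by (simp add: monomial_def[abs_def] mprod_def[abs_def])

context cring
begin

lemma mprod_superset:
  assumes "finite U" "set_mset m \<subseteq> U" "u \<in> U \<rightarrow> carrier R"
  shows "mprod R u m = (\<Otimes>x\<in>U. u x [^] (count m x))"
  unfolding mprod_def
  by (rule finprod_mono_neutral_cong_left) (use assms in \<open>auto simp: Pi_iff not_in_iff\<close>)

lemma mprod_closed: "u \<in> set_mset m \<rightarrow> carrier R ==> mprod R u m \<in> carrier R"
  unfolding mprod_def by (rule finprod_closed) (auto simp: Pi_iff)

lemma mprod_add:
  assumes "u \<in> set_mset m \<rightarrow> carrier R" "u \<in> set_mset n \<rightarrow> carrier R"
  shows "mprod R u (m + n) = mprod R u m \<otimes> mprod R u n"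
proof -
  let ?U = "set_mset m \<union> set_mset n"
  have u: "u \<in> ?U \<rightarrow> carrier R" using assms by auto
  have "(\<Otimes>x\<in>?U. u x [^] (count (m + n) x)) = (\<Otimes>x\<in>?U. u x [^] (count m x) \<otimes> u x [^] (count n x))"
    by (rule finprod_cong') (use u in \<open>auto simp: Pi_iff nat_pow_mult\<close>)
  also have "\<dots> = (\<Otimes>x\<in>?U. u x [^] (count m x)) \<otimes> (\<Otimes>x\<in>?U. u x [^] (count n x))"
    by (rule finprod_multf) (use u in \<open>auto simp: Pi_iff\<close>)
  finally show ?thesis using u by (simp add: mprod_superset[of ?U])
qed

lemma mprod_empty [simp]: "mprod R u {#} = \<one>"
  by (simp add: mprod_def)

lemma mprod_single: "u x \<in> carrier R ==> mprod R u {#x#} = u x"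
  by (simp add: mprod_def)

end

text \<open>Values on monomials define a linear map. It is multiplicative on monomials because
  exponents add, and then everywhere by an induction over the basis in each factor.\<close>

lemma free_algebra_hom:
  assumes A: "algebra R A" and B: "algebra R B" and free: "free_algebra_on R A X" and u: "u \<in> X \<rightarrow> carrier B"
  obtains f where "alg_hom R A B f" "\<And>x. x \<in> X ==> f x = u x"
proof -
  interpret A: algebra R A by fact
  interpret B: algebra R B by fact
  let ?I = "{m. set_mset m \<subseteq> X}"
  have X: "X \<subseteq> carrier A" and b: "is_basis R A ?I (monomial A)" using free by (auto simp: free_algebra_on_def)
  have "mprod B u \<in> ?I \<rightarrow> carrier B" using u by (auto intro!: cring.mprod_closed[OF B.M_cring])
  then obtain f where f: "linear R A B f" "\<And>m. m \<in> ?I ==> f (monomial A m) = mprod B u m"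
    using basis_linear[OF A.module B.module b] by blast
  note fa = linear_addhom[OF f(1)]
  have fc: "x \<in> carrier A ==> f x \<in> carrier B" for x using fa by (rule addhom_closed)
  have f0: "f \<zero>\<^bsub>A\<^esub> = \<zero>\<^bsub>B\<^esub>" using addhom_zero[OF A.abelian_group_axioms B.abelian_group_axioms fa] .
  have mc: "monomial A m \<in> carrier A" if "m \<in> ?I" for m
    unfolding monomial_mprod by (rule cring.mprod_closed[OF A.M_cring]) (use that X in auto)
  have Bmc: "mprod B u m \<in> carrier B" if "m \<in> ?I" for m
    by (rule cring.mprod_closed[OF B.M_cring]) (use that u in auto)
  have fmm: "f (monomial A m \<otimes>\<^bsub>A\<^esub> monomial A n) = f (monomial A m) \<otimes>\<^bsub>B\<^esub> f (monomial A n)" if "m \<in> ?I" "n \<in> ?I" for m n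
  proof -
    have "monomial A m \<otimes>\<^bsub>A\<^esub> monomial A n = monomial A (m + n)"
      unfolding monomial_mprod by (rule cring.mprod_add[OF A.M_cring, symmetric]) (use that X in auto)
    moreover have "mprod B u (m + n) = mprod B u m \<otimes>\<^bsub>B\<^esub> mprod B u n"
      by (rule cring.mprod_add[OF B.M_cring]) (use that u in auto)
    ultimately show ?thesis using that by (simp add: f(2))
  qed
  have fm: "f (x \<otimes>\<^bsub>A\<^esub> y) = f x \<otimes>\<^bsub>B\<^esub> f y" if x: "x \<in> carrier A" and y: "y \<in> carrier A" for x y
  proof (rule A.basis_induct[OF b x])
    show "f (\<zero>\<^bsub>A\<^esub> \<otimes>\<^bsub>A\<^esub> y) = f \<zero>\<^bsub>A\<^esub> \<otimes>\<^bsub>B\<^esub> f y" using y fc by (simp add: f0)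
    show "f ((a \<oplus>\<^bsub>A\<^esub> c) \<otimes>\<^bsub>A\<^esub> y) = f (a \<oplus>\<^bsub>A\<^esub> c) \<otimes>\<^bsub>B\<^esub> f y"
      if "a \<in> carrier A" "c \<in> carrier A" "f (a \<otimes>\<^bsub>A\<^esub> y) = f a \<otimes>\<^bsub>B\<^esub> f y" "f (c \<otimes>\<^bsub>A\<^esub> y) = f c \<otimes>\<^bsub>B\<^esub> f y" for a c
      using that y fc by (simp add: A.l_distr B.l_distr addhom_add[OF fa])
    show "f (r \<odot>\<^bsub>A\<^esub> monomial A m \<otimes>\<^bsub>A\<^esub> y) = f (r \<odot>\<^bsub>A\<^esub> monomial A m) \<otimes>\<^bsub>B\<^esub> f y" if r: "r \<in> carrier R" and m: "m \<in> ?I" for r m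
    proof -
      have "f (monomial A m \<otimes>\<^bsub>A\<^esub> y) = f (monomial A m) \<otimes>\<^bsub>B\<^esub> f y"
      proof (rule A.basis_induct[OF b y])
        show "f (monomial A m \<otimes>\<^bsub>A\<^esub> \<zero>\<^bsub>A\<^esub>) = f (monomial A m) \<otimes>\<^bsub>B\<^esub> f \<zero>\<^bsub>A\<^esub>" using mc[OF m] fc by (simp add: f0)
        show "f (monomial A m \<otimes>\<^bsub>A\<^esub> (a \<oplus>\<^bsub>A\<^esub> c)) = f (monomial A m) \<otimes>\<^bsub>B\<^esub> f (a \<oplus>\<^bsub>A\<^esub> c)"
          if "a \<in> carrier A" "c \<in> carrier A" "f (monomial A m \<otimes>\<^bsub>A\<^esub> a) = f (monomial A m) \<otimes>\<^bsub>B\<^esub> f a"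
           "f (monomial A m \<otimes>\<^bsub>A\<^esub> c) = f (monomial A m) \<otimes>\<^bsub>B\<^esub> f c" for a c
          using that mc[OF m] fc by (simp add: A.r_distr B.r_distr addhom_add[OF fa])
        show "f (monomial A m \<otimes>\<^bsub>A\<^esub> (s \<odot>\<^bsub>A\<^esub> monomial A n)) = f (monomial A m) \<otimes>\<^bsub>B\<^esub> f (s \<odot>\<^bsub>A\<^esub> monomial A n)"
          if "s \<in> carrier R" "n \<in> ?I" for s n
          using that m mc fc fmm by (simp add: algebra_smult_one(3)[OF A] algebra_smult_one(3)[OF B] linear_smult[OF f(1)])
      qed
      then show ?thesis using r mc[OF m] y fc by (simp add: A.smult_assoc2 B.smult_assoc2 linear_smult[OF f(1)])
    qed
  qed
  show thesis
  proof
    have "f \<one>\<^bsub>A\<^esub> = \<one>\<^bsub>B\<^esub>" using f(2)[of "{#}"] by (simp add: monomial_mprod)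
    then show "alg_hom R A B f" using f(1) fm fc
      by (auto simp: alg_hom_def addhom_add[OF fa] intro!: ring_hom_memI)
    show "f x = u x" if "x \<in> X" for x
      using f(2)[of "{#x#}"] that X u cring.mprod_single[OF A.M_cring, of "\<lambda>x. x" x] cring.mprod_single[OF B.M_cring, of u x]
      by (auto simp: monomial_mprod Pi_iff)
  qed
qed

lemma free_algebra_hom_eqI:
  assumes A: "algebra R A" and B: "algebra R B" and free: "free_algebra_on R A X"
    and f: "alg_hom R A B f" and g: "alg_hom R A B g" and eq: "\<And>x. x \<in> X ==> f x = g x" and x: "x \<in> carrier A"
  shows "f x = g x"
proof -
  interpret A: algebra R A by fact
  interpret B: algebra R B by fact
  let ?I = "{m. set_mset m \<subseteq> X}"
  have X: "X \<subseteq> carrier A" and b: "is_basis R A ?I (monomial A)" using free by (auto simp: free_algebra_on_def)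
  have fh: "f \<in> ring_hom A B" "linear R A B f" and gh: "g \<in> ring_hom A B" "linear R A B g" using f g by (auto simp: alg_hom_def)
  have m: "monomial A m \<in> carrier A \<and> f (monomial A m) = g (monomial A m)" if "set_mset m \<subseteq> X" for m using that
  proof (induction m)
    case empty show ?case using ring_hom_one[OF fh(1)] ring_hom_one[OF gh(1)] by (simp add: monomial_mprod)
  next
    case (add x m)
    have "monomial A (add_mset x m) = x \<otimes>\<^bsub>A\<^esub> monomial A m"
      using cring.mprod_add[OF A.M_cring, of "\<lambda>x. x" "{#x#}" m] cring.mprod_single[OF A.M_cring, of "\<lambda>x. x" x] add.prems X by (auto simp: monomial_mprod)
    then show ?case using add X eq[of x] ring_hom_mult[OF fh(1), of x] ring_hom_mult[OF gh(1), of x] by auto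
  qed
  show ?thesis
  proof (rule A.basis_induct[OF b x])
    show "f \<zero>\<^bsub>A\<^esub> = g \<zero>\<^bsub>A\<^esub>" using addhom_zero[OF A.abelian_group_axioms B.abelian_group_axioms] ring_hom_addhom[OF fh(1)] ring_hom_addhom[OF gh(1)] by metis
  qed (auto simp: ring_hom_add[OF fh(1)] ring_hom_add[OF gh(1)] linear_smult[OF fh(2)] linear_smult[OF gh(2)] m)
qed

section \<open>Graded maps\<close>

lemma grading_carrier: "is_grading A gr ==> x \<in> gr k ==> x \<in> carrier A"
  using subgroup.subset[of "gr k" "add_monoid A"] by (auto simp: is_grading_def)

text \<open>Unique finite decompositions give additive component maps, because the componentwise sum
  of two decompositions is the decomposition of the sum.\<close>

lemma grading_components:
  assumes A: "abelian_group A" and gr: "is_grading A gr"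
  obtains co where "\<And>k. addhom A A (\<lambda>x. co x k)" "\<And>x k. x \<in> carrier A ==> co x k \<in> gr k"
    "\<And>x j k. x \<in> gr j ==> co x k = (if k = j then x else \<zero>\<^bsub>A\<^esub>)"
proof -
  interpret A: abelian_group A by fact
  have sub: "subgroup (gr k) (add_monoid A)" for k using gr by (simp add: is_grading_def)
  have grc: "x \<in> gr k ==> x \<in> carrier A" for x k using subgroup.subset[OF sub] by auto
  have gr0: "\<zero>\<^bsub>A\<^esub> \<in> gr k" for k using subgroup.one_closed[OF sub] by simp
  have gradd: "x \<in> gr k ==> y \<in> gr k ==> x \<oplus>\<^bsub>A\<^esub> y \<in> gr k" for x y k using subgroup.m_closed[OF sub] by simp
  define dec where "dec x c \<longleftrightarrow> (\<forall>k. c k \<in> gr k) \<and> finite {k. c k \<noteq> \<zero>\<^bsub>A\<^esub>} \<and> x = (\<Oplus>\<^bsub>A\<^esub>k\<in>{k. c k \<noteq> \<zero>\<^bsub>A\<^esub>}. c k)" for x and c :: "int \<Rightarrow> 'a"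
  have uni: "\<exists>!c. dec x c" if "x \<in> carrier A" for x using gr that by (simp add: is_grading_def dec_def)
  define co where "co x = (THE c. dec x c)" for x
  have co: "dec x (co x)" if "x \<in> carrier A" for x unfolding co_def by (rule theI'[OF uni[OF that]])
  have cou: "co x = c" if "dec x c" "x \<in> carrier A" for x c using uni[OF that(2)] co[OF that(2)] that(1) by blast
  have sup: "x = (\<Oplus>\<^bsub>A\<^esub>k\<in>U. c k)" if "dec x c" "finite U" "{k. c k \<noteq> \<zero>\<^bsub>A\<^esub>} \<subseteq> U" for x c U
    using that unfolding dec_def
    by (auto intro!: A.add.finprod_mono_neutral_cong_left grc)
  have add: "dec (x \<oplus>\<^bsub>A\<^esub> y) (\<lambda>k. c k \<oplus>\<^bsub>A\<^esub> d k)" if "dec x c" "dec y d" for x y c d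
  proof -
    let ?U = "{k. c k \<noteq> \<zero>\<^bsub>A\<^esub>} \<union> {k. d k \<noteq> \<zero>\<^bsub>A\<^esub>}"
    have U: "finite ?U" using that by (simp add: dec_def)
    have cd: "c k \<in> gr k" "d k \<in> gr k" for k using that by (auto simp: dec_def)
    have s: "{k. c k \<oplus>\<^bsub>A\<^esub> d k \<noteq> \<zero>\<^bsub>A\<^esub>} \<subseteq> ?U" by auto
    have "x \<oplus>\<^bsub>A\<^esub> y = (\<Oplus>\<^bsub>A\<^esub>k\<in>?U. c k) \<oplus>\<^bsub>A\<^esub> (\<Oplus>\<^bsub>A\<^esub>k\<in>?U. d k)" using sup[OF that(1) U] sup[OF that(2) U] by auto
    also have "\<dots> = (\<Oplus>\<^bsub>A\<^esub>k\<in>?U. c k \<oplus>\<^bsub>A\<^esub> d k)" by (rule A.finsum_addf[symmetric]) (use cd grc in blast)+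
    also have "\<dots> = (\<Oplus>\<^bsub>A\<^esub>k\<in>{k. c k \<oplus>\<^bsub>A\<^esub> d k \<noteq> \<zero>\<^bsub>A\<^esub>}. c k \<oplus>\<^bsub>A\<^esub> d k)"
      by (rule A.add.finprod_mono_neutral_cong_right) (use U s gradd[OF cd] grc in auto)
    finally show ?thesis using cd gradd finite_subset[OF s U] by (auto simp: dec_def)
  qed
  show thesis
  proof
    show 2: "co x k \<in> gr k" if "x \<in> carrier A" for x k using co[OF that] by (simp add: dec_def)
    show "addhom A A (\<lambda>x. co x k)" for k
      by (rule addhomI) (use 2 grc cou[OF add[OF co co]] in auto)
    show "co x k = (if k = j then x else \<zero>\<^bsub>A\<^esub>)" if "x \<in> gr j" for x j k
    proof -
      \<comment> \<open>For x = 0 the support of this decomposition is empty instead of {j}, hence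
        the case distinction.\<close>
      have "dec x (\<lambda>k. if k = j then x else \<zero>\<^bsub>A\<^esub>)"
      proof (cases "x = \<zero>\<^bsub>A\<^esub>")
        case True then show ?thesis using gr0 by (auto simp: dec_def)
      next
        case False
        then have "{k. (if k = j then x else \<zero>\<^bsub>A\<^esub>) \<noteq> \<zero>\<^bsub>A\<^esub>} = {j}" by auto
        then show ?thesis using that gr0 grc by (auto simp: dec_def)
      qed
      then show ?thesis using cou[OF _ grc[OF that]] by simp
    qed
  qed
qed

lemma graded_zero:
  assumes "abelian_group A" "is_grading A gr" "x \<in> gr j" "x \<in> gr k" "j \<noteq> k" shows "x = \<zero>\<^bsub>A\<^esub>"
proof (rule grading_components[OF assms(1,2)])
  fix co assume "\<And>x j k. x \<in> gr j ==> co x k = (if k = j then x else \<zero>\<^bsub>A\<^esub>)"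
  from this[OF assms(3), of j] this[OF assms(4), of j] show ?thesis using assms(5) by auto
qed

text \<open>The monomials expanding an element of degree k may a priori have other degrees. Taking
  k-components of the expansion removes those terms, since every multiple of a monomial is
  homogeneous.\<close>

lemma free_graded_map:
  assumes ga: "graded_algebra R A" and free: "free_algebra_on R A X"
    and M: "abelian_group M" and f: "addhom A M f" and dp: "\<And>k. subgroup (dp k) (add_monoid M)"
    and mon: "\<And>m. set_mset m \<subseteq> X ==> \<exists>k. monomial A m \<in> dpart A k \<and> f (monomial A m) \<in> dp k"
    and sc: "\<And>r y k. r \<in> carrier R ==> y \<in> dpart A k ==> f y \<in> dp k ==> f (r \<odot>\<^bsub>A\<^esub> y) \<in> dp k"
  shows "f ` dpart A k \<subseteq> dp k"
proof -
  interpret A: algebra R A using ga by (simp add: graded_algebra_def)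
  have gr: "is_grading A (dpart A)" using ga by (simp add: graded_algebra_def)
  interpret M: abelian_group M by fact
  obtain co where co: "\<And>k. addhom A A (\<lambda>x. co x k)" "\<And>x k. x \<in> carrier A ==> co x k \<in> dpart A k"
    "\<And>x j k. x \<in> dpart A j ==> co x k = (if k = j then x else \<zero>\<^bsub>A\<^esub>)"
    using grading_components[OF A.abelian_group_axioms gr] by blast
  have f0: "f \<zero>\<^bsub>A\<^esub> = \<zero>\<^bsub>M\<^esub>" using addhom_zero[OF A.abelian_group_axioms M f] .
  have dp0: "\<zero>\<^bsub>M\<^esub> \<in> dp k" for k using subgroup.one_closed[OF dp] by simp
  have dpa: "x \<in> dp k ==> y \<in> dp k ==> x \<oplus>\<^bsub>M\<^esub> y \<in> dp k" for x y k using subgroup.m_closed[OF dp] by simp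
  have grc: "x \<in> dpart A k ==> x \<in> carrier A" for x k using grading_carrier[OF gr] .
  have b: "is_basis R A {m. set_mset m \<subseteq> X} (monomial A)" using free by (simp add: free_algebra_on_def)
  have Q: "\<forall>k. f (co x k) \<in> dp k" if "x \<in> carrier A" for x
  proof (rule A.basis_induct[OF b that])
    show "\<forall>k. f (co \<zero>\<^bsub>A\<^esub> k) \<in> dp k" using addhom_zero[OF A.abelian_group_axioms A.abelian_group_axioms co(1)] f0 dp0 by simp
    show "\<forall>k. f (co (x \<oplus>\<^bsub>A\<^esub> y) k) \<in> dp k" if "x \<in> carrier A" "y \<in> carrier A" "\<forall>k. f (co x k) \<in> dp k" "\<forall>k. f (co y k) \<in> dp k" for x y
      using that by (simp add: addhom_add[OF co(1)] addhom_closed[OF co(1)] addhom_add[OF f] dpa)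
    show "\<forall>k. f (co (r \<odot>\<^bsub>A\<^esub> monomial A m) k) \<in> dp k" if rm: "r \<in> carrier R" "m \<in> {m. set_mset m \<subseteq> X}" for r m
    proof -
      obtain k where k: "monomial A m \<in> dpart A k" "f (monomial A m) \<in> dp k" using mon rm(2) by blast
      have "r \<odot>\<^bsub>A\<^esub> monomial A m \<in> dpart A k" using ga k(1) rm(1) unfolding graded_algebra_def by blast
      then have "co (r \<odot>\<^bsub>A\<^esub> monomial A m) j = (if j = k then r \<odot>\<^bsub>A\<^esub> monomial A m else \<zero>\<^bsub>A\<^esub>)" for j
        by (rule co(3))
      then show ?thesis using sc[OF rm(1) k] f0 dp0 by simp
    qed
  qed
  show ?thesis
  proof
    fix y assume "y \<in> f ` dpart A k"
    then obtain x where x: "x \<in> dpart A k" "y = f x" by auto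
    then show "y \<in> dp k" using Q[OF grc[OF x(1)]] co(3)[OF x(1)] by (metis (full_types))
  qed
qed

lemma monomial_induct:
  assumes "cring A" "X \<subseteq> carrier A" "set_mset m \<subseteq> X" "P \<one>\<^bsub>A\<^esub>"
    and "\<And>x y. x \<in> X ==> y \<in> carrier A ==> P y ==> P (x \<otimes>\<^bsub>A\<^esub> y)"
  shows "P (monomial A m)"
proof -
  interpret A: cring A by fact
  have "monomial A m \<in> carrier A \<and> P (monomial A m)" using assms(3)
  proof (induction m)
    case empty show ?case using assms(4) by (simp add: monomial_mprod)
  next
    case (add x m)
    have "monomial A (add_mset x m) = x \<otimes>\<^bsub>A\<^esub> monomial A m"
      using A.mprod_add[of "\<lambda>x. x" "{#x#}" m] A.mprod_single[of "\<lambda>x. x" x] add.prems assms(2) by (auto simp: monomial_mprod)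
    then show ?case using add assms(2,5) by auto
  qed
  then show ?thesis by simp
qed

lemma free_graded_hom:
  assumes ga: "graded_algebra R A" and X: "X \<subseteq> (\<Union>k. dpart A k)" and free: "free_algebra_on R A X"
    and B: "algebra R B" and f: "alg_hom R A B f" and dp: "\<And>k. subgroup (dp k) (add_monoid B)"
    and one: "\<one>\<^bsub>B\<^esub> \<in> dp 0" and mult: "\<And>j k x y. x \<in> dp j ==> y \<in> dp k ==> x \<otimes>\<^bsub>B\<^esub> y \<in> dp (j + k)"
    and sc: "\<And>r x k. r \<in> carrier R ==> x \<in> dp k ==> r \<odot>\<^bsub>B\<^esub> x \<in> dp k"
    and gen: "\<And>x k. x \<in> X ==> x \<in> dpart A k ==> f x \<in> dp k"
  shows "f ` dpart A k \<subseteq> dp k"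
proof (rule free_graded_map[OF ga free _ _ dp])
  interpret A: algebra R A using ga by (simp add: graded_algebra_def)
  interpret B: algebra R B by fact
  have fh: "f \<in> ring_hom A B" "linear R A B f" using f by (auto simp: alg_hom_def)
  have gr: "is_grading A (dpart A)" using ga by (simp add: graded_algebra_def)
  have grc: "x \<in> dpart A k ==> x \<in> carrier A" for x k using grading_carrier[OF gr] .
  show "abelian_group B" by (rule B.abelian_group_axioms)
  show "addhom A B f" by (rule ring_hom_addhom[OF fh(1)])
  have XA: "X \<subseteq> carrier A" using free by (simp add: free_algebra_on_def)
  show "\<exists>k. monomial A m \<in> dpart A k \<and> f (monomial A m) \<in> dp k" if "set_mset m \<subseteq> X" for m
  proof (rule monomial_induct[OF A.M_cring XA that])
    have "\<one>\<^bsub>A\<^esub> \<in> dpart A 0" using ga unfolding graded_algebra_def by blast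
    then show "\<exists>k. \<one>\<^bsub>A\<^esub> \<in> dpart A k \<and> f \<one>\<^bsub>A\<^esub> \<in> dp k" using one ring_hom_one[OF fh(1)] by (intro exI[of _ 0]) simp
    fix x y assume x: "x \<in> X" and y: "y \<in> carrier A" "\<exists>k. y \<in> dpart A k \<and> f y \<in> dp k"
    from x obtain j where j: "x \<in> dpart A j" "f x \<in> dp j" using X gen by blast
    obtain k where k: "y \<in> dpart A k" "f y \<in> dp k" using y by blast
    have "x \<otimes>\<^bsub>A\<^esub> y \<in> dpart A (j + k)" using ga j k unfolding graded_algebra_def by blast
    moreover have "f (x \<otimes>\<^bsub>A\<^esub> y) \<in> dp (j + k)"
      using mult[OF j(2) k(2)] ring_hom_mult[OF fh(1), of x y] y(1) x XA by auto
    ultimately show "\<exists>k. x \<otimes>\<^bsub>A\<^esub> y \<in> dpart A k \<and> f (x \<otimes>\<^bsub>A\<^esub> y) \<in> dp k" by blast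
  qed
  show "f (r \<odot>\<^bsub>A\<^esub> y) \<in> dp k" if "r \<in> carrier R" "y \<in> dpart A k" "f y \<in> dp k" for r y k
    using sc that linear_smult[OF fh(2) that(1) grc[OF that(2)]] by simp
qed

section \<open>Cohomology classes as sets of cocycles\<close>

lemma hom_group_simps [simp]:
  "carrier (hom_group H M N) = H"
  "f \<otimes>\<^bsub>hom_group H M N\<^esub> g = (\<lambda>x\<in>carrier M. f x \<oplus>\<^bsub>N\<^esub> g x)"
  "\<one>\<^bsub>hom_group H M N\<^esub> = (\<lambda>x\<in>carrier M. \<zero>\<^bsub>N\<^esub>)"
  by (simp_all add: hom_group_def)

lemma linmaps_closed:
  assumes "module R M" "module R N"
  shows "(\<lambda>x\<in>carrier M. \<zero>\<^bsub>N\<^esub>) \<in> linmaps R M N" (is "PROP ?g1")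
    and "f \<in> linmaps R M N ==> g \<in> linmaps R M N ==> (\<lambda>x\<in>carrier M. f x \<oplus>\<^bsub>N\<^esub> g x) \<in> linmaps R M N" (is "PROP ?g2")
    and "f \<in> linmaps R M N ==> (\<lambda>x\<in>carrier M. \<ominus>\<^bsub>N\<^esub> f x) \<in> linmaps R M N" (is "PROP ?g3")
    and "linear R M N h ==> restrict h (carrier M) \<in> linmaps R M N" (is "PROP ?g4")
proof -
  interpret M: module R M by fact
  interpret N: module R N by fact
  have r: "restrict h (carrier M) \<in> linmaps R M N" if "linear R M N h" for h
    using that by (auto simp: linmaps_def linear_def)
  show "PROP ?g4" by (rule r)
  show "PROP ?g1"
    by (rule r) (auto simp: linear_def)
  show "PROP ?g2"
    by (rule r) (auto simp: linmaps_def linear_def Pi_iff N.M.a_ac N.smult_r_distr)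
  show "PROP ?g3"
    by (rule r) (auto simp: linmaps_def linear_def Pi_iff N.M.a_ac N.M.minus_add N.smult_r_minus)
qed

lemma linmapsD:
  assumes "f \<in> linmaps R M N" shows "linear R M N f" "f \<in> extensional (carrier M)" "f \<in> carrier M \<rightarrow>\<^sub>E carrier N"
  using assms by (auto simp: linmaps_def linear_def PiE_def)

lemma linmaps_mem: "f \<in> linmaps R M N ==> x \<in> carrier M ==> f x \<in> carrier N"
  by (auto simp: linmaps_def linear_def)

lemma glinmaps_closed:
  assumes "module R M" "module R N" "\<And>k. subgroup (dpart N k) (add_monoid N)" "\<And>k. dpart M k \<subseteq> carrier M"
  shows "(\<lambda>x\<in>carrier M. \<zero>\<^bsub>N\<^esub>) \<in> glinmaps R M N" (is "PROP ?g1")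
    and "f \<in> glinmaps R M N ==> g \<in> glinmaps R M N ==> (\<lambda>x\<in>carrier M. f x \<oplus>\<^bsub>N\<^esub> g x) \<in> glinmaps R M N"
proof -
  note sg = subgroup.one_closed[OF assms(3), simplified] subgroup.m_closed[OF assms(3), simplified]
  note lc = linmaps_closed[OF assms(1,2)]
  have dM: "x \<in> dpart M k ==> x \<in> carrier M" for x k using assms(4) by auto
  show "PROP ?g1" using lc(1) sg(1) assms(4) by (auto simp: glinmaps_def)
  show "(\<lambda>x\<in>carrier M. f x \<oplus>\<^bsub>N\<^esub> g x) \<in> glinmaps R M N" if "f \<in> glinmaps R M N" "g \<in> glinmaps R M N"
    using that lc(2)[of f g] sg(2) dM unfolding glinmaps_def by (auto simp: image_subset_iff)
qed

lemma cobd_Suc: "cobd C \<delta> (Suc n) = \<delta> n ` carrier (C n)"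
  by (simp add: cobd_def)

text \<open>The hypotheses make Z a single coset of the coboundaries when it is nonempty. Adding the
  coboundaries to any nonempty part of Z gives back Z, so a class built from some of the admissible
  choices equals the class built from all of them.\<close>

lemma coh_class_torsor:
  assumes Z: "Z \<subseteq> carrier (C (Suc n))"
    and diff: "\<And>z z'. z \<in> Z ==> z' \<in> Z ==> \<exists>g\<in>carrier (C n). z' = \<delta> n g \<otimes>\<^bsub>C (Suc n)\<^esub> z"
    and closed: "\<And>z g. z \<in> Z ==> g \<in> carrier (C n) ==> \<delta> n g \<otimes>\<^bsub>C (Suc n)\<^esub> z \<in> Z"
  shows "Z' \<subseteq> Z ==> Z' \<noteq> {} ==> coh_class C \<delta> (Suc n) Z' = Z"
    and "Z \<noteq> {} ==> (\<And>z. z \<in> Z ==> \<delta> (Suc n) z = \<one>\<^bsub>C (Suc (Suc n))\<^esub>) ==> Z \<in> carrier (cohomology C \<delta> (Suc n))"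
proof -
  have co: "cobd C \<delta> (Suc n) #>\<^bsub>C (Suc n)\<^esub> z = Z" if "z \<in> Z" for z
    using diff[OF that] closed[OF that] by (fastforce simp: r_coset_def cobd_Suc)
  show "coh_class C \<delta> (Suc n) Z' = Z" if "Z' \<subseteq> Z" "Z' \<noteq> {}"
  proof -
    have "coh_class C \<delta> (Suc n) Z' = (\<Union>z\<in>Z'. cobd C \<delta> (Suc n) #>\<^bsub>C (Suc n)\<^esub> z)"
      by (auto simp: coh_class_def set_mult_def r_coset_def)
    also have "\<dots> = (\<Union>z\<in>Z'. Z)" using that(1) co by auto
    finally show ?thesis using that(2) by auto
  qed
  show "Z \<in> carrier (cohomology C \<delta> (Suc n))" if "Z \<noteq> {}" "\<And>z. z \<in> Z ==> \<delta> (Suc n) z = \<one>\<^bsub>C (Suc (Suc n))\<^esub>"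
  proof -
    from that(1) obtain z where z: "z \<in> Z" by auto
    have "Z = cobd C \<delta> (Suc n) #>\<^bsub>C (Suc n)\<lparr>carrier := {f \<in> carrier (C (Suc n)). \<delta> (Suc n) f = \<one>\<^bsub>C (Suc (Suc n))\<^esub>}\<rparr>\<^esub> z"
      using co[OF z] by (simp add: r_coset_def)
    then show ?thesis using z Z that(2) unfolding cohomology_def carrier_FactGroup by auto
  qed
qed

section \<open>Extensions and connections on a free resolution\<close>

text \<open>
  Projecting linear lifts of the augmentation along an additive retraction of an extension gives the connections, where
  \<open>c\<close> measures how far the additive splitting is from being linear.
\<close>

definition connection ::
  "('t, 'y) ring_scheme \<Rightarrow> ('t, 'f, 'n) fres \<Rightarrow> ('t, 'm, 'u) module_scheme \<Rightarrow> ('t \<Rightarrow> 'n \<Rightarrow> 'm) \<Rightarrow> ('f \<Rightarrow> 'm) \<Rightarrow> bool" where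
  "connection T F M c D \<longleftrightarrow> addhom (fobj F 0) M D \<and>
     (\<forall>t\<in>carrier T. \<forall>x\<in>carrier (fobj F 0). D (t \<odot>\<^bsub>fobj F 0\<^esub> x) = t \<odot>\<^bsub>M\<^esub> D x \<ominus>\<^bsub>M\<^esub> c t (faug F x))"

definition connection_cocycles ::
  "('t, 'y) ring_scheme \<Rightarrow> ('t, 'f, 'n) fres \<Rightarrow> ('t, 'm, 'u) module_scheme \<Rightarrow> ('t \<Rightarrow> 'n \<Rightarrow> 'm) \<Rightarrow> ('f \<Rightarrow> 'm) set" where
  "connection_cocycles T F M c = {z \<in> linmaps T (fobj F (Suc 0)) M. \<exists>D. connection T F M c D \<and>
     (\<forall>y\<in>carrier (fobj F (Suc 0)). z y = D (fbd F 0 y))}"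

text \<open>\<open>M\<close> is the coefficient module. Instances with \<open>M = N\<close> are used
  where only the resolution matters.\<close>

locale ext_res = M: module T M + N: module T N
  for T :: "('t, 'y) ring_scheme" and M :: "('t, 'm, 'u) module_scheme" and N :: "('t, 'n, 'v) module_scheme"
    and F :: "('t, 'f, 'n) fres" +
  assumes res: "free_resolution T N F"
begin

lemma F_module: "module T (fobj F n)" using res by (simp add: free_resolution_def)
lemma F_basis: "\<exists>B. is_basis T (fobj F n) B (\<lambda>x. x)" using res by (simp add: free_resolution_def)
lemma F_bd: "linear T (fobj F (Suc n)) (fobj F n) (fbd F n)" using res by (simp add: free_resolution_def)
lemma F_aug: "linear T (fobj F 0) N (faug F)" using res by (simp add: free_resolution_def)
lemma F_ab: "abelian_group (fobj F n)" using module.axioms(2)[OF F_module] .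

lemma bd_closed: "y \<in> carrier (fobj F (Suc n)) ==> fbd F n y \<in> carrier (fobj F n)"
  using addhom_closed[OF linear_addhom[OF F_bd]] .

lemma aug_closed: "y \<in> carrier (fobj F 0) ==> faug F y \<in> carrier N"
  using addhom_closed[OF linear_addhom[OF F_aug]] .

lemma aug_bd: "y \<in> carrier (fobj F (Suc 0)) ==> faug F (fbd F 0 y) = \<zero>\<^bsub>N\<^esub>"
  using res unfolding free_resolution_def by (metis (mono_tags, lifting) image_eqI mem_Collect_eq)

lemma bd_bd: "y \<in> carrier (fobj F (Suc (Suc n))) ==> fbd F n (fbd F (Suc n) y) = \<zero>\<^bsub>fobj F n\<^esub>"
proof -
  assume "y \<in> carrier (fobj F (Suc (Suc n)))"
  then have "fbd F (Suc n) y \<in> fbd F (Suc n) ` carrier (fobj F (Suc (Suc n)))" by simp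
  also have "\<dots> = {x \<in> carrier (fobj F (Suc n)). fbd F n x = \<zero>\<^bsub>fobj F n\<^esub>}"
    using res by (simp add: free_resolution_def)
  finally show ?thesis by simp
qed

lemma ext_d_linmaps: "f \<in> linmaps T (fobj F n) M ==> ext_d F n f \<in> linmaps T (fobj F (Suc n)) M"
  unfolding ext_d_def
  by (rule linmaps_closed(4)[OF F_module M.module_axioms], rule linearI[OF addhom_comp[OF linear_addhom[OF F_bd] linear_addhom[OF linmapsD(1)]]])
    (auto simp: linear_smult[OF F_bd] linear_smult[OF linmapsD(1)] bd_closed)

context
  fixes c :: "'t \<Rightarrow> 'n \<Rightarrow> 'm"
  assumes c: "\<And>t n. t \<in> carrier T ==> n \<in> carrier N ==> c t n \<in> carrier M"
begin

text \<open>The defect depends on x only through its augmentation, so it cancels in a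
  difference.\<close>

lemma connection_diff:
  assumes "connection T F M c D" "connection T F M c D'"
  shows "(\<lambda>x\<in>carrier (fobj F 0). D' x \<ominus>\<^bsub>M\<^esub> D x) \<in> linmaps T (fobj F 0) M"
proof (rule linmaps_closed(4)[OF F_module M.module_axioms], rule linearI)
  have D: "addhom (fobj F 0) M D" "addhom (fobj F 0) M D'" using assms by (auto simp: connection_def)
  show "addhom (fobj F 0) M (\<lambda>x. D' x \<ominus>\<^bsub>M\<^esub> D x)" by (rule addhom_diff[OF M.abelian_group_axioms D(2,1)])
  fix t x assume tx: "t \<in> carrier T" "x \<in> carrier (fobj F 0)"
  have cl: "D x \<in> carrier M" "D' x \<in> carrier M" "c t (faug F x) \<in> carrier M"
    using addhom_closed[OF D(1)] addhom_closed[OF D(2)] c aug_closed tx by auto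
  have "D' (t \<odot>\<^bsub>fobj F 0\<^esub> x) \<ominus>\<^bsub>M\<^esub> D (t \<odot>\<^bsub>fobj F 0\<^esub> x) =
      (t \<odot>\<^bsub>M\<^esub> D' x \<ominus>\<^bsub>M\<^esub> c t (faug F x)) \<ominus>\<^bsub>M\<^esub> (t \<odot>\<^bsub>M\<^esub> D x \<ominus>\<^bsub>M\<^esub> c t (faug F x))"
    using assms tx by (simp add: connection_def)
  also have "\<dots> = t \<odot>\<^bsub>M\<^esub> D' x \<oplus>\<^bsub>M\<^esub> ((\<ominus>\<^bsub>M\<^esub> c t (faug F x) \<oplus>\<^bsub>M\<^esub> c t (faug F x)) \<ominus>\<^bsub>M\<^esub> t \<odot>\<^bsub>M\<^esub> D x)"
    using tx cl by (simp add: a_minus_def M.M.minus_add M.M.a_ac)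
  also have "\<dots> = t \<odot>\<^bsub>M\<^esub> (D' x \<ominus>\<^bsub>M\<^esub> D x)"
    using tx cl by (simp add: M.M.l_neg a_minus_def M.smult_r_distr M.smult_r_minus)
  finally show "D' (t \<odot>\<^bsub>fobj F 0\<^esub> x) \<ominus>\<^bsub>M\<^esub> D (t \<odot>\<^bsub>fobj F 0\<^esub> x) = t \<odot>\<^bsub>M\<^esub> (D' x \<ominus>\<^bsub>M\<^esub> D x)" .
qed

lemma connection_add_linear:
  assumes "connection T F M c D" "g \<in> linmaps T (fobj F 0) M"
  shows "connection T F M c (\<lambda>x. g x \<oplus>\<^bsub>M\<^esub> D x)"
proof -
  have D: "addhom (fobj F 0) M D" using assms by (auto simp: connection_def)
  note g = linmapsD(1)[OF assms(2)]
  have "g (t \<odot>\<^bsub>fobj F 0\<^esub> x) \<oplus>\<^bsub>M\<^esub> D (t \<odot>\<^bsub>fobj F 0\<^esub> x) = t \<odot>\<^bsub>M\<^esub> (g x \<oplus>\<^bsub>M\<^esub> D x) \<ominus>\<^bsub>M\<^esub> c t (faug F x)"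
    if tx: "t \<in> carrier T" "x \<in> carrier (fobj F 0)" for t x
    using assms(1) tx addhom_closed[OF D] addhom_closed[OF linear_addhom[OF g]] c[OF tx(1) aug_closed[OF tx(2)]]
    by (simp add: connection_def linear_smult[OF g] M.smult_r_distr a_minus_def M.M.a_assoc)
  then show ?thesis using addhom_sum[OF M.abelian_group_axioms linear_addhom[OF g] D] by (simp add: connection_def)
qed

text \<open>Connections with defect c differ exactly by the linear maps on \<open>fobj F 0\<close>.
  Restricted to boundaries, these become the coboundaries.\<close>

lemma connection_class:
  shows "Z \<subseteq> connection_cocycles T F M c ==> Z \<noteq> {} ==> ext_cls 1 T F M Z = connection_cocycles T F M c"
    and "connection_cocycles T F M c \<noteq> {} ==> connection_cocycles T F M c \<in> carrier (Ext 1 T F M)"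
proof -
  let ?Z = "connection_cocycles T F M c"
  have 1: "?Z \<subseteq> carrier (ext_C T F M (Suc 0))" by (auto simp: ext_C_def connection_cocycles_def)
  have 2: "\<exists>g\<in>carrier (ext_C T F M 0). z' = ext_d F 0 g \<otimes>\<^bsub>ext_C T F M (Suc 0)\<^esub> z" if z: "z \<in> ?Z" and z': "z' \<in> ?Z" for z z'
  proof -
    from z obtain D where D: "connection T F M c D" "\<forall>y\<in>carrier (fobj F (Suc 0)). z y = D (fbd F 0 y)" "z \<in> linmaps T (fobj F (Suc 0)) M"
      by (auto simp: connection_cocycles_def)
    from z' obtain D' where D': "connection T F M c D'" "\<forall>y\<in>carrier (fobj F (Suc 0)). z' y = D' (fbd F 0 y)" "z' \<in> linmaps T (fobj F (Suc 0)) M"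
      by (auto simp: connection_cocycles_def)
    let ?g = "\<lambda>x\<in>carrier (fobj F 0). D' x \<ominus>\<^bsub>M\<^esub> D x"
    have "addhom (fobj F 0) M D" "addhom (fobj F 0) M D'" using D D' by (auto simp: connection_def)
    note cl = addhom_closed[OF this(1)] addhom_closed[OF this(2)]
    have "z' = ext_d F 0 ?g \<otimes>\<^bsub>ext_C T F M (Suc 0)\<^esub> z"
    proof (rule extensionalityI[OF linmapsD(2)[OF D'(3)]])
      show "ext_d F 0 ?g \<otimes>\<^bsub>ext_C T F M (Suc 0)\<^esub> z \<in> extensional (carrier (fobj F (Suc 0)))" by (simp add: ext_C_def)
      fix y assume y: "y \<in> carrier (fobj F (Suc 0))"
      then show "z' y = (ext_d F 0 ?g \<otimes>\<^bsub>ext_C T F M (Suc 0)\<^esub> z) y"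
        using D(2) D'(2) cl[OF bd_closed[OF y]] bd_closed[OF y]
        by (simp add: ext_C_def ext_d_def a_minus_def M.M.a_assoc M.M.l_neg)
    qed
    then show ?thesis using connection_diff[OF D(1) D'(1)] by (auto simp: ext_C_def)
  qed
  have 3: "ext_d F 0 g \<otimes>\<^bsub>ext_C T F M (Suc 0)\<^esub> z \<in> ?Z" if z: "z \<in> ?Z" and g: "g \<in> carrier (ext_C T F M 0)" for z g
  proof -
    from z obtain D where D: "connection T F M c D" "\<forall>y\<in>carrier (fobj F (Suc 0)). z y = D (fbd F 0 y)" "z \<in> linmaps T (fobj F (Suc 0)) M"
      by (auto simp: connection_cocycles_def)
    have g': "g \<in> linmaps T (fobj F 0) M" using g by (simp add: ext_C_def)
    have "ext_d F 0 g \<otimes>\<^bsub>ext_C T F M (Suc 0)\<^esub> z \<in> linmaps T (fobj F (Suc 0)) M"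
      using linmaps_closed(2)[OF F_module M.module_axioms ext_d_linmaps[OF g'] D(3)] by (simp add: ext_C_def)
    moreover have "connection T F M c (\<lambda>x. g x \<oplus>\<^bsub>M\<^esub> D x)" by (rule connection_add_linear[OF D(1) g'])
    ultimately show ?thesis using D(2) by (auto simp: connection_cocycles_def ext_C_def ext_d_def)
  qed
  note t = coh_class_torsor[of ?Z "ext_C T F M" 0 "ext_d F", OF 1 2 3]
  show "Z \<subseteq> ?Z ==> Z \<noteq> {} ==> ext_cls 1 T F M Z = ?Z"
    unfolding ext_cls_def One_nat_def by (rule t(1))
  have 4: "ext_d F (Suc 0) z = \<one>\<^bsub>ext_C T F M (Suc (Suc 0))\<^esub>" if z: "z \<in> ?Z" for z
  proof -
    from z obtain D where D: "connection T F M c D" "\<forall>y\<in>carrier (fobj F (Suc 0)). z y = D (fbd F 0 y)" "z \<in> linmaps T (fobj F (Suc 0)) M"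
      by (auto simp: connection_cocycles_def)
    have "addhom (fobj F 0) M D" using D by (auto simp: connection_def)
    note z0 = addhom_zero[OF F_ab M.abelian_group_axioms this]
    show ?thesis using D(2) bd_bd bd_closed by (auto simp: ext_C_def ext_d_def z0 intro!: restrict_ext)
  qed
  show "?Z \<noteq> {} ==> ?Z \<in> carrier (Ext 1 T F M)"
    unfolding Ext_def One_nat_def by (rule t(2)) (auto simp: 4)
qed

text \<open>A lift \<phi> of the augmentation corresponds to the connection r \<circ> \<phi>;
  conversely D gives the lift i \<circ> D + s \<circ> \<open>faug F\<close>. The section s is only
  additive, and \<open>tw\<close> names its failure to be linear.\<close>

lemma ses_class_connection:
  assumes E: "module T E" and i: "linear T M E i" and p: "linear T E N p"
    and s: "addhom N E s" and r: "addhom E M r"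
    and ri: "\<And>x. x \<in> carrier M ==> r (i x) = x" and pi: "\<And>x. x \<in> carrier M ==> p (i x) = \<zero>\<^bsub>N\<^esub>"
    and ps: "\<And>x. x \<in> carrier N ==> p (s x) = x"
    and dec: "\<And>e. e \<in> carrier E ==> e = i (r e) \<oplus>\<^bsub>E\<^esub> s (p e)"
    and tw: "\<And>t n. t \<in> carrier T ==> n \<in> carrier N ==> t \<odot>\<^bsub>E\<^esub> s n = s (t \<odot>\<^bsub>N\<^esub> n) \<ominus>\<^bsub>E\<^esub> i (c t n)"
  shows "ses_class T F M E i p = connection_cocycles T F M c"
    and "connection_cocycles T F M c \<noteq> {}"
    and "short_exact T M E N i p"
proof -
  interpret E: module T E by fact
  note ia = linear_addhom[OF i] and pa = linear_addhom[OF p]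
  have cl: "x \<in> carrier M ==> i x \<in> carrier E" "e \<in> carrier E ==> p e \<in> carrier N"
    "n \<in> carrier N ==> s n \<in> carrier E" "e \<in> carrier E ==> r e \<in> carrier M" for x e n
    using addhom_closed[OF ia] addhom_closed[OF pa] addhom_closed[OF s] addhom_closed[OF r] by auto
  have i0: "i \<zero>\<^bsub>M\<^esub> = \<zero>\<^bsub>E\<^esub>" using addhom_zero[OF M.abelian_group_axioms E.abelian_group_axioms ia] .
  have s0: "s \<zero>\<^bsub>N\<^esub> = \<zero>\<^bsub>E\<^esub>" using addhom_zero[OF N.abelian_group_axioms E.abelian_group_axioms s] .
  \<comment> \<open>Comparing s(n) with its own decomposition leaves i(r(s(n))) = 0.\<close>
  have rs: "r (s n) = \<zero>\<^bsub>M\<^esub>" if n: "n \<in> carrier N" for n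
  proof -
    have "s n = i (r (s n)) \<oplus>\<^bsub>E\<^esub> s n" using dec[of "s n"] ps[OF n] cl n by simp
    then have "i (r (s n)) = \<zero>\<^bsub>E\<^esub>" using cl n by (metis E.M.add.r_cancel_one')
    then have "r (s n) = r \<zero>\<^bsub>E\<^esub>" using ri[of "r (s n)"] cl n by simp
    then show ?thesis using addhom_zero[OF E.abelian_group_axioms M.abelian_group_axioms r] by simp
  qed
  have rt: "r (t \<odot>\<^bsub>E\<^esub> e) = t \<odot>\<^bsub>M\<^esub> r e \<ominus>\<^bsub>M\<^esub> c t (p e)" if t: "t \<in> carrier T" and e: "e \<in> carrier E" for t e
  proof -
    have "t \<odot>\<^bsub>E\<^esub> e = t \<odot>\<^bsub>E\<^esub> (i (r e) \<oplus>\<^bsub>E\<^esub> s (p e))" using dec[OF e] by simp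
    also have "\<dots> = i (t \<odot>\<^bsub>M\<^esub> r e) \<oplus>\<^bsub>E\<^esub> (s (t \<odot>\<^bsub>N\<^esub> p e) \<ominus>\<^bsub>E\<^esub> i (c t (p e)))"
      using t e cl by (simp add: E.smult_r_distr tw linear_smult[OF i])
    finally have "r (t \<odot>\<^bsub>E\<^esub> e) = r (i (t \<odot>\<^bsub>M\<^esub> r e)) \<oplus>\<^bsub>M\<^esub> (r (s (t \<odot>\<^bsub>N\<^esub> p e)) \<ominus>\<^bsub>M\<^esub> r (i (c t (p e))))"
      using t e cl c by (simp add: addhom_add[OF r] addhom_minus[OF E.abelian_group_axioms M.abelian_group_axioms r])
    then show ?thesis using t e cl c by (simp add: ri rs a_minus_def)
  qed
  let ?S = "{z \<in> linmaps T (fobj F 1) M. \<exists>\<phi>. linear T (fobj F 0) E \<phi> \<and>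
        (\<forall>x\<in>carrier (fobj F 0). p (\<phi> x) = faug F x) \<and>
        (\<forall>y\<in>carrier (fobj F 1). i (z y) = \<phi> (fbd F 0 y))}"
  have conn: "connection T F M c (\<lambda>x. r (\<phi> x))" if "linear T (fobj F 0) E \<phi>" "\<forall>x\<in>carrier (fobj F 0). p (\<phi> x) = faug F x" for \<phi>
    using that addhom_comp[OF linear_addhom[OF that(1)] r] addhom_closed[OF linear_addhom[OF that(1)]]
    by (simp add: connection_def linear_smult[OF that(1)] rt)
  have S: "?S = connection_cocycles T F M c"
  proof (intro equalityI subsetI)
    fix z assume "z \<in> ?S"
    then obtain \<phi> where z: "z \<in> linmaps T (fobj F (Suc 0)) M" and f: "linear T (fobj F 0) E \<phi>" "\<forall>x\<in>carrier (fobj F 0). p (\<phi> x) = faug F x"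
      "\<forall>y\<in>carrier (fobj F (Suc 0)). i (z y) = \<phi> (fbd F 0 y)" by auto
    have "z y = r (\<phi> (fbd F 0 y))" if "y \<in> carrier (fobj F (Suc 0))" for y
      using that f(3) ri[OF linmaps_mem[OF z that]] by auto
    then show "z \<in> connection_cocycles T F M c" using z conn[OF f(1,2)] by (auto simp: connection_cocycles_def)
  next
    fix z assume "z \<in> connection_cocycles T F M c"
    then obtain D where z: "z \<in> linmaps T (fobj F (Suc 0)) M" and D: "connection T F M c D" "\<forall>y\<in>carrier (fobj F (Suc 0)). z y = D (fbd F 0 y)"
      by (auto simp: connection_cocycles_def)
    have Da: "addhom (fobj F 0) M D" using D by (simp add: connection_def)
    let ?\<phi> = "\<lambda>x. i (D x) \<oplus>\<^bsub>E\<^esub> s (faug F x)"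
    have "addhom (fobj F 0) E ?\<phi>"
      by (rule addhom_sum[OF E.abelian_group_axioms addhom_comp[OF Da ia] addhom_comp[OF linear_addhom[OF F_aug] s]])
    moreover have "?\<phi> (t \<odot>\<^bsub>fobj F 0\<^esub> x) = t \<odot>\<^bsub>E\<^esub> ?\<phi> x" if t: "t \<in> carrier T" and x: "x \<in> carrier (fobj F 0)" for t x
    proof -
      have cc: "c t (faug F x) \<in> carrier M" "D x \<in> carrier M" "faug F x \<in> carrier N" using c t x aug_closed addhom_closed[OF Da] by auto
      have "?\<phi> (t \<odot>\<^bsub>fobj F 0\<^esub> x) = i (t \<odot>\<^bsub>M\<^esub> D x \<ominus>\<^bsub>M\<^esub> c t (faug F x)) \<oplus>\<^bsub>E\<^esub> s (t \<odot>\<^bsub>N\<^esub> faug F x)"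
        using D(1) t x by (simp add: connection_def linear_smult[OF F_aug])
      also have "\<dots> = (i (t \<odot>\<^bsub>M\<^esub> D x) \<ominus>\<^bsub>E\<^esub> i (c t (faug F x))) \<oplus>\<^bsub>E\<^esub> s (t \<odot>\<^bsub>N\<^esub> faug F x)"
        using t cc by (simp add: addhom_minus[OF M.abelian_group_axioms E.abelian_group_axioms ia])
      also have "\<dots> = i (t \<odot>\<^bsub>M\<^esub> D x) \<oplus>\<^bsub>E\<^esub> (s (t \<odot>\<^bsub>N\<^esub> faug F x) \<ominus>\<^bsub>E\<^esub> i (c t (faug F x)))"
        using t cc cl by (simp add: a_minus_def E.M.a_ac)
      also have "\<dots> = t \<odot>\<^bsub>E\<^esub> ?\<phi> x" using t cc cl by (simp add: E.smult_r_distr tw linear_smult[OF i])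
      finally show ?thesis .
    qed
    ultimately have "linear T (fobj F 0) E ?\<phi>" by (rule linearI)
    moreover have "p (?\<phi> x) = faug F x" if x: "x \<in> carrier (fobj F 0)" for x
      using aug_closed[OF x] addhom_closed[OF Da x] cl by (simp add: addhom_add[OF pa] pi ps)
    moreover have "i (z y) = ?\<phi> (fbd F 0 y)" if y: "y \<in> carrier (fobj F (Suc 0))" for y
      using D(2) y addhom_closed[OF Da bd_closed[OF y]] cl by (simp add: aug_bd s0)
    ultimately show "z \<in> ?S" using z by auto
  qed
  \<comment> \<open>One lift exists because \<open>fobj F 0\<close> is free and p is onto. Its
    connection makes the set of cocycles nonempty.\<close>
  obtain B where B: "is_basis T (fobj F 0) B (\<lambda>x. x)" using F_basis by blast
  obtain \<phi> where f: "linear T (fobj F 0) E \<phi>" "\<And>x. x \<in> carrier (fobj F 0) ==> p (\<phi> x) = faug F x"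
  proof (rule basis_lift[OF F_module E N.module_axioms B p F_aug])
    fix b assume "b \<in> B"
    then have "b \<in> carrier (fobj F 0)" using B by (auto simp: is_basis_iff)
    then show "faug F b \<in> p ` carrier E" using ps[OF aug_closed] cl(3)[OF aug_closed] by (metis image_eqI)
  qed blast
  have D: "connection T F M c (\<lambda>x. r (\<phi> x))" using conn f by blast
  have Da: "addhom (fobj F 0) M (\<lambda>x. r (\<phi> x))" using D by (simp add: connection_def)
  \<comment> \<open>A boundary has augmentation 0, so this vanishing makes the restriction of a
    connection to boundaries linear. It is read off from \<open>rt\<close> at 0.\<close>
  have c0: "c t \<zero>\<^bsub>N\<^esub> = \<zero>\<^bsub>M\<^esub>" if "t \<in> carrier T" for t
    using rt[OF that, of "\<zero>\<^bsub>E\<^esub>"] that c[OF that N.M.zero_closed] addhom_zero[OF E.abelian_group_axioms M.abelian_group_axioms r]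
      addhom_zero[OF E.abelian_group_axioms N.abelian_group_axioms pa]
    by (simp add: eq_commute[of "\<zero>\<^bsub>M\<^esub>"] abelian_minus_eq[OF M.abelian_group_axioms])
  have "(\<lambda>y\<in>carrier (fobj F (Suc 0)). r (\<phi> (fbd F 0 y))) \<in> linmaps T (fobj F (Suc 0)) M"
  proof (rule linmaps_closed(4)[OF F_module M.module_axioms], rule linearI)
    show "addhom (fobj F (Suc 0)) M (\<lambda>y. r (\<phi> (fbd F 0 y)))"
      by (rule addhom_comp[OF linear_addhom[OF F_bd] Da])
    fix t y assume t: "t \<in> carrier T" and y: "y \<in> carrier (fobj F (Suc 0))"
    then show "r (\<phi> (fbd F 0 (t \<odot>\<^bsub>fobj F (Suc 0)\<^esub> y))) = t \<odot>\<^bsub>M\<^esub> r (\<phi> (fbd F 0 y))"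
      using D bd_closed[OF y] addhom_closed[OF Da bd_closed[OF y]]
      by (simp add: linear_smult[OF F_bd] connection_def aug_bd c0 abelian_minus_eq[OF M.abelian_group_axioms])
  qed
  then have "(\<lambda>y\<in>carrier (fobj F (Suc 0)). r (\<phi> (fbd F 0 y))) \<in> connection_cocycles T F M c"
    using D by (auto simp: connection_cocycles_def)
  then show ne: "connection_cocycles T F M c \<noteq> {}" by auto
  show "ses_class T F M E i p = connection_cocycles T F M c"
    unfolding ses_class_def S using connection_class(1)[OF order_refl ne] .
  show "short_exact T M E N i p"
    unfolding short_exact_def
  proof (intro conjI)
    show "inj_on i (carrier M)" using ri by (rule inj_on_inverseI)
    show "i ` carrier M = {x \<in> carrier E. p x = \<zero>\<^bsub>N\<^esub>}"
    proof (intro equalityI subsetI)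
      fix e assume "e \<in> {x \<in> carrier E. p x = \<zero>\<^bsub>N\<^esub>}"
      then have "e = i (r e)" "r e \<in> carrier M" using dec[of e] cl by (auto simp: s0)
      then show "e \<in> i ` carrier M" by blast
    qed (use cl pi in auto)
    show "p ` carrier E = carrier N"
    proof (intro equalityI subsetI)
      fix n assume "n \<in> carrier N"
      then show "n \<in> p ` carrier E" using ps[of n] cl(3)[of n] by (metis image_eqI)
    qed (use cl in auto)
  qed (use M.module_axioms E N.module_axioms i p in auto)
qed

text \<open>Composing a connection of defect c with g gives one of defect g \<circ> c, and any
  nonempty set of its cocycles determines the class.\<close>

lemma ext_push_connection:
  assumes M1: "module T M1" and g: "linear T M M1 g" and ne: "connection_cocycles T F M c \<noteq> {}"
    and c': "\<And>t n. t \<in> carrier T ==> n \<in> carrier N ==> c' t n = g (c t n)"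
  shows "ext_push 1 T F M1 g (connection_cocycles T F M c) = connection_cocycles T F M1 c'"
proof -
  interpret E1: ext_res T M1 N F by (simp add: ext_res_def ext_res_axioms_def M1 N.module_axioms res)
  have "(\<lambda>x\<in>carrier (fobj F (Suc 0)). g (z x)) \<in> connection_cocycles T F M1 c'" if z: "z \<in> connection_cocycles T F M c" for z
  proof -
    obtain D where zl: "z \<in> linmaps T (fobj F (Suc 0)) M" and D: "connection T F M c D" "\<forall>y\<in>carrier (fobj F (Suc 0)). z y = D (fbd F 0 y)"
      using z by (auto simp: connection_cocycles_def)
    have Da: "addhom (fobj F 0) M D" using D by (simp add: connection_def)
    have "connection T F M1 c' (\<lambda>x. g (D x))"
      using D addhom_comp[OF Da linear_addhom[OF g]] addhom_closed[OF Da] c aug_closed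
      by (simp add: connection_def c' linear_smult[OF g] addhom_minus[OF M.abelian_group_axioms E1.M.abelian_group_axioms linear_addhom[OF g]])
    moreover have "(\<lambda>x\<in>carrier (fobj F (Suc 0)). g (z x)) \<in> linmaps T (fobj F (Suc 0)) M1"
      by (intro linmaps_closed(4)[OF F_module M1] linearI addhom_comp[OF linear_addhom[OF linmapsD(1)[OF zl]] linear_addhom[OF g]])
        (auto simp: linear_smult[OF linmapsD(1)[OF zl]] linear_smult[OF g] linmaps_mem[OF zl])
    ultimately show ?thesis using D(2) by (auto simp: connection_cocycles_def)
  qed
  moreover have "c' t n \<in> carrier M1" if "t \<in> carrier T" "n \<in> carrier N" for t n
    using c'[OF that] c[OF that] addhom_closed[OF linear_addhom[OF g]] by simp
  ultimately show ?thesis unfolding ext_push_def One_nat_def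
    by (intro E1.connection_class(1)[unfolded One_nat_def]) (use ne in auto)
qed

end

end

text \<open>The comparison theorem for resolutions, made semilinear by regarding the target complex
  over T through restriction of scalars.\<close>

lemma resolution_lift:
  assumes k: "k \<in> ring_hom T T'" and F: "ext_res T N N F" and F': "ext_res T' N' N' F'"
    and g: "linear T N (restr_scalars k N') g"
  obtains \<psi> where "\<And>n. linear T (fobj F n) (restr_scalars k (fobj F' n)) (\<psi> n)"
    "\<And>n x. x \<in> carrier (fobj F (Suc n)) ==> \<psi> n (fbd F n x) = fbd F' n (\<psi> (Suc n) x)"
    "\<And>x. x \<in> carrier (fobj F 0) ==> faug F' (\<psi> 0 x) = g (faug F x)"
proof -
  interpret F: ext_res T N N F by fact
  interpret F': ext_res T' N' N' F' by fact
  have T: "cring T" by (rule module.axioms(1)[OF F.M.module_axioms])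
  have kc: "t \<in> carrier T ==> k t \<in> carrier T'" for t using k by (rule ring_hom_closed)
  have mod': "module T (restr_scalars k (fobj F' n))" for n by (rule restr_scalars_module[OF T F'.F_module k])
  have modN': "module T (restr_scalars k N')" by (rule restr_scalars_module[OF T F'.M.module_axioms k])
  have bd': "linear T (restr_scalars k (fobj F' (Suc n))) (restr_scalars k (fobj F' n)) (fbd F' n)" for n
    by (rule linearI) (auto simp: linear_addhom[OF F'.F_bd] linear_smult[OF F'.F_bd] kc)
  have aug': "linear T (restr_scalars k (fobj F' 0)) (restr_scalars k N') (faug F')"
    by (rule linearI) (auto simp: linear_addhom[OF F'.F_aug] linear_smult[OF F'.F_aug] kc)
  \<comment> \<open>The invariant contains that the n-th map carries boundaries to boundaries; this
    is what a lift to degree n + 1 requires.\<close>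
  define ok where "ok n p \<longleftrightarrow> linear T (fobj F n) (restr_scalars k (fobj F' n)) p \<and>
    (if n = 0 then (\<forall>x\<in>carrier (fobj F 0). faug F' (p x) = g (faug F x))
     else (\<forall>x\<in>carrier (fobj F n). fbd F' (n - 1) (p x) \<in> carrier (fobj F' (n-1)))) \<and>
    (\<forall>x\<in>carrier (fobj F (Suc n)). p (fbd F n x) \<in> fbd F' n ` carrier (fobj F' (Suc n)))" for n p
  have "\<exists>\<psi>. \<forall>n. ok n (\<psi> n) \<and> (\<forall>x\<in>carrier (fobj F (Suc n)). \<psi> n (fbd F n x) = fbd F' n (\<psi> (Suc n) x))"
  proof (rule dependent_nat_choice)
    obtain B where B: "is_basis T (fobj F 0) B (\<lambda>x. x)" using F.F_basis by blast
    have ga: "linear T (fobj F 0) (restr_scalars k N') (\<lambda>x. g (faug F x))"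
      by (rule linearI[OF addhom_comp[OF linear_addhom[OF F.F_aug] linear_addhom[OF g]]])
        (use linear_smult[OF g] F.aug_closed in \<open>auto simp: linear_smult[OF F.F_aug]\<close>)
    obtain p where p: "linear T (fobj F 0) (restr_scalars k (fobj F' 0)) p" "\<And>x. x \<in> carrier (fobj F 0) ==> faug F' (p x) = g (faug F x)"
    proof (rule basis_lift[OF F.F_module mod' modN' B aug' ga])
      fix b assume "b \<in> B"
      then have "b \<in> carrier (fobj F 0)" using B by (auto simp: is_basis_iff)
      then have "g (faug F b) \<in> carrier N'" using F.aug_closed addhom_closed[OF linear_addhom[OF g]] by simp
      also have "carrier N' = faug F' ` carrier (fobj F' 0)" using F'.res by (simp add: free_resolution_def)
      finally show "g (faug F b) \<in> faug F' ` carrier (restr_scalars k (fobj F' 0))" by simp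
    qed blast
    \<comment> \<open>The augmentation of the image is g(0) = 0, and exactness of F' in degree 0
      turns this into a boundary.\<close>
    have "p (fbd F 0 x) \<in> fbd F' 0 ` carrier (fobj F' (Suc 0))" if x: "x \<in> carrier (fobj F (Suc 0))" for x
    proof -
      have "faug F' (p (fbd F 0 x)) = g \<zero>\<^bsub>N\<^esub>" using p(2) F.bd_closed[OF x] F.aug_bd[OF x] by simp
      also have "\<dots> = \<zero>\<^bsub>N'\<^esub>" using addhom_zero[OF F.M.abelian_group_axioms _ linear_addhom[OF g]] F'.M.abelian_group_axioms by simp
      finally have "faug F' (p (fbd F 0 x)) = \<zero>\<^bsub>N'\<^esub>" .
      then show ?thesis using F'.res addhom_closed[OF linear_addhom[OF p(1)] F.bd_closed[OF x]] by (simp add: free_resolution_def)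
    qed
    then have "ok 0 p" using p by (simp add: ok_def)
    then show "\<exists>p. ok 0 p" by blast
  next
    fix p n assume p: "ok n p"
    have pl: "linear T (fobj F n) (restr_scalars k (fobj F' n)) p" using p by (simp add: ok_def)
    obtain B where B: "is_basis T (fobj F (Suc n)) B (\<lambda>x. x)" using F.F_basis by blast
    have ga: "linear T (fobj F (Suc n)) (restr_scalars k (fobj F' n)) (\<lambda>x. p (fbd F n x))"
      by (rule linearI[OF addhom_comp[OF linear_addhom[OF F.F_bd] linear_addhom[OF pl]]])
        (use linear_smult[OF pl] F.bd_closed in \<open>auto simp: linear_smult[OF F.F_bd]\<close>)
    obtain q where q: "linear T (fobj F (Suc n)) (restr_scalars k (fobj F' (Suc n))) q" "\<And>x. x \<in> carrier (fobj F (Suc n)) ==> fbd F' n (q x) = p (fbd F n x)"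
    proof (rule basis_lift[OF F.F_module mod' mod' B bd' ga])
      fix b assume "b \<in> B"
      then have "b \<in> carrier (fobj F (Suc n))" using B by (auto simp: is_basis_iff)
      then show "p (fbd F n b) \<in> fbd F' n ` carrier (restr_scalars k (fobj F' (Suc n)))" using p by (simp add: ok_def)
    qed blast
    have "q (fbd F (Suc n) x) \<in> fbd F' (Suc n) ` carrier (fobj F' (Suc (Suc n)))" if x: "x \<in> carrier (fobj F (Suc (Suc n)))" for x
    proof -
      have "fbd F' n (q (fbd F (Suc n) x)) = p \<zero>\<^bsub>fobj F n\<^esub>" using q(2) F.bd_closed[OF x] F.bd_bd[OF x] by simp
      also have "\<dots> = \<zero>\<^bsub>fobj F' n\<^esub>" using addhom_zero[OF F.F_ab _ linear_addhom[OF pl]] F'.F_ab by simp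
      finally show ?thesis using F'.res addhom_closed[OF linear_addhom[OF q(1)] F.bd_closed[OF x]] by (simp add: free_resolution_def)
    qed
    then have "ok (Suc n) q" using q p F.bd_closed addhom_closed[OF linear_addhom[OF pl]] by (simp add: ok_def)
    then show "\<exists>q. ok (Suc n) q \<and> (\<forall>x\<in>carrier (fobj F (Suc n)). p (fbd F n x) = fbd F' n (q x))" using q(2) by auto
  qed
  then obtain \<psi> where "\<forall>n. ok n (\<psi> n) \<and> (\<forall>x\<in>carrier (fobj F (Suc n)). \<psi> n (fbd F n x) = fbd F' n (\<psi> (Suc n) x))" by blast
  moreover have "ok 0 (\<psi> 0)" using calculation by blast
  ultimately show thesis using that[of \<psi>] by (auto simp: ok_def)
qed

text \<open>A connection over T' composed with the degree 0 component of a chain map over g is a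
  connection over T, for scalars restricted along k. Its defect is the old one evaluated at k(t) and
  g(n).\<close>

lemma ext_pull_connection:
  assumes k: "k \<in> ring_hom T T'" and F: "ext_res T N N F" and F': "ext_res T' M' N' F'"
    and g: "linear T N (restr_scalars k N') g" and ne: "connection_cocycles T' F' M' c' \<noteq> {}"
    and c': "\<And>t n. t \<in> carrier T' ==> n \<in> carrier N' ==> c' t n \<in> carrier M'"
  shows "ext_pull 1 T F F' M' k g (connection_cocycles T' F' M' c') =
    connection_cocycles T F (restr_scalars k M') (\<lambda>t n. c' (k t) (g n))"
proof -
  interpret F: ext_res T N N F by fact
  interpret F': ext_res T' M' N' F' by fact
  have T: "cring T" by (rule module.axioms(1)[OF F.M.module_axioms])
  have kc: "t \<in> carrier T ==> k t \<in> carrier T'" for t using k by (rule ring_hom_closed)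
  have gc: "n \<in> carrier N ==> g n \<in> carrier N'" for n using addhom_closed[OF linear_addhom[OF g]] by simp
  have modM: "module T (restr_scalars k M')" by (rule restr_scalars_module[OF T F'.M.module_axioms k])
  interpret R: ext_res T "restr_scalars k M'" N F
    by (simp add: ext_res_def ext_res_axioms_def modM F.M.module_axioms F.res)
  have F'': "ext_res T' N' N' F'" by (simp add: ext_res_def ext_res_axioms_def F'.N.module_axioms F'.res)
  let ?Z = "{\<lambda>x\<in>carrier (fobj F 1). z (\<psi> 1 x) | z \<psi>. z \<in> connection_cocycles T' F' M' c' \<and>
        (\<forall>n. linear T (fobj F n) (restr_scalars k (fobj F' n)) (\<psi> n)) \<and>
        (\<forall>n. \<forall>x\<in>carrier (fobj F (Suc n)). \<psi> n (fbd F n x) = fbd F' n (\<psi> (Suc n) x)) \<and>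
        (\<forall>x\<in>carrier (fobj F 0). faug F' (\<psi> 0 x) = g (faug F x))}"
  have "?Z \<subseteq> connection_cocycles T F (restr_scalars k M') (\<lambda>t n. c' (k t) (g n))"
  proof
    fix w assume "w \<in> ?Z"
    then obtain z \<psi> where w: "w = (\<lambda>x\<in>carrier (fobj F (Suc 0)). z (\<psi> (Suc 0) x))" and z: "z \<in> connection_cocycles T' F' M' c'"
      and p: "\<And>n. linear T (fobj F n) (restr_scalars k (fobj F' n)) (\<psi> n)"
        "\<And>n x. x \<in> carrier (fobj F (Suc n)) ==> \<psi> n (fbd F n x) = fbd F' n (\<psi> (Suc n) x)"
        "\<And>x. x \<in> carrier (fobj F 0) ==> faug F' (\<psi> 0 x) = g (faug F x)" by auto
    obtain D where zl: "z \<in> linmaps T' (fobj F' (Suc 0)) M'" and D: "connection T' F' M' c' D" "\<forall>y\<in>carrier (fobj F' (Suc 0)). z y = D (fbd F' 0 y)"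
      using z by (auto simp: connection_cocycles_def)
    have Da: "addhom (fobj F' 0) M' D" using D by (simp add: connection_def)
    have pc: "x \<in> carrier (fobj F n) ==> \<psi> n x \<in> carrier (fobj F' n)" for n x
      using addhom_closed[OF linear_addhom[OF p(1)]] by simp
    have pa: "addhom (fobj F n) (fobj F' n) (\<psi> n)" for n using linear_addhom[OF p(1)] by simp
    have "connection T F (restr_scalars k M') (\<lambda>t n. c' (k t) (g n)) (\<lambda>x. D (\<psi> 0 x))"
      using D addhom_comp[OF pa Da] kc pc linear_smult[OF p(1)] by (simp add: connection_def p(3))
    moreover have "w \<in> linmaps T (fobj F (Suc 0)) (restr_scalars k M')"
      unfolding w using linear_addhom[OF linmapsD(1)[OF zl]] linear_smult[OF linmapsD(1)[OF zl]] linear_smult[OF p(1)] kc pc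
      by (intro linmaps_closed(4)[OF F.F_module modM] linearI) (auto intro!: addhom_comp[OF pa])
    ultimately show "w \<in> connection_cocycles T F (restr_scalars k M') (\<lambda>t n. c' (k t) (g n))"
      using D(2) p(2)[symmetric] pc by (auto simp: connection_cocycles_def w intro!: exI[of _ "\<lambda>x. D (\<psi> 0 x)"])
  qed
  moreover have "?Z \<noteq> {}"
  proof -
    obtain \<psi> where "\<And>n. linear T (fobj F n) (restr_scalars k (fobj F' n)) (\<psi> n)"
      "\<And>n x. x \<in> carrier (fobj F (Suc n)) ==> \<psi> n (fbd F n x) = fbd F' n (\<psi> (Suc n) x)"
      "\<And>x. x \<in> carrier (fobj F 0) ==> faug F' (\<psi> 0 x) = g (faug F x)"
      using resolution_lift[OF k F F'' g] by blast
    then show ?thesis using ne by blast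
  qed
  ultimately show ?thesis unfolding ext_pull_def
    by (intro R.connection_class(1)) (auto simp: c' kc gc)
qed

section \<open>The cotangent complex of a resolution\<close>

text \<open>
  The values \<open>c\<close> on the scalars are those of an algebra homomorphism to a square-zero extension, read through a ring
  section that is not linear; ordinary derivations are the case \<open>c = 0\<close>.
\<close>

definition der_along ::
  "('r, 'y) ring_scheme \<Rightarrow> ('r, 'a, 'u) module_scheme \<Rightarrow> ('a \<Rightarrow> 'g) \<Rightarrow> ('g, 'j, 'v) module_scheme \<Rightarrow>
   ('r \<Rightarrow> 'j) \<Rightarrow> ('a \<Rightarrow> 'j) \<Rightarrow> bool" where
  "der_along R A e J c D \<longleftrightarrow> addhom A J D \<and>
     (\<forall>a\<in>carrier A. \<forall>b\<in>carrier A. D (a \<otimes>\<^bsub>A\<^esub> b) = e a \<odot>\<^bsub>J\<^esub> D b \<oplus>\<^bsub>J\<^esub> e b \<odot>\<^bsub>J\<^esub> D a) \<and>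
     (\<forall>r\<in>carrier R. D (r \<odot>\<^bsub>A\<^esub> \<one>\<^bsub>A\<^esub>) = c r)"

lemma aspan_subgroup:
  assumes "abelian_group M" "X \<subseteq> carrier M" shows "subgroup (aspan M X) (add_monoid M)"
  unfolding aspan_def using group.generate_is_subgroup[of "add_monoid M" X] assms abelian_group.a_group by auto

lemma aspan_image:
  assumes M: "abelian_group M" and N: "abelian_group N" and X: "X \<subseteq> carrier M" and f: "addhom M N f"
    and H: "subgroup H (add_monoid N)" and im: "\<And>x. x \<in> X ==> f x \<in> H" and x: "x \<in> aspan M X"
  shows "f x \<in> H"
proof -
  have "x \<in> carrier M \<and> f x \<in> H" using x unfolding aspan_def
  proof (induction x rule: generate.induct)
    case one
    then show ?case using addhom_zero[OF M N f] subgroup.one_closed[OF H] abelian_group.axioms(1)[OF M]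
      by (simp add: abelian_monoid.zero_closed)
  next
    case (incl h) then show ?case using X im by auto
  next
    case (inv h)
    then have h: "h \<in> carrier M" using X by auto
    then show ?case using addhom_neg[OF M N f h] subgroup.m_inv_closed[OF H im[OF inv]] abelian_group.a_inv_closed[OF M h]
      by (simp add: a_inv_def)
  next
    case (eng a b)
    then show ?case using addhom_add[OF f] subgroup.m_closed[OF H, of "f a" "f b"] abelian_group.axioms(1)[OF M]
      by (auto simp: abelian_monoid.a_closed)
  qed
  then show ?thesis by simp
qed

lemma aspan_incl: "x \<in> X ==> x \<in> aspan M X"
  by (simp add: aspan_def generate.incl)

text \<open>A single term \<Omega> \<otimes> G of a cotangent complex, for one algebra A and one
  ring map e. The simplicial levels are instances.\<close>

locale cot_data = kahler R A + G: cring G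
  for R :: "('r, 'y) ring_scheme" and A :: "('r, 'a, 'u) module_scheme" and G :: "('g, 'z) ring_scheme" +
  fixes e :: "'a \<Rightarrow> 'g"
  assumes e: "e \<in> ring_hom A G"
begin

lemma two_modules_cot: "two_modules A W (alg e G)"
  unfolding two_modules_def using W_module alg_module[OF MA.M_cring G.is_cring e] by simp

sublocale L: two_modules A W "alg e G" by (rule two_modules_cot)

abbreviation "LL \<equiv> tensor A W (alg e G)"
abbreviation "LM \<equiv> tensor_right A W (alg e G) (monoid.mult G)"
abbreviation lt (infixl "\<star>" 70) where "w \<star> g \<equiv> tens A W (alg e G) w g"

lemma e_closed [simp]: "a \<in> carrier A ==> e a \<in> carrier G"
  using e by (rule ring_hom_closed)

lemma LM_module: "module G LM"
  and LM_smult: "g \<in> carrier G ==> w \<in> carrier W ==> y \<in> carrier G ==> g \<odot>\<^bsub>LM\<^esub> (w \<star> y) = w \<star> (g \<otimes>\<^bsub>G\<^esub> y)" (is "PROP ?g1")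
proof -
  have 1: "module G (modl (alg e G) (monoid.mult G))"
    by (rule moduleI) (auto simp: G.is_cring G.is_abelian_group G.l_distr G.r_distr G.m_assoc)
  have 2: "g \<otimes>\<^bsub>G\<^esub> (r \<odot>\<^bsub>alg e G\<^esub> n) = r \<odot>\<^bsub>alg e G\<^esub> (g \<otimes>\<^bsub>G\<^esub> n)" if "g \<in> carrier G" "r \<in> carrier A" "n \<in> carrier (alg e G)" for g r n
    using that by (simp add: G.m_ac)
  show "module G LM" by (rule L.tensor_right_module(1)[OF 1 2])
  show "PROP ?g1"
    using L.tensor_right_module(2)[OF 1 2] by simp
qed

lemma LM_simps: "carrier LM = carrier LL" "add LM = add LL" "ring.zero LM = ring.zero LL"
  by (simp_all add: tensor_right_def)

lemma lt_move: "a \<in> carrier A ==> w \<in> carrier W ==> g \<in> carrier G ==> (a \<odot>\<^bsub>W\<^esub> w) \<star> g = w \<star> (e a \<otimes>\<^bsub>G\<^esub> g)"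
  using L.tens_smult by simp

text \<open>Coefficients of differentials move across the tensor sign: a db \<otimes> g = db
  \<otimes> e(a) g.\<close>

lemma LL_induct [consumes 1, case_names gen add]:
  assumes "x \<in> carrier LL"
    and gen: "\<And>a g. a \<in> carrier A ==> g \<in> carrier G ==> Q (dd a \<star> g)"
    and add: "\<And>x y. x \<in> carrier LL ==> y \<in> carrier LL ==> Q x ==> Q y ==> Q (x \<oplus>\<^bsub>LL\<^esub> y)"
  shows "Q x"
  using assms(1)
proof (induction rule: L.tensor_induct)
  case (tens w g)
  show ?case using tens(1)
  proof (induction rule: W_induct)
    case (gen a b)
    then show ?case using assms(2)[of b "e a \<otimes>\<^bsub>G\<^esub> g"] tens(2) by (simp add: lt_move)
  next
    case (add x y)
    then show ?case using assms(3) tens(2) by (simp add: L.tens_add_left)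
  qed
qed (rule add)

lemma dd_tens_addhom: "g \<in> carrier G ==> addhom A LL (\<lambda>a. dd a \<star> g)"
  using addhom_comp[OF dd_addhom L.tens_addhom_left] by simp

text \<open>A derivation along e is a derivation into J with scalars restricted along e. The
  universal property of \<Omega> gives an A-linear map, which extends to the G-linear one.\<close>

lemma cot_lift:
  assumes J: "module G J" and D: "der_along R A e J (\<lambda>r. \<zero>\<^bsub>J\<^esub>) D"
  obtains f where "f \<in> linmaps G LM J" "\<And>a g. a \<in> carrier A ==> g \<in> carrier G ==> f (dd a \<star> g) = g \<odot>\<^bsub>J\<^esub> D a"
proof -
  interpret J: module G J by fact
  let ?M = "restr_scalars e J"
  define D1 where "D1 = restrict D (carrier A)"
  have M: "module A ?M" by (rule restr_scalars_module[OF MA.M_cring J e])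
  have Dd: "D1 \<in> Der R A ?M" using D by (auto simp: D1_def Der_def der_along_def addhom_def)
  define f where "f = lin_of_der R A ?M D1"
  have f: "linear A W ?M f" unfolding f_def using linmapsD(1)[OF lin_of_der(1)[OF M Dd]] .
  have fd: "f (dd a) = D a" if "a \<in> carrier A" for a unfolding f_def using lin_of_der(2)[OF M Dd that] that by (simp add: D1_def)
  have fa: "addhom W J f" using linear_addhom[OF f] by simp
  have fs: "f (a \<odot>\<^bsub>W\<^esub> w) = e a \<odot>\<^bsub>J\<^esub> f w" if "a \<in> carrier A" "w \<in> carrier W" for a w
    using linear_smult[OF f that] by simp
  have b: "balanced A W (alg e G) J (\<lambda>w g. g \<odot>\<^bsub>J\<^esub> f w)"
    by (rule balancedI) (auto simp: addhom_closed[OF fa] addhom_add[OF fa] J.smult_l_distr J.smult_r_distr fs J.smult_assoc1[symmetric] G.m_comm)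
  define F where "F = tlift J (\<lambda>w g. g \<odot>\<^bsub>J\<^esub> f w)"
  have F: "addhom LL J F" unfolding F_def by (rule L.tlift_addhom[OF _ b]) (rule J.abelian_group_axioms)
  have Ft: "F (w \<star> g) = g \<odot>\<^bsub>J\<^esub> f w" if "w \<in> carrier W" "g \<in> carrier G" for w g
    unfolding F_def by (rule L.tlift_tens[OF _ b]) (use that J.abelian_group_axioms in auto)
  interpret LM: module G LM by (rule LM_module)
  have Fl: "F (g \<odot>\<^bsub>LM\<^esub> x) = g \<odot>\<^bsub>J\<^esub> F x" if g: "g \<in> carrier G" and x: "x \<in> carrier LL" for g x
    using x
  proof (induction rule: L.tensor_induct)
    case (tens w y)
    then show ?case using g by (simp add: LM_smult Ft J.smult_assoc1 addhom_closed[OF fa])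
  next
    case (add x y)
    have "g \<odot>\<^bsub>LM\<^esub> x \<in> carrier LL" "g \<odot>\<^bsub>LM\<^esub> y \<in> carrier LL" using LM.smult_closed g add by (auto simp: LM_simps)
    moreover have "g \<odot>\<^bsub>LM\<^esub> (x \<oplus>\<^bsub>LL\<^esub> y) = g \<odot>\<^bsub>LM\<^esub> x \<oplus>\<^bsub>LL\<^esub> g \<odot>\<^bsub>LM\<^esub> y" using LM.smult_r_distr[of g x y] g add by (simp add: LM_simps)
    ultimately show ?case using add g by (simp add: addhom_add[OF F] addhom_closed[OF F] J.smult_r_distr)
  qed
  have "linear G LM J F" by (rule linearI) (use F Fl in \<open>auto simp: tensor_right_def\<close>)
  then have "restrict F (carrier LM) \<in> linmaps G LM J" by (rule linmaps_closed(4)[OF LM_module J])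
  moreover have "restrict F (carrier LM) (dd a \<star> g) = g \<odot>\<^bsub>J\<^esub> D a" if "a \<in> carrier A" "g \<in> carrier G" for a g
    using that by (simp add: LM_simps Ft fd)
  ultimately show thesis using that by blast
qed

lemma linmaps_LM_eqI:
  assumes J: "module G J" and "linear G LM J f" "linear G LM J g"
    and eq: "\<And>a. a \<in> carrier A ==> f (dd a \<star> \<one>\<^bsub>G\<^esub>) = g (dd a \<star> \<one>\<^bsub>G\<^esub>)" and x: "x \<in> carrier LL"
  shows "f x = g x"
  using x
proof (induction rule: LL_induct)
  case (gen a y)
  have "dd a \<star> y = y \<odot>\<^bsub>LM\<^esub> (dd a \<star> \<one>\<^bsub>G\<^esub>)" using gen by (simp add: LM_smult)
  then show ?case using eq[OF gen(1)] gen linear_smult[OF assms(2), of y "dd a \<star> \<one>\<^bsub>G\<^esub>"] linear_smult[OF assms(3), of y "dd a \<star> \<one>\<^bsub>G\<^esub>"]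
    by (simp add: LM_simps)
next
  case (add x y)
  then show ?case using addhom_add[OF linear_addhom[OF assms(2)], of x y] addhom_add[OF linear_addhom[OF assms(3)], of x y]
    by (simp add: LM_simps)
qed

lemma linear_der_along:
  assumes J: "module G J" and f: "linear G LM J f"
  shows "der_along R A e J (\<lambda>r. \<zero>\<^bsub>J\<^esub>) (\<lambda>a. f (dd a \<star> \<one>\<^bsub>G\<^esub>))"
proof -
  interpret J: module G J by fact
  interpret LM: module G LM by (rule LM_module)
  have fa: "addhom LL J f" using linear_addhom[OF f] by (simp add: tensor_right_def)
  have s: "f (w \<star> g) = g \<odot>\<^bsub>J\<^esub> f (w \<star> \<one>\<^bsub>G\<^esub>)" if "w \<in> carrier W" "g \<in> carrier G" for w g
    using that linear_smult[OF f, of g "w \<star> \<one>\<^bsub>G\<^esub>"] by (simp add: LM_simps LM_smult)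
  show ?thesis unfolding der_along_def
  proof (intro conjI ballI)
    show "addhom A J (\<lambda>a. f (dd a \<star> \<one>\<^bsub>G\<^esub>))" by (rule addhom_comp[OF dd_tens_addhom fa]) simp
    show "f (dd (a \<otimes>\<^bsub>A\<^esub> b) \<star> \<one>\<^bsub>G\<^esub>) = e a \<odot>\<^bsub>J\<^esub> f (dd b \<star> \<one>\<^bsub>G\<^esub>) \<oplus>\<^bsub>J\<^esub> e b \<odot>\<^bsub>J\<^esub> f (dd a \<star> \<one>\<^bsub>G\<^esub>)"
      if "a \<in> carrier A" "b \<in> carrier A" for a b
      using that s[of "dd b" "e a"] s[of "dd a" "e b"] by (simp add: dd_mult L.tens_add_left lt_move addhom_add[OF fa])
    show "f (dd (r \<odot>\<^bsub>A\<^esub> \<one>\<^bsub>A\<^esub>) \<star> \<one>\<^bsub>G\<^esub>) = \<zero>\<^bsub>J\<^esub>" if "r \<in> carrier R" for r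
      using that addhom_zero[OF _ J.abelian_group_axioms fa] by (simp add: dd_smult_one L.tens_zero_left)
  qed
qed

end

text \<open>Covers both the faces of one resolution, where G stays fixed, and maps between
  resolutions of different rings over different bases.\<close>

lemma cot_tmap:
  assumes K: "cot_data R A G e" and K1: "cot_data R1 A1 G1 e1" and a: "a \<in> ring_hom A A1"
    and sc: "\<And>r x. r \<in> carrier R ==> x \<in> carrier A ==> \<rho> r \<in> carrier R1 \<and> a (r \<odot>\<^bsub>A\<^esub> x) = \<rho> r \<odot>\<^bsub>A1\<^esub> a x"
    and g: "g \<in> ring_hom G G1" and ea: "\<And>x. x \<in> carrier A ==> e1 (a x) = g (e x)"
  defines "t \<equiv> tmap A1 (Omega R1 A1) (alg e1 G1) (pp_map R1 A1 a) g"
  shows "addhom (tensor A (Omega R A) (alg e G)) (tensor A1 (Omega R1 A1) (alg e1 G1)) t" (is "PROP ?g1")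
    and "w \<in> carrier (Omega R A) ==> y \<in> carrier G ==>
      t (tens A (Omega R A) (alg e G) w y) = tens A1 (Omega R1 A1) (alg e1 G1) (pp_map R1 A1 a w) (g y)"
    and "x \<in> carrier A ==> y \<in> carrier G ==>
      t (tens A (Omega R A) (alg e G) (univ_der R A x) y) = tens A1 (Omega R1 A1) (alg e1 G1) (univ_der R1 A1 (a x)) (g y)" (is "PROP ?g2")
    and "c \<in> carrier G ==> x' \<in> carrier (tensor A (Omega R A) (alg e G)) ==>
      t (c \<odot>\<^bsub>tensor_right A (Omega R A) (alg e G) (monoid.mult G)\<^esub> x')
        = g c \<odot>\<^bsub>tensor_right A1 (Omega R1 A1) (alg e1 G1) (monoid.mult G1)\<^esub> t x'"
    and "x \<in> carrier A ==> x2 \<in> carrier A ==> y \<in> carrier G ==>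
      t (tens A (Omega R A) (alg e G) (x2 \<odot>\<^bsub>Omega R A\<^esub> univ_der R A x) y)
      = tens A1 (Omega R1 A1) (alg e1 G1) (a x2 \<odot>\<^bsub>Omega R1 A1\<^esub> univ_der R1 A1 (a x)) (g y)" (is "PROP ?g3")
proof -
  interpret K: cot_data R A G e by fact
  interpret K1: cot_data R1 A1 G1 e1 by fact
  note pm = pp_map_Omega[OF K.kahler_axioms K1.kahler_axioms a sc]
  have gc: "y \<in> carrier G ==> g y \<in> carrier G1" for y using g by (rule ring_hom_closed)
  have ac: "y \<in> carrier A ==> a y \<in> carrier A1" for y using a by (rule ring_hom_closed)
  have pc: "w \<in> carrier (Omega R A) ==> pp_map R1 A1 a w \<in> carrier (Omega R1 A1)" for w
    using addhom_closed[OF pm(1)] by blast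
  have ps: "pp_map R1 A1 a (r \<odot>\<^bsub>Omega R A\<^esub> w) = a r \<odot>\<^bsub>Omega R1 A1\<^esub> pp_map R1 A1 a w" if "r \<in> carrier A" "w \<in> carrier (Omega R A)" for r w
    using pm(2)[OF _ _ that] .
  have pd: "pp_map R1 A1 a (univ_der R A x) = univ_der R1 A1 (a x)" if "x \<in> carrier A" for x
    using pm(3)[OF _ _ that] .
  have tm: "addhom (tensor A (Omega R A) (alg e G)) (tensor A1 (Omega R1 A1) (alg e1 G1)) t"
    "\<And>w y. w \<in> carrier (Omega R A) ==> y \<in> carrier (alg e G) ==>
      t (tens A (Omega R A) (alg e G) w y) = tens A1 (Omega R1 A1) (alg e1 G1) (pp_map R1 A1 a w) (g y)"
  proof -
    have b: "tens A1 (Omega R1 A1) (alg e1 G1) (pp_map R1 A1 a (r \<odot>\<^bsub>Omega R A\<^esub> m)) (g n) =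
      tens A1 (Omega R1 A1) (alg e1 G1) (pp_map R1 A1 a m) (g (r \<odot>\<^bsub>alg e G\<^esub> n))"
      if "r \<in> carrier A" "m \<in> carrier (Omega R A)" "n \<in> carrier (alg e G)" for r m n
      using that by (simp add: ps K1.lt_move pc gc ac ring_hom_mult[OF g] ea)
    have ga: "addhom (alg e G) (alg e1 G1) g" using ring_hom_addhom[OF g] by simp
    have pa: "addhom (Omega R A) (Omega R1 A1) (pp_map R1 A1 a)" using pm(1) by blast
    show "PROP ?g1"
     "\<And>w y. w \<in> carrier (Omega R A) ==> y \<in> carrier (alg e G) ==>
      t (tens A (Omega R A) (alg e G) w y) = tens A1 (Omega R1 A1) (alg e1 G1) (pp_map R1 A1 a w) (g y)"
      unfolding t_def using tmap_addhom[OF K1.two_modules_cot K.two_modules_cot pa ga b] by blast+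
  qed
  show "addhom (tensor A (Omega R A) (alg e G)) (tensor A1 (Omega R1 A1) (alg e1 G1)) t" by (rule tm(1))
  show tw: "w \<in> carrier (Omega R A) ==> y \<in> carrier G ==>
      t (tens A (Omega R A) (alg e G) w y) = tens A1 (Omega R1 A1) (alg e1 G1) (pp_map R1 A1 a w) (g y)" for w y
    using tm(2) by simp
  show "PROP ?g2"
    by (simp add: tw pd)
  show "PROP ?g3"
    by (simp add: tw ps pd)
  interpret M: module G K.LM by (rule K.LM_module)
  interpret M1: module G1 K1.LM by (rule K1.LM_module)
  show "t (c \<odot>\<^bsub>K.LM\<^esub> x') = g c \<odot>\<^bsub>K1.LM\<^esub> t x'" if c: "c \<in> carrier G" and x': "x' \<in> carrier K.LL"
    using x'
  proof (induction rule: K.L.tensor_induct)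
    case (tens w y)
    then show ?case using c by (simp add: K.LM_smult K1.LM_smult tw pc gc ring_hom_mult[OF g])
  next
    case (add x y)
    have "c \<odot>\<^bsub>K.LM\<^esub> x \<in> carrier K.LL" "c \<odot>\<^bsub>K.LM\<^esub> y \<in> carrier K.LL" using M.smult_closed c add by (auto simp: K.LM_simps)
    moreover have "c \<odot>\<^bsub>K.LM\<^esub> (x \<oplus>\<^bsub>K.LL\<^esub> y) = c \<odot>\<^bsub>K.LM\<^esub> x \<oplus>\<^bsub>K.LL\<^esub> c \<odot>\<^bsub>K.LM\<^esub> y" using M.smult_r_distr[of c x y] c add by (simp add: K.LM_simps)
    moreover have "g c \<odot>\<^bsub>K1.LM\<^esub> (t x \<oplus>\<^bsub>K1.LL\<^esub> t y) = g c \<odot>\<^bsub>K1.LM\<^esub> t x \<oplus>\<^bsub>K1.LL\<^esub> g c \<odot>\<^bsub>K1.LM\<^esub> t y"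
      using M1.smult_r_distr[of "g c" "t x" "t y"] c add addhom_closed[OF tm(1)] gc by (simp add: K1.LM_simps)
    ultimately show ?case using add by (simp add: addhom_add[OF tm(1)])
  qed
qed

text \<open>Homomorphisms of degree 0 into G refer to membership in its parts. Decompositions into
  components are taken on the side of the free algebras, where \<open>graded_algebra\<close>
  provides them.\<close>

definition graded_parts :: "('r, 'y) ring_scheme \<Rightarrow> ('r, 'g) galg \<Rightarrow> bool" where
  "graded_parts R G \<longleftrightarrow> (\<forall>k. subgroup (dpart G k) (add_monoid G)) \<and> \<one>\<^bsub>G\<^esub> \<in> dpart G 0 \<and>
     (\<forall>k m. \<forall>x\<in>dpart G k. \<forall>y\<in>dpart G m. x \<otimes>\<^bsub>G\<^esub> y \<in> dpart G (k + m)) \<and>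
     (\<forall>k. \<forall>r\<in>carrier R. \<forall>x\<in>dpart G k. r \<odot>\<^bsub>G\<^esub> x \<in> dpart G k)"

text \<open>The grading of the ring is a separate argument because G may be a bare ring record. The
  same parts serve \<Gamma> over S and over T.\<close>

definition graded_module :: "('g, 'y) ring_scheme \<Rightarrow> (int \<Rightarrow> 'g set) \<Rightarrow> ('g, 'j) galg \<Rightarrow> bool" where
  "graded_module G gr J \<longleftrightarrow> module G J \<and> (\<forall>k. subgroup (dpart J k) (add_monoid J)) \<and>
     (\<forall>k m. \<forall>x\<in>gr k. \<forall>y\<in>dpart J m. x \<odot>\<^bsub>J\<^esub> y \<in> dpart J (k + m))"

declare augn.simps(2) [simp del]

section \<open>The cotangent complex of a simplicial resolution\<close>

locale sres_res =
  fixes R :: "('r, 'y) ring_scheme" and G :: "('r, 'g) galg" and P :: "('r, 'p, 'g) sres"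
  assumes algG: "algebra R G" and grG: "graded_parts R G" and res: "sres_of R G P"
begin

sublocale G: algebra R G by (rule algG)

lemma simplicial: "simplicial_algebra R P" using conjunct1[OF res[unfolded sres_of_def]] .

lemma obj_graded: "graded_algebra R (obj P n)" using conjunct1[OF simplicial[unfolded simplicial_algebra_def]] by blast

lemma obj_algebra: "algebra R (obj P n)" using obj_graded by (simp add: graded_algebra_def)

lemma obj_cring: "cring (obj P n)" using obj_algebra by (rule algebra.M_cring)

lemma obj_ab: "abelian_group (obj P n)" using module.axioms(2)[OF algebra.module[OF obj_algebra]] .

lemma obj_dpart: "x \<in> dpart (obj P n) k ==> x \<in> carrier (obj P n)"
  using grading_carrier obj_graded unfolding graded_algebra_def by metis

lemma face_hom: "i \<le> Suc n ==> galg_hom R (obj P (Suc n)) (obj P n) (face P n i)"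
  using conjunct1[OF conjunct2[OF simplicial[unfolded simplicial_algebra_def]]] by blast

lemma face_face: "i < j ==> j \<le> n + 2 ==> x \<in> carrier (obj P (n + 2)) ==>
   face P n i (face P (Suc n) j x) = face P n (j - 1) (face P (Suc n) i x)"
  using conjunct1[OF conjunct2[OF conjunct2[OF conjunct2[OF simplicial[unfolded simplicial_algebra_def]]]]] by blast

lemma aug_hom: "galg_hom R (obj P 0) G (aug P)" using conjunct1[OF conjunct2[OF conjunct2[OF res[unfolded sres_of_def]]]] .

lemma face_ring: "i \<le> Suc n ==> face P n i \<in> ring_hom (obj P (Suc n)) (obj P n)"
  using face_hom by (simp add: galg_hom_def alg_hom_def)

lemma face_closed: "i \<le> Suc n ==> x \<in> carrier (obj P (Suc n)) ==> face P n i x \<in> carrier (obj P n)"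
  using ring_hom_closed[OF face_ring] .

lemma face_linear: "i \<le> Suc n ==> linear R (obj P (Suc n)) (obj P n) (face P n i)"
  using face_hom by (simp add: galg_hom_def alg_hom_def)

lemma face_smult: "i \<le> Suc n ==> r \<in> carrier R ==> x \<in> carrier (obj P (Suc n)) ==>
  face P n i (r \<odot>\<^bsub>obj P (Suc n)\<^esub> x) = r \<odot>\<^bsub>obj P n\<^esub> face P n i x"
  using linear_smult[OF face_linear] .

lemma face_dpart: "i \<le> Suc n ==> x \<in> dpart (obj P (Suc n)) k ==> face P n i x \<in> dpart (obj P n) k"
  using face_hom unfolding galg_hom_def by blast

lemma augn_hom: "galg_hom R (obj P n) G (augn P n)"
proof (induction n)
  case 0 show ?case using aug_hom by simp
next
  case (Suc n)
  then have 1: "augn P n \<in> ring_hom (obj P n) G" "linear R (obj P n) G (augn P n)" "\<And>k x. x \<in> dpart (obj P n) k ==> augn P n x \<in> dpart G k"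
    unfolding galg_hom_def alg_hom_def by blast+
  have 2: "linear R (obj P (Suc n)) (obj P n) (face P n 0)" using face_hom[of 0 n] by (simp add: galg_hom_def alg_hom_def)
  show ?case
    unfolding galg_hom_def alg_hom_def augn.simps
  proof (intro conjI allI)
    show "augn P n \<circ> face P n 0 \<in> ring_hom (obj P (Suc n)) G"
      using ring_hom_trans[OF face_ring[of 0 n] 1(1)] by simp
    show "linear R (obj P (Suc n)) G (augn P n \<circ> face P n 0)"
      by (rule linearI) (auto simp: comp_def linear_smult[OF 2] linear_smult[OF 1(2)] face_closed
        intro: addhom_comp[OF linear_addhom[OF 2] linear_addhom[OF 1(2)]])
    show "(augn P n \<circ> face P n 0) ` dpart (obj P (Suc n)) k \<subseteq> dpart G k" for k
      using 1(3) face_dpart[of 0 n] by auto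
  qed
qed

lemma augn_ring: "augn P n \<in> ring_hom (obj P n) G" using augn_hom by (simp add: galg_hom_def alg_hom_def)

lemma augn_closed: "x \<in> carrier (obj P n) ==> augn P n x \<in> carrier G"
  using ring_hom_closed[OF augn_ring] .

lemma augn_linear: "linear R (obj P n) G (augn P n)" using augn_hom by (simp add: galg_hom_def alg_hom_def)

lemma augn_dpart: "x \<in> dpart (obj P n) k ==> augn P n x \<in> dpart G k"
  using augn_hom unfolding galg_hom_def by blast

lemma alt_bd_0: "x \<in> carrier (obj P (Suc 0)) ==> alt_bd P 0 x = face P 0 0 x \<ominus>\<^bsub>obj P 0\<^esub> face P 0 1 x"
proof -
  assume x: "x \<in> carrier (obj P (Suc 0))"
  interpret A: abelian_group "obj P 0" by (rule obj_ab)
  have "{..Suc 0} = {0, 1}" by auto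
  then show ?thesis using face_closed[of 0 0 x] face_closed[of 1 0 x] x
    by (simp add: alt_bd_def add_pow_int[OF obj_ab] a_minus_def A.finsum_insert)
qed

lemma alt_bd_aug: "x \<in> carrier (obj P (Suc 0)) ==> aug P (alt_bd P 0 x) = \<zero>\<^bsub>G\<^esub>"
proof -
  assume "x \<in> carrier (obj P (Suc 0))"
  then have "alt_bd P 0 x \<in> alt_bd P 0 ` carrier (obj P (Suc 0))" by simp
  also have "\<dots> = {x \<in> carrier (obj P 0). aug P x = \<zero>\<^bsub>G\<^esub>}" using conjunct1[OF conjunct2[OF conjunct2[OF conjunct2[OF conjunct2[OF res[unfolded sres_of_def]]]]]] .
  finally show ?thesis by simp
qed

text \<open>Read off from exactness of the resolution, instead of cancelling terms of the
  alternating sums.\<close>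

lemma alt_bd_alt_bd: "x \<in> carrier (obj P (Suc (Suc n))) ==>
  alt_bd P (Suc n) x \<in> carrier (obj P (Suc n)) \<and> alt_bd P n (alt_bd P (Suc n) x) = \<zero>\<^bsub>obj P n\<^esub>"
proof -
  assume "x \<in> carrier (obj P (Suc (Suc n)))"
  then have "alt_bd P (Suc n) x \<in> alt_bd P (Suc n) ` carrier (obj P (Suc (Suc n)))" by simp
  also have "\<dots> = {x \<in> carrier (obj P (Suc n)). alt_bd P n x = \<zero>\<^bsub>obj P n\<^esub>}" using conjunct2[OF conjunct2[OF conjunct2[OF conjunct2[OF conjunct2[OF res[unfolded sres_of_def]]]]]] by blast
  finally show ?thesis by simp
qed

text \<open>\<open>augn\<close> composes zeroth faces. At the bottom, both faces have the same
  augmentation because the image of d_0 - d_1 is the kernel of \<open>aug P\<close>; higher up, d_0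
  d_i = d_(i-1) d_0 for i > 0 reduces to the level below.\<close>

lemma augn_face: "i \<le> Suc n ==> x \<in> carrier (obj P (Suc n)) ==> augn P n (face P n i x) = augn P (Suc n) x"
proof (induction n arbitrary: i x)
  case 0
  have c: "aug P (face P 0 0 x) \<in> carrier G" "aug P (face P 0 1 x) \<in> carrier G"
    using 0 augn_closed[of _ 0] face_closed[of _ 0 x] by auto
  have "aug P (face P 0 0 x) \<ominus>\<^bsub>G\<^esub> aug P (face P 0 1 x) = \<zero>\<^bsub>G\<^esub>"
    using alt_bd_aug[OF 0(2)] alt_bd_0[OF 0(2)] face_closed[of _ 0 x] 0
      addhom_minus[OF obj_ab G.abelian_group_axioms ring_hom_addhom[OF augn_ring], of "face P 0 0 x" 0 "face P 0 1 x"] by simp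
  then have "aug P (face P 0 0 x) = aug P (face P 0 1 x)" using c by (simp add: abelian_minus_eq[OF G.abelian_group_axioms])
  moreover have "i = 0 \<or> i = 1" using 0(1) by auto
  ultimately show ?case by (auto simp: augn.simps(2))
next
  case (Suc n)
  show ?case
  proof (cases "i = 0")
    case False
    have c: "face P (Suc n) i x \<in> carrier (obj P (Suc n))" "face P (Suc n) 0 x \<in> carrier (obj P (Suc n))"
      using Suc.prems face_closed[of _ "Suc n" x] by auto
    have "augn P (Suc n) (face P (Suc n) i x) = augn P n (face P n 0 (face P (Suc n) i x))" by (simp add: augn.simps(2))
    also have "\<dots> = augn P n (face P n (i - 1) (face P (Suc n) 0 x))" using face_face[of 0 i n x] Suc.prems False by simp
    also have "\<dots> = augn P (Suc n) (face P (Suc n) 0 x)" using Suc.IH[of "i - 1", OF _ c(2)] Suc.prems by simp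
    finally show ?thesis by (simp add: augn.simps(2))
  qed (simp add: augn.simps(2))
qed

lemma cot_data: "cot_data R (obj P n) G (augn P n)"
  by (simp add: cot_data_def kahler_def obj_algebra G.M_cring cot_data_axioms_def augn_ring)

abbreviation "CL n \<equiv> tensor (obj P n) (Omega R (obj P n)) (alg (augn P n) G)"
abbreviation "CM n \<equiv> tensor_right (obj P n) (Omega R (obj P n)) (alg (augn P n) G) (monoid.mult G)"
abbreviation "CT n \<equiv> cot_tens R P G n"
abbreviation "du n \<equiv> univ_der R (obj P n)"

lemma cot_simps: "carrier (cot R P G n) = carrier (CL n)" "add (cot R P G n) = add (CL n)" "ring.zero (cot R P G n) = ring.zero (CL n)"
  "smult (cot R P G n) = smult (CM n)" "a_inv (cot R P G n) = a_inv (CL n)" "finsum (cot R P G n) = finsum (CL n)"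
  "add_pow (cot R P G n) (k::int) = add_pow (CL n) k"
  "addhom (cot R P G n) B f \<longleftrightarrow> addhom (CL n) B f" "addhom B' (cot R P G n) g \<longleftrightarrow> addhom B' (CL n) g"
  by (simp_all add: cot_def Let_def)

lemma cot_linear: "linear G (cot R P G n) J f \<longleftrightarrow> linear G (CM n) J f"
  by (simp add: linear_def cot_simps tensor_right_def)

lemma cot_linmaps: "linmaps G (cot R P G n) J = linmaps G (CM n) J"
  by (simp add: linmaps_def cot_linear cot_simps tensor_right_def)

lemma cot_module: "module G (cot R P G n)"
proof -
  interpret cot_data R "obj P n" G "augn P n" by (rule cot_data)
  interpret M: module G LM by (rule LM_module)
  show ?thesis
    by (rule moduleI) (use M.smult_l_distr M.smult_r_distr M.smult_assoc1 M.smult_closed M.smult_one in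
      \<open>auto simp: cot_def Let_def LM_simps G.M_cring\<close>)
qed

definition "cot_gens n k = {CT n (a \<odot>\<^bsub>Omega R (obj P n)\<^esub> du n b) g | a b g i j m.
          a \<in> dpart (obj P n) i \<and> b \<in> dpart (obj P n) j \<and> g \<in> dpart G m \<and> i + j + m = k}"

lemma cot_dpart: "dpart (cot R P G n) k = aspan (CL n) (cot_gens n k)"
  by (simp add: cot_def Let_def cot_gens_def)

lemma G_dpart: "x \<in> dpart G k ==> x \<in> carrier G"
  using grG subgroup.subset[of "dpart G k" "add_monoid G"] by (auto simp: graded_parts_def)

lemma cot_gens_carrier: "cot_gens n k \<subseteq> carrier (CL n)"
proof -
  interpret cot_data R "obj P n" G "augn P n" by (rule cot_data)
  show ?thesis by (auto simp: cot_gens_def cot_tens_def G_dpart obj_dpart)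
qed

lemma CL_ab: "abelian_group (CL n)"
proof -
  interpret cot_data R "obj P n" G "augn P n" by (rule cot_data)
  show ?thesis by simp
qed

lemma cot_dpart_subgroup: "subgroup (dpart (cot R P G n) k) (add_monoid (CL n))"
  unfolding cot_dpart by (rule aspan_subgroup[OF CL_ab cot_gens_carrier])

lemma cot_dpart_carrier: "dpart (cot R P G n) k \<subseteq> carrier (cot R P G n)"
  using subgroup.subset[OF cot_dpart_subgroup] by (simp add: cot_simps)

lemma cot_map_face:
  assumes "i \<le> Suc n"
  shows "addhom (CL (Suc n)) (CL n) (cot_map R P G n (face P n i) (\<lambda>g. g))" (is "PROP ?g1")
    and "x \<in> carrier (obj P (Suc n)) ==> y \<in> carrier G ==>
      cot_map R P G n (face P n i) (\<lambda>g. g) (CT (Suc n) (du (Suc n) x) y) = CT n (du n (face P n i x)) y"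
    and "c \<in> carrier G ==> x' \<in> carrier (CL (Suc n)) ==>
      cot_map R P G n (face P n i) (\<lambda>g. g) (c \<odot>\<^bsub>CM (Suc n)\<^esub> x') = c \<odot>\<^bsub>CM n\<^esub> cot_map R P G n (face P n i) (\<lambda>g. g) x'"
    and "x' \<in> dpart (cot R P G (Suc n)) k ==> cot_map R P G n (face P n i) (\<lambda>g. g) x' \<in> dpart (cot R P G n) k"
proof -
  have g: "(\<lambda>g. g) \<in> ring_hom G G" by (rule ring_hom_memI) auto
  have sc: "r \<in> carrier R \<and> face P n i (r \<odot>\<^bsub>obj P (Suc n)\<^esub> x) = r \<odot>\<^bsub>obj P n\<^esub> face P n i x" if "r \<in> carrier R" "x \<in> carrier (obj P (Suc n))" for r x
    using that face_smult[OF assms] by simp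
  note ct = cot_tmap[OF cot_data[of "Suc n"] cot_data[of n] face_ring[OF assms] sc g augn_face[OF assms]]
  show ah: "PROP ?g1"
    and "x \<in> carrier (obj P (Suc n)) ==> y \<in> carrier G ==>
      cot_map R P G n (face P n i) (\<lambda>g. g) (CT (Suc n) (du (Suc n) x) y) = CT n (du n (face P n i x)) y"
    and "c \<in> carrier G ==> x' \<in> carrier (CL (Suc n)) ==>
      cot_map R P G n (face P n i) (\<lambda>g. g) (c \<odot>\<^bsub>CM (Suc n)\<^esub> x') = c \<odot>\<^bsub>CM n\<^esub> cot_map R P G n (face P n i) (\<lambda>g. g) x'"
    unfolding cot_map_def cot_tens_def using ct(1,3,4) by blast+
  show "cot_map R P G n (face P n i) (\<lambda>g. g) x' \<in> dpart (cot R P G n) k" if x': "x' \<in> dpart (cot R P G (Suc n)) k"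
  proof (rule aspan_image[OF CL_ab CL_ab cot_gens_carrier ah cot_dpart_subgroup _ x'[unfolded cot_dpart]])
    fix x assume "x \<in> cot_gens (Suc n) k"
    then obtain a b g i' j m where x: "x = CT (Suc n) (a \<odot>\<^bsub>Omega R (obj P (Suc n))\<^esub> du (Suc n) b) g"
      "a \<in> dpart (obj P (Suc n)) i'" "b \<in> dpart (obj P (Suc n)) j" "g \<in> dpart G m" "i' + j + m = k"
      by (auto simp: cot_gens_def)
    have "cot_map R P G n (face P n i) (\<lambda>g. g) x = CT n (face P n i a \<odot>\<^bsub>Omega R (obj P n)\<^esub> du n (face P n i b)) g"
      unfolding x(1) cot_map_def cot_tens_def
      by (rule ct(5)) (use obj_dpart[OF x(3)] obj_dpart[OF x(2)] G_dpart[OF x(4)] in auto)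
    also have "\<dots> \<in> cot_gens n k" unfolding cot_gens_def using face_dpart[OF assms x(2)] face_dpart[OF assms x(3)] x(4,5) by blast
    finally show "cot_map R P G n (face P n i) (\<lambda>g. g) x \<in> dpart (cot R P G n) k" unfolding cot_dpart by (rule aspan_incl)
  qed
qed

lemma cot_bd_addhom: "addhom (CL (Suc n)) (CL n) (cot_bd R P G n)"
proof -
  interpret C: abelian_group "CL n" by (rule CL_ab)
  let ?t = "\<lambda>i x. add_pow (CL n) ((-1::int) ^ i) (cot_map R P G n (face P n i) (\<lambda>g. g) x)"
  have t: "addhom (CL (Suc n)) (CL n) (?t i)" if "i \<le> Suc n" for i
  proof (cases "even i")
    case True
    then show ?thesis using addhom_cong[OF cot_map_face(1)[OF that] _ CL_ab] addhom_closed[OF cot_map_face(1)[OF that]]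
      by (simp add: add_pow_int[OF CL_ab])
  next
    case False
    then show ?thesis using addhom_cong[OF addhom_uminus[OF CL_ab cot_map_face(1)[OF that]] _ CL_ab] addhom_closed[OF cot_map_face(1)[OF that]]
      by (simp add: add_pow_int[OF CL_ab])
  qed
  show ?thesis
  proof (rule addhomI)
    show "cot_bd R P G n x \<in> carrier (CL n)" if "x \<in> carrier (CL (Suc n))" for x
      unfolding cot_bd_def cot_simps using addhom_closed[OF t that] by (intro C.finsum_closed) auto
    show "cot_bd R P G n (x \<oplus>\<^bsub>CL (Suc n)\<^esub> y) = cot_bd R P G n x \<oplus>\<^bsub>CL n\<^esub> cot_bd R P G n y"
      if "x \<in> carrier (CL (Suc n))" "y \<in> carrier (CL (Suc n))" for x y
    proof -
      have "(\<Oplus>\<^bsub>CL n\<^esub>i\<in>{..Suc n}. ?t i (x \<oplus>\<^bsub>CL (Suc n)\<^esub> y)) = (\<Oplus>\<^bsub>CL n\<^esub>i\<in>{..Suc n}. ?t i x \<oplus>\<^bsub>CL n\<^esub> ?t i y)"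
        by (rule C.finsum_cong') (use addhom_closed[OF t] addhom_add[OF t] that in auto)
      also have "\<dots> = (\<Oplus>\<^bsub>CL n\<^esub>i\<in>{..Suc n}. ?t i x) \<oplus>\<^bsub>CL n\<^esub> (\<Oplus>\<^bsub>CL n\<^esub>i\<in>{..Suc n}. ?t i y)"
        by (rule C.finsum_addf) (use addhom_closed[OF t] that in auto)
      finally show ?thesis unfolding cot_bd_def cot_simps .
    qed
  qed
qed

lemma alt_bd_closed: "x \<in> carrier (obj P (Suc n)) ==> alt_bd P n x \<in> carrier (obj P n)"
proof -
  interpret A: abelian_group "obj P n" by (rule obj_ab)
  show "x \<in> carrier (obj P (Suc n)) ==> alt_bd P n x \<in> carrier (obj P n)"
    unfolding alt_bd_def by (rule A.finsum_closed) (auto simp: add_pow_int[OF obj_ab] face_closed)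
qed

text \<open>The differential is additive, so the alternating sum passes inside it. Linearity and
  vanishing of squares for \<open>cot_bd\<close> then follow on generators.\<close>

lemma cot_bd_d:
  assumes x: "x \<in> carrier (obj P (Suc n))" and y: "y \<in> carrier G"
  shows "cot_bd R P G n (CT (Suc n) (du (Suc n) x) y) = CT n (du n (alt_bd P n x)) y"
proof -
  interpret cot_data R "obj P n" G "augn P n" by (rule cot_data)
  interpret C: abelian_group "CL n" by (rule CL_ab)
  note h = dd_tens_addhom[OF y]
  have "CT n (du n (alt_bd P n x)) y = (\<Oplus>\<^bsub>CL n\<^esub>i\<in>{..Suc n}. CT n (du n (add_pow (obj P n) ((-1::int) ^ i) (face P n i x))) y)"
    unfolding alt_bd_def cot_tens_def
    by (rule addhom_finsum[OF obj_ab CL_ab h]) (auto simp: add_pow_int[OF obj_ab] face_closed x)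
  also have "\<dots> = (\<Oplus>\<^bsub>CL n\<^esub>i\<in>{..Suc n}. add_pow (CL n) ((-1::int) ^ i) (CT n (du n (face P n i x)) y))"
    unfolding cot_tens_def
    by (rule C.finsum_cong') (auto simp: addhom_add_pow[OF obj_ab CL_ab h] face_closed x add_pow_int[OF CL_ab] addhom_closed[OF h] y)
  also have "\<dots> = cot_bd R P G n (CT (Suc n) (du (Suc n) x) y)"
    unfolding cot_bd_def cot_simps
    by (rule C.finsum_cong') (auto simp: cot_map_face(2) x y add_pow_int[OF CL_ab] face_closed, auto simp: cot_tens_def x y face_closed)
  finally show ?thesis by simp
qed

lemma CT_closed: "x \<in> carrier (obj P n) ==> y \<in> carrier G ==> CT n (du n x) y \<in> carrier (CL n)"
proof -
  interpret cot_data R "obj P n" G "augn P n" by (rule cot_data)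
  show "x \<in> carrier (obj P n) ==> y \<in> carrier G ==> CT n (du n x) y \<in> carrier (CL n)" by (simp add: cot_tens_def)
qed

lemma cot_bd_smult:
  assumes c: "c \<in> carrier G" and x: "x \<in> carrier (CL (Suc n))"
  shows "cot_bd R P G n (c \<odot>\<^bsub>CM (Suc n)\<^esub> x) = c \<odot>\<^bsub>CM n\<^esub> cot_bd R P G n x"
proof -
  interpret C0: cot_data R "obj P n" G "augn P n" by (rule cot_data)
  interpret C1: cot_data R "obj P (Suc n)" G "augn P (Suc n)" by (rule cot_data)
  interpret M0: module G "CM n" by (rule C0.LM_module)
  interpret M1: module G "CM (Suc n)" by (rule C1.LM_module)
  show ?thesis using x
  proof (induction rule: C1.LL_induct)
    case (gen a g)
    then show ?case using cot_bd_d[OF gen] cot_bd_d[OF gen(1), of "c \<otimes>\<^bsub>G\<^esub> g"] c alt_bd_closed[OF gen(1)]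
      by (simp add: cot_tens_def C1.LM_smult C0.LM_smult)
  next
    case (add x y)
    have "c \<odot>\<^bsub>CM (Suc n)\<^esub> x \<in> carrier (CL (Suc n))" "c \<odot>\<^bsub>CM (Suc n)\<^esub> y \<in> carrier (CL (Suc n))" using M1.smult_closed c add by (auto simp: C1.LM_simps)
    moreover have "c \<odot>\<^bsub>CM (Suc n)\<^esub> (x \<oplus>\<^bsub>CL (Suc n)\<^esub> y) = c \<odot>\<^bsub>CM (Suc n)\<^esub> x \<oplus>\<^bsub>CL (Suc n)\<^esub> c \<odot>\<^bsub>CM (Suc n)\<^esub> y"
      using M1.smult_r_distr[of c x y] c add by (simp add: C1.LM_simps)
    moreover have "c \<odot>\<^bsub>CM n\<^esub> (cot_bd R P G n x \<oplus>\<^bsub>CL n\<^esub> cot_bd R P G n y) = c \<odot>\<^bsub>CM n\<^esub> cot_bd R P G n x \<oplus>\<^bsub>CL n\<^esub> c \<odot>\<^bsub>CM n\<^esub> cot_bd R P G n y"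
      using M0.smult_r_distr[of c "cot_bd R P G n x" "cot_bd R P G n y"] c add addhom_closed[OF cot_bd_addhom] by (simp add: C0.LM_simps)
    ultimately show ?case using add by (simp add: addhom_add[OF cot_bd_addhom])
  qed
qed

lemma cot_bd_bd: "x \<in> carrier (CL (Suc (Suc n))) ==> cot_bd R P G n (cot_bd R P G (Suc n) x) = \<zero>\<^bsub>CL n\<^esub>"
proof -
  interpret C: cot_data R "obj P n" G "augn P n" by (rule cot_data)
  interpret C2: cot_data R "obj P (Suc (Suc n))" G "augn P (Suc (Suc n))" by (rule cot_data)
  interpret A: abelian_group "CL n" by (rule CL_ab)
  note h = addhom_comp[OF cot_bd_addhom[of "Suc n"] cot_bd_addhom[of n]]
  show "x \<in> carrier (CL (Suc (Suc n))) ==> cot_bd R P G n (cot_bd R P G (Suc n) x) = \<zero>\<^bsub>CL n\<^esub>"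
  proof (induction rule: C2.LL_induct)
    case (gen a g)
    then show ?case using cot_bd_d[OF gen] cot_bd_d[OF _ gen(2), of "alt_bd P (Suc n) a" n] alt_bd_alt_bd[OF gen(1)]
       addhom_zero[OF obj_ab CL_ab C.dd_tens_addhom[OF gen(2)]] by (simp add: cot_tens_def)
  next
    case (add x y) then show ?case using addhom_add[OF h add(1,2)] by simp
  qed
qed

lemma cot_bd_dpart: "x \<in> dpart (cot R P G (Suc n)) k ==> cot_bd R P G n x \<in> dpart (cot R P G n) k"
proof -
  assume x: "x \<in> dpart (cot R P G (Suc n)) k"
  interpret C: abelian_group "CL n" by (rule CL_ab)
  note s = cot_dpart_subgroup[of n k]
  have t: "add_pow (CL n) ((-1::int) ^ i) (cot_map R P G n (face P n i) (\<lambda>g. g) x) \<in> dpart (cot R P G n) k" if "i \<le> Suc n" for i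
    using cot_map_face(4)[OF that x] subgroup.m_inv_closed[OF s cot_map_face(4)[OF that x]] subgroup.subset[OF s]
    by (cases "even i") (auto simp: add_pow_int[OF CL_ab] a_inv_def)
  have "(\<Oplus>\<^bsub>CL n\<^esub>i\<in>I. add_pow (CL n) ((-1::int) ^ i) (cot_map R P G n (face P n i) (\<lambda>g. g) x)) \<in> dpart (cot R P G n) k"
    if "finite I" "I \<subseteq> {..Suc n}" for I using that
  proof (induction rule: finite_induct)
    case empty then show ?case using subgroup.one_closed[OF s] by simp
  next
    case (insert i I)
    have 1: "add_pow (CL n) ((-1::int) ^ j) (cot_map R P G n (face P n j) (\<lambda>g. g) x) \<in> dpart (cot R P G n) k" if "j \<in> insert i I" for j
      using t insert.prems that by auto
    then show ?case using insert subgroup.m_closed[OF s 1[of i]] subgroup.subset[OF s]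
      by (subst C.finsum_insert) auto
  qed
  then show ?thesis unfolding cot_bd_def cot_simps by simp
qed

end

section \<open>Cocycles of graded lifts of the augmentation\<close>

definition graded_lift ::
  "('r, 'y) ring_scheme \<Rightarrow> ('r, 'p, 'g) sres \<Rightarrow> ('g, 'j) galg \<Rightarrow> ('r \<Rightarrow> 'j) \<Rightarrow> ('p \<Rightarrow> 'j) \<Rightarrow> bool" where
  "graded_lift R P J c D \<longleftrightarrow> der_along R (obj P 0) (aug P) J c D \<and> (\<forall>k. D ` dpart (obj P 0) k \<subseteq> dpart J k)"

text \<open>The counterpart of \<open>connection_cocycles\<close>: D after d_0 - d_1, read as a
  1-cochain on the cotangent complex.\<close>

definition lift_cocycles ::
  "('r, 'y) ring_scheme \<Rightarrow> ('r, 'g) galg \<Rightarrow> ('r, 'p, 'g) sres \<Rightarrow> ('g, 'j) galg \<Rightarrow> ('r \<Rightarrow> 'j) \<Rightarrow>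
   ((('p \<times> 'p \<Rightarrow>\<^sub>0 int) set set \<times> 'g \<Rightarrow>\<^sub>0 int) set \<Rightarrow> 'j) set" where
  "lift_cocycles R G P J c = {f \<in> glinmaps G (cot R P G (Suc 0)) J. \<exists>D. graded_lift R P J c D \<and>
     (\<forall>x\<in>carrier (obj P (Suc 0)). f (cot_tens R P G (Suc 0) (univ_der R (obj P (Suc 0)) x) \<one>\<^bsub>G\<^esub>) = D (alt_bd P 0 x))}"

lemma graded_lift_dpart: "graded_lift R P J c D ==> x \<in> dpart (obj P 0) k ==> D x \<in> dpart J k"
  by (auto simp: graded_lift_def)

lemma der_alongD:
  assumes "der_along R A e J c D"
  shows "addhom A J D" "\<And>a b. a \<in> carrier A ==> b \<in> carrier A ==> D (a \<otimes>\<^bsub>A\<^esub> b) = e a \<odot>\<^bsub>J\<^esub> D b \<oplus>\<^bsub>J\<^esub> e b \<odot>\<^bsub>J\<^esub> D a"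
    "\<And>r. r \<in> carrier R ==> D (r \<odot>\<^bsub>A\<^esub> \<one>\<^bsub>A\<^esub>) = c r"
  using assms by (auto simp: der_along_def)

lemma der_along_sum:
  assumes J: "module G J" and e: "\<And>a. a \<in> carrier A ==> e a \<in> carrier G"
    and D: "der_along R A e J c D" and D': "der_along R A e J c' D'"
  shows "der_along R A e J (\<lambda>r. c r \<oplus>\<^bsub>J\<^esub> c' r) (\<lambda>x. D x \<oplus>\<^bsub>J\<^esub> D' x)"
proof -
  interpret J: module G J by fact
  note d = der_alongD[OF D] and d' = der_alongD[OF D']
  show ?thesis unfolding der_along_def
    using addhom_sum[OF J.abelian_group_axioms d(1) d'(1)] addhom_closed[OF d(1)] addhom_closed[OF d'(1)] e
    by (auto simp: d(2,3) d'(2,3) J.smult_r_distr J.M.a_ac)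
qed

lemma der_along_uminus:
  assumes J: "module G J" and e: "\<And>a. a \<in> carrier A ==> e a \<in> carrier G" and D: "der_along R A e J c D"
  shows "der_along R A e J (\<lambda>r. \<ominus>\<^bsub>J\<^esub> c r) (\<lambda>x. \<ominus>\<^bsub>J\<^esub> D x)"
proof -
  interpret J: module G J by fact
  note d = der_alongD[OF D]
  show ?thesis unfolding der_along_def
    using addhom_uminus[OF J.abelian_group_axioms d(1)] addhom_closed[OF d(1)] e
    by (auto simp: d(2,3) J.M.minus_add J.smult_r_minus J.M.a_ac)
qed

text \<open>Equal values on scalars cancel, which leaves an ordinary derivation.\<close>

lemma der_along_diff:
  assumes J: "module G J" and e: "\<And>a. a \<in> carrier A ==> e a \<in> carrier G"
    and D: "der_along R A e J c D" and D': "der_along R A e J c D'" and A: "algebra R A"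
  shows "der_along R A e J (\<lambda>r. \<zero>\<^bsub>J\<^esub>) (\<lambda>x. D x \<ominus>\<^bsub>J\<^esub> D' x)"
proof -
  interpret J: module G J by fact
  interpret A: algebra R A by fact
  have "c r \<in> carrier J" if "r \<in> carrier R" for r
    using der_alongD(3)[OF D that] addhom_closed[OF der_alongD(1)[OF D], of "r \<odot>\<^bsub>A\<^esub> \<one>\<^bsub>A\<^esub>"] that by simp
  then show ?thesis
    using der_along_sum[OF J e D der_along_uminus[OF J e D']] by (auto simp: der_along_def a_minus_def J.M.r_neg)
qed

text \<open>The Leibniz rule at 1 = 1 \<cdot> 1, whatever c is.\<close>

lemma der_along_one:
  assumes J: "module G J" and A: "cring A" and e: "e \<in> ring_hom A G" and D: "der_along R A e J c D"
  shows "D \<one>\<^bsub>A\<^esub> = \<zero>\<^bsub>J\<^esub>"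
proof -
  interpret J: module G J by fact
  interpret A: cring A by fact
  note d = der_alongD[OF D]
  have c: "D \<one>\<^bsub>A\<^esub> \<in> carrier J" using addhom_closed[OF d(1)] by simp
  have "D \<one>\<^bsub>A\<^esub> \<oplus>\<^bsub>J\<^esub> D \<one>\<^bsub>A\<^esub> = D \<one>\<^bsub>A\<^esub>"
    using d(2)[of "\<one>\<^bsub>A\<^esub>" "\<one>\<^bsub>A\<^esub>"] c by (simp add: ring_hom_one[OF e])
  then show ?thesis using c by (metis J.M.add.r_cancel_one)
qed

lemma der_along_smult:
  assumes J: "module G J" and A: "algebra R A" and e: "\<And>a. a \<in> carrier A ==> e a \<in> carrier G" and D: "der_along R A e J (\<lambda>r. \<zero>\<^bsub>J\<^esub>) D"
    and r: "r \<in> carrier R" and x: "x \<in> carrier A"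
  shows "D (r \<odot>\<^bsub>A\<^esub> x) = e (r \<odot>\<^bsub>A\<^esub> \<one>\<^bsub>A\<^esub>) \<odot>\<^bsub>J\<^esub> D x"
proof -
  interpret J: module G J by fact
  interpret A: algebra R A by fact
  note d = der_alongD[OF D]
  have "D (r \<odot>\<^bsub>A\<^esub> x) = D ((r \<odot>\<^bsub>A\<^esub> \<one>\<^bsub>A\<^esub>) \<otimes>\<^bsub>A\<^esub> x)" using algebra_smult_one(2)[OF A r x] by simp
  also have "\<dots> = e (r \<odot>\<^bsub>A\<^esub> \<one>\<^bsub>A\<^esub>) \<odot>\<^bsub>J\<^esub> D x"
    using d(2)[of "r \<odot>\<^bsub>A\<^esub> \<one>\<^bsub>A\<^esub>" x] r x d(3)[OF r] addhom_closed[OF d(1) x] e by simp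
  finally show ?thesis .
qed

context sres_res
begin

context
  fixes J :: "('g, 'j) galg"
  assumes J: "graded_module G (dpart G) J"
begin

lemma J_module: "module G J" using J by (simp add: graded_module_def)
lemma J_sub: "subgroup (dpart J k) (add_monoid J)" using J by (simp add: graded_module_def)
lemma J_act: "x \<in> dpart G k ==> y \<in> dpart J m ==> x \<odot>\<^bsub>J\<^esub> y \<in> dpart J (k + m)" using J unfolding graded_module_def by blast
lemma J_ab: "abelian_group J" using module.axioms(2)[OF J_module] .
lemma J_dpart: "y \<in> dpart J m ==> y \<in> carrier J" using subgroup.subset[OF J_sub] by auto
lemma J_add: "x \<in> dpart J k ==> y \<in> dpart J k ==> x \<oplus>\<^bsub>J\<^esub> y \<in> dpart J k" using subgroup.m_closed[OF J_sub] by simp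
lemma J_minus: "x \<in> dpart J k ==> y \<in> dpart J k ==> x \<ominus>\<^bsub>J\<^esub> y \<in> dpart J k"
  using J_add subgroup.m_inv_closed[OF J_sub, of y k] by (simp add: a_minus_def a_inv_def)

lemma aq_d_glinmaps:
  assumes f: "f \<in> glinmaps G (cot R P G n) J" shows "aq_d R P G n f \<in> glinmaps G (cot R P G (Suc n)) J"
proof -
  have l: "linear G (cot R P G n) J f" "f \<in> linmaps G (cot R P G n) J" using f linmapsD(1)[of f G "cot R P G n" J] by (auto simp: glinmaps_def)
  have g: "x \<in> dpart (cot R P G n) k ==> f x \<in> dpart J k" for x k using f unfolding glinmaps_def by blast
  have bc: "x \<in> carrier (CL (Suc n)) ==> cot_bd R P G n x \<in> carrier (CL n)" for x using addhom_closed[OF cot_bd_addhom] .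
  have "aq_d R P G n f \<in> linmaps G (cot R P G (Suc n)) J" unfolding aq_d_def
  proof (rule linmaps_closed(4)[OF cot_module J_module], rule linearI)
    show "addhom (cot R P G (Suc n)) J (\<lambda>x. f (cot_bd R P G n x))"
      using addhom_comp[OF cot_bd_addhom] linear_addhom[OF l(1)] by (simp add: cot_simps)
    show "f (cot_bd R P G n (r \<odot>\<^bsub>cot R P G (Suc n)\<^esub> x)) = r \<odot>\<^bsub>J\<^esub> f (cot_bd R P G n x)"
      if "r \<in> carrier G" "x \<in> carrier (cot R P G (Suc n))" for r x
      using that linear_smult[OF l(1), of r "cot_bd R P G n x"] by (simp add: cot_simps cot_bd_smult bc)
  qed
  moreover have "aq_d R P G n f x \<in> dpart J k" if "x \<in> dpart (cot R P G (Suc n)) k" for x k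
    using g[OF cot_bd_dpart[OF that]] cot_dpart_carrier[of "Suc n" k] that by (auto simp: aq_d_def)
  ultimately show ?thesis by (auto simp: glinmaps_def)
qed

text \<open>On a generator a db \<otimes> g the value is e(a) g D(b), with e the augmentation, so
  its degree is the sum prescribed in \<open>cot\<close>.\<close>

lemma glinmaps_lift:
  assumes D: "der_along R (obj P n) (augn P n) J (\<lambda>r. \<zero>\<^bsub>J\<^esub>) D" and gr: "\<And>k x. x \<in> dpart (obj P n) k ==> D x \<in> dpart J k"
  obtains f where "f \<in> glinmaps G (cot R P G n) J" "\<And>x y. x \<in> carrier (obj P n) ==> y \<in> carrier G ==> f (CT n (du n x) y) = y \<odot>\<^bsub>J\<^esub> D x"
proof -
  interpret cot_data R "obj P n" G "augn P n" by (rule cot_data)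
  obtain f where f: "f \<in> linmaps G LM J" "\<And>a g. a \<in> carrier (obj P n) ==> g \<in> carrier G ==> f (lt (dd a) g) = g \<odot>\<^bsub>J\<^esub> D a"
    using cot_lift[OF J_module D] by blast
  have fl: "f \<in> linmaps G (cot R P G n) J" using f by (simp add: cot_linmaps)
  have fa: "addhom (CL n) J f" using linear_addhom[OF linmapsD(1)[OF fl]] by (simp add: cot_simps)
  have "f x \<in> dpart J k" if x: "x \<in> dpart (cot R P G n) k" for x k
  proof (rule aspan_image[OF CL_ab J_ab cot_gens_carrier fa J_sub _ x[unfolded cot_dpart]])
    fix x assume "x \<in> cot_gens n k"
    then obtain a b g i j m where g: "x = CT n (a \<odot>\<^bsub>Omega R (obj P n)\<^esub> du n b) g"
      "a \<in> dpart (obj P n) i" "b \<in> dpart (obj P n) j" "g \<in> dpart G m" "i + j + m = k"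
      by (auto simp: cot_gens_def)
    note c = obj_dpart[OF g(2)] obj_dpart[OF g(3)] G_dpart[OF g(4)]
    have "f x = (augn P n a \<otimes>\<^bsub>G\<^esub> g) \<odot>\<^bsub>J\<^esub> D b" using c f(2) by (simp add: g(1) cot_tens_def lt_move)
    moreover have "augn P n a \<otimes>\<^bsub>G\<^esub> g \<in> dpart G (i + m)"
      using augn_dpart[OF g(2)] g(4) grG unfolding graded_parts_def by blast
    ultimately have "f x \<in> dpart J (i + m + j)" using J_act gr[OF g(3)] by simp
    then show "f x \<in> dpart J k" using g(5) by (simp add: ac_simps)
  qed
  then have "f \<in> glinmaps G (cot R P G n) J" using fl by (auto simp: glinmaps_def)
  then show thesis using that f(2) by (simp add: cot_tens_def)
qed

lemma glinmaps_der:
  assumes f: "f \<in> glinmaps G (cot R P G n) J"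
  shows "der_along R (obj P n) (augn P n) J (\<lambda>r. \<zero>\<^bsub>J\<^esub>) (\<lambda>x. f (CT n (du n x) \<one>\<^bsub>G\<^esub>))" (is "PROP ?g1")
    and "x \<in> dpart (obj P n) k ==> f (CT n (du n x) \<one>\<^bsub>G\<^esub>) \<in> dpart J k"
    and "x \<in> carrier (obj P n) ==> y \<in> carrier G ==> f (CT n (du n x) y) = y \<odot>\<^bsub>J\<^esub> f (CT n (du n x) \<one>\<^bsub>G\<^esub>)" (is "PROP ?g2")
proof -
  interpret cot_data R "obj P n" G "augn P n" by (rule cot_data)
  have l: "linear G LM J f" using f linmapsD(1)[of f G LM J] by (simp add: glinmaps_def cot_linmaps)
  show "PROP ?g1"
    unfolding cot_tens_def by (rule linear_der_along[OF J_module l])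
  show "PROP ?g2"
    using linear_smult[OF l, of y "lt (dd x) \<one>\<^bsub>G\<^esub>"] by (simp add: cot_tens_def LM_smult LM_simps)
  show "f (CT n (du n x) \<one>\<^bsub>G\<^esub>) \<in> dpart J k" if x: "x \<in> dpart (obj P n) k"
  proof -
    have 1: "\<one>\<^bsub>obj P n\<^esub> \<in> dpart (obj P n) 0" using obj_graded unfolding graded_algebra_def by blast
    have 2: "\<one>\<^bsub>G\<^esub> \<in> dpart G 0" using grG by (simp add: graded_parts_def)
    \<comment> \<open>The differential is written with coefficient 1 so that it has the form of the
      generators of the graded parts.\<close>
    have "CT n (du n x) \<one>\<^bsub>G\<^esub> = CT n (\<one>\<^bsub>obj P n\<^esub> \<odot>\<^bsub>Omega R (obj P n)\<^esub> du n x) \<one>\<^bsub>G\<^esub>"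
      using obj_dpart[OF x] by simp
    also have "\<dots> \<in> cot_gens n k" unfolding cot_gens_def using 1 2 x by force
    finally have "CT n (du n x) \<one>\<^bsub>G\<^esub> \<in> dpart (cot R P G n) k" unfolding cot_dpart by (rule aspan_incl)
    then show ?thesis using f unfolding glinmaps_def by blast
  qed
qed

lemma glinmaps_eqI:
  assumes f: "f \<in> glinmaps G (cot R P G n) J" and g: "g \<in> glinmaps G (cot R P G n) J"
    and eq: "\<And>x. x \<in> carrier (obj P n) ==> f (CT n (du n x) \<one>\<^bsub>G\<^esub>) = g (CT n (du n x) \<one>\<^bsub>G\<^esub>)"
  shows "f = g"
proof -
  interpret cot_data R "obj P n" G "augn P n" by (rule cot_data)
  have l: "linear G LM J f" "linear G LM J g" "f \<in> extensional (carrier (CL n))" "g \<in> extensional (carrier (CL n))"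
    using f g linmapsD(1,2)[of f G LM J] linmapsD(1,2)[of g G LM J] unfolding glinmaps_def cot_linmaps LM_simps by auto
  show ?thesis
    by (rule extensionalityI[OF l(3,4)]) (rule linmaps_LM_eqI[OF J_module l(1,2)], use eq in \<open>auto simp: cot_tens_def\<close>)
qed

lemma aq_d_CT:
  "x \<in> carrier (obj P (Suc n)) ==> y \<in> carrier G ==>
    aq_d R P G n f (CT (Suc n) (du (Suc n) x) y) = f (CT n (du n (alt_bd P n x)) y)"
  by (simp add: aq_d_def cot_simps CT_closed cot_bd_d)

lemma face1_closed: "x \<in> carrier (obj P (Suc 0)) ==> face P 0 0 x \<in> carrier (obj P 0)"
  "x \<in> carrier (obj P (Suc 0)) ==> face P 0 1 x \<in> carrier (obj P 0)"
  "x \<in> carrier (obj P (Suc 0)) ==> face P 0 (Suc 0) x \<in> carrier (obj P 0)"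
  using face_closed[of 0 0 x] face_closed[of 1 0 x] by auto

lemma additive_alt_bd:
  assumes "addhom (obj P 0) J D" "x \<in> carrier (obj P (Suc 0))"
  shows "D (face P 0 0 x) \<ominus>\<^bsub>J\<^esub> D (face P 0 1 x) = D (alt_bd P 0 x)"
  using assms alt_bd_0[OF assms(2)] addhom_minus[OF obj_ab J_ab assms(1)] face1_closed[OF assms(2)] by simp

text \<open>D after d_0 and D after d_1 have the same values c on scalars and, by
  \<open>augn_face\<close>, lie along the same map; their difference is therefore an ordinary
  derivation.\<close>

lemma lift_face_der:
  assumes D: "graded_lift R P J c D"
  shows "der_along R (obj P (Suc 0)) (augn P (Suc 0)) J (\<lambda>r. \<zero>\<^bsub>J\<^esub>) (\<lambda>x. D (face P 0 0 x) \<ominus>\<^bsub>J\<^esub> D (face P 0 1 x))" (is "PROP ?g1")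
    and "x \<in> dpart (obj P (Suc 0)) k ==> D (face P 0 0 x) \<ominus>\<^bsub>J\<^esub> D (face P 0 1 x) \<in> dpart J k" (is "PROP ?g2")
proof -
  have d: "der_along R (obj P 0) (aug P) J c D" using D by (simp add: graded_lift_def)
  note dd = der_alongD[OF d]
  have 1: "der_along R (obj P (Suc 0)) (augn P (Suc 0)) J c (\<lambda>x. D (face P 0 i x))" if i: "i \<le> Suc 0" for i
    unfolding der_along_def
  proof (intro conjI ballI)
    show "addhom (obj P (Suc 0)) J (\<lambda>x. D (face P 0 i x))" by (rule addhom_comp[OF ring_hom_addhom[OF face_ring[OF i]] dd(1)])
    show "D (face P 0 i (a \<otimes>\<^bsub>obj P (Suc 0)\<^esub> b)) = augn P (Suc 0) a \<odot>\<^bsub>J\<^esub> D (face P 0 i b) \<oplus>\<^bsub>J\<^esub> augn P (Suc 0) b \<odot>\<^bsub>J\<^esub> D (face P 0 i a)"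
      if "a \<in> carrier (obj P (Suc 0))" "b \<in> carrier (obj P (Suc 0))" for a b
      using that face_closed[OF i] augn_face[OF i] by (simp add: ring_hom_mult[OF face_ring[OF i]] dd(2))
    show "D (face P 0 i (r \<odot>\<^bsub>obj P (Suc 0)\<^esub> \<one>\<^bsub>obj P (Suc 0)\<^esub>)) = c r" if "r \<in> carrier R" for r
      using that face_smult[OF i that] ring_hom_one[OF face_ring[OF i]] dd(3) obj_cring[of "Suc 0"] cring.axioms(1) ring.ring_simprules(6)
      by (metis)
  qed
  show "PROP ?g1"
    by (rule der_along_diff[OF J_module augn_closed 1 1 obj_algebra]) auto
  show "PROP ?g2"
    using face_dpart[of 0 0] face_dpart[of 1 0] by (intro J_minus graded_lift_dpart[OF D]) auto
qed

lemma graded_lift_addhom: "graded_lift R P J c D ==> addhom (obj P 0) J D"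
  by (simp add: graded_lift_def der_along_def)

lemma lift_cocycle_exists:
  assumes D: "graded_lift R P J c D"
  obtains f where "f \<in> glinmaps G (cot R P G (Suc 0)) J" "f \<in> lift_cocycles R G P J c"
    "\<And>x y. x \<in> carrier (obj P (Suc 0)) ==> y \<in> carrier G ==> f (CT (Suc 0) (du (Suc 0) x) y) = y \<odot>\<^bsub>J\<^esub> D (alt_bd P 0 x)"
proof -
  interpret M: module G J by (rule J_module)
  note a = graded_lift_addhom[OF D]
  obtain f where f: "f \<in> glinmaps G (cot R P G (Suc 0)) J"
    "\<And>x y. x \<in> carrier (obj P (Suc 0)) ==> y \<in> carrier G ==> f (CT (Suc 0) (du (Suc 0) x) y) = y \<odot>\<^bsub>J\<^esub> (D (face P 0 0 x) \<ominus>\<^bsub>J\<^esub> D (face P 0 1 x))"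
    using glinmaps_lift[OF lift_face_der[OF D]] by blast
  have "f (CT (Suc 0) (du (Suc 0) x) y) = y \<odot>\<^bsub>J\<^esub> D (alt_bd P 0 x)" if "x \<in> carrier (obj P (Suc 0))" "y \<in> carrier G" for x y
    using f(2)[OF that] additive_alt_bd[OF a that(1)] by simp
  then show thesis using that f(1) D addhom_closed[OF a alt_bd_closed] unfolding lift_cocycles_def by auto
qed

text \<open>The values on generators identify the additive map F with the cocycle of D, from which
  it inherits linearity and degree.\<close>

lemma lift_cocyclesI:
  assumes D: "graded_lift R P J c D" and F: "addhom (CL (Suc 0)) J F"
    and eq: "\<And>x y. x \<in> carrier (obj P (Suc 0)) ==> y \<in> carrier G ==> F (CT (Suc 0) (du (Suc 0) x) y) = y \<odot>\<^bsub>J\<^esub> D (alt_bd P 0 x)"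
  shows "restrict F (carrier (cot R P G (Suc 0))) \<in> lift_cocycles R G P J c"
proof -
  interpret C: cot_data R "obj P (Suc 0)" G "augn P (Suc 0)" by (rule cot_data)
  obtain f where f: "f \<in> glinmaps G (cot R P G (Suc 0)) J" "f \<in> lift_cocycles R G P J c"
    "\<And>x y. x \<in> carrier (obj P (Suc 0)) ==> y \<in> carrier G ==> f (CT (Suc 0) (du (Suc 0) x) y) = y \<odot>\<^bsub>J\<^esub> D (alt_bd P 0 x)"
    by (rule lift_cocycle_exists[OF D]) blast
  have fl: "addhom (CL (Suc 0)) J f" "f \<in> extensional (carrier (CL (Suc 0)))" using f(1) linmapsD(1,2)[of f G "cot R P G (Suc 0)" J] linear_addhom
    by (auto simp: glinmaps_def cot_simps dest!: linear_addhom)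
  have "F x = f x" if "x \<in> carrier (CL (Suc 0))" for x
    using that by (induction rule: C.LL_induct)
      (simp_all add: eq[unfolded cot_tens_def] f(3)[unfolded cot_tens_def] addhom_add[OF F] addhom_add[OF fl(1)])
  then have "restrict F (carrier (cot R P G (Suc 0))) = f"
    using fl(2) by (intro extensionalityI[of _ "carrier (CL (Suc 0))"]) (auto simp: cot_simps)
  then show ?thesis using f(2) by simp
qed

lemma lift_cocyclesD:
  assumes f: "f \<in> lift_cocycles R G P J c"
  obtains D where "graded_lift R P J c D"
    "\<And>x y. x \<in> carrier (obj P (Suc 0)) ==> y \<in> carrier G ==> f (CT (Suc 0) (du (Suc 0) x) y) = y \<odot>\<^bsub>J\<^esub> D (alt_bd P 0 x)"
    "addhom (CL (Suc 0)) J f"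
proof -
  obtain D where D: "f \<in> glinmaps G (cot R P G (Suc 0)) J" "graded_lift R P J c D"
    "\<And>x. x \<in> carrier (obj P (Suc 0)) ==> f (CT (Suc 0) (du (Suc 0) x) \<one>\<^bsub>G\<^esub>) = D (alt_bd P 0 x)"
    using f unfolding lift_cocycles_def by blast
  have "addhom (CL (Suc 0)) J f" using D(1) linmapsD(1)[of f G "cot R P G (Suc 0)" J] by (auto simp: glinmaps_def cot_simps dest!: linear_addhom)
  then show thesis using that[OF D(2)] glinmaps_der(3)[OF D(1)] D(3) by metis
qed

text \<open>As for connections: lifts with the same c differ exactly by the ordinary derivations of
  degree 0, which are the 0-cochains.\<close>

lemma lift_cocycles_class:
  shows "Z \<subseteq> lift_cocycles R G P J c ==> Z \<noteq> {} ==> aq_cls 1 R P G J Z = lift_cocycles R G P J c"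
    and "lift_cocycles R G P J c \<noteq> {} ==> lift_cocycles R G P J c \<in> carrier (AQ 1 R P G J)"
proof -
  interpret J: module G J by (rule J_module)
  let ?Z = "lift_cocycles R G P J c" and ?C = "aq_C R P G J" and ?d = "aq_d R P G" and ?u = "\<lambda>n x. CT n (du n x) \<one>\<^bsub>G\<^esub>"
  note gc = glinmaps_closed[OF cot_module J_module J_sub cot_dpart_carrier]
  have mono: "f \<otimes>\<^bsub>?C n\<^esub> z \<in> glinmaps G (cot R P G n) J" if "f \<in> glinmaps G (cot R P G n) J" "z \<in> glinmaps G (cot R P G n) J" for f z n
    using gc(2)[OF that] by (simp add: aq_C_def)
  have D: "\<exists>D. graded_lift R P J c D \<and> (\<forall>x\<in>carrier (obj P (Suc 0)). z (?u (Suc 0) x) = D (alt_bd P 0 x))" "z \<in> glinmaps G (cot R P G (Suc 0)) J"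
    if "z \<in> ?Z" for z using that by (auto simp: lift_cocycles_def)
  have val: "(?d 0 g \<otimes>\<^bsub>?C (Suc 0)\<^esub> z) (?u (Suc 0) x) = g (?u 0 (alt_bd P 0 x)) \<oplus>\<^bsub>J\<^esub> z (?u (Suc 0) x)" if "x \<in> carrier (obj P (Suc 0))" for g z x
    using that CT_closed[OF that G.one_closed] by (simp add: aq_C_def aq_d_CT cot_simps)
  have 1: "?Z \<subseteq> carrier (?C (Suc 0))" by (auto simp: aq_C_def lift_cocycles_def)
  have 2: "\<exists>g\<in>carrier (?C 0). z' = ?d 0 g \<otimes>\<^bsub>?C (Suc 0)\<^esub> z" if z: "z \<in> ?Z" and z': "z' \<in> ?Z" for z z'
  proof -
    obtain E E' where E: "graded_lift R P J c E" "\<And>x. x \<in> carrier (obj P (Suc 0)) ==> z (?u (Suc 0) x) = E (alt_bd P 0 x)"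
      and E': "graded_lift R P J c E'" "\<And>x. x \<in> carrier (obj P (Suc 0)) ==> z' (?u (Suc 0) x) = E' (alt_bd P 0 x)"
      using D(1)[OF z] D(1)[OF z'] by metis
    have d: "der_along R (obj P 0) (augn P 0) J c E" "der_along R (obj P 0) (augn P 0) J c E'" using E E' by (simp_all add: graded_lift_def)
    \<comment> \<open>The 0-cochain of the derivation E' - E.\<close>
    obtain g where g: "g \<in> glinmaps G (cot R P G 0) J" "\<And>x y. x \<in> carrier (obj P 0) ==> y \<in> carrier G ==> g (CT 0 (du 0 x) y) = y \<odot>\<^bsub>J\<^esub> (E' x \<ominus>\<^bsub>J\<^esub> E x)"
      using glinmaps_lift[OF der_along_diff[OF J_module augn_closed d(2,1) obj_algebra] J_minus[OF graded_lift_dpart[OF E'(1)] graded_lift_dpart[OF E(1)]]] by blast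
    have "z' = ?d 0 g \<otimes>\<^bsub>?C (Suc 0)\<^esub> z"
    proof (rule glinmaps_eqI[OF D(2)[OF z'] mono[OF aq_d_glinmaps[OF g(1)] D(2)[OF z]]])
      fix x assume x: "x \<in> carrier (obj P (Suc 0))"
      then show "z' (?u (Suc 0) x) = (?d 0 g \<otimes>\<^bsub>?C (Suc 0)\<^esub> z) (?u (Suc 0) x)"
        using E(2) E'(2) g(2)[OF alt_bd_closed[OF x] G.one_closed] addhom_closed[OF graded_lift_addhom[OF E(1)] alt_bd_closed[OF x]]
          addhom_closed[OF graded_lift_addhom[OF E'(1)] alt_bd_closed[OF x]] by (simp add: val a_minus_def J.M.a_assoc J.M.l_neg)
    qed
    then show ?thesis using g(1) by (auto simp: aq_C_def)
  qed
  have 3: "?d 0 g \<otimes>\<^bsub>?C (Suc 0)\<^esub> z \<in> ?Z" if z: "z \<in> ?Z" and "g \<in> carrier (?C 0)" for z g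
  proof -
    obtain E where E: "graded_lift R P J c E" "\<And>x. x \<in> carrier (obj P (Suc 0)) ==> z (?u (Suc 0) x) = E (alt_bd P 0 x)"
      using D(1)[OF z] by metis
    have g: "g \<in> glinmaps G (cot R P G 0) J" using that by (simp add: aq_C_def)
    have d: "der_along R (obj P 0) (augn P 0) J c E" using E by (simp add: graded_lift_def)
    have c: "c r \<in> carrier J" if "r \<in> carrier R" for r
      using der_alongD(3)[OF d that] addhom_closed[OF der_alongD(1)[OF d], of "r \<odot>\<^bsub>obj P 0\<^esub> \<one>\<^bsub>obj P 0\<^esub>"]
        module.smult_closed[OF algebra.module[OF obj_algebra] that] cring.axioms(1)[OF obj_cring] ring.ring_simprules(6) by metis
    have "der_along R (obj P 0) (aug P) J c (\<lambda>x. g (?u 0 x) \<oplus>\<^bsub>J\<^esub> E x)"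
      using der_along_sum[OF J_module augn_closed glinmaps_der(1)[OF g] d] c by (simp add: der_along_def)
    then have "graded_lift R P J c (\<lambda>x. g (?u 0 x) \<oplus>\<^bsub>J\<^esub> E x)"
      using glinmaps_der(2)[OF g] graded_lift_dpart[OF E(1)] unfolding graded_lift_def by (blast intro: J_add)
    then show ?thesis unfolding lift_cocycles_def using mono[OF aq_d_glinmaps[OF g] D(2)[OF z]] val E(2) by auto
  qed
  note t = coh_class_torsor[of ?Z ?C 0 ?d, OF 1 2 3]
  show "Z \<subseteq> ?Z ==> Z \<noteq> {} ==> aq_cls 1 R P G J Z = ?Z"
    unfolding aq_cls_def One_nat_def by (rule t(1))
  have 4: "?d (Suc 0) z = \<one>\<^bsub>?C (Suc (Suc 0))\<^esub>" if z: "z \<in> ?Z" for z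
  proof -
    obtain E where E: "graded_lift R P J c E" "\<And>x. x \<in> carrier (obj P (Suc 0)) ==> z (?u (Suc 0) x) = E (alt_bd P 0 x)"
      using D(1)[OF z] by metis
    have one: "\<one>\<^bsub>?C (Suc (Suc 0))\<^esub> \<in> glinmaps G (cot R P G (Suc (Suc 0))) J" using gc(1) by (simp add: aq_C_def)
    show ?thesis
    proof (rule glinmaps_eqI[OF aq_d_glinmaps[OF D(2)[OF z]] one])
      fix x assume x: "x \<in> carrier (obj P (Suc (Suc 0)))"
      then show "?d (Suc 0) z (?u (Suc (Suc 0)) x) = \<one>\<^bsub>?C (Suc (Suc 0))\<^esub> (?u (Suc (Suc 0)) x)"
        using alt_bd_alt_bd[OF x] E(2) addhom_zero[OF obj_ab J_ab graded_lift_addhom[OF E(1)]] CT_closed[OF x G.one_closed] by (simp add: aq_d_CT aq_C_def cot_simps)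
    qed
  qed
  show "?Z \<noteq> {} ==> ?Z \<in> carrier (AQ 1 R P G J)"
    unfolding AQ_def One_nat_def by (rule t(2)) (auto simp: 4)
qed

text \<open>The zero class contains the coboundary of 0. Hence some lift vanishes on boundaries and
  can descend along the augmentation.\<close>

lemma lift_cocycles_trivial:
  assumes "lift_cocycles R G P J c = \<one>\<^bsub>AQ 1 R P G J\<^esub>"
  obtains D where "graded_lift R P J c D" "\<And>x. x \<in> carrier (obj P (Suc 0)) ==> D (alt_bd P 0 x) = \<zero>\<^bsub>J\<^esub>"
proof -
  let ?o = "\<one>\<^bsub>aq_C R P G J 0\<^esub>"
  have "\<one>\<^bsub>AQ 1 R P G J\<^esub> = aq_d R P G 0 ` carrier (aq_C R P G J 0)"
    by (simp add: AQ_def cohomology_def cobd_Suc)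
  then have "aq_d R P G 0 ?o \<in> lift_cocycles R G P J c"
    using assms glinmaps_closed(1)[OF cot_module J_module J_sub cot_dpart_carrier] by (simp add: aq_C_def)
  then obtain D where D: "graded_lift R P J c D"
    "\<And>x. x \<in> carrier (obj P (Suc 0)) ==> aq_d R P G 0 ?o (CT (Suc 0) (du (Suc 0) x) \<one>\<^bsub>G\<^esub>) = D (alt_bd P 0 x)"
    by (auto simp: lift_cocycles_def)
  have "D (alt_bd P 0 x) = \<zero>\<^bsub>J\<^esub>" if x: "x \<in> carrier (obj P (Suc 0))" for x
    using D(2)[OF x] x CT_closed[OF alt_bd_closed[OF x] G.one_closed] by (simp add: aq_d_CT) (simp add: aq_C_def cot_simps)
  then show thesis using that D(1) by blast
qed

end

end

section \<open>Trivial square-zero extensions\<close>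

lemma Gam_simps [simp]:
  "carrier (Gam h T N) = carrier T \<times> carrier N"
  "g \<otimes>\<^bsub>Gam h T N\<^esub> g' = (fst g \<otimes>\<^bsub>T\<^esub> fst g', fst g \<odot>\<^bsub>N\<^esub> snd g' \<oplus>\<^bsub>N\<^esub> fst g' \<odot>\<^bsub>N\<^esub> snd g)"
  "\<one>\<^bsub>Gam h T N\<^esub> = (\<one>\<^bsub>T\<^esub>, \<zero>\<^bsub>N\<^esub>)" "\<zero>\<^bsub>Gam h T N\<^esub> = (\<zero>\<^bsub>T\<^esub>, \<zero>\<^bsub>N\<^esub>)"
  "g \<oplus>\<^bsub>Gam h T N\<^esub> g' = (fst g \<oplus>\<^bsub>T\<^esub> fst g', snd g \<oplus>\<^bsub>N\<^esub> snd g')"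
  "r \<odot>\<^bsub>Gam h T N\<^esub> g = (h r \<otimes>\<^bsub>T\<^esub> fst g, h r \<odot>\<^bsub>N\<^esub> snd g)"
  "dpart (Gam h T N) k = (if k = 0 then carrier T \<times> {\<zero>\<^bsub>N\<^esub>}
                  else if k = 1 then {\<zero>\<^bsub>T\<^esub>} \<times> carrier N else {(\<zero>\<^bsub>T\<^esub>, \<zero>\<^bsub>N\<^esub>)})"
  by (simp_all add: Gam_def case_prod_unfold)

lemma Gam_cring:
  assumes "module T N" shows "cring (Gam h T N)"
proof -
  interpret N: module T N by fact
  show ?thesis
  proof (rule cringI)
    show "abelian_group (Gam h T N)"
    proof (rule abelian_groupI)
      show "\<exists>y\<in>carrier (Gam h T N). y \<oplus>\<^bsub>Gam h T N\<^esub> x = \<zero>\<^bsub>Gam h T N\<^esub>" if "x \<in> carrier (Gam h T N)" for x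
        using that by (intro bexI[of _ "(\<ominus>\<^bsub>T\<^esub> fst x, \<ominus>\<^bsub>N\<^esub> snd x)"]) (auto simp: N.R.l_neg N.M.l_neg)
    qed (auto simp: N.R.a_ac N.M.a_ac)
    show "comm_monoid (Gam h T N)"
      by (rule comm_monoidI) (auto simp: N.R.m_ac N.smult_r_distr N.smult_assoc1[symmetric] N.M.a_ac)
  qed (auto simp: N.R.l_distr N.smult_r_distr N.smult_l_distr N.M.a_ac)
qed

lemma Gam_algebra:
  assumes S: "cring S" and N: "module T N" and h: "h \<in> ring_hom S T" shows "algebra S (Gam h T N)"
proof -
  interpret N: module T N by fact
  interpret S: cring S by fact
  have [simp]: "h r \<in> carrier T" if "r \<in> carrier S" for r using h that by (rule ring_hom_closed)
  show ?thesis
    by (rule algebraI) (auto simp: S Gam_cring[OF N] ring_hom_add[OF h] ring_hom_mult[OF h] ring_hom_one[OF h]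
      N.R.l_distr N.R.r_distr N.smult_r_distr N.smult_l_distr N.R.m_ac N.smult_assoc1[symmetric])
qed

lemma Gam_graded:
  assumes S: "cring S" and N: "module T N" and h: "h \<in> ring_hom S T" shows "graded_parts S (Gam h T N)"
proof -
  interpret N: module T N by fact
  interpret S: cring S by fact
  interpret G: cring "Gam h T N" by (rule Gam_cring[OF N])
  have [simp]: "h r \<in> carrier T" if "r \<in> carrier S" for r using h that by (rule ring_hom_closed)
  have inv: "\<ominus>\<^bsub>Gam h T N\<^esub> (t, x) = (\<ominus>\<^bsub>T\<^esub> t, \<ominus>\<^bsub>N\<^esub> x)" if "t \<in> carrier T" "x \<in> carrier N" for t x
    by (rule G.minus_equality) (use that in \<open>auto simp: N.R.l_neg N.M.l_neg\<close>)
  have n0: "\<ominus>\<^bsub>N\<^esub> \<zero>\<^bsub>N\<^esub> = \<zero>\<^bsub>N\<^esub>" "\<ominus>\<^bsub>T\<^esub> \<zero>\<^bsub>T\<^esub> = \<zero>\<^bsub>T\<^esub>" by (auto intro: N.M.minus_equality)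
  show ?thesis unfolding graded_parts_def
  proof (intro conjI allI)
    show "subgroup (dpart (Gam h T N) k) (add_monoid (Gam h T N))" for k
      by (rule group.subgroupI[OF G.a_group], unfold a_inv_def[symmetric]) (auto simp: inv n0 split: if_splits)
  qed auto
qed

text \<open>A derivation along e is the second component of an algebra homomorphism to the trivial
  extension of G by J whose first component is e.\<close>

lemma free_derivation:
  assumes A: "algebra R A" and free: "free_algebra_on R A X" and G: "algebra R G" and e: "alg_hom R A G e"
    and J: "module G J" and u: "u \<in> X \<rightarrow> carrier J"
  obtains D where "der_along R A e J (\<lambda>r. \<zero>\<^bsub>J\<^esub>) D" "\<And>x. x \<in> X ==> D x = u x"
proof -
  interpret A: algebra R A by fact
  interpret G: algebra R G by fact
  interpret J: module G J by fact
  let ?h = "\<lambda>r. r \<odot>\<^bsub>G\<^esub> \<one>\<^bsub>G\<^esub>"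
  let ?B = "Gam ?h G J"
  have h: "?h \<in> ring_hom R G" by (rule algebra_smult_one(1)[OF G])
  have B: "algebra R ?B" by (rule Gam_algebra[OF A.R_cring J h])
  have X: "X \<subseteq> carrier A" using free by (simp add: free_algebra_on_def)
  have eh: "e \<in> ring_hom A G" "linear R A G e" using e by (auto simp: alg_hom_def)
  have "(\<lambda>x. (e x, u x)) \<in> X \<rightarrow> carrier ?B" using u X ring_hom_closed[OF eh(1)] by auto
  then obtain \<phi> where p: "alg_hom R A ?B \<phi>" "\<And>x. x \<in> X ==> \<phi> x = (e x, u x)"
    using free_algebra_hom[OF A B free] by blast
  have ph: "\<phi> \<in> ring_hom A ?B" "linear R A ?B \<phi>" using p by (auto simp: alg_hom_def)
  have pc: "\<phi> x \<in> carrier G \<times> carrier J" if "x \<in> carrier A" for x using ring_hom_closed[OF ph(1) that] by simp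
  have pf: "fst (\<phi> x) \<in> carrier G" if "x \<in> carrier A" for x using pc[OF that] by (simp add: mem_Times_iff)
  have "fst (\<phi> (r \<odot>\<^bsub>A\<^esub> x)) = r \<odot>\<^bsub>G\<^esub> fst (\<phi> x)" if "r \<in> carrier R" "x \<in> carrier A" for r x
    using linear_smult[OF ph(2) that] algebra_smult_one(2)[OF G that(1) pf[OF that(2)], symmetric] by simp
  then have "alg_hom R A G (\<lambda>x. fst (\<phi> x))"
    using pf ring_hom_mult[OF ph(1)] ring_hom_add[OF ph(1)] ring_hom_one[OF ph(1)]
    by (auto simp: alg_hom_def intro!: ring_hom_memI linearI addhomI)
  \<comment> \<open>The first component is an algebra homomorphism agreeing with e on the
    variables.\<close>
  then have fst: "fst (\<phi> x) = e x" if "x \<in> carrier A" for x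
    by (rule free_algebra_hom_eqI[OF A G free _ e _ that]) (simp add: p(2))
  have "\<phi> (r \<odot>\<^bsub>A\<^esub> \<one>\<^bsub>A\<^esub>) = (?h r \<otimes>\<^bsub>G\<^esub> \<one>\<^bsub>G\<^esub>, \<zero>\<^bsub>J\<^esub>)" if "r \<in> carrier R" for r
    using linear_smult[OF ph(2) that, of "\<one>\<^bsub>A\<^esub>"] ring_hom_one[OF ph(1)] that by simp
  then have "der_along R A e J (\<lambda>r. \<zero>\<^bsub>J\<^esub>) (\<lambda>x. snd (\<phi> x))"
    using pc ring_hom_mult[OF ph(1)] ring_hom_add[OF ph(1)] fst
    by (auto simp: der_along_def mem_Times_iff intro!: addhomI)
  then show thesis using that p(2) by fastforce
qed

lemma der_along_eqI:
  assumes A: "algebra R A" and free: "free_algebra_on R A X" and J: "module G J" and e: "e \<in> ring_hom A G"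
    and D: "der_along R A e J c D" and D': "der_along R A e J c D'" and eq: "\<And>x. x \<in> X ==> D x = D' x" and x: "x \<in> carrier A"
  shows "D x = D' x"
proof -
  interpret A: algebra R A by fact
  interpret J: module G J by fact
  note d = der_alongD[OF D] and d' = der_alongD[OF D']
  have X: "X \<subseteq> carrier A" and b: "is_basis R A {m. set_mset m \<subseteq> X} (monomial A)" using free by (auto simp: free_algebra_on_def)
  have mc: "monomial A m \<in> carrier A" if "set_mset m \<subseteq> X" for m
    using that b by (auto simp: is_basis_iff Pi_iff)
  have m: "D (monomial A m) = D' (monomial A m)" if "set_mset m \<subseteq> X" for m
  proof (rule monomial_induct[OF A.M_cring X that])
    show "D \<one>\<^bsub>A\<^esub> = D' \<one>\<^bsub>A\<^esub>" using der_along_one[OF J A.M_cring e D] der_along_one[OF J A.M_cring e D'] by simp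
    show "D (x \<otimes>\<^bsub>A\<^esub> y) = D' (x \<otimes>\<^bsub>A\<^esub> y)" if "x \<in> X" "y \<in> carrier A" "D y = D' y" for x y
      using that X eq by (auto simp: d(2) d'(2) subset_iff)
  qed
  show ?thesis
  proof (rule A.basis_induct[OF b x])
    show "D \<zero>\<^bsub>A\<^esub> = D' \<zero>\<^bsub>A\<^esub>" using addhom_zero[OF A.abelian_group_axioms J.abelian_group_axioms] d(1) d'(1) by metis
    show "D (r \<odot>\<^bsub>A\<^esub> monomial A m) = D' (r \<odot>\<^bsub>A\<^esub> monomial A m)" if "r \<in> carrier R" "m \<in> {m. set_mset m \<subseteq> X}" for r m
    proof -
      have "r \<odot>\<^bsub>A\<^esub> monomial A m = (r \<odot>\<^bsub>A\<^esub> \<one>\<^bsub>A\<^esub>) \<otimes>\<^bsub>A\<^esub> monomial A m"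
        using algebra_smult_one(2)[OF A that(1) mc] that(2) by simp
      then show ?thesis using that mc m by (simp add: d(2,3) d'(2,3))
    qed
  qed (simp add: addhom_add[OF d(1)] addhom_add[OF d'(1)])
qed

context sres_res
begin

lemma obj_free: obtains X where "X \<subseteq> (\<Union>k. dpart (obj P n) k)" "free_algebra_on R (obj P n) X"
  using conjunct1[OF conjunct2[OF res[unfolded sres_of_def]]] by blast

lemma augn_alg_hom: "alg_hom R (obj P n) G (augn P n)"
  using augn_hom by (simp add: galg_hom_def)

text \<open>Projectivity of the cotangent terms among graded modules: homogeneous preimages under q
  are prescribed on the variables and extended to a derivation.\<close>

lemma glinmaps_lift_along:
  assumes J: "graded_module G (dpart G) J" and J2: "graded_module G (dpart G) J2" and q: "linear G J J2 q"
    and D2: "der_along R (obj P n) (augn P n) J2 (\<lambda>r. \<zero>\<^bsub>J2\<^esub>) D2"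
    and im: "\<And>k x. x \<in> dpart (obj P n) k ==> D2 x \<in> q ` dpart J k"
  obtains f where "f \<in> glinmaps G (cot R P G n) J"
    "\<And>x y. x \<in> carrier (obj P n) ==> y \<in> carrier G ==> q (f (CT n (du n x) y)) = y \<odot>\<^bsub>J2\<^esub> D2 x"
proof -
  interpret J: module G J using J by (simp add: graded_module_def)
  interpret J2: module G J2 using J2 by (simp add: graded_module_def)
  interpret A: algebra R "obj P n" by (rule obj_algebra)
  obtain X where X: "X \<subseteq> (\<Union>k. dpart (obj P n) k)" and free: "free_algebra_on R (obj P n) X" by (rule obj_free)
  have gr: "is_grading (obj P n) (dpart (obj P n))" using obj_graded by (simp add: graded_algebra_def)
  note J_sub = J_sub[OF J] and J_dpart = J_dpart[OF J]
  have J0: "\<zero>\<^bsub>J\<^esub> \<in> dpart J k" for k using subgroup.one_closed[OF J_sub] by simp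
  note d2 = der_alongD[OF D2]
  have q0: "q \<zero>\<^bsub>J\<^esub> = \<zero>\<^bsub>J2\<^esub>" using addhom_zero[OF J.abelian_group_axioms J2.abelian_group_axioms linear_addhom[OF q]] .
  have D20: "D2 \<zero>\<^bsub>obj P n\<^esub> = \<zero>\<^bsub>J2\<^esub>" using addhom_zero[OF obj_ab J2.abelian_group_axioms d2(1)] .
  \<comment> \<open>The zero element lies in every degree, so it is sent to 0; an arbitrary choice
    could be homogeneous of one degree only.\<close>
  define u where "u x = (if x = \<zero>\<^bsub>obj P n\<^esub> then \<zero>\<^bsub>J\<^esub> else SOME y. \<exists>k. x \<in> dpart (obj P n) k \<and> y \<in> dpart J k \<and> q y = D2 x)" for x
  have u: "u x \<in> carrier J" "q (u x) = D2 x" "\<And>k. x \<in> dpart (obj P n) k ==> u x \<in> dpart J k" if x: "x \<in> X" for x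
  proof -
    have "u x \<in> carrier J \<and> q (u x) = D2 x \<and> (\<forall>k. x \<in> dpart (obj P n) k \<longrightarrow> u x \<in> dpart J k)"
    proof (cases "x = \<zero>\<^bsub>obj P n\<^esub>")
      case True then show ?thesis by (simp add: u_def J0 q0 D20)
    next
      case False
      have "\<exists>y k. x \<in> dpart (obj P n) k \<and> y \<in> dpart J k \<and> q y = D2 x" using X x im by fastforce
      then have "\<exists>k. x \<in> dpart (obj P n) k \<and> u x \<in> dpart J k \<and> q (u x) = D2 x"
        unfolding u_def if_not_P[OF False] by (rule someI_ex)
      then obtain k where k: "x \<in> dpart (obj P n) k" "u x \<in> dpart J k" "q (u x) = D2 x" by blast
      \<comment> \<open>A nonzero element has at most one degree, so the chosen preimage has the
        right degree for every part containing x.\<close>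
      then have "j = k" if "x \<in> dpart (obj P n) j" for j
        using graded_zero[OF obj_ab gr that k(1)] False by blast
      then show ?thesis using k J_dpart by blast
    qed
    then show "u x \<in> carrier J" "q (u x) = D2 x" "\<And>k. x \<in> dpart (obj P n) k ==> u x \<in> dpart J k" by auto
  qed
  have uX: "u \<in> X \<rightarrow> carrier J" using u(1) by simp
  obtain D where D: "der_along R (obj P n) (augn P n) J (\<lambda>r. \<zero>\<^bsub>J\<^esub>) D" "\<And>x. x \<in> X ==> D x = u x"
    using free_derivation[OF obj_algebra free algG augn_alg_hom J.module_axioms uX] by blast
  note d = der_alongD[OF D(1)]
  have XA: "X \<subseteq> carrier (obj P n)" using free by (simp add: free_algebra_on_def)
  have gr1: "\<one>\<^bsub>obj P n\<^esub> \<in> dpart (obj P n) 0" using obj_graded unfolding graded_algebra_def by blast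
  have grm: "x \<otimes>\<^bsub>obj P n\<^esub> y \<in> dpart (obj P n) (j + k)" if "x \<in> dpart (obj P n) j" "y \<in> dpart (obj P n) k" for x y j k
    using that obj_graded unfolding graded_algebra_def by blast
  have grs: "r \<odot>\<^bsub>obj P n\<^esub> y \<in> dpart (obj P n) k" if "r \<in> carrier R" "y \<in> dpart (obj P n) k" for r y k
    using that obj_graded unfolding graded_algebra_def by blast
  have "D ` dpart (obj P n) k \<subseteq> dpart J k" for k
  proof (rule free_graded_map[OF obj_graded free J.abelian_group_axioms d(1) J_sub])
    show "\<exists>k. monomial (obj P n) m \<in> dpart (obj P n) k \<and> D (monomial (obj P n) m) \<in> dpart J k" if "set_mset m \<subseteq> X" for m
    proof (rule monomial_induct[OF obj_cring XA that])
      show "\<exists>k. \<one>\<^bsub>obj P n\<^esub> \<in> dpart (obj P n) k \<and> D \<one>\<^bsub>obj P n\<^esub> \<in> dpart J k"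
        using gr1 der_along_one[OF J.module_axioms obj_cring augn_ring D(1)] J0 by (intro exI[of _ 0]) simp
      fix x y assume x: "x \<in> X" and y: "y \<in> carrier (obj P n)" "\<exists>k. y \<in> dpart (obj P n) k \<and> D y \<in> dpart J k"
      obtain j where j: "x \<in> dpart (obj P n) j" "D x \<in> dpart J j" using X x u(3)[OF x] D(2)[OF x] by auto
      obtain k where k: "y \<in> dpart (obj P n) k" "D y \<in> dpart J k" using y by blast
      have "augn P n x \<odot>\<^bsub>J\<^esub> D y \<in> dpart J (j + k)" "augn P n y \<odot>\<^bsub>J\<^esub> D x \<in> dpart J (k + j)"
        using J_act[OF J augn_dpart[OF j(1)] k(2)] J_act[OF J augn_dpart[OF k(1)] j(2)] by auto
      then have "D (x \<otimes>\<^bsub>obj P n\<^esub> y) \<in> dpart J (j + k)" using d(2)[of x y] x XA y(1) J_add[OF J] by (auto simp: add.commute)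
      then show "\<exists>k. x \<otimes>\<^bsub>obj P n\<^esub> y \<in> dpart (obj P n) k \<and> D (x \<otimes>\<^bsub>obj P n\<^esub> y) \<in> dpart J k" using grm[OF j(1) k(1)] by blast
    qed
    show "D (r \<odot>\<^bsub>obj P n\<^esub> y) \<in> dpart J k" if r: "r \<in> carrier R" and y: "y \<in> dpart (obj P n) k" "D y \<in> dpart J k" for r y k
      using der_along_smult[OF J.module_axioms obj_algebra augn_closed D(1) r obj_dpart[OF y(1)]]
        J_act[OF J augn_dpart[OF grs[OF r gr1]] y(2)] by simp
  qed
  then obtain f where f: "f \<in> glinmaps G (cot R P G n) J"
    "\<And>x y. x \<in> carrier (obj P n) ==> y \<in> carrier G ==> f (CT n (du n x) y) = y \<odot>\<^bsub>J\<^esub> D x"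
    using glinmaps_lift[OF J D(1)] by blast
  \<comment> \<open>q \<circ> D and D2 are derivations along the same map that agree on the
    variables, hence everywhere.\<close>
  have "der_along R (obj P n) (augn P n) J2 (\<lambda>r. \<zero>\<^bsub>J2\<^esub>) (\<lambda>x. q (D x))"
    using addhom_comp[OF d(1) linear_addhom[OF q]] addhom_closed[OF d(1)] augn_closed
    by (simp add: der_along_def d(2,3) q0 addhom_add[OF linear_addhom[OF q]] linear_smult[OF q])
  then have "q (D x) = D2 x" if "x \<in> carrier (obj P n)" for x
    by (rule der_along_eqI[OF obj_algebra free J2.module_axioms augn_ring _ D2 _ that]) (simp add: D(2) u(2))
  then have "q (f (CT n (du n x) y)) = y \<odot>\<^bsub>J2\<^esub> D2 x" if "x \<in> carrier (obj P n)" "y \<in> carrier G" for x y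
    using that f(2) addhom_closed[OF d(1)] by (simp add: linear_smult[OF q])
  then show thesis using that f(1) by blast
qed

end

section \<open>The comparison of the cotangent complex of a trivial extension with a free resolution\<close>

lemma shift1_simps [simp]:
  "carrier (shift1 M) = carrier M" "add (shift1 M) = add M" "ring.zero (shift1 M) = ring.zero M"
  "smult (shift1 M) = (\<lambda>g x. fst g \<odot>\<^bsub>M\<^esub> x)" "dpart (shift1 M) k = (if k = 1 then carrier M else {\<zero>\<^bsub>M\<^esub>})"
  "a_inv (shift1 M) = a_inv M" "a_minus (shift1 M) = a_minus M"
  "addhom (shift1 M) B f \<longleftrightarrow> addhom M B f" "addhom C (shift1 M) g \<longleftrightarrow> addhom C M g"
  by (simp_all add: shift1_def)

text \<open>Elements of \<Gamma> of degree other than 0 have T-component 0 and act as 0, which is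
  compatible with a module placed entirely in degree 1.\<close>

lemma shift1_graded_module:
  assumes M: "module T M" and N: "module T N"
  shows "graded_module (Gam h T N) (dpart (Gam h T N)) (shift1 M)"
proof -
  interpret M: module T M by fact
  interpret N: module T N by fact
  have ab: "abelian_group (shift1 M)" using M.abelian_group_axioms by (simp add: shift1_def)
  have "module (Gam h T N) (shift1 M)"
    by (rule moduleI[OF Gam_cring[OF N] ab]) (auto simp: M.smult_l_distr M.smult_r_distr M.smult_assoc1)
  moreover have "subgroup (dpart (shift1 M) k) (add_monoid (shift1 M))" for k
    by (rule group.subgroupI[OF abelian_group.a_group[OF ab]], unfold a_inv_def[symmetric])
      (auto intro: M.M.minus_equality split: if_splits)
  moreover have "\<forall>k m. \<forall>x\<in>dpart (Gam h T N) k. \<forall>y\<in>dpart (shift1 M) m. x \<odot>\<^bsub>shift1 M\<^esub> y \<in> dpart (shift1 M) (k + m)"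
    by auto
  ultimately show ?thesis unfolding graded_module_def by blast
qed

lemma shift1_linear:
  assumes "linear T M M' q" shows "linear (Gam h T N) (shift1 M) (shift1 M') q"
  using assms by (auto simp: linear_def)

text \<open>The construction of \<open>resolution_lift\<close> with derivations on the free algebras
  in place of linear maps on free modules; F is exact and \<open>glinmaps_lift_along\<close>
  provides the lifts.\<close>

lemma comparison_exists:
  assumes N: "module T N" and F: "ext_res T N N F" and R: "sres_of T (Gam (\<lambda>t. t) T N) R"
  obtains \<psi> where "comparison T N F R \<psi>"
proof -
  interpret F: ext_res T N N F by fact
  let ?G = "Gam (\<lambda>t. t) T N"
  have T: "cring T" by (rule module.axioms(1)[OF N])
  have idh: "(\<lambda>t. t) \<in> ring_hom T T" by (rule ring_hom_memI) auto
  interpret R: sres_res T ?G R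
    by (simp add: sres_res_def Gam_algebra[OF T N idh] Gam_graded[OF T N idh] R)
  note gm = shift1_graded_module[OF F.F_module N, of "\<lambda>t. t"] and gN = shift1_graded_module[OF N N, of "\<lambda>t. t"]
  \<comment> \<open>Again the invariant asks that boundaries of the cotangent complex go to
    boundaries of F.\<close>
  define ok where "ok n p \<longleftrightarrow> p \<in> glinmaps ?G (cot T R ?G n) (shift1 (fobj F n)) \<and>
     (n = 0 \<longrightarrow> (\<forall>r\<in>carrier (obj R 0). \<forall>g\<in>carrier ?G. faug F (p (cot_tens T R ?G 0 (univ_der T (obj R 0) r) g)) = fst g \<odot>\<^bsub>N\<^esub> snd (aug R r))) \<and>
     (\<forall>x\<in>carrier (cot T R ?G (Suc n)). p (cot_bd T R ?G n x) \<in> fbd F n ` carrier (fobj F (Suc n)))" for n p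
  have "\<exists>\<psi>. \<forall>n. ok n (\<psi> n) \<and> (\<forall>x\<in>carrier (cot T R ?G (Suc n)). \<psi> n (cot_bd T R ?G n x) = fbd F n (\<psi> (Suc n) x))"
  proof (rule dependent_nat_choice)
    have ah: "aug R \<in> ring_hom (obj R 0) ?G" "linear T (obj R 0) ?G (aug R)" using R.aug_hom by (auto simp: galg_hom_def alg_hom_def)
    have ac: "aug R x \<in> carrier T \<times> carrier N" if "x \<in> carrier (obj R 0)" for x using ring_hom_closed[OF ah(1) that] by simp
    interpret A0: algebra T "obj R 0" by (rule R.obj_algebra)
    have "aug R (r \<odot>\<^bsub>obj R 0\<^esub> \<one>\<^bsub>obj R 0\<^esub>) = (r \<otimes>\<^bsub>T\<^esub> \<one>\<^bsub>T\<^esub>, \<zero>\<^bsub>N\<^esub>)" if "r \<in> carrier T" for r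
      using linear_smult[OF ah(2) that, of "\<one>\<^bsub>obj R 0\<^esub>"] ring_hom_one[OF ah(1)] that by simp
    \<comment> \<open>The N-component of the augmentation is a derivation by the product of
      \<Gamma>, and it kills scalars because their image is (t, 0).\<close>
    then have d: "der_along T (obj R 0) (augn R 0) (shift1 N) (\<lambda>r. \<zero>\<^bsub>shift1 N\<^esub>) (\<lambda>x. snd (aug R x))"
      using ac ring_hom_mult[OF ah(1)] ring_hom_add[OF ah(1)] by (auto simp: der_along_def mem_Times_iff intro!: addhomI)
    \<comment> \<open>Outside degree 1 the N-component vanishes and has the preimage 0; in degree 1
      the augmentation of F is onto.\<close>
    have im: "snd (aug R x) \<in> faug F ` dpart (shift1 (fobj F 0)) k" if x: "x \<in> dpart (obj R 0) k" for k x
    proof -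
      have g: "aug R x \<in> dpart ?G k" using R.augn_dpart[of x 0 k] x by simp
      have "faug F \<zero>\<^bsub>fobj F 0\<^esub> = \<zero>\<^bsub>N\<^esub>" using addhom_zero[OF F.F_ab F.M.abelian_group_axioms linear_addhom[OF F.F_aug]] .
      moreover have "faug F ` carrier (fobj F 0) = carrier N" using F.res by (simp add: free_resolution_def)
      ultimately show ?thesis using g by (auto split: if_splits)
    qed
    obtain p where p: "p \<in> glinmaps ?G (cot T R ?G 0) (shift1 (fobj F 0))"
      "\<And>x y. x \<in> carrier (obj R 0) ==> y \<in> carrier ?G ==> faug F (p (R.CT 0 (R.du 0 x) y)) = y \<odot>\<^bsub>shift1 N\<^esub> snd (aug R x)"
      using R.glinmaps_lift_along[OF gm gN shift1_linear[OF F.F_aug] d im] by blast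
    have pa: "addhom (R.CL 0) (fobj F 0) p" using linear_addhom[OF linmapsD(1), of p ?G "cot T R ?G 0" "shift1 (fobj F 0)"] p(1)
      by (simp add: glinmaps_def R.cot_simps)
    \<comment> \<open>On generators its augmentation is a multiple of the N-component of the
      augmentation of \<open>alt_bd\<close>, which is 0; exactness of F then gives a
      boundary.\<close>
    have "p (cot_bd T R ?G 0 x) \<in> fbd F 0 ` carrier (fobj F (Suc 0))" if x: "x \<in> carrier (R.CL (Suc 0))" for x
    proof -
      interpret C: cot_data T "obj R (Suc 0)" ?G "augn R (Suc 0)" by (rule R.cot_data)
      note h = addhom_comp[OF addhom_comp[OF R.cot_bd_addhom[of 0] pa] linear_addhom[OF F.F_aug]]
      have "faug F (p (cot_bd T R ?G 0 x)) = \<zero>\<^bsub>N\<^esub>" using x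
      proof (induction rule: C.LL_induct)
        case (gen a g)
        then show ?case using R.cot_bd_d[OF gen] p(2)[OF R.alt_bd_closed[OF gen(1)] gen(2)] R.alt_bd_aug[OF gen(1)]
          by (auto simp: cot_tens_def)
      next
        case (add x y) then show ?case using addhom_add[OF h add(1,2)] by simp
      qed
      moreover have "p (cot_bd T R ?G 0 x) \<in> carrier (fobj F 0)" using addhom_closed[OF pa addhom_closed[OF R.cot_bd_addhom x]] .
      ultimately show ?thesis using F.res by (simp add: free_resolution_def)
    qed
    then have "ok 0 p" using p by (simp add: ok_def R.cot_simps)
    then show "\<exists>p. ok 0 p" by blast
  next
    fix p n assume p: "ok n p"
    have pg: "p \<in> glinmaps ?G (cot T R ?G n) (shift1 (fobj F n))" using p by (simp add: ok_def)
    \<comment> \<open>This is p after the boundary. Lifting it along \<open>fbd F n\<close> gives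
      the next component.\<close>
    let ?f = "aq_d T R ?G n p"
    have f: "?f \<in> glinmaps ?G (cot T R ?G (Suc n)) (shift1 (fobj F n))" by (rule R.aq_d_glinmaps[OF gm pg])
    note fd = R.glinmaps_der[OF gm f]
    have fim: "?f x \<in> fbd F n ` carrier (fobj F (Suc n))" if "x \<in> carrier (R.CL (Suc n))" for x
      using p that by (simp add: ok_def aq_d_def R.cot_simps)
    have im: "?f (R.CT (Suc n) (R.du (Suc n) x) \<one>\<^bsub>?G\<^esub>) \<in> fbd F n ` dpart (shift1 (fobj F (Suc n))) k" if x: "x \<in> dpart (obj R (Suc n)) k" for k x
    proof -
      have "fbd F n \<zero>\<^bsub>fobj F (Suc n)\<^esub> = \<zero>\<^bsub>fobj F n\<^esub>" using addhom_zero[OF F.F_ab F.F_ab linear_addhom[OF F.F_bd]] .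
      moreover have "?f (R.CT (Suc n) (R.du (Suc n) x) \<one>\<^bsub>?G\<^esub>) \<in> fbd F n ` carrier (fobj F (Suc n))"
        by (rule fim[OF R.CT_closed[OF R.obj_dpart[OF x]]]) (rule R.G.one_closed)
      ultimately show ?thesis using fd(2)[OF x] by (auto split: if_splits)
    qed
    obtain q where q: "q \<in> glinmaps ?G (cot T R ?G (Suc n)) (shift1 (fobj F (Suc n)))"
      "\<And>x y. x \<in> carrier (obj R (Suc n)) ==> y \<in> carrier ?G ==> fbd F n (q (R.CT (Suc n) (R.du (Suc n) x) y)) = y \<odot>\<^bsub>shift1 (fobj F n)\<^esub> ?f (R.CT (Suc n) (R.du (Suc n) x) \<one>\<^bsub>?G\<^esub>)"
      using R.glinmaps_lift_along[OF gm gm shift1_linear[OF F.F_bd] fd(1) im] by blast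
    have qa: "addhom (R.CL (Suc n)) (fobj F (Suc n)) q" using linear_addhom[OF linmapsD(1), of q ?G "cot T R ?G (Suc n)" "shift1 (fobj F (Suc n))"] q(1)
      by (simp add: glinmaps_def R.cot_simps)
    have pa: "addhom (R.CL n) (fobj F n) p" using linear_addhom[OF linmapsD(1), of p ?G "cot T R ?G n" "shift1 (fobj F n)"] pg
      by (simp add: glinmaps_def R.cot_simps)
    have eq: "p (cot_bd T R ?G n x) = fbd F n (q x)" if x: "x \<in> carrier (R.CL (Suc n))" for x
    proof -
      interpret C: cot_data T "obj R (Suc n)" ?G "augn R (Suc n)" by (rule R.cot_data)
      note h1 = addhom_comp[OF R.cot_bd_addhom[of n] pa] and h2 = addhom_comp[OF qa linear_addhom[OF F.F_bd]]
      show ?thesis using x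
      proof (induction rule: C.LL_induct)
        case (gen a g)
        have "?f (R.CT (Suc n) (R.du (Suc n) a) g) = fbd F n (q (R.CT (Suc n) (R.du (Suc n) a) g))"
          using q(2)[OF gen] fd(3)[OF gen] by simp
        then show ?case using R.CT_closed[OF gen] by (simp add: aq_d_def R.cot_simps cot_tens_def)
      next
        case (add x y) then show ?case using addhom_add[OF h1 add(1,2)] addhom_add[OF h2 add(1,2)] by simp
      qed
    qed
    have "q (cot_bd T R ?G (Suc n) x) \<in> fbd F (Suc n) ` carrier (fobj F (Suc (Suc n)))" if x: "x \<in> carrier (R.CL (Suc (Suc n)))" for x
    proof -
      have c: "cot_bd T R ?G (Suc n) x \<in> carrier (R.CL (Suc n))" using addhom_closed[OF R.cot_bd_addhom x] .
      have "fbd F n (q (cot_bd T R ?G (Suc n) x)) = \<zero>\<^bsub>fobj F n\<^esub>"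
        using eq[OF c] R.cot_bd_bd[OF x] addhom_zero[OF R.CL_ab F.F_ab pa] by simp
      then show ?thesis using F.res addhom_closed[OF qa c] by (simp add: free_resolution_def)
    qed
    then have "ok (Suc n) q" using q(1) by (simp add: ok_def R.cot_simps)
    then show "\<exists>q. ok (Suc n) q \<and> (\<forall>x\<in>carrier (cot T R ?G (Suc n)). p (cot_bd T R ?G n x) = fbd F n (q x))"
      using eq by (auto simp: R.cot_simps)
  qed
  then obtain \<psi> where psi: "\<And>n. ok n (\<psi> n)" "\<And>n. \<forall>x\<in>carrier (cot T R ?G (Suc n)). \<psi> n (cot_bd T R ?G n x) = fbd F n (\<psi> (Suc n) x)" by blast
  have "comparison T N F R \<psi>"
    unfolding comparison_def Let_def using psi(1)[of 0] psi by (simp add: ok_def del: Gam_simps)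
  then show thesis by (rule that)
qed

section \<open>The Kodaira-Spencer extension\<close>

text \<open>Principal parts of S are formed for the record \<open>alg l S\<close>, which as a ring
  is S; the resulting modules are moved to S itself.\<close>

lemma module_alg:
  assumes "module (alg l S) M" shows "module S M"
proof -
  interpret M: module "alg l S" M by fact
  have S: "cring S" using M.R.is_cring by simp
  show ?thesis
    by (rule moduleI[OF S M.abelian_group_axioms])
      (use M.smult_closed M.smult_l_distr M.smult_r_distr M.smult_assoc1 M.smult_one in auto)
qed

lemma algebra_alg:
  assumes "algebra (alg l S) M" shows "algebra S M"
proof -
  interpret M: algebra "alg l S" M by fact
  have S: "cring S" using M.R_cring by simp
  show ?thesis
    by (rule algebraI[OF S M.M_cring])
      (use M.smult_closed M.smult_l_distr M.smult_r_distr M.smult_assoc1 M.smult_one M.smult_assoc2 in auto)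
qed

locale ks_base = L: cring \<Lambda> + S: cring S
  for \<Lambda> :: "('l, 'y) ring_scheme" and S :: "('s, 'w) ring_scheme" +
  fixes l :: "'l \<Rightarrow> 's"
  assumes l: "l \<in> ring_hom \<Lambda> S"
begin

sublocale K: kahler \<Lambda> "alg l S"
  by (simp add: kahler_def alg_algebra L.is_cring S.is_cring l)

abbreviation "OW \<equiv> Omega \<Lambda> (alg l S)"
abbreviation "PP \<equiv> pparts \<Lambda> (alg l S)"
abbreviation "PR \<equiv> pp_right \<Lambda> (alg l S)"
abbreviation "J1 \<equiv> j1 \<Lambda> (alg l S)"
abbreviation "J2 \<equiv> j2 \<Lambda> (alg l S)"
abbreviation "dS \<equiv> univ_der \<Lambda> (alg l S)"
abbreviation "eps \<equiv> pp_aug S"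

lemma OW_module: "module S OW" by (rule module_alg[OF K.W_module])
lemma PR_algebra: "algebra S PR" by (rule algebra_alg[OF K.pp_right_algebra])
lemma PR_module: "module S PR" using algebra.module[OF PR_algebra] .

lemma eps_simps:
  "p \<in> carrier PP ==> eps p \<in> carrier S"
  "p \<in> carrier PP ==> q \<in> carrier PP ==> eps (p \<oplus>\<^bsub>PP\<^esub> q) = eps p \<oplus>\<^bsub>S\<^esub> eps q"
  "p \<in> carrier PP ==> q \<in> carrier PP ==> eps (p \<otimes>\<^bsub>PP\<^esub> q) = eps p \<otimes>\<^bsub>S\<^esub> eps q"
  "eps \<one>\<^bsub>PP\<^esub> = \<one>\<^bsub>S\<^esub>" "s \<in> carrier S ==> eps (J1 s) = s" "s \<in> carrier S ==> eps (J2 s) = s"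
  "w \<in> carrier OW ==> eps w = \<zero>\<^bsub>S\<^esub>"
  using K.aug_closed K.aug_simps K.aug_J K.W_aug by (simp_all add: pp_aug_alg)

text \<open>The retraction onto \<Omega> that is linear for j2 and kills the image of j2. Its values
  -ds on j1(s) are the source of every twist below.\<close>

definition "omega_part p = p \<ominus>\<^bsub>PP\<^esub> J2 (eps p)"

lemma omega_part:
  "p \<in> carrier PP ==> omega_part p \<in> carrier OW"
  "p \<in> carrier PP ==> p = omega_part p \<oplus>\<^bsub>PP\<^esub> J2 (eps p)"
  "addhom PP OW omega_part"
  "w \<in> carrier OW ==> omega_part w = w"
  "s \<in> carrier S ==> omega_part (J2 s) = \<zero>\<^bsub>OW\<^esub>"
  "p \<in> carrier PP ==> q \<in> carrier PP ==> omega_part (p \<otimes>\<^bsub>PP\<^esub> q) = eps p \<odot>\<^bsub>OW\<^esub> omega_part q \<oplus>\<^bsub>OW\<^esub> eps q \<odot>\<^bsub>OW\<^esub> omega_part p"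
  "s \<in> carrier S ==> omega_part (J1 s) = \<ominus>\<^bsub>OW\<^esub> dS s"
proof -
  have J2c: "s \<in> carrier S ==> J2 s \<in> carrier PP" and J1c: "s \<in> carrier S ==> J1 s \<in> carrier PP" for s
    using K.J_closed by auto
  have W: "w \<in> carrier OW ==> w \<in> carrier PP" for w by (rule K.W_sub)
  show c: "omega_part p \<in> carrier OW" if "p \<in> carrier PP" for p
    using K.pp_decomp[OF that] by (simp add: omega_part_def)
  show dec: "p = omega_part p \<oplus>\<^bsub>PP\<^esub> J2 (eps p)" if "p \<in> carrier PP" for p
    using that J2c eps_simps(1) by (simp add: omega_part_def a_minus_def K.P.a_assoc K.P.l_neg)
  show "addhom PP OW omega_part"
  proof (rule addhomI)
    fix p q assume pq: "p \<in> carrier PP" "q \<in> carrier PP"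
    have "J2 (eps p \<oplus>\<^bsub>S\<^esub> eps q) = J2 (eps p) \<oplus>\<^bsub>PP\<^esub> J2 (eps q)" using K.J2_simps(1)[of "eps p" "eps q"] pq eps_simps(1) by simp
    then show "omega_part (p \<oplus>\<^bsub>PP\<^esub> q) = omega_part p \<oplus>\<^bsub>OW\<^esub> omega_part q"
      using pq J2c eps_simps(1) by (simp add: omega_part_def eps_simps a_minus_def K.P.minus_add K.P.a_ac K.W_simps)
  qed (rule c)
  have J20: "J2 \<zero>\<^bsub>S\<^esub> = \<zero>\<^bsub>PP\<^esub>" using addhom_zero[OF _ K.P.is_abelian_group ring_hom_addhom[OF K.J2_hom]] S.is_abelian_group by simp
  show ow: "omega_part w = w" if "w \<in> carrier OW" for w
    using that W by (simp add: omega_part_def eps_simps J20 abelian_minus_eq[OF K.P.is_abelian_group])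
  show oJ2: "omega_part (J2 s) = \<zero>\<^bsub>OW\<^esub>" if "s \<in> carrier S" for s
    using that J2c by (simp add: omega_part_def eps_simps K.W_simps a_minus_def K.P.r_neg)
  show "omega_part (p \<otimes>\<^bsub>PP\<^esub> q) = eps p \<odot>\<^bsub>OW\<^esub> omega_part q \<oplus>\<^bsub>OW\<^esub> eps q \<odot>\<^bsub>OW\<^esub> omega_part p" if p: "p \<in> carrier PP" and q: "q \<in> carrier PP"
  proof -
    let ?v = "omega_part p" and ?w = "omega_part q" and ?a = "J2 (eps p)" and ?b = "J2 (eps q)"
    note e = eps_simps(1)[OF p] eps_simps(1)[OF q]
    note cc = W[OF c[OF p]] W[OF c[OF q]] J2c[OF e(1)] J2c[OF e(2)]
    \<comment> \<open>Of the four products of \<Omega>-parts and j2-parts this one vanishes, which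
      leaves a Leibniz rule.\<close>
    have z: "?v \<otimes>\<^bsub>PP\<^esub> ?w = \<zero>\<^bsub>PP\<^esub>" using K.W_mult_zero c p q by simp
    have "p \<otimes>\<^bsub>PP\<^esub> q = (?v \<oplus>\<^bsub>PP\<^esub> ?a) \<otimes>\<^bsub>PP\<^esub> (?w \<oplus>\<^bsub>PP\<^esub> ?b)" using dec[OF p] dec[OF q] by simp
    also have "\<dots> = ?v \<otimes>\<^bsub>PP\<^esub> ?w \<oplus>\<^bsub>PP\<^esub> (?a \<otimes>\<^bsub>PP\<^esub> ?w \<oplus>\<^bsub>PP\<^esub> ?b \<otimes>\<^bsub>PP\<^esub> ?v) \<oplus>\<^bsub>PP\<^esub> ?a \<otimes>\<^bsub>PP\<^esub> ?b"
      using cc by algebra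
    also have "?a \<otimes>\<^bsub>PP\<^esub> ?b = J2 (eps (p \<otimes>\<^bsub>PP\<^esub> q))" using K.J2_simps(2)[of "eps p" "eps q"] e p q by (simp add: eps_simps)
    also have "?a \<otimes>\<^bsub>PP\<^esub> ?w = eps p \<odot>\<^bsub>OW\<^esub> ?w" using K.W_right[of "eps p" ?w] e c[OF q] by simp
    also have "?b \<otimes>\<^bsub>PP\<^esub> ?v = eps q \<odot>\<^bsub>OW\<^esub> ?v" using K.W_right[of "eps q" ?v] e c[OF p] by simp
    finally have "p \<otimes>\<^bsub>PP\<^esub> q = (eps p \<odot>\<^bsub>OW\<^esub> ?w \<oplus>\<^bsub>OW\<^esub> eps q \<odot>\<^bsub>OW\<^esub> ?v) \<oplus>\<^bsub>PP\<^esub> J2 (eps (p \<otimes>\<^bsub>PP\<^esub> q))"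
      using z cc module.smult_closed[OF OW_module] e c p q W by (simp add: K.W_simps(1))
    moreover have "eps p \<odot>\<^bsub>OW\<^esub> ?w \<oplus>\<^bsub>OW\<^esub> eps q \<odot>\<^bsub>OW\<^esub> ?v \<in> carrier PP"
      using W K.W.M.a_closed module.smult_closed[OF OW_module] e c p q by simp
    ultimately show ?thesis unfolding omega_part_def[of "p \<otimes>\<^bsub>PP\<^esub> q"]
      using p q eps_simps(1)[of "p \<otimes>\<^bsub>PP\<^esub> q"] J2c by (subst abelian_minus_eq[OF K.P.is_abelian_group]) auto
  qed
  show "omega_part (J1 s) = \<ominus>\<^bsub>OW\<^esub> dS s" if s: "s \<in> carrier S" for s
    using s J1c[OF s] J2c[OF s] K.dd_closed[of s] W
    by (simp add: omega_part_def eps_simps K.W_neg univ_der_def a_minus_def K.P.minus_add K.P.a_ac)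
qed

end

text \<open>The extension for an arbitrary S-module. It serves algebras over S, the module N and,
  with T in place of S, the Atiyah extension.\<close>

locale ks_mod = ks_base \<Lambda> S l + N: module S N
  for \<Lambda> :: "('l, 'y) ring_scheme" and S :: "('s, 'w) ring_scheme" and l :: "'l \<Rightarrow> 's" and N :: "('s, 'n, 'v) module_scheme"
begin

sublocale JT: two_modules S OW N by (simp add: two_modules_def OW_module N.module_axioms)
sublocale ET: two_modules S PR N by (simp add: two_modules_def PR_module N.module_axioms)

abbreviation "JJ \<equiv> tensor S OW N"
abbreviation "EE \<equiv> tensor S PR N"
abbreviation "jt \<equiv> tens S OW N"
abbreviation "et \<equiv> tens S PR N"
abbreviation "inc \<equiv> tmap S PR N (\<lambda>w. w) (\<lambda>g. g)"
abbreviation "prj \<equiv> tlift N (\<lambda>p g. eps p \<odot>\<^bsub>N\<^esub> g)"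
abbreviation "unt g \<equiv> et \<one>\<^bsub>PP\<^esub> g"

definition "ret = tlift JJ (\<lambda>p g. jt (omega_part p) g)"

sublocale JG: abelian_group JJ by (rule JT.tensor_abelian_group)
sublocale EG: abelian_group EE by (rule ET.tensor_abelian_group)

lemma inc_addhom: "addhom JJ EE inc"
  and inc_tens: "w \<in> carrier OW ==> g \<in> carrier N ==> inc (jt w g) = et w g"
proof -
  have 1: "addhom OW PR (\<lambda>w. w)" by (rule addhomI) (auto simp: K.W_sub K.W_simps)
  have 2: "et (r \<odot>\<^bsub>OW\<^esub> m) n = et m (r \<odot>\<^bsub>N\<^esub> n)" if "r \<in> carrier S" "m \<in> carrier OW" "n \<in> carrier N" for r m n
    using that K.W_right[of r m] ET.tens_smult[of r m n] K.W_sub[of m] by simp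
  show "addhom JJ EE inc" "w \<in> carrier OW ==> g \<in> carrier N ==> inc (jt w g) = et w g"
    using tmap_addhom[OF ET.two_modules_axioms JT.two_modules_axioms 1 addhom_id 2] by auto
qed

lemma prj_addhom: "addhom EE N prj"
  and prj_tens: "p \<in> carrier PP ==> g \<in> carrier N ==> prj (et p g) = eps p \<odot>\<^bsub>N\<^esub> g"
proof -
  have b: "balanced S PR N N (\<lambda>p g. eps p \<odot>\<^bsub>N\<^esub> g)"
    by (rule balancedI) (use K.J_closed in \<open>auto simp: eps_simps N.smult_l_distr N.smult_r_distr N.smult_assoc1[symmetric] S.m_comm\<close>)
  show "addhom EE N prj" "p \<in> carrier PP ==> g \<in> carrier N ==> prj (et p g) = eps p \<odot>\<^bsub>N\<^esub> g"
    using ET.tlift_addhom[OF N.abelian_group_axioms b] ET.tlift_tens[OF N.abelian_group_axioms b] by auto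
qed

lemma ret_addhom: "addhom EE JJ ret"
  and ret_tens: "p \<in> carrier PP ==> g \<in> carrier N ==> ret (et p g) = jt (omega_part p) g"
proof -
  have b: "balanced S PR N JJ (\<lambda>p g. jt (omega_part p) g)"
  proof (rule balancedI)
    \<comment> \<open>Tensor products are formed through j2, so linearity of
      \<open>omega_part\<close> for j2 is the balance condition.\<close>
    show "jt (omega_part (r \<odot>\<^bsub>PR\<^esub> p)) g = jt (omega_part p) (r \<odot>\<^bsub>N\<^esub> g)" if "r \<in> carrier S" "p \<in> carrier PR" "g \<in> carrier N" for r p g
      using that omega_part(6)[of "J2 r" p] omega_part(1) omega_part(5)[of r] K.J_closed(2)[of r]
        module.smult_r_null[OF OW_module] module.smult_closed[OF OW_module, of r "omega_part p"] JT.tens_smult[of r "omega_part p" g] eps_simps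
      by simp
  qed (auto simp: omega_part(1) addhom_add[OF omega_part(3)] JT.tens_add_left JT.tens_add_right)
  show "addhom EE JJ ret" "p \<in> carrier PP ==> g \<in> carrier N ==> ret (et p g) = jt (omega_part p) g"
    unfolding ret_def using ET.tlift_addhom[OF JG.abelian_group_axioms b] ET.tlift_tens[OF JG.abelian_group_axioms b] by auto
qed

lemma unt_addhom: "addhom N EE unt"
  using ET.tens_addhom_right by simp

lemma ks_closed: "x \<in> carrier JJ ==> inc x \<in> carrier EE" "y \<in> carrier EE ==> prj y \<in> carrier N"
  "y \<in> carrier EE ==> ret y \<in> carrier JJ" "g \<in> carrier N ==> unt g \<in> carrier EE"
  using addhom_closed[OF inc_addhom] addhom_closed[OF prj_addhom] addhom_closed[OF ret_addhom] addhom_closed[OF unt_addhom] by auto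

lemma ret_inc: "x \<in> carrier JJ ==> ret (inc x) = x"
  by (rule JT.addhom_tensor_eqI[OF addhom_comp[OF inc_addhom ret_addhom] addhom_id])
    (auto simp: inc_tens ret_tens K.W_sub omega_part(4))

lemma prj_inc: "x \<in> carrier JJ ==> prj (inc x) = \<zero>\<^bsub>N\<^esub>"
  by (rule JT.addhom_tensor_eqI[OF addhom_comp[OF inc_addhom prj_addhom] addhom_const_zero[OF N.abelian_group_axioms]])
    (auto simp: inc_tens prj_tens K.W_sub eps_simps)

lemma prj_unt: "g \<in> carrier N ==> prj (unt g) = g"
  by (simp add: prj_tens eps_simps)

lemma ret_unt: "g \<in> carrier N ==> ret (unt g) = \<zero>\<^bsub>JJ\<^esub>"
  using omega_part(5)[of "\<one>\<^bsub>S\<^esub>"] K.J2_simps(3) by (simp add: ret_tens JT.tens_zero_left)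

text \<open>Split p into its \<Omega>-part and j2 of its augmentation; the latter moves across the
  tensor sign and leaves 1 on the left.\<close>

lemma ks_dec: "y \<in> carrier EE ==> y = inc (ret y) \<oplus>\<^bsub>EE\<^esub> unt (prj y)"
proof (rule ET.addhom_tensor_eqI[OF addhom_id addhom_sum[OF EG.abelian_group_axioms addhom_comp[OF ret_addhom inc_addhom] addhom_comp[OF prj_addhom unt_addhom]]])
  fix p g assume pg: "p \<in> carrier PR" "g \<in> carrier N"
  have e: "eps p \<in> carrier S" "J2 (eps p) \<in> carrier PP" using pg eps_simps(1) K.J_closed by auto
  have "et p g = et (omega_part p \<oplus>\<^bsub>PP\<^esub> J2 (eps p)) g" using omega_part(2)[of p] pg by simp
  also have "\<dots> = et (omega_part p) g \<oplus>\<^bsub>EE\<^esub> et (J2 (eps p)) g"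
    using ET.tens_add_left[of "omega_part p" "J2 (eps p)" g] pg e omega_part(1)[of p] K.W_sub by simp
  also have "et (J2 (eps p)) g = unt (eps p \<odot>\<^bsub>N\<^esub> g)" using ET.tens_smult[of "eps p" "\<one>\<^bsub>PP\<^esub>" g] pg e by simp
  finally have "et p g = et (omega_part p) g \<oplus>\<^bsub>EE\<^esub> unt (eps p \<odot>\<^bsub>N\<^esub> g)" .
  moreover have "inc (ret (et p g)) = et (omega_part p) g" "prj (et p g) = eps p \<odot>\<^bsub>N\<^esub> g"
    using pg omega_part(1) by (simp_all add: ret_tens prj_tens inc_tens)
  ultimately show "et p g = inc (ret (et p g)) \<oplus>\<^bsub>EE\<^esub> unt (prj (et p g))" by metis
qed

text \<open>\<open>ret\<close> and \<open>prj\<close> are coordinates on the extension, and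
  identities in it are checked there.\<close>

lemma EE_eqI:
  assumes "x \<in> carrier EE" "y \<in> carrier EE" "ret x = ret y" "prj x = prj y" shows "x = y"
  using ks_dec[OF assms(1)] ks_dec[OF assms(2)] assms(3,4) by simp

lemma left_module: "module S (tensor_left S PR N (pp_left \<Lambda> (alg l S)))"
  and left_smult: "r \<in> carrier S ==> p \<in> carrier PP ==> g \<in> carrier N ==>
    r \<odot>\<^bsub>tensor_left S PR N (pp_left \<Lambda> (alg l S))\<^esub> et p g = et (J1 r \<otimes>\<^bsub>PP\<^esub> p) g"
proof -
  have Jc: "r \<in> carrier S ==> J1 r \<in> carrier PP" "r \<in> carrier S ==> J2 r \<in> carrier PP" for r using K.J_closed by auto
  have ab: "abelian_group (modl PR (pp_left \<Lambda> (alg l S)))" using module.axioms(2)[OF PR_module] by simp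
  have J1a: "J1 (a \<oplus>\<^bsub>S\<^esub> b) = J1 a \<oplus>\<^bsub>PP\<^esub> J1 b" "J1 (a \<otimes>\<^bsub>S\<^esub> b) = J1 a \<otimes>\<^bsub>PP\<^esub> J1 b" if "a \<in> carrier S" "b \<in> carrier S" for a b
    using K.J1_simps(1,2)[of a b] that by auto
  have J11: "J1 \<one>\<^bsub>S\<^esub> = \<one>\<^bsub>PP\<^esub>" using K.J1_simps(3) by simp
  have 1: "module S (modl PR (pp_left \<Lambda> (alg l S)))"
    by (rule moduleI[OF S.is_cring ab]) (auto simp: pp_left_def Jc J1a J11 K.P.l_distr K.P.r_distr K.P.m_assoc)
  have 2: "pp_left \<Lambda> (alg l S) c (r \<odot>\<^bsub>PR\<^esub> n) = r \<odot>\<^bsub>PR\<^esub> pp_left \<Lambda> (alg l S) c n" if "c \<in> carrier S" "r \<in> carrier S" "n \<in> carrier PR" for c r n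
    using that Jc by (simp add: pp_left_def K.P.m_ac)
  note t = ET.tensor_left_module[OF 1 2]
  show "module S (tensor_left S PR N (pp_left \<Lambda> (alg l S)))" by (rule t(1))
  assume "r \<in> carrier S" "p \<in> carrier PP" "g \<in> carrier N"
  then have "r \<odot>\<^bsub>tensor_left S PR N (pp_left \<Lambda> (alg l S))\<^esub> et p g = et (pp_left \<Lambda> (alg l S) r p) g"
    using t(2)[of r p g] by simp
  then show "r \<odot>\<^bsub>tensor_left S PR N (pp_left \<Lambda> (alg l S))\<^esub> et p g = et (J1 r \<otimes>\<^bsub>PP\<^esub> p) g" by (simp only: pp_left_def)
qed

lemma dS_closed: "r \<in> carrier S ==> dS r \<in> carrier OW"
  using K.dd_closed by simp

end

section \<open>The Kodaira-Spencer extension of a graded algebra\<close>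

locale ks_data_alg = ks_base \<Lambda> S l + G: algebra S G
  for \<Lambda> :: "('l, 'y) ring_scheme" and S :: "('s, 'w) ring_scheme" and l :: "'l \<Rightarrow> 's" and G :: "('s, 'g) galg" +
  assumes grG: "graded_parts S G"
begin

lemma GM: "module S G" by (rule G.module)

sublocale JT: two_modules S OW G by (simp add: two_modules_def OW_module GM)
sublocale ET: two_algebras S PR G
  by (simp add: two_algebras_def two_modules_def PR_module GM PR_algebra G.algebra_axioms)

abbreviation "JJ \<equiv> tensor S OW G"
abbreviation "EE \<equiv> tensor S PR G"
abbreviation "KE \<equiv> ks_ext \<Lambda> S l G"
abbreviation "KK \<equiv> ks_ker \<Lambda> S l G"
abbreviation "jt \<equiv> tens S OW G"
abbreviation "et \<equiv> tens S PR G"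
abbreviation "inc \<equiv> ks_incl \<Lambda> S l G"
abbreviation "prj \<equiv> ks_proj S G"
abbreviation "unt g \<equiv> et \<one>\<^bsub>PP\<^esub> g"

lemma KE_simps: "carrier KE = carrier EE" "add KE = add EE" "ring.zero KE = ring.zero EE" "monoid.mult KE = monoid.mult EE"
  "one KE = one EE" "a_inv KE = a_inv EE" "a_minus KE = a_minus EE"
  "addhom KE B f \<longleftrightarrow> addhom EE B f" "addhom C KE g \<longleftrightarrow> addhom C EE g"
  by (simp_all add: ks_ext_def Let_def)

lemma KK_simps: "carrier KK = carrier JJ" "add KK = add JJ" "ring.zero KK = ring.zero JJ"
  "a_inv KK = a_inv JJ" "a_minus KK = a_minus JJ"
  "addhom KK B f \<longleftrightarrow> addhom JJ B f" "addhom C KK g \<longleftrightarrow> addhom C JJ g"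
  by (simp_all add: ks_ker_def Let_def)

lemma EE_cring: "cring EE" by (rule ET.tensor_cring)
sublocale EC: cring EE by (rule EE_cring)
sublocale JG: abelian_group JJ by (rule JT.tensor_abelian_group)

lemma KE_cring: "cring KE" using EE_cring by (simp add: ks_ext_def Let_def)

sublocale KN: ks_mod \<Lambda> S l G by (simp add: ks_mod_def ks_base_axioms GM)

abbreviation "ret \<equiv> KN.ret"

lemmas inc_addhom = KN.inc_addhom[folded ks_incl_def ks_proj_def]
lemmas inc_tens = KN.inc_tens[folded ks_incl_def ks_proj_def]
lemmas prj_addhom = KN.prj_addhom[folded ks_incl_def ks_proj_def]
lemmas prj_tens = KN.prj_tens[folded ks_incl_def ks_proj_def]
lemmas ret_addhom = KN.ret_addhom[folded ks_incl_def ks_proj_def]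
lemmas ret_tens = KN.ret_tens[folded ks_incl_def ks_proj_def]
lemmas unt_addhom = KN.unt_addhom[folded ks_incl_def ks_proj_def]
lemmas ks_closed = KN.ks_closed[folded ks_incl_def ks_proj_def]
lemmas ret_inc = KN.ret_inc[folded ks_incl_def ks_proj_def]
lemmas prj_inc = KN.prj_inc[folded ks_incl_def ks_proj_def]
lemmas prj_unt = KN.prj_unt[folded ks_incl_def ks_proj_def]
lemmas ret_unt = KN.ret_unt[folded ks_incl_def ks_proj_def]
lemmas ks_dec = KN.ks_dec[folded ks_incl_def ks_proj_def]
lemmas EE_eqI = KN.EE_eqI[folded ks_incl_def ks_proj_def]

lemma KK_module: "module G KK"
  and KK_smult: "g \<in> carrier G ==> w \<in> carrier OW ==> y \<in> carrier G ==> g \<odot>\<^bsub>KK\<^esub> jt w y = jt w (g \<otimes>\<^bsub>G\<^esub> y)" (is "PROP ?g1")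
proof -
  have 1: "module G (modl G (monoid.mult G))"
    by (rule moduleI) (auto simp: G.M_cring G.abelian_group_axioms G.l_distr G.r_distr G.m_assoc)
  have 2: "g \<otimes>\<^bsub>G\<^esub> (r \<odot>\<^bsub>G\<^esub> n) = r \<odot>\<^bsub>G\<^esub> (g \<otimes>\<^bsub>G\<^esub> n)" if "g \<in> carrier G" "r \<in> carrier S" "n \<in> carrier G" for g r n
    using algebra_smult_one(3)[OF G.algebra_axioms that(2,1,3)] .
  note t = JT.tensor_right_module[OF 1 2]
  interpret M: module G "tensor_right S OW G (monoid.mult G)" by (rule t(1))
  show "module G KK"
    by (rule moduleI[OF G.M_cring]) (use M.smult_closed M.smult_l_distr M.smult_r_distr M.smult_assoc1 M.smult_one in
      \<open>auto simp: ks_ker_def Let_def tensor_right_def\<close>)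
  show "PROP ?g1"
    using t(2) by (simp add: ks_ker_def Let_def)
qed

sublocale KM: module G KK by (rule KK_module)

lemma KK_sm: "g \<in> carrier G ==> x \<in> carrier JJ ==> g \<odot>\<^bsub>KK\<^esub> x \<in> carrier JJ"
  "g \<in> carrier G ==> x \<in> carrier JJ ==> y \<in> carrier JJ ==> g \<odot>\<^bsub>KK\<^esub> (x \<oplus>\<^bsub>JJ\<^esub> y) = g \<odot>\<^bsub>KK\<^esub> x \<oplus>\<^bsub>JJ\<^esub> g \<odot>\<^bsub>KK\<^esub> y"
  "g \<in> carrier G ==> g' \<in> carrier G ==> x \<in> carrier JJ ==> (g \<oplus>\<^bsub>G\<^esub> g') \<odot>\<^bsub>KK\<^esub> x = g \<odot>\<^bsub>KK\<^esub> x \<oplus>\<^bsub>JJ\<^esub> g' \<odot>\<^bsub>KK\<^esub> x"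
  using KM.smult_closed KM.smult_r_distr KM.smult_l_distr by (auto simp: KK_simps)

lemma prj_ring_hom: "prj \<in> ring_hom EE G"
proof (rule ring_hom_memI)
  show "prj (x \<otimes>\<^bsub>EE\<^esub> y) = prj x \<otimes>\<^bsub>G\<^esub> prj y" if x: "x \<in> carrier EE" and y: "y \<in> carrier EE" for x y
    using x
  proof (induction rule: ET.tensor_induct)
    case (tens p g)
    show ?case using y
    proof (induction rule: ET.tensor_induct)
      case (tens p' g')
      then show ?case using \<open>p \<in> _\<close> \<open>g \<in> _\<close> by (simp add: ET.tens_mult prj_tens eps_simps G.smult_assoc1[symmetric] G.smult_assoc2 algebra_smult_one(3)[OF G.algebra_axioms] S.m_comm)
    next
      case (add x y) then show ?case using tens by (simp add: EC.r_distr addhom_add[OF prj_addhom] ks_closed G.r_distr)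
    qed
  next
    case (add u v) then show ?case using y by (simp add: EC.l_distr addhom_add[OF prj_addhom] ks_closed G.l_distr)
  qed
  show "prj \<one>\<^bsub>EE\<^esub> = \<one>\<^bsub>G\<^esub>" by (simp add: ET.tensor_one prj_unt)
qed (auto simp: ks_closed addhom_add[OF prj_addhom])

text \<open>In the coordinates \<open>prj\<close> and \<open>ret\<close> the ring is a trivial
  square-zero extension; the S-algebra structure is what distinguishes it.\<close>

lemma ret_mult:
  assumes x: "x \<in> carrier EE" and y: "y \<in> carrier EE"
  shows "ret (x \<otimes>\<^bsub>EE\<^esub> y) = prj x \<odot>\<^bsub>KK\<^esub> ret y \<oplus>\<^bsub>JJ\<^esub> prj y \<odot>\<^bsub>KK\<^esub> ret x"
  using x
proof (induction rule: ET.tensor_induct)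
  case (tens p g)
  show ?case using y
  proof (induction rule: ET.tensor_induct)
    case (tens p' g')
    have c: "omega_part p \<in> carrier OW" "omega_part p' \<in> carrier OW" "eps p \<in> carrier S" "eps p' \<in> carrier S"
      using tens \<open>p \<in> _\<close> omega_part(1) eps_simps(1) by auto
    have "ret (et p g \<otimes>\<^bsub>EE\<^esub> et p' g') = jt (omega_part (p \<otimes>\<^bsub>PP\<^esub> p')) (g \<otimes>\<^bsub>G\<^esub> g')"
      using tens \<open>p \<in> _\<close> \<open>g \<in> _\<close> by (simp add: ET.tens_mult ret_tens)
    also have "\<dots> = jt (omega_part p') (eps p \<odot>\<^bsub>G\<^esub> (g \<otimes>\<^bsub>G\<^esub> g')) \<oplus>\<^bsub>JJ\<^esub> jt (omega_part p) (eps p' \<odot>\<^bsub>G\<^esub> (g \<otimes>\<^bsub>G\<^esub> g'))"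
      using tens \<open>p \<in> _\<close> \<open>g \<in> _\<close> c module.smult_closed[OF OW_module] by (simp add: omega_part(6) JT.tens_add_left JT.tens_smult)
    also have "\<dots> = prj (et p g) \<odot>\<^bsub>KK\<^esub> ret (et p' g') \<oplus>\<^bsub>JJ\<^esub> prj (et p' g') \<odot>\<^bsub>KK\<^esub> ret (et p g)"
      using tens \<open>p \<in> _\<close> \<open>g \<in> _\<close> c by (simp add: prj_tens ret_tens KK_smult G.smult_assoc2 G.m_comm[of g' g])
    finally show ?case .
  next
    case (add x y)
    then show ?case using tens
      by (simp add: EC.r_distr addhom_add[OF prj_addhom] addhom_add[OF ret_addhom] ks_closed KK_sm JG.a_ac)
  qed
next
  case (add u v)
  then show ?case using y
    by (simp add: EC.l_distr addhom_add[OF prj_addhom] addhom_add[OF ret_addhom] ks_closed KK_sm JG.a_ac)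
qed

lemma KE_module: "module S KE"
  and KE_smult: "r \<in> carrier S ==> p \<in> carrier PP ==> g \<in> carrier G ==> r \<odot>\<^bsub>KE\<^esub> et p g = et (J1 r \<otimes>\<^bsub>PP\<^esub> p) g" (is "PROP ?g1")
proof -
  interpret M: module S "tensor_left S PR G (pp_left \<Lambda> (alg l S))" by (rule KN.left_module)
  show "module S KE"
    by (rule moduleI[OF S.is_cring]) (use M.smult_closed M.smult_l_distr M.smult_r_distr M.smult_assoc1 M.smult_one in
      \<open>auto simp: ks_ext_def Let_def tensor_left_def EC.is_abelian_group\<close>)
  show "PROP ?g1"
    using KN.left_smult[of r p g] by (simp add: ks_ext_def Let_def)
qed

sublocale KEM: module S KE by (rule KE_module)

lemma KE_sm: "r \<in> carrier S ==> x \<in> carrier EE ==> r \<odot>\<^bsub>KE\<^esub> x \<in> carrier EE"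
  "r \<in> carrier S ==> x \<in> carrier EE ==> y \<in> carrier EE ==> r \<odot>\<^bsub>KE\<^esub> (x \<oplus>\<^bsub>EE\<^esub> y) = r \<odot>\<^bsub>KE\<^esub> x \<oplus>\<^bsub>EE\<^esub> r \<odot>\<^bsub>KE\<^esub> y"
  using KEM.smult_closed KEM.smult_r_distr by (auto simp: KE_simps)

text \<open>Scalars act as multiplication by j1(r) \<otimes> 1, so their effect on coordinates
  follows from that of products.\<close>

lemma KE_smult_mult:
  assumes r: "r \<in> carrier S" and x: "x \<in> carrier EE" shows "r \<odot>\<^bsub>KE\<^esub> x = et (J1 r) \<one>\<^bsub>G\<^esub> \<otimes>\<^bsub>EE\<^esub> x"
proof -
  have Jc: "J1 r \<in> carrier PP" using K.J_closed r by simp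
  have ec: "et (J1 r) \<one>\<^bsub>G\<^esub> \<in> carrier EE" using Jc by simp
  show ?thesis using x
  proof (induction rule: ET.tensor_induct)
    case (tens p g) then show ?case using r Jc by (simp add: KE_smult ET.tens_mult)
  next
    case (add x y) then show ?case using r ec by (simp add: KE_sm EC.r_distr)
  qed
qed

lemma KE_algebra: "algebra S KE"
proof -
  interpret C: cring KE by (rule KE_cring)
  have "(r \<odot>\<^bsub>KE\<^esub> x) \<otimes>\<^bsub>EE\<^esub> y = r \<odot>\<^bsub>KE\<^esub> (x \<otimes>\<^bsub>EE\<^esub> y)" if "r \<in> carrier S" "x \<in> carrier EE" "y \<in> carrier EE" for r x y
    using that KE_smult_mult K.J_closed by (simp add: EC.m_assoc)
  then show ?thesis
    by (intro algebraI[OF S.is_cring KE_cring])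
      (use KEM.smult_l_distr KEM.smult_r_distr KEM.smult_assoc1 in \<open>auto simp: KE_simps KE_sm\<close>)
qed

lemma prj_smult: "r \<in> carrier S ==> x \<in> carrier EE ==> prj (r \<odot>\<^bsub>KE\<^esub> x) = r \<odot>\<^bsub>G\<^esub> prj x"
  using K.J_closed by (simp add: KE_smult_mult ring_hom_mult[OF prj_ring_hom] prj_tens eps_simps G.smult_assoc2 ks_closed)

lemmas dS_closed = KN.dS_closed

text \<open>The scalars act through \<open>j\<^sub>1\<close>, the section \<open>unt\<close> is linear for \<open>j\<^sub>2\<close>.\<close>

definition "sc r = \<ominus>\<^bsub>JJ\<^esub> jt (dS r) \<one>\<^bsub>G\<^esub>"

lemma sc_closed: "r \<in> carrier S ==> sc r \<in> carrier JJ"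
  by (simp add: sc_def dS_closed)

text \<open>The second term is the trace of the difference between j1 and j2: it is the product rule
  applied to j1(r) \<otimes> 1.\<close>

lemma ret_smult:
  assumes "r \<in> carrier S" "x \<in> carrier EE"
  shows "ret (r \<odot>\<^bsub>KE\<^esub> x) = (r \<odot>\<^bsub>G\<^esub> \<one>\<^bsub>G\<^esub>) \<odot>\<^bsub>KK\<^esub> ret x \<oplus>\<^bsub>JJ\<^esub> prj x \<odot>\<^bsub>KK\<^esub> sc r"
  using assms K.J_closed
  by (simp add: KE_smult_mult ret_mult prj_tens eps_simps ret_tens omega_part(7) JT.tens_neg_left dS_closed sc_def)

lemma der_of_hom:
  assumes A: "algebra S A" and p: "alg_hom S A KE \<phi>" and pe: "\<And>x. x \<in> carrier A ==> prj (\<phi> x) = e x"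
  shows "der_along S A e KK sc (\<lambda>x. ret (\<phi> x))"
proof -
  interpret A: algebra S A by fact
  have ph: "\<phi> \<in> ring_hom A KE" "linear S A KE \<phi>" using p by (auto simp: alg_hom_def)
  have pc: "\<phi> x \<in> carrier EE" if "x \<in> carrier A" for x using ring_hom_closed[OF ph(1) that] by (simp add: KE_simps)
  have r1: "ret \<one>\<^bsub>EE\<^esub> = \<zero>\<^bsub>JJ\<^esub>" "prj \<one>\<^bsub>EE\<^esub> = \<one>\<^bsub>G\<^esub>" by (simp_all add: ET.tensor_one ret_unt prj_unt)
  show ?thesis unfolding der_along_def
  proof (intro conjI ballI)
    show "addhom A KK (\<lambda>x. ret (\<phi> x))"
      using addhom_comp[OF _ ret_addhom, of A \<phi>] ring_hom_addhom[OF ph(1)] by (simp add: KE_simps KK_simps)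
    show "ret (\<phi> (a \<otimes>\<^bsub>A\<^esub> b)) = e a \<odot>\<^bsub>KK\<^esub> ret (\<phi> b) \<oplus>\<^bsub>KK\<^esub> e b \<odot>\<^bsub>KK\<^esub> ret (\<phi> a)" if "a \<in> carrier A" "b \<in> carrier A" for a b
      using that ring_hom_mult[OF ph(1) that] by (simp add: KE_simps KK_simps ret_mult pc pe)
    show "ret (\<phi> (r \<odot>\<^bsub>A\<^esub> \<one>\<^bsub>A\<^esub>)) = sc r" if "r \<in> carrier S" for r
    proof -
      have "\<phi> (r \<odot>\<^bsub>A\<^esub> \<one>\<^bsub>A\<^esub>) = r \<odot>\<^bsub>KE\<^esub> \<one>\<^bsub>EE\<^esub>" using linear_smult[OF ph(2) that, of "\<one>\<^bsub>A\<^esub>"] ring_hom_one[OF ph(1)] by (simp add: KE_simps)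
      then show ?thesis using that sc_closed[OF that] KM.smult_one KM.smult_r_null by (simp add: ret_smult r1 KK_simps)
    qed
  qed
qed

text \<open>The converse of \<open>der_of_hom\<close>: algebra homomorphisms over e correspond to
  derivations along e with the values \<open>sc\<close> on scalars.\<close>

lemma hom_of_der:
  assumes A: "algebra S A" and e: "alg_hom S A G e" and D: "der_along S A e KK sc D"
  shows "alg_hom S A KE (\<lambda>x. inc (D x) \<oplus>\<^bsub>EE\<^esub> unt (e x))"
    and "x \<in> carrier A ==> ret (inc (D x) \<oplus>\<^bsub>EE\<^esub> unt (e x)) = D x"
    and "x \<in> carrier A ==> prj (inc (D x) \<oplus>\<^bsub>EE\<^esub> unt (e x)) = e x"
proof -
  interpret A: algebra S A by fact
  have eh: "e \<in> ring_hom A G" "linear S A G e" using e by (auto simp: alg_hom_def)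
  note d = der_alongD[OF D]
  have Dc: "D x \<in> carrier JJ" if "x \<in> carrier A" for x using addhom_closed[OF d(1) that] by (simp add: KK_simps)
  have ec: "e x \<in> carrier G" if "x \<in> carrier A" for x using ring_hom_closed[OF eh(1) that] .
  let ?p = "\<lambda>x. inc (D x) \<oplus>\<^bsub>EE\<^esub> unt (e x)"
  have pc: "?p x \<in> carrier EE" if "x \<in> carrier A" for x using that Dc ec ks_closed by simp
  show r: "ret (?p x) = D x" if "x \<in> carrier A" for x
    using that Dc[OF that] ec[OF that] by (simp add: addhom_add[OF ret_addhom] ks_closed ret_inc ret_unt)
  show pp: "prj (?p x) = e x" if "x \<in> carrier A" for x
    using that Dc[OF that] ec[OF that] by (simp add: addhom_add[OF prj_addhom] ks_closed prj_inc prj_unt)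
  show "alg_hom S A KE ?p" unfolding alg_hom_def
  proof (intro conjI ring_hom_memI linearI)
    show a: "addhom A KE ?p"
      using addhom_sum[OF EC.is_abelian_group addhom_comp[OF _ inc_addhom] addhom_comp[OF ring_hom_addhom[OF eh(1)] unt_addhom], of D] d(1)
      by (simp add: KE_simps KK_simps)
    then show "?p (x \<oplus>\<^bsub>A\<^esub> y) = ?p x \<oplus>\<^bsub>KE\<^esub> ?p y" if "x \<in> carrier A" "y \<in> carrier A" for x y
      using addhom_add[OF a that] by simp
    show "?p x \<in> carrier KE" if "x \<in> carrier A" for x using pc[OF that] by (simp add: KE_simps)
    show "?p (x \<otimes>\<^bsub>A\<^esub> y) = ?p x \<otimes>\<^bsub>KE\<^esub> ?p y" if xy: "x \<in> carrier A" "y \<in> carrier A" for x y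
    proof -
      have "ret (?p (x \<otimes>\<^bsub>A\<^esub> y)) = ret (?p x \<otimes>\<^bsub>EE\<^esub> ?p y)"
        unfolding r[OF A.m_closed[OF xy]] ret_mult[OF pc[OF xy(1)] pc[OF xy(2)]] r[OF xy(1)] r[OF xy(2)] pp[OF xy(1)] pp[OF xy(2)]
        using d(2)[OF xy] by (simp add: KK_simps)
      moreover have "prj (?p (x \<otimes>\<^bsub>A\<^esub> y)) = prj (?p x \<otimes>\<^bsub>EE\<^esub> ?p y)"
        unfolding pp[OF A.m_closed[OF xy]] ring_hom_mult[OF prj_ring_hom pc[OF xy(1)] pc[OF xy(2)]] pp[OF xy(1)] pp[OF xy(2)]
        by (rule ring_hom_mult[OF eh(1) xy])
      ultimately show ?thesis using EE_eqI pc xy by (simp add: KE_simps)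
    qed
    show "?p \<one>\<^bsub>A\<^esub> = \<one>\<^bsub>KE\<^esub>"
      using der_along_one[OF KK_module A.M_cring eh(1) D] addhom_zero[OF JG.abelian_group_axioms EC.is_abelian_group inc_addhom]
      by (simp add: ring_hom_one[OF eh(1)] KE_simps KK_simps ET.tensor_one)
    show "?p (s \<odot>\<^bsub>A\<^esub> x) = s \<odot>\<^bsub>KE\<^esub> ?p x" if sx: "s \<in> carrier S" "x \<in> carrier A" for s x
    proof -
      have s1: "s \<odot>\<^bsub>A\<^esub> \<one>\<^bsub>A\<^esub> \<in> carrier A" using sx by simp
      have e1: "e (s \<odot>\<^bsub>A\<^esub> \<one>\<^bsub>A\<^esub>) = s \<odot>\<^bsub>G\<^esub> \<one>\<^bsub>G\<^esub>" using linear_smult[OF eh(2) sx(1), of "\<one>\<^bsub>A\<^esub>"] ring_hom_one[OF eh(1)] by simp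
      have "D (s \<odot>\<^bsub>A\<^esub> x) = D ((s \<odot>\<^bsub>A\<^esub> \<one>\<^bsub>A\<^esub>) \<otimes>\<^bsub>A\<^esub> x)" using algebra_smult_one(2)[OF A sx] by simp
      also have "\<dots> = (s \<odot>\<^bsub>G\<^esub> \<one>\<^bsub>G\<^esub>) \<odot>\<^bsub>KK\<^esub> D x \<oplus>\<^bsub>KK\<^esub> e x \<odot>\<^bsub>KK\<^esub> sc s"
        using d(2)[OF s1 sx(2)] d(3)[OF sx(1)] e1 by simp
      finally have 1: "D (s \<odot>\<^bsub>A\<^esub> x) = (s \<odot>\<^bsub>G\<^esub> \<one>\<^bsub>G\<^esub>) \<odot>\<^bsub>KK\<^esub> D x \<oplus>\<^bsub>KK\<^esub> e x \<odot>\<^bsub>KK\<^esub> sc s" .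
      have sxA: "s \<odot>\<^bsub>A\<^esub> x \<in> carrier A" using sx by simp
      have "ret (?p (s \<odot>\<^bsub>A\<^esub> x)) = ret (s \<odot>\<^bsub>KE\<^esub> ?p x)"
        unfolding r[OF sxA] ret_smult[OF sx(1) pc[OF sx(2)]] r[OF sx(2)] pp[OF sx(2)] using 1 by (simp add: KK_simps)
      moreover have "prj (?p (s \<odot>\<^bsub>A\<^esub> x)) = prj (s \<odot>\<^bsub>KE\<^esub> ?p x)"
        unfolding pp[OF sxA] prj_smult[OF sx(1) pc[OF sx(2)]] pp[OF sx(2)] using linear_smult[OF eh(2) sx] .
      ultimately show ?thesis using EE_eqI[OF pc[OF sxA] KE_sm(1)[OF sx(1) pc[OF sx(2)]]] by blast
    qed
  qed
qed

lemma G_gr: "subgroup (dpart G k) (add_monoid G)" "\<one>\<^bsub>G\<^esub> \<in> dpart G 0"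
  "x \<in> dpart G j ==> y \<in> dpart G k ==> x \<otimes>\<^bsub>G\<^esub> y \<in> dpart G (j + k)" "r \<in> carrier S ==> x \<in> dpart G k ==> r \<odot>\<^bsub>G\<^esub> x \<in> dpart G k"
  using grG by (auto simp: graded_parts_def)

lemma G_gr_carrier: "x \<in> dpart G k ==> x \<in> carrier G" using subgroup.subset[OF G_gr(1)] by auto

lemma KE_dpart: "dpart KE k = aspan EE {et p g | p g. p \<in> carrier PP \<and> g \<in> dpart G k}"
  by (simp add: ks_ext_def Let_def)

lemma KK_dpart: "dpart KK k = aspan JJ {jt w g | w g. w \<in> carrier OW \<and> g \<in> dpart G k}"
  by (simp add: ks_ker_def Let_def)

lemma KE_gens: "{et p g | p g. p \<in> carrier PP \<and> g \<in> dpart G k} \<subseteq> carrier EE"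
  and KK_gens: "{jt w g | w g. w \<in> carrier OW \<and> g \<in> dpart G k} \<subseteq> carrier JJ"
  using G_gr_carrier ET.tens_closed JT.tens_closed by fastforce+

lemma KE_sub: "subgroup (dpart KE k) (add_monoid EE)" and KK_sub: "subgroup (dpart KK k) (add_monoid JJ)"
  unfolding KE_dpart KK_dpart using aspan_subgroup[OF EC.is_abelian_group KE_gens] aspan_subgroup[OF JG.abelian_group_axioms KK_gens] by auto

lemma KE_sub_carrier: "x \<in> dpart KE k ==> x \<in> carrier EE" and KK_sub_carrier: "y \<in> dpart KK k ==> y \<in> carrier JJ"
  using subgroup.subset[OF KE_sub] subgroup.subset[OF KK_sub] by auto

lemma KE_dpart_add: "x \<in> dpart KE k ==> y \<in> dpart KE k ==> x \<oplus>\<^bsub>EE\<^esub> y \<in> dpart KE k"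
  and KK_dpart_add: "x' \<in> dpart KK k ==> y' \<in> dpart KK k ==> x' \<oplus>\<^bsub>JJ\<^esub> y' \<in> dpart KK k"
  using subgroup.m_closed[OF KE_sub] subgroup.m_closed[OF KK_sub] by auto

lemma KK_dpart_act:
  assumes g: "g \<in> dpart G k" and x: "x \<in> dpart KK m" shows "g \<odot>\<^bsub>KK\<^esub> x \<in> dpart KK (k + m)"
proof -
  have h: "addhom JJ JJ (\<lambda>x. g \<odot>\<^bsub>KK\<^esub> x)" by (rule addhomI) (auto simp: KK_sm G_gr_carrier[OF g])
  show ?thesis
  proof (rule aspan_image[OF JG.abelian_group_axioms JG.abelian_group_axioms KK_gens h KK_sub _ x[unfolded KK_dpart]])
    fix y assume "y \<in> {jt w g |w g. w \<in> carrier OW \<and> g \<in> dpart G m}"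
    then obtain w g' where y: "y = jt w g'" "w \<in> carrier OW" "g' \<in> dpart G m" by blast
    then have "g \<odot>\<^bsub>KK\<^esub> y = jt w (g \<otimes>\<^bsub>G\<^esub> g')" using KK_smult G_gr_carrier g by simp
    then show "g \<odot>\<^bsub>KK\<^esub> y \<in> dpart KK (k + m)" unfolding KK_dpart using y G_gr(3)[OF g y(3)] by (auto intro: aspan_incl)
  qed
qed

lemma KK_graded_module: "graded_module G (dpart G) KK"
proof -
  have "subgroup (dpart KK k) (add_monoid KK)" for k
    using KK_sub[of k] by (simp add: subgroup_def m_inv_def KK_simps)
  then show ?thesis unfolding graded_module_def using KK_module KK_dpart_act by blast
qed

lemma ks_graded: "x \<in> dpart KK k ==> inc x \<in> dpart KE k" "g \<in> dpart G k ==> unt g \<in> dpart KE k"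
  "y \<in> dpart KE k ==> ret y \<in> dpart KK k" "y \<in> dpart KE k ==> prj y \<in> dpart G k"
proof -
  note Ja = JG.abelian_group_axioms and Ea = EC.is_abelian_group
  show "inc x \<in> dpart KE k" if "x \<in> dpart KK k"
  proof (rule aspan_image[OF Ja Ea KK_gens inc_addhom KE_sub _ that[unfolded KK_dpart]])
    fix y assume "y \<in> {jt w g |w g. w \<in> carrier OW \<and> g \<in> dpart G k}"
    then obtain w g where "y = jt w g" "w \<in> carrier OW" "g \<in> dpart G k" by blast
    then have "inc y = et w g" "w \<in> carrier PP" "g \<in> dpart G k" using inc_tens G_gr_carrier K.W_sub by auto
    then show "inc y \<in> dpart KE k" unfolding KE_dpart by (auto intro: aspan_incl)
  qed
  show "unt g \<in> dpart KE k" if "g \<in> dpart G k" unfolding KE_dpart using that by (auto intro!: aspan_incl)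
  show "ret y \<in> dpart KK k" if "y \<in> dpart KE k"
  proof (rule aspan_image[OF Ea Ja KE_gens ret_addhom KK_sub _ that[unfolded KE_dpart]])
    fix y assume "y \<in> {et w g |w g. w \<in> carrier PP \<and> g \<in> dpart G k}"
    then obtain w g where "y = et w g" "w \<in> carrier PP" "g \<in> dpart G k" by blast
    then have "ret y = jt (omega_part w) g" "omega_part w \<in> carrier OW" "g \<in> dpart G k" using ret_tens G_gr_carrier omega_part(1) by auto
    then show "ret y \<in> dpart KK k" unfolding KK_dpart by (auto intro: aspan_incl)
  qed
  show "prj y \<in> dpart G k" if "y \<in> dpart KE k"
  proof (rule aspan_image[OF Ea G.abelian_group_axioms KE_gens prj_addhom G_gr(1) _ that[unfolded KE_dpart]])
    fix y assume "y \<in> {et w g |w g. w \<in> carrier PP \<and> g \<in> dpart G k}"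
    then obtain w g where "y = et w g" "w \<in> carrier PP" "g \<in> dpart G k" by blast
    then show "prj y \<in> dpart G k" using prj_tens G_gr_carrier eps_simps(1) G_gr(4) by auto
  qed
qed

text \<open>Degrees, too, can be read off from the coordinates.\<close>

lemma KE_dpart_iff: "y \<in> carrier EE ==> ret y \<in> dpart KK k ==> prj y \<in> dpart G k ==> y \<in> dpart KE k"
  using ks_dec[of y] KE_dpart_add[OF ks_graded(1,2)] by metis

lemma KE_graded:
  "\<one>\<^bsub>EE\<^esub> \<in> dpart KE 0"
  "x \<in> dpart KE j ==> y \<in> dpart KE k ==> x \<otimes>\<^bsub>EE\<^esub> y \<in> dpart KE (j + k)"
  "r \<in> carrier S ==> x \<in> dpart KE k ==> r \<odot>\<^bsub>KE\<^esub> x \<in> dpart KE k"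
proof -
  show "\<one>\<^bsub>EE\<^esub> \<in> dpart KE 0" using ks_graded(2)[OF G_gr(2)] by (simp add: ET.tensor_one)
  show m: "x \<otimes>\<^bsub>EE\<^esub> y \<in> dpart KE (j + k)" if x: "x \<in> dpart KE j" and y: "y \<in> dpart KE k" for x y j k
  proof (rule KE_dpart_iff)
    note c = KE_sub_carrier[OF x] KE_sub_carrier[OF y]
    show "x \<otimes>\<^bsub>EE\<^esub> y \<in> carrier EE" using c by simp
    have "prj y \<odot>\<^bsub>KK\<^esub> ret x \<in> dpart KK (j + k)" using KK_dpart_act[OF ks_graded(4)[OF y] ks_graded(3)[OF x]] by (simp add: add.commute)
    then show "ret (x \<otimes>\<^bsub>EE\<^esub> y) \<in> dpart KK (j + k)"
      unfolding ret_mult[OF c] using KK_dpart_act[OF ks_graded(4)[OF x] ks_graded(3)[OF y]] by (rule KK_dpart_add[rotated])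
    show "prj (x \<otimes>\<^bsub>EE\<^esub> y) \<in> dpart G (j + k)"
      using G_gr(3)[OF ks_graded(4)[OF x] ks_graded(4)[OF y]] ring_hom_mult[OF prj_ring_hom c] by simp
  qed
  show "r \<odot>\<^bsub>KE\<^esub> x \<in> dpart KE k" if r: "r \<in> carrier S" and x: "x \<in> dpart KE k"
  proof -
    have "et (J1 r) \<one>\<^bsub>G\<^esub> \<in> dpart KE 0" unfolding KE_dpart using G_gr(2) K.J_closed(1)[of r] r by (intro aspan_incl CollectI exI[of _ "J1 r"] exI[of _ "\<one>\<^bsub>G\<^esub>"]) simp
    from m[OF this x] show ?thesis using KE_smult_mult[OF r KE_sub_carrier[OF x]] by simp
  qed
qed

end

section \<open>The Kodaira-Spencer class of a resolved algebra\<close>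

locale ks_res = ks_data_alg \<Lambda> S l G
  for \<Lambda> :: "('l, 'y) ring_scheme" and S :: "('s, 'w) ring_scheme" and l :: "'l \<Rightarrow> 's" and G :: "('s, 'g) galg" +
  fixes P :: "('s, 'p, 'g) sres"
  assumes res: "sres_of S G P"
begin

sublocale R: sres_res S G P by (simp add: sres_res_def G.algebra_axioms grG res)

lemma aug_alg_hom: "alg_hom S (obj P 0) G (aug P)" using R.augn_alg_hom[of 0] by simp

lemma graded_lift_of_hom:
  assumes p: "galg_hom S (obj P 0) KE \<phi>" and pe: "\<And>x. x \<in> carrier (obj P 0) ==> prj (\<phi> x) = aug P x"
  shows "graded_lift S P KK sc (\<lambda>x. ret (\<phi> x))"
proof -
  have a: "alg_hom S (obj P 0) KE \<phi>" and g: "x \<in> dpart (obj P 0) k ==> \<phi> x \<in> dpart KE k" for x k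
    using p unfolding galg_hom_def by blast+
  show ?thesis unfolding graded_lift_def using der_of_hom[OF R.obj_algebra a pe] ks_graded(3) g by blast
qed

lemma graded_hom_exists:
  obtains \<phi> where "galg_hom S (obj P 0) KE \<phi>" "\<And>x. x \<in> carrier (obj P 0) ==> prj (\<phi> x) = aug P x"
proof -
  obtain X where X: "X \<subseteq> (\<Union>k. dpart (obj P 0) k)" and free: "free_algebra_on S (obj P 0) X" by (rule R.obj_free)
  have XA: "X \<subseteq> carrier (obj P 0)" using free by (simp add: free_algebra_on_def)
  have ac: "aug P x \<in> carrier G" if "x \<in> carrier (obj P 0)" for x using R.augn_closed[of x 0] that by simp
  \<comment> \<open>On the variables the ring section provides homogeneous lifts; on other elements
    S-linearity may force a different value.\<close>
  have "(\<lambda>x. unt (aug P x)) \<in> X \<rightarrow> carrier KE" using XA ac ks_closed by (auto simp: KE_simps)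
  then obtain \<phi> where p: "alg_hom S (obj P 0) KE \<phi>" "\<And>x. x \<in> X ==> \<phi> x = unt (aug P x)"
    using free_algebra_hom[OF R.obj_algebra KE_algebra free] by blast
  have sub: "subgroup (dpart KE k) (add_monoid KE)" for k
    using KE_sub[of k] by (simp add: subgroup_def m_inv_def KE_simps)
  have "\<phi> ` dpart (obj P 0) k \<subseteq> dpart KE k" for k
    by (rule free_graded_hom[OF R.obj_graded X free KE_algebra p(1) sub])
      (use KE_graded ks_graded(2) R.augn_dpart[of _ 0] p(2) in \<open>auto simp: KE_simps\<close>)
  then have g: "galg_hom S (obj P 0) KE \<phi>" using p by (simp add: galg_hom_def)
  have ph: "\<phi> \<in> ring_hom (obj P 0) KE" "linear S (obj P 0) KE \<phi>" using p(1) by (auto simp: alg_hom_def)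
  have pc: "\<phi> x \<in> carrier EE" if "x \<in> carrier (obj P 0)" for x using ring_hom_closed[OF ph(1) that] by (simp add: KE_simps)
  have "alg_hom S (obj P 0) G (\<lambda>x. prj (\<phi> x))"
    unfolding alg_hom_def
  proof (intro conjI ring_hom_memI linearI)
    show a: "addhom (obj P 0) G (\<lambda>x. prj (\<phi> x))" using addhom_comp[OF _ prj_addhom, of "obj P 0" \<phi>] ring_hom_addhom[OF ph(1)] by (simp add: KE_simps)
    show "prj (\<phi> (x \<oplus>\<^bsub>obj P 0\<^esub> y)) = prj (\<phi> x) \<oplus>\<^bsub>G\<^esub> prj (\<phi> y)" if "x \<in> carrier (obj P 0)" "y \<in> carrier (obj P 0)" for x y
      using addhom_add[OF a that] .
    show "prj (\<phi> (x \<otimes>\<^bsub>obj P 0\<^esub> y)) = prj (\<phi> x) \<otimes>\<^bsub>G\<^esub> prj (\<phi> y)" if "x \<in> carrier (obj P 0)" "y \<in> carrier (obj P 0)" for x y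
      using ring_hom_mult[OF ph(1) that] ring_hom_mult[OF prj_ring_hom pc pc] that by (simp add: KE_simps)
    show "prj (\<phi> \<one>\<^bsub>obj P 0\<^esub>) = \<one>\<^bsub>G\<^esub>" using ring_hom_one[OF ph(1)] ring_hom_one[OF prj_ring_hom] by (simp add: KE_simps)
    show "prj (\<phi> (r \<odot>\<^bsub>obj P 0\<^esub> x)) = r \<odot>\<^bsub>G\<^esub> prj (\<phi> x)" if "r \<in> carrier S" "x \<in> carrier (obj P 0)" for r x
      using linear_smult[OF ph(2) that] prj_smult[OF that(1) pc[OF that(2)]] by simp
    show "prj (\<phi> x) \<in> carrier G" if "x \<in> carrier (obj P 0)" for x using ks_closed(2)[OF pc[OF that]] .
  qed
  then have "prj (\<phi> x) = aug P x" if "x \<in> carrier (obj P 0)" for x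
    by (rule free_algebra_hom_eqI[OF R.obj_algebra G.algebra_axioms free _ aug_alg_hom _ that]) (use p(2) prj_unt ac XA in auto)
  then show thesis using that[OF g] by blast
qed

text \<open>Applying \<open>ret\<close> makes the cocycles of homomorphisms into cocycles of lifts.
  The latter fill one coset, so one homomorphism is enough for equality of the classes.\<close>

lemma KS_class_eq: "KS_class \<Lambda> S l G P = lift_cocycles S G P KK sc"
  and lift_cocycles_ne: "lift_cocycles S G P KK sc \<noteq> {}"
proof -
  note KG = KK_graded_module
  let ?u = "\<lambda>x. R.CT (Suc 0) (R.du (Suc 0) x) \<one>\<^bsub>G\<^esub>"
  let ?Z = "{f \<in> glinmaps G (cot S P G 1) KK. \<exists>\<phi>. galg_hom S (obj P 0) KE \<phi> \<and> (\<forall>x\<in>carrier (obj P 0). prj (\<phi> x) = aug P x) \<and>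
    (\<forall>x\<in>carrier (obj P 1). inc (f (cot_tens S P G 1 (univ_der S (obj P 1) x) \<one>\<^bsub>G\<^esub>)) = \<phi> (face P 0 0 x) \<ominus>\<^bsub>KE\<^esub> \<phi> (face P 0 1 x))}"
  have ph: "addhom (obj P 0) EE \<phi>" if "galg_hom S (obj P 0) KE \<phi>" for \<phi>
    using that ring_hom_addhom[of \<phi> "obj P 0" KE] by (simp add: galg_hom_def alg_hom_def KE_simps)
  have alt: "\<phi> (face P 0 0 x) \<ominus>\<^bsub>KE\<^esub> \<phi> (face P 0 1 x) = \<phi> (alt_bd P 0 x)" if "galg_hom S (obj P 0) KE \<phi>" "x \<in> carrier (obj P (Suc 0))" for \<phi> x
    using R.face1_closed[OF KG that(2)] addhom_minus[OF R.obj_ab EC.is_abelian_group ph[OF that(1)]] R.alt_bd_0[OF that(2)] by (simp add: KE_simps)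
  have fz: "f (?u x) \<in> carrier JJ" if "f \<in> glinmaps G (cot S P G (Suc 0)) KK" "x \<in> carrier (obj P (Suc 0))" for f x
    using linmaps_mem[of f G "cot S P G (Suc 0)" KK] that R.CT_closed[OF that(2), of "\<one>\<^bsub>G\<^esub>"] by (simp add: glinmaps_def R.cot_simps KK_simps)
  have sub: "?Z \<subseteq> lift_cocycles S G P KK sc"
  proof
    fix f assume "f \<in> ?Z"
    then obtain \<phi> where f: "f \<in> glinmaps G (cot S P G (Suc 0)) KK" and p: "galg_hom S (obj P 0) KE \<phi>"
      "\<And>x. x \<in> carrier (obj P 0) ==> prj (\<phi> x) = aug P x"
      "\<And>x. x \<in> carrier (obj P (Suc 0)) ==> inc (f (?u x)) = \<phi> (face P 0 0 x) \<ominus>\<^bsub>KE\<^esub> \<phi> (face P 0 1 x)" by auto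
    have "f (?u x) = ret (\<phi> (alt_bd P 0 x))" if x: "x \<in> carrier (obj P (Suc 0))" for x
      using ret_inc[OF fz[OF f x]] p(3)[OF x] alt[OF p(1) x] by simp
    then show "f \<in> lift_cocycles S G P KK sc" using f graded_lift_of_hom[OF p(1,2)] by (auto simp: lift_cocycles_def)
  qed
  obtain \<phi> where p: "galg_hom S (obj P 0) KE \<phi>" "\<And>x. x \<in> carrier (obj P 0) ==> prj (\<phi> x) = aug P x" by (rule graded_hom_exists) blast
  have D: "graded_lift S P KK sc (\<lambda>x. ret (\<phi> x))" by (rule graded_lift_of_hom[OF p])
  obtain f where f: "f \<in> glinmaps G (cot S P G (Suc 0)) KK" "f \<in> lift_cocycles S G P KK sc"
    "\<And>x y. x \<in> carrier (obj P (Suc 0)) ==> y \<in> carrier G ==> f (R.CT (Suc 0) (R.du (Suc 0) x) y) = y \<odot>\<^bsub>KK\<^esub> ret (\<phi> (alt_bd P 0 x))"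
    by (rule R.lift_cocycle_exists[OF KG D]) blast
  then show "lift_cocycles S G P KK sc \<noteq> {}" by blast
  have "inc (f (?u x)) = \<phi> (face P 0 0 x) \<ominus>\<^bsub>KE\<^esub> \<phi> (face P 0 1 x)" if x: "x \<in> carrier (obj P (Suc 0))" for x
  proof -
    note a = R.alt_bd_closed[OF x]
    note c = addhom_closed[OF ph[OF p(1)] a]
    have "\<one>\<^bsub>G\<^esub> \<odot>\<^bsub>KK\<^esub> ret (\<phi> (alt_bd P 0 x)) = ret (\<phi> (alt_bd P 0 x))" using ks_closed(3)[OF c] by (simp add: KK_simps)
    \<comment> \<open>Boundaries have augmentation 0, so their images under \<phi> come from
      \<Omega> \<otimes> G.\<close>
    moreover have "\<phi> (alt_bd P 0 x) = inc (ret (\<phi> (alt_bd P 0 x)))"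
      using ks_dec[OF c] p(2)[OF a] R.alt_bd_aug[OF x] ET.tens_zero_right[of "\<one>\<^bsub>PP\<^esub>"] ks_closed(1)[OF ks_closed(3)[OF c]] by simp
    ultimately show ?thesis using f(3)[OF x G.one_closed] alt[OF p(1) x] by simp
  qed
  then have "f \<in> ?Z" using f(1) p by auto
  then have "?Z \<noteq> {}" by blast
  then show "KS_class \<Lambda> S l G P = lift_cocycles S G P KK sc"
    unfolding KS_class_def alg_ext_class_def using R.lift_cocycles_class(1)[OF KG sub] by simp
qed

lemma KS_class_carrier: "KS_class \<Lambda> S l G P \<in> carrier (AQ 1 S P G KK)"
  unfolding KS_class_eq by (rule R.lift_cocycles_class(2)[OF KK_graded_module lift_cocycles_ne])

end

section \<open>The parts of the Kodaira-Spencer extension of a trivial extension\<close>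

lemma aspan_eqI:
  assumes A: "abelian_group A" and B: "abelian_group B" and X: "X \<subseteq> carrier A" and f: "addhom A B f" and g: "addhom A B g"
    and eq: "\<And>x. x \<in> X ==> f x = g x" and x: "x \<in> aspan A X"
  shows "f x = g x"
proof -
  interpret A: abelian_group A by fact
  interpret B: abelian_group B by fact
  have c: "y \<in> carrier A" if "y \<in> aspan A X" for y using that subgroup.subset[OF aspan_subgroup[OF A X]] by auto
  have sg: "subgroup {\<zero>\<^bsub>B\<^esub>} (add_monoid B)" using group.triv_subgroup[OF B.a_group] by simp
  have "f x \<ominus>\<^bsub>B\<^esub> g x \<in> {\<zero>\<^bsub>B\<^esub>}"
  proof (rule aspan_image[OF A B X addhom_diff[OF B f g] sg _ x])
    fix y assume "y \<in> X"
    then show "f y \<ominus>\<^bsub>B\<^esub> g y \<in> {\<zero>\<^bsub>B\<^esub>}" using eq addhom_closed[OF g] X by (auto simp: B.r_neg a_minus_def)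
  qed
  then show ?thesis using addhom_closed[OF f c[OF x]] addhom_closed[OF g c[OF x]] abelian_minus_eq[OF B, of "f x" "g x" "\<zero>\<^bsub>B\<^esub>"] by simp
qed

lemma tmap_right:
  assumes M: "two_modules R M N" and M': "two_modules R M N'" and v: "linear R N N' v"
  shows "addhom (tensor R M N) (tensor R M N') (tmap R M N' (\<lambda>x. x) v)" (is "PROP ?g1")
    and "m \<in> carrier M ==> n \<in> carrier N ==> tmap R M N' (\<lambda>x. x) v (tens R M N m n) = tens R M N' m (v n)"
proof -
  have "tens R M N' (r \<odot>\<^bsub>M\<^esub> m) (v n) = tens R M N' m (v (r \<odot>\<^bsub>N\<^esub> n))" if "r \<in> carrier R" "m \<in> carrier M" "n \<in> carrier N" for r m n
    using that linear_smult[OF v] addhom_closed[OF linear_addhom[OF v]] two_modules.tens_smult[OF M'] by simp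
  note t = tmap_addhom[OF M' M addhom_id linear_addhom[OF v] this]
  show "PROP ?g1"
    and "m \<in> carrier M ==> n \<in> carrier N ==> tmap R M N' (\<lambda>x. x) v (tens R M N m n) = tens R M N' m (v n)"
    using t by auto
qed

locale ks_setup = ks_base \<Lambda> S l + T: cring T + N: module T N
  for \<Lambda> :: "('l, 'y) ring_scheme" and S :: "('s, 'w) ring_scheme" and l :: "'l \<Rightarrow> 's"
    and T :: "('t, 'u) ring_scheme" and N :: "('t, 'n) module" +
  fixes h :: "'s \<Rightarrow> 't"
  assumes h: "h \<in> ring_hom S T"
begin

abbreviation "TU \<equiv> ungr (alg h T)"
abbreviation "GG \<equiv> Gam h T N"
abbreviation "NS \<equiv> restr_scalars h N"

lemma TU_algebra: "algebra S TU" by (rule ungr_algebra[OF alg_algebra[OF S.is_cring T.is_cring h]])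

lemma TU_graded: "graded_parts S TU"
proof -
  interpret A: algebra S TU by (rule TU_algebra)
  have g: "group (add_monoid T)" by (rule T.a_group)
  have "subgroup (dpart TU k) (add_monoid TU)" for k
    using group.subgroup_self[OF g] group.triv_subgroup[OF g] by (simp add: ungr_def alg_def subgroup_def m_inv_def)
  then show ?thesis using ring_hom_closed[OF h] by (auto simp: graded_parts_def ungr_def)
qed

sublocale D0: ks_data_alg \<Lambda> S l TU
  by (simp add: ks_data_alg_def ks_data_alg_axioms_def ks_base_axioms TU_algebra TU_graded)

sublocale D1: ks_data_alg \<Lambda> S l GG
  using Gam_algebra[OF S.is_cring N.module_axioms h] Gam_graded[OF S.is_cring N.module_axioms h]
  by (simp add: ks_data_alg_def ks_data_alg_axioms_def ks_base_axioms)

sublocale M1: ks_mod \<Lambda> S l NS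
  by (simp add: ks_mod_def ks_base_axioms restr_scalars_module[OF S.is_cring N.module_axioms h])

lemma h_closed [simp]: "s \<in> carrier S ==> h s \<in> carrier T" using ring_hom_closed[OF h] .

lemma Gam_linear: "linear S TU GG (in0 N)" "linear S GG TU fst" "linear S NS GG (in1 T)" "linear S GG NS snd"
  by (rule linearI, rule addhomI; auto simp: in0_def in1_def N.smult_r_null)+

abbreviation "O0 \<equiv> Omega_in0 \<Lambda> S l h T N"
abbreviation "O1 \<equiv> Omega_in1 \<Lambda> S l h T N"
text \<open>\<open>e0\<close> and \<open>e1\<close> include the parts of degree 0 and 1 in the
  extension of \<Gamma>, as \<open>Omega_in0\<close> and \<open>Omega_in1\<close> do in its kernel;
  \<open>q0\<close>, \<open>q1\<close> and \<open>r1\<close> are additive retractions induced by the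
  projections of \<Gamma>.\<close>

definition "e0 = tmap S PR GG (\<lambda>p. p) (in0 N)"
definition "e1 = tmap S PR GG (\<lambda>p. p) (in1 T)"
definition "q0 = tmap S OW TU (\<lambda>w. w) fst"
definition "q1 = tmap S OW NS (\<lambda>w. w) snd"
definition "r1 = tmap S PR NS (\<lambda>w. w) snd"

lemmas twm = D0.JT.two_modules_axioms D1.JT.two_modules_axioms M1.JT.two_modules_axioms
  D0.ET.two_modules_axioms D1.ET.two_modules_axioms M1.ET.two_modules_axioms

lemmas O0_addhom = tmap_right(1)[OF twm(1,2) Gam_linear(1), folded Omega_in0_def]
  and O1_addhom = tmap_right(1)[OF twm(3,2) Gam_linear(3), folded Omega_in1_def]
  and q0_addhom = tmap_right(1)[OF twm(2,1) Gam_linear(2), folded q0_def]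
  and q1_addhom = tmap_right(1)[OF twm(2,3) Gam_linear(4), folded q1_def]
  and e0_addhom = tmap_right(1)[OF twm(4,5) Gam_linear(1), folded e0_def]
  and e1_addhom = tmap_right(1)[OF twm(6,5) Gam_linear(3), folded e1_def]
  and r1_addhom = tmap_right(1)[OF twm(5,6) Gam_linear(4), folded r1_def]

lemmas O0_tens = tmap_right(2)[OF twm(1,2) Gam_linear(1), folded Omega_in0_def, unfolded in0_def]
  and O1_tens = tmap_right(2)[OF twm(3,2) Gam_linear(3), folded Omega_in1_def, unfolded in1_def]
  and q0_tens = tmap_right(2)[OF twm(2,1) Gam_linear(2), folded q0_def]
  and q1_tens = tmap_right(2)[OF twm(2,3) Gam_linear(4), folded q1_def]
  and e0_tens = tmap_right(2)[OF twm(4,5) Gam_linear(1), folded e0_def, unfolded in0_def]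
  and e1_tens = tmap_right(2)[OF twm(6,5) Gam_linear(3), folded e1_def, unfolded in1_def]
  and r1_tens = tmap_right(2)[OF twm(5,6) Gam_linear(4), folded r1_def]

lemmas O_closed = addhom_closed[OF O0_addhom] addhom_closed[OF O1_addhom] addhom_closed[OF q0_addhom] addhom_closed[OF q1_addhom]
  addhom_closed[OF e0_addhom] addhom_closed[OF e1_addhom]

lemma q0_O0: "x \<in> carrier D0.JJ ==> q0 (O0 x) = x"
  by (rule D0.JT.addhom_tensor_eqI[OF addhom_comp[OF O0_addhom q0_addhom] addhom_id]) (auto simp: O0_tens q0_tens)

lemma q1_O1: "x \<in> carrier M1.JJ ==> q1 (O1 x) = x"
  by (rule M1.JT.addhom_tensor_eqI[OF addhom_comp[OF O1_addhom q1_addhom] addhom_id]) (auto simp: O1_tens q1_tens)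

lemma r1_e1: "x \<in> carrier M1.EE ==> r1 (e1 x) = x"
  by (rule M1.ET.addhom_tensor_eqI[OF addhom_comp[OF e1_addhom r1_addhom] addhom_id]) (auto simp: e1_tens in1_def r1_tens)

text \<open>The generators w \<otimes> (t, 0) of the degree 0 part have no N-component, so
  projecting to T loses nothing there.\<close>

lemma O0_q0: "x \<in> dpart D1.KK 0 ==> O0 (q0 x) = x"
  unfolding D1.KK_dpart
  by (erule aspan_eqI[OF D1.JG.abelian_group_axioms D1.JG.abelian_group_axioms D1.KK_gens addhom_comp[OF q0_addhom O0_addhom] addhom_id, rotated])
    (auto simp: q0_tens O0_tens)

lemma O1_q1: "x \<in> dpart D1.KK 1 ==> O1 (q1 x) = x"
  unfolding D1.KK_dpart
  by (erule aspan_eqI[OF D1.JG.abelian_group_axioms D1.JG.abelian_group_axioms D1.KK_gens addhom_comp[OF q1_addhom O1_addhom] addhom_id, rotated])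
    (auto simp: q1_tens O1_tens)

lemma e1_r1: "x \<in> dpart D1.KE 1 ==> e1 (r1 x) = x"
  unfolding D1.KE_dpart
  by (erule aspan_eqI[OF D1.EC.is_abelian_group D1.EC.is_abelian_group D1.KE_gens addhom_comp[OF r1_addhom e1_addhom] addhom_id, rotated])
    (auto simp: r1_tens e1_tens in1_def)

lemma O0_dpart: "x \<in> carrier D0.JJ ==> O0 x \<in> dpart D1.KK 0"
proof (induction rule: D0.JT.tensor_induct)
  case (tens w t)
  then show ?case unfolding D1.KK_dpart by (intro aspan_incl) (auto simp: O0_tens)
qed (simp add: addhom_add[OF O0_addhom] D1.KK_dpart_add)

lemma O1_dpart: "x \<in> carrier M1.JJ ==> O1 x \<in> dpart D1.KK 1"
proof (induction rule: M1.JT.tensor_induct)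
  case (tens w t)
  then show ?case unfolding D1.KK_dpart by (intro aspan_incl) (auto simp: O1_tens)
qed (simp add: addhom_add[OF O1_addhom] D1.KK_dpart_add)

lemma e0_dpart: "x \<in> carrier D0.EE ==> e0 x \<in> dpart D1.KE 0"
proof (induction rule: D0.ET.tensor_induct)
  case (tens w t)
  then show ?case unfolding D1.KE_dpart by (intro aspan_incl) (auto simp: e0_tens in0_def)
qed (simp add: addhom_add[OF e0_addhom] D1.KE_dpart_add)

lemma e1_dpart: "x \<in> carrier M1.EE ==> e1 x \<in> dpart D1.KE 1"
proof (induction rule: M1.ET.tensor_induct)
  case (tens w t)
  then show ?case unfolding D1.KE_dpart by (intro aspan_incl) (auto simp: e1_tens in1_def)
qed (simp add: addhom_add[OF e1_addhom] D1.KE_dpart_add)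

lemma TU_dpart: "dpart TU k = (if k = 0 then carrier T else {\<zero>\<^bsub>T\<^esub>})"
  by (simp add: ungr_def)

text \<open>T is concentrated in degree 0; the other parts are generated by tensors w \<otimes>
  0.\<close>

lemma D0_dpart: "dpart D0.KK k = (if k = 0 then carrier D0.JJ else {\<zero>\<^bsub>D0.JJ\<^esub>})"
proof (cases "k = 0")
  case True
  have "x \<in> dpart D0.KK 0" if "x \<in> carrier D0.JJ" for x using that
  proof (induction rule: D0.JT.tensor_induct)
    case (tens w t) then show ?case unfolding D0.KK_dpart by (intro aspan_incl) (auto simp: TU_dpart)
  qed (rule D0.KK_dpart_add)
  then show ?thesis using True D0.KK_sub_carrier by auto
next
  case False
  have "x = \<zero>\<^bsub>D0.JJ\<^esub>" if "x \<in> dpart D0.KK k" for x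
    by (rule aspan_eqI[OF D0.JG.abelian_group_axioms D0.JG.abelian_group_axioms D0.KK_gens addhom_id addhom_const_zero[OF D0.JG.abelian_group_axioms] _ that[unfolded D0.KK_dpart]])
      (use False D0.JT.tens_zero_right in \<open>auto simp: TU_dpart\<close>)
  moreover have "\<zero>\<^bsub>D0.JJ\<^esub> \<in> dpart D0.KK k" using subgroup.one_closed[OF D0.KK_sub] by simp
  ultimately have "dpart D0.KK k = {\<zero>\<^bsub>D0.JJ\<^esub>}" by blast
  then show ?thesis using False by simp
qed

abbreviation "OM \<equiv> Omega_mod \<Lambda> S l h N"

lemma OM_simps: "carrier OM = carrier M1.JJ" "add OM = add M1.JJ" "ring.zero OM = ring.zero M1.JJ"
  "a_inv OM = a_inv M1.JJ" "a_minus OM = a_minus M1.JJ"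
  "addhom OM B f \<longleftrightarrow> addhom M1.JJ B f" "addhom C OM g \<longleftrightarrow> addhom C M1.JJ g"
  by (simp_all add: Omega_mod_def tensor_right_def)

lemma OM_module: "module T OM"
  and OM_tens: "t \<in> carrier T ==> w \<in> carrier OW ==> n \<in> carrier N ==> t \<odot>\<^bsub>OM\<^esub> M1.jt w n = M1.jt w (t \<odot>\<^bsub>N\<^esub> n)" (is "PROP ?g1")
proof -
  have 1: "module T (modl NS (smult N))"
    by (rule moduleI[OF T.is_cring]) (auto simp: N.abelian_group_axioms N.smult_l_distr N.smult_r_distr N.smult_assoc1)
  have 2: "t \<odot>\<^bsub>N\<^esub> (r \<odot>\<^bsub>NS\<^esub> n) = r \<odot>\<^bsub>NS\<^esub> (t \<odot>\<^bsub>N\<^esub> n)" if "t \<in> carrier T" "r \<in> carrier S" "n \<in> carrier NS" for t r n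
    using that by (simp add: N.smult_assoc1[symmetric] T.m_comm)
  note t = M1.JT.tensor_right_module[OF 1 2]
  show "module T OM" unfolding Omega_mod_def by (rule t(1))
  show "PROP ?g1"
    unfolding Omega_mod_def using t(2) by simp
qed

sublocale OM: module T OM by (rule OM_module)

lemma OM_sm: "t \<in> carrier T ==> x \<in> carrier M1.JJ ==> t \<odot>\<^bsub>OM\<^esub> x \<in> carrier M1.JJ"
  "t \<in> carrier T ==> x \<in> carrier M1.JJ ==> y \<in> carrier M1.JJ ==> t \<odot>\<^bsub>OM\<^esub> (x \<oplus>\<^bsub>M1.JJ\<^esub> y) = t \<odot>\<^bsub>OM\<^esub> x \<oplus>\<^bsub>M1.JJ\<^esub> t \<odot>\<^bsub>OM\<^esub> y"
  using OM.smult_closed OM.smult_r_distr by (auto simp: OM_simps)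

lemma
  assumes g: "g \<in> carrier GG"
  shows q0_smult: "y \<in> carrier D1.JJ ==> q0 (g \<odot>\<^bsub>D1.KK\<^esub> y) = fst g \<odot>\<^bsub>D0.KK\<^esub> q0 y"
    and O0_smult: "y0 \<in> carrier D0.JJ ==> snd g = \<zero>\<^bsub>N\<^esub> ==> O0 (fst g \<odot>\<^bsub>D0.KK\<^esub> y0) = g \<odot>\<^bsub>D1.KK\<^esub> O0 y0"
    and O1_smult: "y1 \<in> carrier M1.JJ ==> O1 (fst g \<odot>\<^bsub>OM\<^esub> y1) = g \<odot>\<^bsub>D1.KK\<^esub> O1 y1"
proof -
  have f: "fst g \<in> carrier T" "snd g \<in> carrier N" using g by auto
  show "q0 (g \<odot>\<^bsub>D1.KK\<^esub> y) = fst g \<odot>\<^bsub>D0.KK\<^esub> q0 y" if "y \<in> carrier D1.JJ" using that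
    by (induction rule: D1.JT.tensor_induct) (use g f in \<open>auto simp: D1.KK_smult D1.KK_sm q0_tens D0.KK_smult addhom_add[OF q0_addhom] D0.KK_sm O_closed\<close>)
  show "O0 (fst g \<odot>\<^bsub>D0.KK\<^esub> y0) = g \<odot>\<^bsub>D1.KK\<^esub> O0 y0" if "y0 \<in> carrier D0.JJ" "snd g = \<zero>\<^bsub>N\<^esub>" using that(1)
    by (induction rule: D0.JT.tensor_induct)
      (use g f that(2) in \<open>auto simp: D1.KK_smult D1.KK_sm O0_tens D0.KK_smult addhom_add[OF O0_addhom] D0.KK_sm O_closed N.smult_r_null\<close>)
  show "O1 (fst g \<odot>\<^bsub>OM\<^esub> y1) = g \<odot>\<^bsub>D1.KK\<^esub> O1 y1" if "y1 \<in> carrier M1.JJ" using that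
    by (induction rule: M1.JT.tensor_induct)
      (use g f in \<open>auto simp: D1.KK_smult D1.KK_sm O1_tens OM_tens addhom_add[OF O1_addhom] OM_sm O_closed N.smult_l_null\<close>)
qed

text \<open>\<open>act y n\<close> is the product of \<open>y \<in> \<Omega> \<otimes>\<^sub>S T\<close> with \<open>n \<in> N\<close>.\<close>

definition "act y n = tlift M1.JJ (\<lambda>w t. M1.jt w (t \<odot>\<^bsub>N\<^esub> n)) y"

lemma act_addhom: "n \<in> carrier N ==> addhom D0.JJ M1.JJ (\<lambda>y. act y n)"
  and act_tens: "n \<in> carrier N ==> w \<in> carrier OW ==> t \<in> carrier T ==> act (D0.jt w t) n = M1.jt w (t \<odot>\<^bsub>N\<^esub> n)"
proof -
  assume n: "n \<in> carrier N"
  have "linear S TU NS (\<lambda>t. t \<odot>\<^bsub>N\<^esub> n)"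
    by (rule linearI, rule addhomI) (use n in \<open>auto simp: N.smult_l_distr N.smult_assoc1\<close>)
  note t = tmap_right[OF twm(1,3) this, unfolded tmap_def]
  show "addhom D0.JJ M1.JJ (\<lambda>y. act y n)"
    "w \<in> carrier OW ==> t \<in> carrier T ==> act (D0.jt w t) n = M1.jt w (t \<odot>\<^bsub>N\<^esub> n)" unfolding act_def using t by auto
qed

lemma act_closed: "y \<in> carrier D0.JJ ==> n \<in> carrier N ==> act y n \<in> carrier M1.JJ"
  using addhom_closed[OF act_addhom] .

text \<open>Multiplication by (0, n) raises the degree by one, and in \<Gamma> it sends t to t
  n.\<close>

lemma act_O0: "y \<in> carrier D0.JJ ==> n \<in> carrier N ==> (\<zero>\<^bsub>T\<^esub>, n) \<odot>\<^bsub>D1.KK\<^esub> O0 y = O1 (act y n)"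
  by (induction y rule: D0.JT.tensor_induct) (auto simp: D1.KK_smult D1.KK_sm O0_tens act_tens O1_tens addhom_add[OF O0_addhom]
    addhom_add[OF O1_addhom] addhom_add[OF act_addhom] O_closed act_closed N.smult_l_null)

lemma e0_ret: "y \<in> carrier D0.EE ==> D1.ret (e0 y) = O0 (D0.ret y)"
  by (rule D0.ET.addhom_tensor_eqI[OF addhom_comp[OF e0_addhom D1.ret_addhom] addhom_comp[OF D0.ret_addhom O0_addhom]])
    (auto simp: e0_tens D1.ret_tens D0.ret_tens O0_tens omega_part(1))

lemma e0_prj: "y \<in> carrier D0.EE ==> D1.prj (e0 y) = (D0.prj y, \<zero>\<^bsub>N\<^esub>)"
  by (rule D0.ET.addhom_tensor_eqI[OF addhom_comp[OF e0_addhom D1.prj_addhom] addhom_comp[OF D0.prj_addhom linear_addhom[OF Gam_linear(1)], unfolded in0_def]])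
    (auto simp: e0_tens D1.prj_tens D0.prj_tens eps_simps N.smult_r_null)

text \<open>Checked in coordinates, with which the inclusion is compatible by \<open>e0_ret\<close>
  and \<open>e0_prj\<close>.\<close>

lemma e0_ring_hom: "e0 \<in> ring_hom D0.EE D1.EE"
proof (rule ring_hom_memI)
  fix x y assume x: "x \<in> carrier D0.EE" and y: "y \<in> carrier D0.EE"
  note c = x y D0.EC.m_closed[OF x y] O_closed(5)[OF x] O_closed(5)[OF y]
  note k = D0.ks_closed(2)[OF x] D0.ks_closed(2)[OF y] D0.ks_closed(3)[OF x] D0.ks_closed(3)[OF y]
  show "e0 (x \<otimes>\<^bsub>D0.EE\<^esub> y) = e0 x \<otimes>\<^bsub>D1.EE\<^esub> e0 y"
  proof (rule D1.EE_eqI)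
    show "D1.ret (e0 (x \<otimes>\<^bsub>D0.EE\<^esub> y)) = D1.ret (e0 x \<otimes>\<^bsub>D1.EE\<^esub> e0 y)"
      using k D0.KK_sm by (simp add: c e0_ret e0_prj D0.ret_mult D1.ret_mult addhom_add[OF O0_addhom] O0_smult[of "(_, \<zero>\<^bsub>N\<^esub>)", simplified])
    show "D1.prj (e0 (x \<otimes>\<^bsub>D0.EE\<^esub> y)) = D1.prj (e0 x \<otimes>\<^bsub>D1.EE\<^esub> e0 y)"
      using k by (simp add: c e0_prj ring_hom_mult[OF D0.prj_ring_hom x y] ring_hom_mult[OF D1.prj_ring_hom c(4,5)] N.smult_r_null)
  qed (rule O_closed(5)[OF c(3)], rule D1.EC.m_closed[OF c(4,5)])
  show "e0 (x \<oplus>\<^bsub>D0.EE\<^esub> y) = e0 x \<oplus>\<^bsub>D1.EE\<^esub> e0 y" using addhom_add[OF e0_addhom x y] .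
next
  show "e0 \<one>\<^bsub>D0.EE\<^esub> = \<one>\<^bsub>D1.EE\<^esub>" using e0_tens[of "\<one>\<^bsub>PR\<^esub>" "\<one>\<^bsub>TU\<^esub>"] by (simp add: D0.ET.tensor_one D1.ET.tensor_one)
qed (rule O_closed(5))

end

section \<open>The splitting, its derivation and the twisted degree 1 part\<close>

locale ks_split = ks_setup \<Lambda> S l T N h
  for \<Lambda> :: "('l, 'y) ring_scheme" and S :: "('s, 'w) ring_scheme" and l :: "'l \<Rightarrow> 's"
    and T :: "('t, 'u) ring_scheme" and N :: "('t, 'n) module" and h :: "'s \<Rightarrow> 't" +
  fixes \<sigma>
  assumes \<sigma>: "is_splitting \<Lambda> S T l h \<sigma>"
begin

text \<open>D(\<sigma>) as a total function, by \<open>split_der_eq\<close>: the section 1 \<otimes>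
  t has \<Omega>-coordinate 0, so 1 \<otimes> t - \<sigma>(t) has minus that of \<sigma>(t).\<close>

definition "Ds t = \<ominus>\<^bsub>D0.JJ\<^esub> D0.ret (\<sigma> t)"

lemma \<sigma>_hom: "\<sigma> \<in> ring_hom T D0.EE"
  using \<sigma> unfolding is_splitting_def alg_hom_def ring_hom_def by (simp add: D0.KE_simps)

lemma \<sigma>_closed: "t \<in> carrier T ==> \<sigma> t \<in> carrier D0.EE" and \<sigma>_prj: "t \<in> carrier T ==> D0.prj (\<sigma> t) = t"
  using ring_hom_closed[OF \<sigma>_hom] \<sigma> by (auto simp: is_splitting_def)

lemma Ds_closed: "t \<in> carrier T ==> Ds t \<in> carrier D0.JJ"
  by (simp add: Ds_def D0.ks_closed \<sigma>_closed)

text \<open>As an algebra homomorphism over the identity, \<sigma> has a coordinate with the values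
  \<open>sc\<close> on scalars; changing the sign gives ds \<otimes> 1.\<close>

lemma Ds_der: "der_along S (alg h T) (\<lambda>t. t) D0.KK (\<lambda>r. D0.jt (dS r) \<one>\<^bsub>T\<^esub>) Ds"
proof -
  have "der_along S (alg h T) (\<lambda>t. t) D0.KK (\<lambda>r. \<ominus>\<^bsub>D0.KK\<^esub> D0.sc r) (\<lambda>t. \<ominus>\<^bsub>D0.KK\<^esub> D0.ret (\<sigma> t))"
    by (rule der_along_uminus[OF D0.KK_module _ D0.der_of_hom[OF alg_algebra[OF S.is_cring T.is_cring h]]])
      (use \<sigma> in \<open>auto simp: is_splitting_def\<close>)
  then show ?thesis unfolding der_along_def Ds_def by (simp add: D0.KK_simps D0.sc_def D0.dS_closed)
qed

lemma Ds_addhom: "addhom T D0.JJ Ds" and Ds_mult: "a \<in> carrier T ==> b \<in> carrier T ==> Ds (a \<otimes>\<^bsub>T\<^esub> b) = a \<odot>\<^bsub>D0.KK\<^esub> Ds b \<oplus>\<^bsub>D0.JJ\<^esub> b \<odot>\<^bsub>D0.KK\<^esub> Ds a"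
  and Ds_h: "s \<in> carrier S ==> Ds (h s) = D0.jt (dS s) \<one>\<^bsub>T\<^esub>"
  using Ds_der unfolding der_along_def by (auto simp: D0.KK_simps)

lemma split_der_eq: "split_der \<Lambda> S T l h \<sigma> = restrict Ds (carrier T)"
proof -
  have "(THE w. w \<in> carrier D0.KK \<and> D0.inc w = D0.unt t \<ominus>\<^bsub>D0.EE\<^esub> \<sigma> t) = Ds t" if t: "t \<in> carrier T" for t
  proof -
    note c = D0.ks_closed(4)[of t] \<sigma>_closed[OF t]
    have u: "D0.unt t \<in> carrier D0.EE" using t by simp
    have z: "t \<ominus>\<^bsub>T\<^esub> t = \<zero>\<^bsub>T\<^esub>" using t by (simp add: a_minus_def T.r_neg)
    have 1: "D0.ret (D0.unt t \<ominus>\<^bsub>D0.EE\<^esub> \<sigma> t) = Ds t"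
      using t c addhom_minus[OF D0.EC.is_abelian_group D0.JG.abelian_group_axioms D0.ret_addhom u c(2)]
      by (simp add: Ds_def D0.ret_unt D0.ks_closed a_minus_def)
    have 2: "D0.prj (D0.unt t \<ominus>\<^bsub>D0.EE\<^esub> \<sigma> t) = \<zero>\<^bsub>T\<^esub>"
      using t addhom_minus[OF D0.EC.is_abelian_group D0.G.abelian_group_axioms D0.prj_addhom u c(2)] z
      by (simp add: \<sigma>_prj D0.prj_unt)
    have "D0.inc (Ds t) = D0.unt t \<ominus>\<^bsub>D0.EE\<^esub> \<sigma> t"
      by (rule D0.EE_eqI) (use 1 2 u c Ds_closed[OF t] D0.ret_inc D0.prj_inc D0.ks_closed in \<open>auto\<close>)
    moreover have "w = Ds t" if "w \<in> carrier D0.KK" "D0.inc w = D0.unt t \<ominus>\<^bsub>D0.EE\<^esub> \<sigma> t" for w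
      using D0.ret_inc[of w] that 1 by (simp add: D0.KK_simps)
    moreover have "Ds t \<in> carrier D0.KK" using Ds_closed[OF t] by (simp add: D0.KK_simps)
    ultimately show ?thesis by (intro the_equality conjI) blast+
  qed
  then show ?thesis unfolding split_der_def Let_def by (intro ext) (simp add: D0.KE_simps)
qed

lemma split_der_Der: "split_der \<Lambda> S T l h \<sigma> \<in> Der \<Lambda> (alg (h \<circ> l) T) D0.KK"
proof -
  \<comment> \<open>Elements of \<Lambda> reach T through S, where their differential
    vanishes.\<close>
  have "Ds (h (l r) \<otimes>\<^bsub>T\<^esub> \<one>\<^bsub>T\<^esub>) = \<zero>\<^bsub>D0.JJ\<^esub>" if r: "r \<in> carrier \<Lambda>" for r
    using Ds_h[of "l r"] K.dd_smult_one[OF r] ring_hom_closed[OF l r] D0.JT.tens_zero_left[of "\<one>\<^bsub>T\<^esub>"] by simp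
  moreover have "h (l r) \<in> carrier T" if "r \<in> carrier \<Lambda>" for r using h_closed ring_hom_closed[OF l that] .
  ultimately show ?thesis unfolding split_der_eq Der_def
    using Ds_closed Ds_mult addhom_add[OF Ds_addhom] by (auto simp: D0.KK_simps)
qed

text \<open>The failure of n -> 1 \<otimes> n to be linear when T acts through \<sigma>.\<close>

definition "ck t n = act (Ds t) n"

lemma ck_closed: "t \<in> carrier T ==> n \<in> carrier N ==> ck t n \<in> carrier OM"
  unfolding ck_def OM_simps by (rule act_closed[OF Ds_closed])

abbreviation "DM \<equiv> deg1_mod \<Lambda> S T N l h \<sigma>"

lemma DM_simps: "carrier DM = dpart D1.KE 1" "add DM = add D1.EE" "ring.zero DM = ring.zero D1.EE" "smult DM = (\<lambda>t x. e0 (\<sigma> t) \<otimes>\<^bsub>D1.EE\<^esub> x)"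
  by (simp_all add: deg1_mod_def Let_def D1.KE_simps e0_def)

text \<open>\<open>e0\<close> after \<sigma> is a ring homomorphism into the degree 0 part, so
  multiplication by its values preserves degree 1.\<close>

lemma DM_module: "module T DM"
proof -
  have e: "e0 (\<sigma> t) \<in> carrier D1.EE" "e0 (\<sigma> t) \<in> dpart D1.KE 0" if "t \<in> carrier T" for t
    using O_closed(5) e0_dpart \<sigma>_closed[OF that] by auto
  have g: "group (add_monoid D1.EE\<lparr>carrier := dpart D1.KE 1\<rparr>)" by (rule subgroup.subgroup_is_group[OF D1.KE_sub D1.EC.a_group])
  have a: "abelian_group DM"
  proof (rule abelian_groupI)
    fix x assume x: "x \<in> carrier DM"
    have "\<ominus>\<^bsub>D1.EE\<^esub> x \<in> dpart D1.KE 1" using subgroup.m_inv_closed[OF D1.KE_sub, of x 1] x by (simp add: DM_simps a_inv_def)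
    then show "\<exists>y\<in>carrier DM. y \<oplus>\<^bsub>DM\<^esub> x = \<zero>\<^bsub>DM\<^esub>"
      using x D1.KE_sub_carrier by (intro bexI[of _ "\<ominus>\<^bsub>D1.EE\<^esub> x"]) (auto simp: DM_simps D1.EC.l_neg)
  qed (use D1.KE_sub_carrier D1.KE_dpart_add subgroup.one_closed[OF D1.KE_sub, of 1] in \<open>auto simp: DM_simps D1.EC.a_ac\<close>)
  note s = ring_hom_add[OF \<sigma>_hom] ring_hom_mult[OF \<sigma>_hom] ring_hom_one[OF \<sigma>_hom]
    addhom_add[OF e0_addhom] ring_hom_mult[OF e0_ring_hom] ring_hom_one[OF e0_ring_hom]
  show ?thesis
    by (rule moduleI[OF T.is_cring a])
      (use e D1.KE_sub_carrier D1.KE_graded(2)[of _ 0 _ 1] in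
        \<open>auto simp: DM_simps s \<sigma>_closed D1.EC.l_distr D1.EC.r_distr D1.EC.m_assoc\<close>)
qed

abbreviation "di \<equiv> deg1_incl \<Lambda> S T N l h"
abbreviation "dp \<equiv> deg1_proj S T N h"

lemma DM_prj: "x \<in> dpart D1.KE 1 ==> D1.prj x = (\<zero>\<^bsub>T\<^esub>, dp x) \<and> dp x \<in> carrier N"
  using D1.ks_graded(4)[of x 1] by (auto simp: deg1_proj_def)

lemma di_linear: "linear T OM DM di"
proof (rule linearI)
  have c: "di x \<in> dpart D1.KE 1" if "x \<in> carrier M1.JJ" for x
    unfolding deg1_incl_def by (rule D1.ks_graded(1)[OF O1_dpart[OF that]])
  have add: "addhom M1.JJ D1.EE di" using addhom_comp[OF O1_addhom D1.inc_addhom] by (simp add: deg1_incl_def[abs_def])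
  show "addhom OM DM di" using addhom_add[OF add] c by (intro addhomI) (simp_all add: OM_simps DM_simps)
  fix t x assume t: "t \<in> carrier T" and "x \<in> carrier OM"
  then have x: "x \<in> carrier M1.JJ" by (simp add: OM_simps)
  have s: "e0 (\<sigma> t) \<in> carrier D1.EE" using O_closed(5) \<sigma>_closed[OF t] .
  have i: "D1.inc (O1 x) \<in> carrier D1.EE" using D1.ks_closed(1) O_closed(2) x by auto
  have tx: "t \<odot>\<^bsub>OM\<^esub> x \<in> carrier M1.JJ" using OM_sm t x by simp
  \<comment> \<open>On the kernel, \<sigma>(t) acts through its projection t alone, since the kernel
    has square zero.\<close>
  have "D1.inc (O1 (t \<odot>\<^bsub>OM\<^esub> x)) = e0 (\<sigma> t) \<otimes>\<^bsub>D1.EE\<^esub> D1.inc (O1 x)"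
  proof (rule D1.EE_eqI)
    have m: "D1.prj (D1.inc (O1 x)) = \<zero>\<^bsub>GG\<^esub>" "D1.ret (D1.inc (O1 x)) = O1 x" using D1.prj_inc D1.ret_inc O_closed(2)[OF x] by auto
    have r: "D1.ret (e0 (\<sigma> t)) \<in> carrier D1.KK" using D1.ks_closed(3)[OF s] by (simp add: D1.KK_simps)
    have p: "D1.prj (e0 (\<sigma> t)) = (t, \<zero>\<^bsub>N\<^esub>)" using e0_prj \<sigma>_closed \<sigma>_prj t by simp
    have "D1.ret (e0 (\<sigma> t) \<otimes>\<^bsub>D1.EE\<^esub> D1.inc (O1 x)) = (t, \<zero>\<^bsub>N\<^esub>) \<odot>\<^bsub>D1.KK\<^esub> O1 x \<oplus>\<^bsub>D1.JJ\<^esub> \<zero>\<^bsub>GG\<^esub> \<odot>\<^bsub>D1.KK\<^esub> D1.ret (e0 (\<sigma> t))"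
      unfolding D1.ret_mult[OF s i] m p ..
    also have "\<dots> = O1 (t \<odot>\<^bsub>OM\<^esub> x)" using D1.KM.smult_l_null[OF r] O1_smult[of "(t, \<zero>\<^bsub>N\<^esub>)" x] t x O_closed(2)[OF tx] by (simp add: D1.KK_simps)
    finally show "D1.ret (D1.inc (O1 (t \<odot>\<^bsub>OM\<^esub> x))) = D1.ret (e0 (\<sigma> t) \<otimes>\<^bsub>D1.EE\<^esub> D1.inc (O1 x))"
      using D1.ret_inc[OF O_closed(2)[OF tx]] by simp
    show "D1.prj (D1.inc (O1 (t \<odot>\<^bsub>OM\<^esub> x))) = D1.prj (e0 (\<sigma> t) \<otimes>\<^bsub>D1.EE\<^esub> D1.inc (O1 x))"
      unfolding ring_hom_mult[OF D1.prj_ring_hom s i] m p D1.prj_inc[OF O_closed(2)[OF tx]] using t by (simp add: N.smult_r_null N.smult_l_null)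
  qed (use s i D1.ks_closed(1) O_closed(2)[OF tx] in auto)
  then show "di (t \<odot>\<^bsub>OM\<^esub> x) = t \<odot>\<^bsub>DM\<^esub> di x" by (simp add: deg1_incl_def DM_simps)
qed

lemma dp_linear: "linear T DM N dp"
proof (rule linearI)
  show "addhom DM N dp"
    using DM_prj D1.KE_dpart_add addhom_add[OF D1.prj_addhom] D1.KE_sub_carrier
    by (intro addhomI) (auto simp: DM_simps deg1_proj_def)
  fix t x assume t: "t \<in> carrier T" and "x \<in> carrier DM"
  then have x: "x \<in> dpart D1.KE 1" by (simp add: DM_simps)
  have s: "e0 (\<sigma> t) \<in> carrier D1.EE" using O_closed(5) \<sigma>_closed[OF t] .
  have "D1.prj (e0 (\<sigma> t) \<otimes>\<^bsub>D1.EE\<^esub> x) = (t, \<zero>\<^bsub>N\<^esub>) \<otimes>\<^bsub>GG\<^esub> (\<zero>\<^bsub>T\<^esub>, dp x)"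
    unfolding ring_hom_mult[OF D1.prj_ring_hom s D1.KE_sub_carrier[OF x]] using DM_prj[OF x] e0_prj[OF \<sigma>_closed[OF t]] \<sigma>_prj[OF t] by simp
  then show "dp (t \<odot>\<^bsub>DM\<^esub> x) = t \<odot>\<^bsub>N\<^esub> dp x" using t DM_prj[OF x, THEN conjunct2] by (simp add: deg1_proj_def[of S T N h "_ \<otimes>\<^bsub>_\<^esub> _"] DM_simps N.smult_l_null)
qed

lemma deg1_bij: "bij_betw e1 (carrier M1.EE) (carrier DM)"
proof -
  have "x \<in> e1 ` carrier M1.EE" if "x \<in> dpart D1.KE 1" for x
    using e1_r1[OF that] addhom_closed[OF r1_addhom D1.KE_sub_carrier[OF that]] by (metis imageI)
  then show ?thesis unfolding bij_betw_def using e1_dpart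
    by (auto simp: DM_simps intro!: inj_on_inverseI[of _ r1] r1_e1)
qed

context
  fixes F :: "('t, 'f, 'n) fres"
  assumes F: "free_resolution T N F"
begin

interpretation X: ext_res T OM N F by (simp add: ext_res_def ext_res_axioms_def OM_module N.module_axioms F)

text \<open>An instance of \<open>ses_class_connection\<close>, with section n -> 1 \<otimes> (0, n)
  and retraction \<open>q1\<close> after \<open>ret\<close>.\<close>

lemma kappa_connection:
  "kappa \<Lambda> S T N l h \<sigma> F = connection_cocycles T F OM ck" (is "PROP ?g1") "connection_cocycles T F OM ck \<noteq> {}" "short_exact T OM DM N di dp"
proof -
  have n: "D1.unt (\<zero>\<^bsub>T\<^esub>, n) \<in> dpart D1.KE 1" "D1.unt (\<zero>\<^bsub>T\<^esub>, n) \<in> carrier D1.EE" if "n \<in> carrier N" for n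
    using D1.ks_graded(2)[of "(\<zero>\<^bsub>T\<^esub>, n)" 1] D1.KE_sub_carrier that by auto
  have s: "addhom N DM (\<lambda>n. D1.unt (\<zero>\<^bsub>T\<^esub>, n))"
    using n addhom_add[OF D1.unt_addhom, of "(\<zero>\<^bsub>T\<^esub>, _)" "(\<zero>\<^bsub>T\<^esub>, _)"] by (intro addhomI) (auto simp: DM_simps)
  have "addhom D1.EE M1.JJ (\<lambda>x. q1 (D1.ret x))" by (rule addhom_comp[OF D1.ret_addhom q1_addhom])
  then have r: "addhom DM OM (\<lambda>x. q1 (D1.ret x))"
    unfolding addhom_def using D1.KE_sub_carrier by (auto simp: DM_simps OM_simps)
  have O1: "O1 x \<in> carrier D1.JJ" if "x \<in> carrier OM" for x using O_closed(2) that by (simp add: OM_simps)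
  have ri: "q1 (D1.ret (di x)) = x" and pi: "dp (di x) = \<zero>\<^bsub>N\<^esub>" if "x \<in> carrier OM" for x
    using that q1_O1 D1.ret_inc[OF O1[OF that]] D1.prj_inc[OF O1[OF that]] by (auto simp: deg1_incl_def deg1_proj_def OM_simps)
  have ps: "dp (D1.unt (\<zero>\<^bsub>T\<^esub>, x)) = x" if "x \<in> carrier N" for x using that D1.prj_unt[of "(\<zero>\<^bsub>T\<^esub>, x)"] by (simp add: deg1_proj_def)
  have dec: "e = di (q1 (D1.ret e)) \<oplus>\<^bsub>DM\<^esub> D1.unt (\<zero>\<^bsub>T\<^esub>, dp e)" if "e \<in> carrier DM" for e
  proof -
    have e: "e \<in> dpart D1.KE 1" using that by (simp add: DM_simps)
    show ?thesis using D1.ks_dec[OF D1.KE_sub_carrier[OF e]] O1_q1[OF D1.ks_graded(3)[OF e]] DM_prj[OF e] by (simp add: deg1_incl_def DM_simps)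
  qed
  \<comment> \<open>In coordinates \<sigma>(t) is t together with -D(\<sigma>)(t); the second entry
    multiplied by (0, n) gives minus \<open>ck t n\<close>.\<close>
  have tw: "t \<odot>\<^bsub>DM\<^esub> D1.unt (\<zero>\<^bsub>T\<^esub>, n) = D1.unt (\<zero>\<^bsub>T\<^esub>, t \<odot>\<^bsub>N\<^esub> n) \<ominus>\<^bsub>DM\<^esub> di (ck t n)" if t: "t \<in> carrier T" and nn: "n \<in> carrier N" for t n
  proof -
    note st = \<sigma>_closed[OF t] and cl = D0.ks_closed(3)[OF \<sigma>_closed[OF t]]
    have e: "e0 (\<sigma> t) \<in> carrier D1.EE" using O_closed(5) st .
    have tn: "t \<odot>\<^bsub>N\<^esub> n \<in> carrier N" using t nn by simp
    have k: "ck t n \<in> carrier M1.JJ" using ck_closed[OF t nn] by (simp add: OM_simps)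
    have ok: "O1 (ck t n) \<in> carrier D1.JJ" using O_closed(2) k .
    have nk: "\<ominus>\<^bsub>D1.JJ\<^esub> O1 (ck t n) = O1 (act (D0.ret (\<sigma> t)) n)"
      using addhom_neg[OF D0.JG.abelian_group_axioms M1.JG.abelian_group_axioms act_addhom[OF nn] cl]
        addhom_neg[OF M1.JG.abelian_group_axioms D1.JG.abelian_group_axioms O1_addhom k] act_closed[OF cl nn] by (simp add: ck_def Ds_def)
    have i: "di (ck t n) \<in> carrier D1.EE" using D1.ks_closed(1)[OF ok] by (simp add: deg1_incl_def)
    have di: "D1.ret (di (ck t n)) = O1 (ck t n)" "D1.prj (di (ck t n)) = \<zero>\<^bsub>GG\<^esub>" using D1.ret_inc[OF ok] D1.prj_inc[OF ok] by (simp_all add: deg1_incl_def)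
    have g: "(\<zero>\<^bsub>T\<^esub>, n) \<in> carrier GG" "(\<zero>\<^bsub>T\<^esub>, t \<odot>\<^bsub>N\<^esub> n) \<in> carrier GG" using nn tn by auto
    have "e0 (\<sigma> t) \<otimes>\<^bsub>D1.EE\<^esub> D1.unt (\<zero>\<^bsub>T\<^esub>, n) = D1.unt (\<zero>\<^bsub>T\<^esub>, t \<odot>\<^bsub>N\<^esub> n) \<oplus>\<^bsub>D1.EE\<^esub> \<ominus>\<^bsub>D1.EE\<^esub> di (ck t n)"
    proof (rule D1.EE_eqI)
      have ek: "(t, \<zero>\<^bsub>N\<^esub>) \<odot>\<^bsub>D1.KK\<^esub> \<zero>\<^bsub>D1.JJ\<^esub> = \<zero>\<^bsub>D1.JJ\<^esub>" using D1.KM.smult_r_null[of "(t, \<zero>\<^bsub>N\<^esub>)"] t by (simp add: D1.KK_simps)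
      have "D1.ret (e0 (\<sigma> t) \<otimes>\<^bsub>D1.EE\<^esub> D1.unt (\<zero>\<^bsub>T\<^esub>, n)) = O1 (act (D0.ret (\<sigma> t)) n)"
        unfolding D1.ret_mult[OF e n(2)[OF nn]] e0_prj[OF st] e0_ret[OF st] \<sigma>_prj[OF t] D1.ret_unt[OF g(1)] D1.prj_unt[OF g(1)] ek act_O0[OF cl nn]
        using O_closed(2)[OF act_closed[OF cl nn]] by simp
      also have "\<dots> = D1.ret (D1.unt (\<zero>\<^bsub>T\<^esub>, t \<odot>\<^bsub>N\<^esub> n) \<oplus>\<^bsub>D1.EE\<^esub> \<ominus>\<^bsub>D1.EE\<^esub> di (ck t n))"
        unfolding addhom_add[OF D1.ret_addhom n(2)[OF tn] D1.EC.a_inv_closed[OF i]] addhom_neg[OF D1.EC.is_abelian_group D1.JG.abelian_group_axioms D1.ret_addhom i]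
          di D1.ret_unt[OF g(2)] nk using O_closed(2)[OF act_closed[OF cl nn]] by simp
      finally show "D1.ret (e0 (\<sigma> t) \<otimes>\<^bsub>D1.EE\<^esub> D1.unt (\<zero>\<^bsub>T\<^esub>, n)) = D1.ret (D1.unt (\<zero>\<^bsub>T\<^esub>, t \<odot>\<^bsub>N\<^esub> n) \<oplus>\<^bsub>D1.EE\<^esub> \<ominus>\<^bsub>D1.EE\<^esub> di (ck t n))" .
      have z: "\<ominus>\<^bsub>GG\<^esub> \<zero>\<^bsub>GG\<^esub> = \<zero>\<^bsub>GG\<^esub>" using addhom_zero[OF D1.G.abelian_group_axioms D1.G.abelian_group_axioms addhom_uminus[OF D1.G.abelian_group_axioms addhom_id]] .
      show "D1.prj (e0 (\<sigma> t) \<otimes>\<^bsub>D1.EE\<^esub> D1.unt (\<zero>\<^bsub>T\<^esub>, n)) = D1.prj (D1.unt (\<zero>\<^bsub>T\<^esub>, t \<odot>\<^bsub>N\<^esub> n) \<oplus>\<^bsub>D1.EE\<^esub> \<ominus>\<^bsub>D1.EE\<^esub> di (ck t n))"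
        unfolding addhom_add[OF D1.prj_addhom n(2)[OF tn] D1.EC.a_inv_closed[OF i]] addhom_neg[OF D1.EC.is_abelian_group D1.G.abelian_group_axioms D1.prj_addhom i]
          ring_hom_mult[OF D1.prj_ring_hom e n(2)[OF nn]] di D1.prj_unt[OF g(1)] D1.prj_unt[OF g(2)] e0_prj[OF st] \<sigma>_prj[OF t] z
        using t nn by (simp add: N.smult_l_null)
    qed (use e n nn tn i in auto)
    \<comment> \<open>The degree 1 part is a record of its own, whose negation must be identified
      with that of the ambient ring.\<close>
    moreover have "\<ominus>\<^bsub>DM\<^esub> di (ck t n) = \<ominus>\<^bsub>D1.EE\<^esub> di (ck t n)"
    proof -
      have "addhom DM D1.EE (\<lambda>x. x)" by (rule addhomI) (auto simp: DM_simps D1.KE_sub_carrier)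
      from addhom_neg[OF module.axioms(2)[OF DM_module] D1.EC.is_abelian_group this]
      show ?thesis using addhom_closed[OF linear_addhom[OF di_linear] ck_closed[OF t nn]] by simp
    qed
    ultimately show ?thesis by (simp add: a_minus_def DM_simps)
  qed
  note x = X.ses_class_connection[OF ck_closed DM_module di_linear dp_linear s r ri pi ps dec tw]
  show "PROP ?g1" unfolding kappa_def by (rule x(1))
  show "connection_cocycles T F OM ck \<noteq> {}" by (rule x(2))
  show "short_exact T OM DM N di dp" by (rule x(3))
qed

lemma kappa_carrier: "kappa \<Lambda> S T N l h \<sigma> F \<in> carrier (Ext 1 T F OM)"
  unfolding kappa_connection(1) by (rule X.connection_class(2)[OF ck_closed kappa_connection(2)])

end

end

section \<open>The transitivity maps on classes of extensions\<close>

lemma sres_mapD: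
  assumes "sres_map R P P1 s g a"
  shows "a n \<in> ring_hom (obj P n) (obj P1 n)"
    "r \<in> carrier R ==> x \<in> carrier (obj P n) ==> a n (r \<odot>\<^bsub>obj P n\<^esub> x) = s r \<odot>\<^bsub>obj P1 n\<^esub> a n x" (is "PROP ?g1")
    "x \<in> dpart (obj P n) k ==> a n x \<in> dpart (obj P1 n) k" (is "PROP ?g2")
    "i \<le> Suc n ==> x \<in> carrier (obj P (Suc n)) ==> a n (face P n i x) = face P1 n i (a (Suc n) x)" (is "PROP ?g3")
    "x \<in> carrier (obj P 0) ==> aug P1 (a 0 x) = g (aug P x)" (is "PROP ?g4")
proof -
  note m = assms[unfolded sres_map_def]
  note A = conjunct1[OF m, THEN spec[of _ n]] and B = conjunct1[OF conjunct2[OF m]] and C = conjunct2[OF conjunct2[OF conjunct2[OF m]]]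
  show "a n \<in> ring_hom (obj P n) (obj P1 n)" by (rule conjunct1[OF A])
  show "PROP ?g1"
    using conjunct1[OF conjunct2[OF A]] by blast
  show "PROP ?g2" using conjunct2[OF conjunct2[OF A]] by blast
  show "PROP ?g3" using B by blast
  show "PROP ?g4" using C by blast
qed

text \<open>Cocycles of degree 1 are functions on level 1 of the cotangent complex, and their lifts
  live on level 0; these are the two levels compared.\<close>

lemma sres_map_cot:
  assumes P: "sres_res R G P" and P1: "sres_res R1 G1 P1" and m: "sres_map R P P1 s g a"
    and s: "\<And>r. r \<in> carrier R ==> s r \<in> carrier R1" and g: "g \<in> ring_hom G G1"
  shows "addhom (tensor (obj P (Suc 0)) (Omega R (obj P (Suc 0))) (alg (augn P (Suc 0)) G))
      (tensor (obj P1 (Suc 0)) (Omega R1 (obj P1 (Suc 0))) (alg (augn P1 (Suc 0)) G1)) (cot_map R1 P1 G1 (Suc 0) (a (Suc 0)) g)" (is "PROP ?g1")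
    and "x \<in> carrier (obj P (Suc 0)) ==> y \<in> carrier G ==>
      cot_map R1 P1 G1 (Suc 0) (a (Suc 0)) g (cot_tens R P G (Suc 0) (univ_der R (obj P (Suc 0)) x) y)
        = cot_tens R1 P1 G1 (Suc 0) (univ_der R1 (obj P1 (Suc 0)) (a (Suc 0) x)) (g y)" (is "PROP ?g2")
    and "x \<in> carrier (obj P (Suc 0)) ==> a 0 (alt_bd P 0 x) = alt_bd P1 0 (a (Suc 0) x)"
proof -
  interpret P: sres_res R G P by fact
  interpret P1: sres_res R1 G1 P1 by fact
  note m = sres_mapD[OF m]
  have e: "augn P1 (Suc 0) (a (Suc 0) x) = g (augn P (Suc 0) x)" if x: "x \<in> carrier (obj P (Suc 0))" for x
    using P.augn_face[of 0 0 x] P1.augn_face[of 0 0 "a (Suc 0) x"] m(4)[of 0 0 x] m(5)[of "face P 0 0 x"] P.face_closed[of 0 0 x]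
      ring_hom_closed[OF m(1) x] x by simp
  have sc: "s r \<in> carrier R1 \<and> a (Suc 0) (r \<odot>\<^bsub>obj P (Suc 0)\<^esub> x) = s r \<odot>\<^bsub>obj P1 (Suc 0)\<^esub> a (Suc 0) x"
    if "r \<in> carrier R" "x \<in> carrier (obj P (Suc 0))" for r x using s m(2) that by blast
  note c = cot_tmap[OF P.cot_data P1.cot_data m(1) sc g e, folded cot_map_def cot_tens_def]
  show "PROP ?g1" by (rule c(1))
  show "PROP ?g2" by (rule c(3))
  show "a 0 (alt_bd P 0 x) = alt_bd P1 0 (a (Suc 0) x)" if x: "x \<in> carrier (obj P (Suc 0))"
    using addhom_minus[OF P.obj_ab P1.obj_ab ring_hom_addhom[OF m(1)], of "face P 0 0 x" 0 "face P 0 1 x"] P.face_closed[of _ 0 x]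
      m(4)[of _ 0 x] ring_hom_closed[OF m(1) x] x by (simp add: P.alt_bd_0 P1.alt_bd_0)
qed

section \<open>Restriction to T, and splittings from a vanishing class\<close>

context ks_setup
begin

lemma in0_ring_hom: "in0 N \<in> ring_hom TU GG"
  by (rule ring_hom_memI) (auto simp: in0_def N.smult_r_null)

context
  fixes Q :: "('s, 'q, 't) sres"
  assumes Q: "sres_of S TU Q" "concentrated Q"
begin

interpretation Q: ks_res \<Lambda> S l TU Q
  by (simp add: ks_res_def ks_res_axioms_def D0.ks_data_alg_axioms Q)

text \<open>A lift that vanishes on boundaries depends only on the augmentation. It descends to a
  derivation of T with the values \<open>sc\<close>, which \<open>hom_of_der\<close> turns into a
  splitting.\<close>

lemma splitting_exists:
  assumes triv: "KS_class \<Lambda> S l TU Q = \<one>\<^bsub>AQ 1 S Q TU D0.KK\<^esub>"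
  shows "\<exists>\<sigma>. is_splitting \<Lambda> S T l h \<sigma>"
proof -
  obtain D where D: "graded_lift S Q D0.KK D0.sc D" and D0: "\<And>x. x \<in> carrier (obj Q (Suc 0)) ==> D (alt_bd Q 0 x) = \<zero>\<^bsub>D0.KK\<^esub>"
    using Q.R.lift_cocycles_trivial[OF D0.KK_graded_module] triv[unfolded Q.KS_class_eq] by metis
  have d: "der_along S (obj Q 0) (aug Q) D0.KK D0.sc D" using D by (simp add: graded_lift_def)
  note dd = der_alongD[OF d]
  have sur: "aug Q ` carrier (obj Q 0) = carrier TU" and ker: "alt_bd Q 0 ` carrier (obj Q (Suc 0)) = {x \<in> carrier (obj Q 0). aug Q x = \<zero>\<^bsub>TU\<^esub>}"
    using Q(1) by (auto simp: sres_of_def)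
  interpret O: algebra S "obj Q 0" by (rule Q.R.obj_algebra)
  have ar: "aug Q \<in> ring_hom (obj Q 0) TU" using Q.R.augn_ring[of 0] by simp
  note aa = ring_hom_addhom[OF ar]
  have eq: "D x = D y" if x: "x \<in> carrier (obj Q 0)" and y: "y \<in> carrier (obj Q 0)" and xy: "aug Q x = aug Q y" for x y
  proof -
    have "aug Q (x \<ominus>\<^bsub>obj Q 0\<^esub> y) = \<zero>\<^bsub>TU\<^esub>"
      using addhom_minus[OF O.abelian_group_axioms D0.G.abelian_group_axioms aa x y] xy addhom_closed[OF aa y] by (simp add: a_minus_def T.r_neg)
    then obtain z where "z \<in> carrier (obj Q (Suc 0))" "alt_bd Q 0 z = x \<ominus>\<^bsub>obj Q 0\<^esub> y" using ker x y by (metis (mono_tags, lifting) O.M.minus_closed imageE mem_Collect_eq)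
    then have "D (x \<ominus>\<^bsub>obj Q 0\<^esub> y) = \<zero>\<^bsub>D0.KK\<^esub>" using D0 by metis
    then show ?thesis
      using addhom_minus[OF O.abelian_group_axioms D0.KM.abelian_group_axioms dd(1) x y] addhom_closed[OF dd(1)] x y
        abelian_minus_eq[OF D0.KM.abelian_group_axioms, of "D x" "D y" "\<zero>\<^bsub>D0.KK\<^esub>"] by simp
  qed
  \<comment> \<open>By \<open>eq\<close> the value does not depend on the chosen preimage of
    t.\<close>
  define \<delta> where "\<delta> t = D (SOME x. x \<in> carrier (obj Q 0) \<and> aug Q x = t)" for t
  have \<delta>: "\<delta> (aug Q x) = D x" if "x \<in> carrier (obj Q 0)" for x
    unfolding \<delta>_def using someI[of "\<lambda>y. y \<in> carrier (obj Q 0) \<and> aug Q y = aug Q x" x] that by (intro eq) auto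
  have lft: "\<exists>x\<in>carrier (obj Q 0). t = aug Q x" if "t \<in> carrier T" for t using sur that by auto
  have der: "der_along S (alg h T) (\<lambda>t. t) D0.KK D0.sc \<delta>"
    unfolding der_along_def
  proof (intro conjI ballI addhomI)
    fix t t' assume "t \<in> carrier (alg h T)" "t' \<in> carrier (alg h T)"
    then have "t \<in> carrier T" "t' \<in> carrier T" by simp_all
    then obtain x y where xy: "x \<in> carrier (obj Q 0)" "t = aug Q x" "y \<in> carrier (obj Q 0)" "t' = aug Q y" using lft by meson
    show "\<delta> (t \<otimes>\<^bsub>alg h T\<^esub> t') = t \<odot>\<^bsub>D0.KK\<^esub> \<delta> t' \<oplus>\<^bsub>D0.KK\<^esub> t' \<odot>\<^bsub>D0.KK\<^esub> \<delta> t"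
      using \<delta>[of "x \<otimes>\<^bsub>obj Q 0\<^esub> y"] dd(2)[OF xy(1,3)] ring_hom_mult[OF ar xy(1,3)] xy \<delta> by simp
    show "\<delta> (t \<oplus>\<^bsub>alg h T\<^esub> t') = \<delta> t \<oplus>\<^bsub>D0.KK\<^esub> \<delta> t'"
      using \<delta>[of "x \<oplus>\<^bsub>obj Q 0\<^esub> y"] addhom_add[OF dd(1) xy(1,3)] addhom_add[OF aa xy(1,3)] xy \<delta> by simp
  next
    fix t assume "t \<in> carrier (alg h T)"
    then obtain x where "x \<in> carrier (obj Q 0)" "t = aug Q x" using lft[of t] by auto
    then show "\<delta> t \<in> carrier D0.KK" using \<delta>[of x] addhom_closed[OF dd(1), of x] by simp
  next
    fix r assume r: "r \<in> carrier S"
    have "aug Q (r \<odot>\<^bsub>obj Q 0\<^esub> \<one>\<^bsub>obj Q 0\<^esub>) = r \<odot>\<^bsub>TU\<^esub> \<one>\<^bsub>TU\<^esub>"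
      using linear_smult[OF Q.R.augn_linear[of 0], of r "\<one>\<^bsub>obj Q 0\<^esub>"] ring_hom_one[OF ar] r by simp
    then show "\<delta> (r \<odot>\<^bsub>alg h T\<^esub> \<one>\<^bsub>alg h T\<^esub>) = D0.sc r" using \<delta>[of "r \<odot>\<^bsub>obj Q 0\<^esub> \<one>\<^bsub>obj Q 0\<^esub>"] dd(3)[OF r] r by simp
  qed
  have "alg_hom S (alg h T) TU (\<lambda>t. t)"
    unfolding alg_hom_def by (intro conjI ring_hom_memI linearI addhomI) auto
  note hd = D0.hom_of_der[OF alg_algebra[OF S.is_cring T.is_cring h] this der]
  show ?thesis unfolding is_splitting_def using hd(1,3) by auto
qed

context
  fixes P :: "('s, 'p, 't \<times> 'n) sres" and a :: "nat \<Rightarrow> 'q \<Rightarrow> 'p"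
  assumes P: "sres_of S GG P" and a: "sres_map S Q P (\<lambda>s. s) (in0 N) a"
begin

interpretation P: ks_res \<Lambda> S l GG P
  by (simp add: ks_res_def ks_res_axioms_def D1.ks_data_alg_axioms P)

text \<open>A lift for \<Gamma> restricted along Q -> P takes values in degree 0, where
  \<open>q0\<close> reads it as a lift for T; 1 goes to 1, so the values on scalars correspond as
  well.\<close>

lemma trans_i_KS_class: "trans_i 1 S T N h Q P a D0.KK O0 (KS_class \<Lambda> S l GG P) = KS_class \<Lambda> S l TU Q"
proof -
  let ?cm = "cot_map S P GG (Suc 0) (a (Suc 0)) (in0 N)"
  let ?Z = "{g \<in> glinmaps TU (cot S Q TU 1) D0.KK. \<exists>f\<in>KS_class \<Lambda> S l GG P. \<forall>x\<in>carrier (cot S Q TU 1). O0 (g x) = f (?cm x)}"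
  note am = sres_mapD[OF a] and cm = sres_map_cot[OF Q.R.sres_res_axioms P.R.sres_res_axioms a _ in0_ring_hom]
  interpret C: cot_data S "obj Q (Suc 0)" TU "augn Q (Suc 0)" by (rule Q.R.cot_data)
  \<comment> \<open>Q lives in degree 0, so its image in P does, and degree 0 derivations take it to
    the degree 0 part of \<Omega> \<otimes> \<Gamma>.\<close>
  have dp0: "x \<in> dpart (obj Q n) 0" if "x \<in> carrier (obj Q n)" for n x using Q(2) that by (simp add: concentrated_def)
  have dpk: "x = \<zero>\<^bsub>obj Q n\<^esub>" if "x \<in> dpart (obj Q n) k" "k \<noteq> 0" for n x k
    using graded_zero[OF Q.R.obj_ab, of n "dpart (obj Q n)" x 0 k] dp0[OF Q.R.obj_dpart] that Q.R.obj_graded[of n] unfolding graded_algebra_def by metis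
  have pull: "restrict (\<lambda>x. q0 (f (?cm x))) (carrier (cot S Q TU (Suc 0))) \<in> lift_cocycles S TU Q D0.KK D0.sc"
    and im: "\<And>x. x \<in> carrier (cot S Q TU (Suc 0)) ==> O0 (q0 (f (?cm x))) = f (?cm x)"
    if f: "f \<in> lift_cocycles S GG P D1.KK D1.sc" for f
  proof -
    obtain D where D: "graded_lift S P D1.KK D1.sc D"
      and fD: "\<And>x y. x \<in> carrier (obj P (Suc 0)) ==> y \<in> carrier GG ==> f (P.R.CT (Suc 0) (P.R.du (Suc 0) x) y) = y \<odot>\<^bsub>D1.KK\<^esub> D (alt_bd P 0 x)"
      and fa: "addhom (P.R.CL (Suc 0)) D1.KK f"
      by (rule P.R.lift_cocyclesD[OF D1.KK_graded_module f]) blast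
    have d: "der_along S (obj P 0) (aug P) D1.KK D1.sc D" using D by (simp add: graded_lift_def)
    note dd = der_alongD[OF d]
    note a0 = ring_hom_addhom[OF am(1)[of 0]]
    have Dc: "D (a 0 x) \<in> carrier D1.JJ" if "x \<in> carrier (obj Q 0)" for x
      using addhom_closed[OF dd(1) addhom_closed[OF a0 that]] by (simp add: D1.KK_simps)
    let ?D = "\<lambda>x. q0 (D (a 0 x))"
    have ad: "addhom (obj Q 0) D0.JJ ?D"
      using addhom_comp[OF a0 addhom_comp[OF dd(1), of D0.JJ q0]] q0_addhom by (simp add: D1.KK_simps)
    have ac: "aug Q x \<in> carrier T" if "x \<in> carrier (obj Q 0)" for x using Q.R.augn_closed[of x 0] that by simp
    have lift: "graded_lift S Q D0.KK D0.sc ?D"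
      unfolding graded_lift_def der_along_def
    proof (intro conjI ballI allI)
      show "addhom (obj Q 0) D0.KK ?D" using ad by (simp add: D0.KK_simps)
      fix x y assume x: "x \<in> carrier (obj Q 0)" and y: "y \<in> carrier (obj Q 0)"
      have g: "in0 N (aug Q x) \<in> carrier GG" "in0 N (aug Q y) \<in> carrier GG" using ac[OF x] ac[OF y] by (auto simp: in0_def)
      have "D (a 0 (x \<otimes>\<^bsub>obj Q 0\<^esub> y)) = in0 N (aug Q x) \<odot>\<^bsub>D1.KK\<^esub> D (a 0 y) \<oplus>\<^bsub>D1.JJ\<^esub> in0 N (aug Q y) \<odot>\<^bsub>D1.KK\<^esub> D (a 0 x)"
        using ring_hom_mult[OF am(1) x y] dd(2)[OF ring_hom_closed[OF am(1) x] ring_hom_closed[OF am(1) y]] am(5)[OF x] am(5)[OF y] by (simp add: D1.KK_simps)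
      then show "?D (x \<otimes>\<^bsub>obj Q 0\<^esub> y) = aug Q x \<odot>\<^bsub>D0.KK\<^esub> ?D y \<oplus>\<^bsub>D0.KK\<^esub> aug Q y \<odot>\<^bsub>D0.KK\<^esub> ?D x"
        using addhom_add[OF q0_addhom D1.KK_sm(1)[OF g(1) Dc[OF y]] D1.KK_sm(1)[OF g(2) Dc[OF x]]] q0_smult[OF g(1) Dc[OF y]] q0_smult[OF g(2) Dc[OF x]]
        by (simp add: D0.KK_simps in0_def)
    next
      fix r assume r: "r \<in> carrier S"
      have "a 0 (r \<odot>\<^bsub>obj Q 0\<^esub> \<one>\<^bsub>obj Q 0\<^esub>) = r \<odot>\<^bsub>obj P 0\<^esub> \<one>\<^bsub>obj P 0\<^esub>"
        using am(2)[OF r cring.cring_simprules(6)[OF Q.R.obj_cring]] ring_hom_one[OF am(1)[of 0]] by simp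
      then have "?D (r \<odot>\<^bsub>obj Q 0\<^esub> \<one>\<^bsub>obj Q 0\<^esub>) = q0 (D1.sc r)" using dd(3)[OF r] by simp
      also have "\<dots> = D0.sc r" unfolding D1.sc_def D0.sc_def
        using addhom_neg[OF D1.JG.abelian_group_axioms D0.JG.abelian_group_axioms q0_addhom, of "D1.jt (dS r) \<one>\<^bsub>GG\<^esub>"] r D0.dS_closed by (simp add: q0_tens)
      finally show "?D (r \<odot>\<^bsub>obj Q 0\<^esub> \<one>\<^bsub>obj Q 0\<^esub>) = D0.sc r" .
    next
      fix k show "?D ` dpart (obj Q 0) k \<subseteq> dpart D0.KK k"
        using addhom_closed[OF ad Q.R.obj_dpart[of _ 0 k]] dpk[of _ 0 k] addhom_zero[OF Q.R.obj_ab D0.JG.abelian_group_axioms ad] by (auto simp: D0_dpart)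
    qed
    have fcm: "f (?cm (Q.R.CT (Suc 0) (Q.R.du (Suc 0) x) y)) = in0 N y \<odot>\<^bsub>D1.KK\<^esub> D (a 0 (alt_bd Q 0 x))"
      if x: "x \<in> carrier (obj Q (Suc 0))" and y: "y \<in> carrier TU" for x y
      using cm(2)[OF _ x y] fD[OF ring_hom_closed[OF am(1) x] ring_hom_closed[OF in0_ring_hom y]] cm(3)[OF _ x] by simp
    have fcma: "addhom (Q.R.CL (Suc 0)) D1.JJ (\<lambda>x. f (?cm x))"
      using addhom_comp[OF cm(1) fa] by (simp add: D1.KK_simps)
    have xD: "D (a 0 (alt_bd Q 0 x)) \<in> carrier D1.JJ" "D (a 0 (alt_bd Q 0 x)) \<in> dpart D1.KK 0" if "x \<in> carrier (obj Q (Suc 0))" for x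
      using Dc Q.R.alt_bd_closed[OF that] graded_lift_dpart[OF D am(3)[OF dp0]] by auto
    have in0: "in0 N y \<in> carrier GG" "fst (in0 N y) = y" "snd (in0 N y) = \<zero>\<^bsub>N\<^esub>" if "y \<in> carrier TU" for y using that by (auto simp: in0_def)
    show "restrict (\<lambda>x. q0 (f (?cm x))) (carrier (cot S Q TU (Suc 0))) \<in> lift_cocycles S TU Q D0.KK D0.sc"
      by (rule Q.R.lift_cocyclesI[OF D0.KK_graded_module lift])
        (use addhom_comp[OF fcma q0_addhom] fcm q0_smult xD in0 in \<open>auto simp: D0.KK_simps\<close>)
    show "O0 (q0 (f (?cm x))) = f (?cm x)" if "x \<in> carrier (cot S Q TU (Suc 0))" for x
      using that unfolding Q.R.cot_simps
    proof (induction rule: C.LL_induct)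
      case (gen x y)
      have "O0 (y \<odot>\<^bsub>D0.KK\<^esub> q0 (D (a 0 (alt_bd Q 0 x)))) = in0 N y \<odot>\<^bsub>D1.KK\<^esub> D (a 0 (alt_bd Q 0 x))"
        using O0_smult[OF in0(1)[OF gen(2)] O_closed(3)[OF xD(1)[OF gen(1)]] in0(3)[OF gen(2)]] in0(2)[OF gen(2)] O0_q0[OF xD(2)[OF gen(1)]] by simp
      then show ?case using fcm[OF gen] q0_smult[OF in0(1)[OF gen(2)] xD(1)[OF gen(1)]] in0(2)[OF gen(2)] by (simp add: cot_tens_def)
    next
      case (add x y)
      then show ?case using addhom_closed[OF fcma] by (simp add: addhom_add[OF fcma] addhom_add[OF q0_addhom] addhom_add[OF O0_addhom] O_closed)
    qed
  qed
  have sub: "?Z \<subseteq> lift_cocycles S TU Q D0.KK D0.sc"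
  proof
    fix g assume "g \<in> ?Z"
    then obtain f where g: "g \<in> glinmaps TU (cot S Q TU (Suc 0)) D0.KK" and f: "f \<in> lift_cocycles S GG P D1.KK D1.sc"
      and eq: "\<And>x. x \<in> carrier (cot S Q TU (Suc 0)) ==> O0 (g x) = f (?cm x)" by (auto simp: P.KS_class_eq)
    have gl: "g \<in> linmaps TU (cot S Q TU (Suc 0)) D0.KK" using g by (simp add: glinmaps_def)
    have "restrict (\<lambda>x. q0 (f (?cm x))) (carrier (cot S Q TU (Suc 0))) = g"
      using eq q0_O0 linmaps_mem[OF gl] linmapsD(2)[OF gl] by (intro extensionalityI[of _ "carrier (cot S Q TU (Suc 0))"]) (auto simp: D0.KK_simps simp flip: eq)
    then show "g \<in> lift_cocycles S TU Q D0.KK D0.sc" using pull[OF f] by simp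
  qed
  obtain f where f: "f \<in> lift_cocycles S GG P D1.KK D1.sc" using P.lift_cocycles_ne by blast
  have "restrict (\<lambda>x. q0 (f (?cm x))) (carrier (cot S Q TU (Suc 0))) \<in> ?Z"
    using pull[OF f] im[OF f] f by (auto simp: P.KS_class_eq lift_cocycles_def)
  then have ne: "?Z \<noteq> {}" by blast
  show ?thesis unfolding trans_i_def Let_def Q.KS_class_eq One_nat_def[symmetric]
    using Q.R.lift_cocycles_class(1)[OF D0.KK_graded_module sub ne] by simp
qed

end
end
end

section \<open>The Kodaira-Spencer class of \<Gamma> as the image of \<kappa>(\<sigma>, N)\<close>

context ks_split
begin

context
  fixes F :: "('t, 'f, 'n) fres" and P :: "('s, 'p, 't \<times> 'n) sres" and R :: "('t, 'r, 't \<times> 'n) sres" and b :: "nat \<Rightarrow> 'p \<Rightarrow> 'r"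
  assumes F: "free_resolution T N F" and P: "sres_of S GG P" and R: "sres_of T (Gam (\<lambda>t. t) T N) R"
    and b: "sres_map S P R h (\<lambda>g. g) b"
begin

abbreviation "GT \<equiv> Gam (\<lambda>t. t) T N"

interpretation X: ext_res T N N F by (simp add: ext_res_def ext_res_axioms_def N.module_axioms F)

interpretation P: ks_res \<Lambda> S l GG P
  by (simp add: ks_res_def ks_res_axioms_def D1.ks_data_alg_axioms P)

lemma id_hom: "(\<lambda>t. t) \<in> ring_hom T T" by (rule ring_hom_memI) auto

interpretation R: sres_res T GT R
  by (simp add: sres_res_def R Gam_algebra[OF T.is_cring N.module_axioms id_hom] Gam_graded[OF T.is_cring N.module_axioms id_hom])

text \<open>\<Gamma> over S and \<Gamma> over T are the same graded ring; the records differ in the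
  scalar action.\<close>

lemma KK_graded_GT: "graded_module GT (dpart GT) D1.KK"
proof -
  have "module GT D1.KK"
    by (rule moduleI[OF Gam_cring[OF N.module_axioms] D1.KM.abelian_group_axioms])
      (use D1.KM.smult_closed D1.KM.smult_l_distr D1.KM.smult_r_distr D1.KM.smult_assoc1 D1.KM.smult_one in auto)
  then show ?thesis using D1.KK_graded_module unfolding graded_module_def by simp
qed

text \<open>The scalar values of the lift over T built from a connection. On h(s) they become
  \<open>sc\<close>, since D(\<sigma>)(h(s)) = ds \<otimes> 1.\<close>

definition "sc_rel t = \<ominus>\<^bsub>D1.JJ\<^esub> O0 (Ds t)"

text \<open>
  A connection \<open>nab\<close> on \<open>F\<close> becomes a derivation along \<open>aug R\<close> after subtracting the derivation \<open>D(\<sigma>)\<close> in degree 0: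
  the terms by which both fail to be derivations cancel.
\<close>

context
  fixes \<psi> nab
  assumes \<psi>: "comparison T N F R \<psi>" and nab: "connection T F OM ck nab"
begin

text \<open>The comparison map in degree 0, read as a derivation along \<open>aug R\<close> with
  values in \<open>fobj F 0\<close>.\<close>

definition "pc r = \<psi> 0 (R.CT 0 (R.du 0 r) \<one>\<^bsub>GT\<^esub>)"

lemma \<psi>_glin: "\<psi> n \<in> glinmaps GT (cot T R GT n) (shift1 (fobj F n))" (is "PROP ?g1")
  and \<psi>_bd: "x \<in> carrier (cot T R GT (Suc n)) ==> \<psi> n (cot_bd T R GT n x) = fbd F n (\<psi> (Suc n) x)" (is "PROP ?g2")
  and \<psi>_aug: "r \<in> carrier (obj R 0) ==> faug F (pc r) = snd (aug R r)"
proof -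
  note c = \<psi>[unfolded comparison_def Let_def]
  show "PROP ?g1" using conjunct1[OF c] by blast
  show "PROP ?g2" using conjunct1[OF conjunct2[OF c]] by blast
  assume r: "r \<in> carrier (obj R 0)"
  then have "snd (aug R r) \<in> carrier N" using R.augn_closed[of r 0] by auto
  then show "faug F (pc r) = snd (aug R r)"
    using conjunct2[OF conjunct2[OF c], THEN bspec, OF r, THEN bspec, OF R.G.one_closed] by (simp add: pc_def)
qed

lemma shift_graded: "graded_module GT (dpart GT) (shift1 (fobj F n))"
  by (rule shift1_graded_module[OF X.F_module N.module_axioms])

lemma pc_der: "der_along T (obj R 0) (aug R) (shift1 (fobj F 0)) (\<lambda>r. \<zero>\<^bsub>fobj F 0\<^esub>) pc"
  and pc_dpart: "r \<in> dpart (obj R 0) k ==> pc r \<in> dpart (shift1 (fobj F 0)) k"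
  using R.glinmaps_der(1,2)[OF shift_graded \<psi>_glin[of 0]] by (simp_all add: pc_def[abs_def])

definition "DR r = O1 (nab (pc r)) \<ominus>\<^bsub>D1.JJ\<^esub> O0 (Ds (fst (aug R r)))"

lemma aug_R: "r \<in> carrier (obj R 0) ==> fst (aug R r) \<in> carrier T \<and> snd (aug R r) \<in> carrier N \<and> aug R r \<in> carrier GG"
  using R.augn_closed[of r 0] by auto

lemma nab_closed: "x \<in> carrier (fobj F 0) ==> nab x \<in> carrier M1.JJ" and nab_add: "addhom (fobj F 0) M1.JJ nab"
  and nab_smult: "t \<in> carrier T ==> x \<in> carrier (fobj F 0) ==> nab (t \<odot>\<^bsub>fobj F 0\<^esub> x) = t \<odot>\<^bsub>OM\<^esub> nab x \<ominus>\<^bsub>M1.JJ\<^esub> ck t (faug F x)"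
  using nab addhom_closed[of "fobj F 0" M1.JJ nab x] unfolding connection_def by (auto simp: OM_simps)

lemma DR_add: "addhom (obj R 0) D1.JJ DR"
proof -
  have "addhom (obj R 0) T (\<lambda>r. fst (aug R r))"
    by (rule addhomI) (use aug_R addhom_add[OF ring_hom_addhom[OF R.augn_ring[of 0]]] in auto)
  from addhom_comp[OF this addhom_comp[OF Ds_addhom O0_addhom]]
  show ?thesis unfolding DR_def using addhom_diff[OF D1.JG.abelian_group_axioms addhom_comp[OF _ addhom_comp[OF nab_add O1_addhom]]]
      der_alongD(1)[OF pc_der] by simp
qed

lemma DR_mult:
  assumes x: "x \<in> carrier (obj R 0)" and y: "y \<in> carrier (obj R 0)"
  shows "DR (x \<otimes>\<^bsub>obj R 0\<^esub> y) = aug R x \<odot>\<^bsub>D1.KK\<^esub> DR y \<oplus>\<^bsub>D1.JJ\<^esub> aug R y \<odot>\<^bsub>D1.KK\<^esub> DR x"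
proof -
  interpret F0: module T "fobj F 0" by (rule X.F_module)
  define t n t' n' where tn: "t = fst (aug R x)" "n = snd (aug R x)" "t' = fst (aug R y)" "n' = snd (aug R y)"
  have tc: "t \<in> carrier T" "n \<in> carrier N" "t' \<in> carrier T" "n' \<in> carrier N" using aug_R[OF x] aug_R[OF y] tn by auto
  have ax: "aug R x = (t, n)" "aug R y = (t', n')" by (simp_all add: tn)
  define u v where uv: "u = Ds t" "v = Ds t'"
  have uvc: "u \<in> carrier D0.JJ" "v \<in> carrier D0.JJ" using tc Ds_closed uv by auto
  define p q where pq: "p = nab (pc x)" "q = nab (pc y)"
  have pcc: "pc r \<in> carrier (fobj F 0)" if "r \<in> carrier (obj R 0)" for r using addhom_closed[OF der_alongD(1)[OF pc_der] that] by simp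
  have pqc: "p \<in> carrier M1.JJ" "q \<in> carrier M1.JJ" using nab_closed pcc x y pq by auto
  have kc: "act u n' \<in> carrier M1.JJ" "act v n \<in> carrier M1.JJ" using act_closed uvc tc by auto
  have "pc (x \<otimes>\<^bsub>obj R 0\<^esub> y) = t \<odot>\<^bsub>fobj F 0\<^esub> pc y \<oplus>\<^bsub>fobj F 0\<^esub> t' \<odot>\<^bsub>fobj F 0\<^esub> pc x"
    using der_alongD(2)[OF pc_der x y] by (simp add: ax)
  then have 1: "nab (pc (x \<otimes>\<^bsub>obj R 0\<^esub> y)) = (t \<odot>\<^bsub>OM\<^esub> q \<ominus>\<^bsub>M1.JJ\<^esub> act u n') \<oplus>\<^bsub>M1.JJ\<^esub> (t' \<odot>\<^bsub>OM\<^esub> p \<ominus>\<^bsub>M1.JJ\<^esub> act v n)"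
    using pcc x y tc addhom_add[OF nab_add] nab_smult \<psi>_aug by (simp add: pq ck_def uv ax)
  have 2: "fst (aug R (x \<otimes>\<^bsub>obj R 0\<^esub> y)) = t \<otimes>\<^bsub>T\<^esub> t'"
    using ring_hom_mult[OF R.augn_ring[of 0] x y] by (simp add: ax)
  have g: "(t, n) \<in> carrier GG" "(t', n') \<in> carrier GG" using tc by auto
  \<comment> \<open>A product with (s, m) has a part that keeps the degree and a part, the product
    with m, that raises it by one.\<close>
  have split: "(s, m) \<odot>\<^bsub>D1.KK\<^esub> O0 w = O0 (s \<odot>\<^bsub>D0.KK\<^esub> w) \<oplus>\<^bsub>D1.JJ\<^esub> O1 (act w m)"
    if s: "s \<in> carrier T" and m: "m \<in> carrier N" and w: "w \<in> carrier D0.JJ" for s m w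
    using D1.KK_sm(3)[of "(s, \<zero>\<^bsub>N\<^esub>)" "(\<zero>\<^bsub>T\<^esub>, m)" "O0 w"] O_closed(1)[OF w] s m act_O0[OF w m] O0_smult[of "(s, \<zero>\<^bsub>N\<^esub>)" w] w by simp
  have o1: "O1 (t \<odot>\<^bsub>OM\<^esub> q) = (t, n) \<odot>\<^bsub>D1.KK\<^esub> O1 q" "O1 (t' \<odot>\<^bsub>OM\<^esub> p) = (t', n') \<odot>\<^bsub>D1.KK\<^esub> O1 p"
    using O1_smult[OF g(1) pqc(2)] O1_smult[OF g(2) pqc(1)] by simp_all
  have m1: "O1 (z \<ominus>\<^bsub>M1.JJ\<^esub> z') = O1 z \<ominus>\<^bsub>D1.JJ\<^esub> O1 z'" if "z \<in> carrier M1.JJ" "z' \<in> carrier M1.JJ" for z z'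
    by (rule addhom_minus[OF M1.JG.abelian_group_axioms D1.JG.abelian_group_axioms O1_addhom that])
  have sm: "g \<odot>\<^bsub>D1.KK\<^esub> (z \<ominus>\<^bsub>D1.JJ\<^esub> z') = g \<odot>\<^bsub>D1.KK\<^esub> z \<ominus>\<^bsub>D1.JJ\<^esub> g \<odot>\<^bsub>D1.KK\<^esub> z'" if "g \<in> carrier GG" "z \<in> carrier D1.JJ" "z' \<in> carrier D1.JJ" for g z z'
    by (rule addhom_minus[OF D1.JG.abelian_group_axioms D1.JG.abelian_group_axioms addhomI that(2,3)]) (use D1.KK_sm that(1) in auto)
  have smc: "t \<odot>\<^bsub>OM\<^esub> q \<in> carrier M1.JJ" "t' \<odot>\<^bsub>OM\<^esub> p \<in> carrier M1.JJ" "t \<odot>\<^bsub>D0.KK\<^esub> v \<in> carrier D0.JJ" "t' \<odot>\<^bsub>D0.KK\<^esub> u \<in> carrier D0.JJ"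
    using OM_sm D0.KK_sm pqc uvc tc by auto
  have "DR (x \<otimes>\<^bsub>obj R 0\<^esub> y) = ((t, n) \<odot>\<^bsub>D1.KK\<^esub> O1 q \<ominus>\<^bsub>D1.JJ\<^esub> O1 (act u n')) \<oplus>\<^bsub>D1.JJ\<^esub> ((t', n') \<odot>\<^bsub>D1.KK\<^esub> O1 p \<ominus>\<^bsub>D1.JJ\<^esub> O1 (act v n))
     \<ominus>\<^bsub>D1.JJ\<^esub> (O0 (t \<odot>\<^bsub>D0.KK\<^esub> v) \<oplus>\<^bsub>D1.JJ\<^esub> O0 (t' \<odot>\<^bsub>D0.KK\<^esub> u))"
    unfolding DR_def 1 2 using smc kc by (simp add: Ds_mult[OF tc(1,3)] addhom_add[OF O1_addhom] addhom_add[OF O0_addhom] m1 o1 uv)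
  \<comment> \<open>Exchanging the two defect terms pairs each with the D(\<sigma>)-term having the
    same factor u or v; by \<open>split\<close> each pair is one product in \<Omega> \<otimes>
    \<Gamma>.\<close>
  also have "\<dots> = ((t, n) \<odot>\<^bsub>D1.KK\<^esub> O1 q \<ominus>\<^bsub>D1.JJ\<^esub> (O0 (t \<odot>\<^bsub>D0.KK\<^esub> v) \<oplus>\<^bsub>D1.JJ\<^esub> O1 (act v n)))
     \<oplus>\<^bsub>D1.JJ\<^esub> ((t', n') \<odot>\<^bsub>D1.KK\<^esub> O1 p \<ominus>\<^bsub>D1.JJ\<^esub> (O0 (t' \<odot>\<^bsub>D0.KK\<^esub> u) \<oplus>\<^bsub>D1.JJ\<^esub> O1 (act u n')))"
    using smc kc pqc O_closed(1,2) D1.KK_sm(1)[OF g(1)] D1.KK_sm(1)[OF g(2)] by (simp add: a_minus_def D1.JG.minus_add D1.JG.a_ac)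
  also have "\<dots> = aug R x \<odot>\<^bsub>D1.KK\<^esub> DR y \<oplus>\<^bsub>D1.JJ\<^esub> aug R y \<odot>\<^bsub>D1.KK\<^esub> DR x"
    unfolding DR_def ax pq(1)[symmetric] pq(2)[symmetric] using split tc uvc pqc O_closed(1,2) sm g by (simp add: uv)
  finally show ?thesis .
qed

lemma DR_lift: "graded_lift T R D1.KK sc_rel DR"
  unfolding graded_lift_def der_along_def
proof (intro conjI ballI allI)
  show "addhom (obj R 0) D1.KK DR" using DR_add by (simp add: D1.KK_simps)
  show "DR (x \<otimes>\<^bsub>obj R 0\<^esub> y) = aug R x \<odot>\<^bsub>D1.KK\<^esub> DR y \<oplus>\<^bsub>D1.KK\<^esub> aug R y \<odot>\<^bsub>D1.KK\<^esub> DR x"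
    if "x \<in> carrier (obj R 0)" "y \<in> carrier (obj R 0)" for x y using DR_mult[OF that] by (simp add: D1.KK_simps)
  have z: "O1 (nab \<zero>\<^bsub>fobj F 0\<^esub>) = \<zero>\<^bsub>D1.JJ\<^esub>"
    using addhom_zero[OF X.F_ab M1.JG.abelian_group_axioms nab_add] addhom_zero[OF M1.JG.abelian_group_axioms D1.JG.abelian_group_axioms O1_addhom] by simp
  have z0: "O0 (Ds \<zero>\<^bsub>T\<^esub>) = \<zero>\<^bsub>D1.JJ\<^esub>"
    using addhom_zero[OF T.is_abelian_group D0.JG.abelian_group_axioms Ds_addhom] addhom_zero[OF D0.JG.abelian_group_axioms D1.JG.abelian_group_axioms O0_addhom] by simp
  show "DR (t \<odot>\<^bsub>obj R 0\<^esub> \<one>\<^bsub>obj R 0\<^esub>) = sc_rel t" if t: "t \<in> carrier T" for t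
  proof -
    have "aug R (t \<odot>\<^bsub>obj R 0\<^esub> \<one>\<^bsub>obj R 0\<^esub>) = t \<odot>\<^bsub>GT\<^esub> \<one>\<^bsub>GT\<^esub>"
      using linear_smult[OF R.augn_linear[of 0] t, of "\<one>\<^bsub>obj R 0\<^esub>"] ring_hom_one[OF R.augn_ring[of 0]] cring.cring_simprules(6)[OF R.obj_cring] by simp
    then show ?thesis using der_alongD(3)[OF pc_der t] z O_closed(1)[OF Ds_closed[OF t]] t by (simp add: DR_def sc_rel_def a_minus_def)
  qed
  \<comment> \<open>\<open>pc\<close> vanishes outside degree 1 and the T-component outside degree
    0, so each summand has one relevant degree.\<close>
  fix k show "DR ` dpart (obj R 0) k \<subseteq> dpart D1.KK k"
  proof clarify
    fix r assume r: "r \<in> dpart (obj R 0) k"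
    have zk: "\<zero>\<^bsub>D1.JJ\<^esub> \<in> dpart D1.KK k" using subgroup.one_closed[OF D1.KK_sub] by simp
    have p: "pc r \<in> carrier (fobj F 0)" "k \<noteq> 1 ==> pc r = \<zero>\<^bsub>fobj F 0\<^esub>"
      using pc_dpart[OF r] abelian_monoid.zero_closed[OF abelian_group.axioms(1)[OF X.F_ab]] by (auto split: if_splits)
    have g: "fst (aug R r) \<in> carrier T" "k \<noteq> 0 ==> fst (aug R r) = \<zero>\<^bsub>T\<^esub>" using R.augn_dpart[of r 0 k] r by (auto split: if_splits)
    have a: "O1 (nab (pc r)) \<in> dpart D1.KK k" using p z zk O1_dpart[OF nab_closed[OF p(1)]] by (cases "k = 1") auto
    have b: "O0 (Ds (fst (aug R r))) \<in> dpart D1.KK k" using g z0 zk O0_dpart[OF Ds_closed[OF g(1)]] by (cases "k = 0") auto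
    show "DR r \<in> dpart D1.KK k" using R.J_minus[OF KK_graded_GT a b] by (simp add: DR_def D1.KK_simps)
  qed
qed

text \<open>Boundaries have augmentation 0, so there the correction by D(\<sigma>) disappears and
  the cocycle of the lift is the pulled-back cocycle of the connection.\<close>

lemma comparison_cocycle:
  assumes z: "\<And>y. y \<in> carrier (fobj F (Suc 0)) ==> z y = nab (fbd F 0 y)"
  shows "(\<lambda>x\<in>carrier (cot T R GT (Suc 0)). O1 (z (\<psi> (Suc 0) x))) \<in> lift_cocycles T GT R D1.KK sc_rel"
proof (rule R.lift_cocyclesI[OF KK_graded_GT DR_lift])
  interpret F0: module T "fobj F 0" by (rule X.F_module)
  interpret KM: module GT D1.KK by (rule R.J_module[OF KK_graded_GT])
  have pl: "linear GT (cot T R GT n) (shift1 (fobj F n)) (\<psi> n)" for n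
    using \<psi>_glin[of n] by (auto simp: glinmaps_def intro: linmapsD(1))
  have pa: "addhom (R.CL n) (fobj F n) (\<psi> n)" for n using linear_addhom[OF pl] by (simp add: R.cot_simps)
  have "addhom (R.CL (Suc 0)) D1.JJ (\<lambda>x. O1 (nab (fbd F 0 (\<psi> (Suc 0) x))))"
    by (rule addhom_comp[OF addhom_comp[OF addhom_comp[OF pa linear_addhom[OF X.F_bd]] nab_add] O1_addhom])
  then show "addhom (R.CL (Suc 0)) D1.KK (\<lambda>x. O1 (z (\<psi> (Suc 0) x)))"
    using z addhom_closed[OF pa[of "Suc 0"]] addhom_cong[OF _ _ R.CL_ab, of "Suc 0" D1.JJ "\<lambda>x. O1 (nab (fbd F 0 (\<psi> (Suc 0) x)))" "\<lambda>x. O1 (z (\<psi> (Suc 0) x))"]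
    by (simp add: D1.KK_simps)
  fix x y assume x: "x \<in> carrier (obj R (Suc 0))" and y: "y \<in> carrier GT"
  note ac = R.alt_bd_closed[OF x]
  have yc: "fst y \<in> carrier T" "y \<in> carrier GG" using y by auto
  have pcc: "pc (alt_bd R 0 x) \<in> carrier (fobj F 0)" using addhom_closed[OF der_alongD(1)[OF pc_der] ac] by simp
  have a0: "aug R (alt_bd R 0 x) = (\<zero>\<^bsub>T\<^esub>, \<zero>\<^bsub>N\<^esub>)" using R.alt_bd_aug[OF x] by simp
  have "z (\<psi> (Suc 0) (R.CT (Suc 0) (R.du (Suc 0) x) y)) = nab (\<psi> 0 (R.CT 0 (R.du 0 (alt_bd R 0 x)) y))"
    using z addhom_closed[OF pa R.CT_closed[OF x y]] \<psi>_bd[of "R.CT (Suc 0) (R.du (Suc 0) x) y" 0] R.CT_closed[OF x y] R.cot_bd_d[OF x y] by (simp add: R.cot_simps)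
  also have "\<psi> 0 (R.CT 0 (R.du 0 (alt_bd R 0 x)) y) = fst y \<odot>\<^bsub>fobj F 0\<^esub> pc (alt_bd R 0 x)"
    using R.glinmaps_der(3)[OF shift_graded \<psi>_glin ac y] by (simp add: pc_def)
  also have "nab \<dots> = fst y \<odot>\<^bsub>OM\<^esub> nab (pc (alt_bd R 0 x)) \<ominus>\<^bsub>M1.JJ\<^esub> ck (fst y) \<zero>\<^bsub>N\<^esub>"
    using nab_smult[OF yc(1) pcc] \<psi>_aug[OF ac] a0 by simp
  \<comment> \<open>Evaluating the connection on a multiple of 0 shows that the defect at 0
    vanishes.\<close>
  also have "ck (fst y) \<zero>\<^bsub>N\<^esub> = \<zero>\<^bsub>M1.JJ\<^esub>"
  proof -
    have "nab (fst y \<odot>\<^bsub>fobj F 0\<^esub> \<zero>\<^bsub>fobj F 0\<^esub>) = fst y \<odot>\<^bsub>OM\<^esub> nab \<zero>\<^bsub>fobj F 0\<^esub> \<ominus>\<^bsub>M1.JJ\<^esub> ck (fst y) (faug F \<zero>\<^bsub>fobj F 0\<^esub>)" using nab_smult[OF yc(1) F0.zero_closed] .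
    moreover have "nab \<zero>\<^bsub>fobj F 0\<^esub> = \<zero>\<^bsub>M1.JJ\<^esub>" by (rule addhom_zero[OF X.F_ab M1.JG.abelian_group_axioms nab_add])
    moreover have "faug F \<zero>\<^bsub>fobj F 0\<^esub> = \<zero>\<^bsub>N\<^esub>" by (rule addhom_zero[OF X.F_ab N.abelian_group_axioms linear_addhom[OF X.F_aug]])
    moreover have "fst y \<odot>\<^bsub>OM\<^esub> \<zero>\<^bsub>M1.JJ\<^esub> = \<zero>\<^bsub>M1.JJ\<^esub>" using OM.smult_r_null[OF yc(1)] by (simp add: OM_simps)
    moreover have "ck (fst y) \<zero>\<^bsub>N\<^esub> \<in> carrier M1.JJ" using ck_closed[OF yc(1) N.zero_closed] by (simp add: OM_simps)
    ultimately show ?thesis using yc(1) abelian_minus_eq[OF M1.JG.abelian_group_axioms, of "\<zero>\<^bsub>M1.JJ\<^esub>" "ck (fst y) \<zero>\<^bsub>N\<^esub>" "\<zero>\<^bsub>M1.JJ\<^esub>"] by simp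
  qed
  finally have "z (\<psi> (Suc 0) (R.CT (Suc 0) (R.du (Suc 0) x) y)) = fst y \<odot>\<^bsub>OM\<^esub> nab (pc (alt_bd R 0 x))"
    using OM_sm(1)[OF yc(1) nab_closed[OF pcc]] addhom_zero[OF M1.JG.abelian_group_axioms M1.JG.abelian_group_axioms addhom_uminus[OF M1.JG.abelian_group_axioms addhom_id]]
    by (simp add: a_minus_def)
  moreover have "DR (alt_bd R 0 x) = O1 (nab (pc (alt_bd R 0 x)))"
    using addhom_zero[OF T.is_abelian_group D0.JG.abelian_group_axioms Ds_addhom] addhom_zero[OF D0.JG.abelian_group_axioms D1.JG.abelian_group_axioms O0_addhom]
      O_closed(2)[OF nab_closed[OF pcc]] abelian_minus_eq[OF D1.JG.abelian_group_axioms, of _ "\<zero>\<^bsub>D1.JJ\<^esub>"] by (simp add: DR_def a0)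
  ultimately show "O1 (z (\<psi> (Suc 0) (R.CT (Suc 0) (R.du (Suc 0) x) y))) = y \<odot>\<^bsub>D1.KK\<^esub> DR (alt_bd R 0 x)"
    using O1_smult[OF yc(2) nab_closed[OF pcc]] by simp
qed

end

text \<open>The pulled-back cocycles form a nonempty part of the coset belonging to
  \<open>sc_rel\<close>, so they generate its class.\<close>

lemma ext_to_cot_kappa: "ext_to_cot 1 T N F R D1.KK O1 (kappa \<Lambda> S T N l h \<sigma> F) = lift_cocycles T GT R D1.KK sc_rel" (is "PROP ?g1")
  and rel_cocycles_ne: "lift_cocycles T GT R D1.KK sc_rel \<noteq> {}"
proof -
  let ?Z = "{\<lambda>x\<in>carrier (cot T R GT 1). O1 (z (\<psi> 1 x)) | z \<psi>. z \<in> kappa \<Lambda> S T N l h \<sigma> F \<and> comparison T N F R \<psi>}"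
  have sub: "?Z \<subseteq> lift_cocycles T GT R D1.KK sc_rel"
    using comparison_cocycle by (auto simp: kappa_connection(1)[OF F] connection_cocycles_def)
  obtain \<psi> where "comparison T N F R \<psi>" by (rule comparison_exists[OF N.module_axioms X.ext_res_axioms R])
  moreover obtain z where "z \<in> kappa \<Lambda> S T N l h \<sigma> F" using kappa_connection(1,2)[OF F] by blast
  ultimately have ne: "?Z \<noteq> {}" by blast
  show "PROP ?g1"
    unfolding ext_to_cot_def Let_def by (rule R.lift_cocycles_class(1)[OF KK_graded_GT sub ne])
  show "lift_cocycles T GT R D1.KK sc_rel \<noteq> {}" using sub ne by blast
qed

text \<open>Lifts over T restrict along P -> R to lifts over S. A scalar s acts through h(s), where
  \<open>sc_rel\<close> has the value -ds \<otimes> 1 of the Kodaira-Spencer extension.\<close>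

lemma trans_u_kappa: "trans_u 1 S T N h F P R b D1.KK O1 (kappa \<Lambda> S T N l h \<sigma> F) = KS_class \<Lambda> S l GG P"
proof -
  let ?cm = "cot_map T R GT (Suc 0) (b (Suc 0)) (\<lambda>g. g)"
  let ?Z = "{\<lambda>x\<in>carrier (cot S P GG 1). f (?cm x) | f. f \<in> lift_cocycles T GT R D1.KK sc_rel}"
  have idg: "(\<lambda>g. g) \<in> ring_hom GG GT" by (rule ring_hom_memI) auto
  note bm = sres_mapD[OF b] and cm = sres_map_cot[OF P.R.sres_res_axioms R.sres_res_axioms b h_closed idg]
  have sub: "?Z \<subseteq> lift_cocycles S GG P D1.KK D1.sc"
  proof clarify
    fix f assume f: "f \<in> lift_cocycles T GT R D1.KK sc_rel"
    obtain D where D: "graded_lift T R D1.KK sc_rel D"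
      and fD: "\<And>x y. x \<in> carrier (obj R (Suc 0)) ==> y \<in> carrier GT ==> f (R.CT (Suc 0) (R.du (Suc 0) x) y) = y \<odot>\<^bsub>D1.KK\<^esub> D (alt_bd R 0 x)"
      and fa: "addhom (R.CL (Suc 0)) D1.KK f"
      by (rule R.lift_cocyclesD[OF KK_graded_GT f]) blast
    have d: "der_along T (obj R 0) (aug R) D1.KK sc_rel D" using D by (simp add: graded_lift_def)
    note dd = der_alongD[OF d]
    have "graded_lift S P D1.KK D1.sc (\<lambda>x. D (b 0 x))"
      unfolding graded_lift_def der_along_def
    proof (intro conjI ballI allI)
      show "addhom (obj P 0) D1.KK (\<lambda>x. D (b 0 x))" by (rule addhom_comp[OF ring_hom_addhom[OF bm(1)] dd(1)])
      show "D (b 0 (x \<otimes>\<^bsub>obj P 0\<^esub> y)) = aug P x \<odot>\<^bsub>D1.KK\<^esub> D (b 0 y) \<oplus>\<^bsub>D1.KK\<^esub> aug P y \<odot>\<^bsub>D1.KK\<^esub> D (b 0 x)"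
        if "x \<in> carrier (obj P 0)" "y \<in> carrier (obj P 0)" for x y
        using ring_hom_mult[OF bm(1) that] dd(2) ring_hom_closed[OF bm(1)] bm(5) that by simp
      show "D (b 0 (r \<odot>\<^bsub>obj P 0\<^esub> \<one>\<^bsub>obj P 0\<^esub>)) = D1.sc r" if r: "r \<in> carrier S" for r
        using bm(2)[OF r cring.cring_simprules(6)[OF P.R.obj_cring]] ring_hom_one[OF bm(1)[of 0]] dd(3)[of "h r"] Ds_h[OF r] D0.dS_closed[OF r] r
        by (simp add: sc_rel_def D1.sc_def O0_tens)
      show "(\<lambda>x. D (b 0 x)) ` dpart (obj P 0) k \<subseteq> dpart D1.KK k" for k
        using graded_lift_dpart[OF D] bm(3)[of _ 0 k] by auto
    qed
    then show "(\<lambda>x\<in>carrier (cot S P GG 1). f (?cm x)) \<in> lift_cocycles S GG P D1.KK D1.sc"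
      unfolding One_nat_def
    proof (rule P.R.lift_cocyclesI[OF D1.KK_graded_module])
      show "addhom (P.R.CL (Suc 0)) D1.KK (\<lambda>x. f (?cm x))" by (rule addhom_comp[OF cm(1) fa])
      fix x y assume x: "x \<in> carrier (obj P (Suc 0))" and y: "y \<in> carrier GG"
      then show "f (?cm (P.R.CT (Suc 0) (P.R.du (Suc 0) x) y)) = y \<odot>\<^bsub>D1.KK\<^esub> D (b 0 (alt_bd P 0 x))"
        using cm(2)[OF _ x y] cm(3)[OF _ x] fD[OF ring_hom_closed[OF bm(1) x], of y] by simp
    qed
  qed
  have ne: "?Z \<noteq> {}" using rel_cocycles_ne by blast
  show ?thesis unfolding trans_u_def ext_to_cot_kappa P.KS_class_eq
    using P.R.lift_cocycles_class(1)[OF D1.KK_graded_module sub ne] by simp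
qed

end
end

section \<open>Atiyah classes and contractions\<close>

lemma restr_scalars_id [simp]: "restr_scalars (\<lambda>t. t) N = N" for N :: "('t, 'n) module"
  by (simp add: restr_scalars_def modl_def)

lemma ungr_tensor: "tensor R M (ungr A) = tensor R M A" "tens R M (ungr A) = tens R M A"
  by (simp_all add: tensor_def tens_def tensor_cls_def tensor_ker_def tensor_free_def tensor_rels_def fun_eq_iff)

text \<open>The section n -> 1 \<otimes> n is linear for j2 and the module acts through j1, so the
  defect is ds \<otimes> n. The result is applied to T over \<Lambda> in place of S.\<close>

lemma (in ks_base) atiyah_connection:
  fixes N :: "('s, 'n) module"
  assumes N: "module S N" and F: "free_resolution S N F"
  shows "atiyah \<Lambda> S N l F = connection_cocycles S F (Omega_mod \<Lambda> S l (\<lambda>s. s) N) (\<lambda>s n. tens S OW N (dS s) n)"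
    and "connection_cocycles S F (Omega_mod \<Lambda> S l (\<lambda>s. s) N) (\<lambda>s n. tens S OW N (dS s) n) \<noteq> {}"
    and "ext_res S (Omega_mod \<Lambda> S l (\<lambda>s. s) N) N F"
proof -
  interpret N: module S N by fact
  interpret A: ks_setup \<Lambda> S l S N "\<lambda>s. s"
    by (simp add: ks_setup_def ks_setup_axioms_def ks_base_axioms S.is_cring N ring_hom_def)
  interpret M: ks_mod \<Lambda> S l N by (simp add: ks_mod_def ks_base_axioms N)
  note os = A.OM_simps[simplified]
  show x: "ext_res S A.OM N F" by (simp add: ext_res_def ext_res_axioms_def A.OM_module N F)
  let ?E = "tensor_left S PR N (pp_left \<Lambda> (alg l S))"
  have E: "carrier ?E = carrier M.EE" "add ?E = add M.EE" "a_minus ?E = a_minus M.EE"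
    "addhom ?E B f \<longleftrightarrow> addhom M.EE B f" "addhom C ?E g \<longleftrightarrow> addhom C M.EE g" for B f C g
    by (simp_all add: tensor_left_def)
  interpret L: module S ?E by (rule M.left_module)
  have J1: "s \<in> carrier S ==> J1 s \<in> carrier PP" for s using K.J_closed by simp
  have sm: "x \<in> carrier M.JJ ==> y \<in> carrier M.JJ ==> s \<in> carrier S ==> s \<odot>\<^bsub>A.OM\<^esub> (x \<oplus>\<^bsub>M.JJ\<^esub> y) = s \<odot>\<^bsub>A.OM\<^esub> x \<oplus>\<^bsub>M.JJ\<^esub> s \<odot>\<^bsub>A.OM\<^esub> y \<and> s \<odot>\<^bsub>A.OM\<^esub> x \<in> carrier M.JJ" for x y s
    using A.OM_sm by simp
  have esm: "x \<in> carrier M.EE ==> y \<in> carrier M.EE ==> s \<in> carrier S ==> s \<odot>\<^bsub>?E\<^esub> (x \<oplus>\<^bsub>M.EE\<^esub> y) = s \<odot>\<^bsub>?E\<^esub> x \<oplus>\<^bsub>M.EE\<^esub> s \<odot>\<^bsub>?E\<^esub> y \<and> s \<odot>\<^bsub>?E\<^esub> x \<in> carrier M.EE" for x y s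
    using L.smult_r_distr[of s x y] L.smult_closed[of s x] by (simp add: E)
  have i: "linear S A.OM ?E M.inc"
  proof (rule linearI)
    show "addhom A.OM ?E M.inc" using M.inc_addhom by (simp add: os E)
    fix s x assume s: "s \<in> carrier S" and "x \<in> carrier A.OM"
    then have "x \<in> carrier M.JJ" by (simp add: os)
    then show "M.inc (s \<odot>\<^bsub>A.OM\<^esub> x) = s \<odot>\<^bsub>?E\<^esub> M.inc x"
    proof (induction rule: M.JT.tensor_induct)
      case (tens w n)
      have "M.et (J1 s \<otimes>\<^bsub>PP\<^esub> w) n = M.et w (s \<odot>\<^bsub>N\<^esub> n)"
        using M.ET.tens_smult[of s w n] K.W_right[of s w] K.W_sub[of w] s tens by (simp add: K.W_simps pp_left_def)
      then show ?case using s tens A.OM_tens[of s w n] M.left_smult[of s w n] K.W_sub[of w] by (simp add: M.inc_tens)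
    qed (use s in \<open>simp add: sm esm addhom_add[OF M.inc_addhom] M.ks_closed\<close>)
  qed
  have p: "linear S ?E N M.prj"
  proof (rule linearI)
    show "addhom ?E N M.prj" using M.prj_addhom by (simp add: E)
    fix s x assume s: "s \<in> carrier S" and "x \<in> carrier ?E"
    then have "x \<in> carrier M.EE" by (simp add: E)
    then show "M.prj (s \<odot>\<^bsub>?E\<^esub> x) = s \<odot>\<^bsub>N\<^esub> M.prj x"
      by (induction rule: M.ET.tensor_induct)
        (use s J1 in \<open>simp_all add: esm M.left_smult M.prj_tens eps_simps addhom_add[OF M.prj_addhom] M.ks_closed N.smult_r_distr N.smult_assoc1\<close>)
  qed
  \<comment> \<open>The relation j1(s) = j2(s) - ds, verified in coordinates.\<close>
  have tw: "s \<odot>\<^bsub>?E\<^esub> M.unt n = M.unt (s \<odot>\<^bsub>N\<^esub> n) \<ominus>\<^bsub>?E\<^esub> M.inc (M.jt (dS s) n)" if s: "s \<in> carrier S" and n: "n \<in> carrier N" for s n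
  proof -
    have c: "M.jt (dS s) n \<in> carrier M.JJ" "M.unt (s \<odot>\<^bsub>N\<^esub> n) \<in> carrier M.EE" "M.et (J1 s) n \<in> carrier M.EE"
      using M.dS_closed s n M.ks_closed(4) J1 by auto
    note ic = M.ks_closed(1)[OF c(1)]
    have o1: "omega_part \<one>\<^bsub>PP\<^esub> = \<zero>\<^bsub>OW\<^esub>" using omega_part(5)[of "\<one>\<^bsub>S\<^esub>"] K.J2_simps(3) by simp
    have "M.et (J1 s) n = M.unt (s \<odot>\<^bsub>N\<^esub> n) \<ominus>\<^bsub>M.EE\<^esub> M.inc (M.jt (dS s) n)"
      by (rule M.EE_eqI)
        (use c ic s n J1[OF s] addhom_minus[OF M.EG.abelian_group_axioms M.JG.abelian_group_axioms M.ret_addhom c(2) ic]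
          addhom_minus[OF M.EG.abelian_group_axioms N.abelian_group_axioms M.prj_addhom c(2) ic] in
         \<open>simp_all add: M.ret_tens o1 M.JT.tens_zero_left M.ret_inc M.prj_inc M.prj_unt omega_part(7) M.JT.tens_neg_left M.dS_closed M.prj_tens eps_simps a_minus_def\<close>)
    then show ?thesis using M.left_smult[of s "\<one>\<^bsub>PP\<^esub>" n] s n J1 by (simp add: E)
  qed
  have jc: "M.jt (dS s) n \<in> carrier A.OM" if "s \<in> carrier S" "n \<in> carrier N" for s n using that M.dS_closed by (simp add: os)
  have "addhom N ?E M.unt" "addhom ?E A.OM M.ret" using M.unt_addhom M.ret_addhom by (simp_all add: os E)
  note x = ext_res.ses_class_connection[OF x jc M.left_module i p this _ _ M.prj_unt _ tw, unfolded os E, OF _ _ M.ret_inc M.prj_inc _ M.ks_dec]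
  show "atiyah \<Lambda> S N l F = connection_cocycles S F A.OM (\<lambda>s n. M.jt (dS s) n)"
    "connection_cocycles S F A.OM (\<lambda>s n. M.jt (dS s) n) \<noteq> {}"
    using x by (simp_all add: atiyah_def Let_def)
qed

lemma (in ks_base) Omega_mod_linearI:
  fixes N :: "('s, 'n) module"
  assumes N: "module S N" and M: "module S M" and f: "addhom (tensor S OW N) M f"
    and eq: "\<And>s w n. s \<in> carrier S ==> w \<in> carrier OW ==> n \<in> carrier N ==>
      f (tens S OW N w (s \<odot>\<^bsub>N\<^esub> n)) = s \<odot>\<^bsub>M\<^esub> f (tens S OW N w n)"
  shows "linear S (Omega_mod \<Lambda> S l (\<lambda>s. s) N) M f"
proof -
  interpret M: module S M by fact
  interpret A: ks_setup \<Lambda> S l S N "\<lambda>s. s"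
    by (simp add: ks_setup_def ks_setup_axioms_def ks_base_axioms S.is_cring N ring_hom_def)
  interpret B: ks_mod \<Lambda> S l N by (simp add: ks_mod_def ks_base_axioms N)
  show ?thesis
  proof (rule linearI)
    show "addhom A.OM M f" using f by (simp add: A.OM_simps)
    fix s x assume s: "s \<in> carrier S" and "x \<in> carrier A.OM"
    then have "x \<in> carrier B.JJ" by (simp add: A.OM_simps)
    then show "f (s \<odot>\<^bsub>A.OM\<^esub> x) = s \<odot>\<^bsub>M\<^esub> f x"
      by (induction rule: B.JT.tensor_induct)
        (use s A.OM_tens[of s] A.OM_sm[of s] eq addhom_closed[OF f] in \<open>simp_all add: addhom_add[OF f] M.smult_r_distr\<close>)
  qed
qed

lemma (in ks_mod) contract:
  assumes f: "linear S OW (alg (\<lambda>s. s) S) f"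
  shows "addhom JJ N (contract S N f)"
    and "w \<in> carrier OW ==> n \<in> carrier N ==> contract S N f (jt w n) = f w \<odot>\<^bsub>N\<^esub> n" (is "PROP ?g1")
proof -
  have "module S (alg (\<lambda>s. s) S)" by (rule alg_module[OF S.is_cring S.is_cring]) (simp add: ring_hom_def)
  then interpret U: two_modules S "alg (\<lambda>s. s) S" N by (simp add: two_modules_def N.module_axioms)
  have fc: "f w \<in> carrier S" if "w \<in> carrier OW" for w using addhom_closed[OF linear_addhom[OF f] that] by simp
  have "tens S (alg (\<lambda>s. s) S) N (f (r \<odot>\<^bsub>OW\<^esub> m)) n = tens S (alg (\<lambda>s. s) S) N (f m) (r \<odot>\<^bsub>N\<^esub> n)" if "r \<in> carrier S" "m \<in> carrier OW" "n \<in> carrier N" for r m n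
    using linear_smult[OF f that(1,2)] U.tens_smult[of r "f m" n] fc that by simp
  note t = tmap_addhom[OF U.two_modules_axioms JT.two_modules_axioms linear_addhom[OF f] addhom_id this]
  have b: "balanced S (alg (\<lambda>s. s) S) N N (\<lambda>s n. s \<odot>\<^bsub>N\<^esub> n)"
    by (rule balancedI) (auto simp: N.smult_l_distr N.smult_r_distr N.smult_assoc1[symmetric] S.m_comm)
  note u = U.tlift_addhom[OF N.abelian_group_axioms b, folded tensor_unit_def] U.tlift_tens[OF N.abelian_group_axioms b, folded tensor_unit_def]
  show "addhom JJ N (contract S N f)"
    unfolding contract_def using addhom_comp[OF t(1) u(1)] .
  show "PROP ?g1"
    unfolding contract_def using t(2) u(2) fc by simp
qed

lemma (in ks_base) lin_of_der_scalars:
  assumes Y: "Y \<in> Der \<Lambda> (alg l S) (alg (\<lambda>s. s) S)"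
  shows "linear S OW (alg (\<lambda>s. s) S) (lin_of_der \<Lambda> (alg l S) (alg (\<lambda>s. s) S) Y)" (is "PROP ?g1")
    and "s \<in> carrier S ==> lin_of_der \<Lambda> (alg l S) (alg (\<lambda>s. s) S) Y (dS s) = Y s" (is "PROP ?g2")
proof -
  have "module (alg l S) (alg (\<lambda>s. s) S)" by (rule alg_module) (auto simp: S.is_cring ring_hom_def)
  note d = K.lin_of_der[OF this Y]
  show "PROP ?g1" using linmapsD(1)[OF d(1)] by (simp add: linear_def)
  show "PROP ?g2" using d(2) by simp
qed

context ks_setup
begin

text \<open>The first identity is the balance of \<open>act\<close> over T, the second its
  linearity; together they make it a T-linear map on (\<Omega> \<otimes> T) \<otimes> N.\<close>

lemma act_smult:
  assumes t: "t \<in> carrier T" and y: "y \<in> carrier D0.JJ" and n: "n \<in> carrier N"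
  shows "act (t \<odot>\<^bsub>D0.KK\<^esub> y) n = act y (t \<odot>\<^bsub>N\<^esub> n)" (is "PROP ?g1") "t \<odot>\<^bsub>OM\<^esub> act y n = act y (t \<odot>\<^bsub>N\<^esub> n)" (is "PROP ?g2")
proof -
  have tn: "t \<odot>\<^bsub>N\<^esub> n \<in> carrier N" using t n by simp
  note s = addhom_add[OF act_addhom[OF n]] addhom_add[OF act_addhom[OF tn]] D0.KK_sm(1,2) act_closed
  show "PROP ?g1" using y
    by (induction rule: D0.JT.tensor_induct) (use t n s in \<open>simp_all add: D0.KK_smult act_tens N.smult_assoc1[symmetric] T.m_comm\<close>)
  show "PROP ?g2" using y
    by (induction rule: D0.JT.tensor_induct) (use t n s OM_sm in \<open>simp_all add: act_tens OM_tens N.smult_assoc1[symmetric] T.m_comm\<close>)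
qed

lemma act_add:
  assumes n: "n \<in> carrier N" "n' \<in> carrier N" and y: "y \<in> carrier D0.JJ"
  shows "act y (n \<oplus>\<^bsub>N\<^esub> n') = act y n \<oplus>\<^bsub>M1.JJ\<^esub> act y n'"
proof -
  have nn: "n \<oplus>\<^bsub>N\<^esub> n' \<in> carrier N" using n by simp
  show ?thesis using y
    by (induction rule: D0.JT.tensor_induct)
      (use n nn addhom_add[OF act_addhom[OF nn]] addhom_add[OF act_addhom[OF n(1)]] addhom_add[OF act_addhom[OF n(2)]] act_closed in
        \<open>simp_all add: act_tens N.smult_r_distr M1.JT.tens_add_right[simplified] M1.JG.a_ac\<close>)
qed

text \<open>The isomorphism \<open>tensor_cancel\<close> sends y \<otimes> n to
  \<open>act y n\<close>, so f \<otimes> id becomes the product of f(w) with n.\<close>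

lemma tensor_der_map:
  assumes WM: "module T WT" and f: "linear T WT D0.KK f"
  shows "addhom (tensor T WT N) M1.JJ (tensor_der_map \<Lambda> S T N l h f)" (is "PROP ?g1")
    and "w \<in> carrier WT ==> n \<in> carrier N ==> tensor_der_map \<Lambda> S T N l h f (tens T WT N w n) = act (f w) n" (is "PROP ?g2")
proof -
  have "module T D0.KK"
    by (rule moduleI[OF T.is_cring D0.KM.abelian_group_axioms])
      (use D0.KM.smult_closed D0.KM.smult_l_distr D0.KM.smult_r_distr D0.KM.smult_assoc1 D0.KM.smult_one in auto)
  then interpret U: two_modules T D0.KK N by (simp add: two_modules_def N.module_axioms)
  interpret V: two_modules T WT N using WM by (simp add: two_modules_def N.module_axioms)
  have fc: "f w \<in> carrier D0.KK" if "w \<in> carrier WT" for w using addhom_closed[OF linear_addhom[OF f] that] .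
  have "tens T D0.KK N (f (r \<odot>\<^bsub>WT\<^esub> m)) n = tens T D0.KK N (f m) (r \<odot>\<^bsub>N\<^esub> n)" if "r \<in> carrier T" "m \<in> carrier WT" "n \<in> carrier N" for r m n
    using linear_smult[OF f that(1,2)] U.tens_smult[of r "f m" n] fc that by simp
  note t = tmap_addhom[OF U.two_modules_axioms V.two_modules_axioms linear_addhom[OF f] addhom_id this]
  have b: "balanced T D0.KK N M1.JJ act"
    by (rule balancedI) (auto simp: D0.KK_simps act_closed act_add addhom_add[OF act_addhom] act_smult(1))
  note u = U.tlift_addhom[OF M1.JG.abelian_group_axioms b] U.tlift_tens[OF M1.JG.abelian_group_axioms b]
  have e: "tensor_der_map \<Lambda> S T N l h f x = tlift M1.JJ act (tmap T D0.KK N f (\<lambda>y. y) x)" for x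
    by (simp add: tensor_der_map_def tensor_cancel_def Let_def act_def[abs_def])
  show "PROP ?g1"
    unfolding e[abs_def] by (rule addhom_comp[OF t(1) u(1)])
  show "PROP ?g2"
    unfolding e using t(2) u(2) fc by simp
qed

text \<open>Contraction with f is compatible with multiplication by T, and it turns the product of
  \<Omega> \<otimes> T with N into the action of T on N.\<close>

lemma contract_act:
  assumes f: "linear S OW (alg (\<lambda>s. s) S) f" and t: "t \<in> carrier T" and n: "n \<in> carrier N"
  shows "x \<in> carrier M1.JJ ==> contract S NS f (t \<odot>\<^bsub>OM\<^esub> x) = t \<odot>\<^bsub>N\<^esub> contract S NS f x"
    and "y \<in> carrier D0.JJ ==> contract S (alg h T) f (t \<odot>\<^bsub>D0.KK\<^esub> y) = t \<otimes>\<^bsub>T\<^esub> contract S (alg h T) f y"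
    and "y \<in> carrier D0.JJ ==> contract S NS f (act y n) = contract S (alg h T) f y \<odot>\<^bsub>N\<^esub> n"
proof -
  have "ks_mod \<Lambda> S l (alg h T)" by (simp add: ks_mod_def ks_base_axioms alg_module[OF S.is_cring T.is_cring h])
  note T = ks_mod.contract[OF this f] and N = M1.contract[OF f]
  have Ta: "addhom D0.JJ T (contract S (alg h T) f)" and Na: "addhom M1.JJ N (contract S NS f)" using T(1) N(1) by (simp_all add: ungr_tensor)
  have fc: "f w \<in> carrier S" if "w \<in> carrier OW" for w using addhom_closed[OF linear_addhom[OF f] that] by simp
  have Tt: "contract S (alg h T) f (D0.jt w s) = h (f w) \<otimes>\<^bsub>T\<^esub> s" if "w \<in> carrier OW" "s \<in> carrier T" for w s using T(2) that by (simp add: ungr_tensor)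
  have Nt: "contract S NS f (M1.jt w m) = h (f w) \<odot>\<^bsub>N\<^esub> m" if "w \<in> carrier OW" "m \<in> carrier N" for w m using N(2) that by simp
  show "contract S NS f (t \<odot>\<^bsub>OM\<^esub> x) = t \<odot>\<^bsub>N\<^esub> contract S NS f x" if "x \<in> carrier M1.JJ" using that
    by (induction rule: M1.JT.tensor_induct)
      (use t fc addhom_closed[OF Na] in \<open>simp_all add: OM_tens OM_sm Nt addhom_add[OF Na] N.smult_r_distr N.smult_assoc1[symmetric] T.m_comm\<close>)
  show "contract S (alg h T) f (t \<odot>\<^bsub>D0.KK\<^esub> y) = t \<otimes>\<^bsub>T\<^esub> contract S (alg h T) f y" if "y \<in> carrier D0.JJ" using that
  proof (induction rule: D0.JT.tensor_induct)
    case (tens w s) then show ?case using t fc Tt[of w s] Tt[of w "t \<otimes>\<^bsub>T\<^esub> s"] D0.KK_smult[of t w s] by (simp add: T.m_lcomm)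
  next
    case (add x y) then show ?case using t D0.KK_sm[of t] by (simp add: addhom_add[OF Ta] addhom_closed[OF Ta] T.r_distr)
  qed
  show "contract S NS f (act y n) = contract S (alg h T) f y \<odot>\<^bsub>N\<^esub> n" if "y \<in> carrier D0.JJ" using that
  proof (induction rule: D0.JT.tensor_induct)
    case (tens w s) then show ?case using n fc Tt[of w s] act_tens[OF n, of w s] Nt[of w "s \<odot>\<^bsub>N\<^esub> n"] by (simp add: N.smult_assoc1)
  next
    case (add x y) then show ?case
      using n by (simp add: addhom_add[OF Ta] addhom_closed[OF Ta] addhom_add[OF act_addhom[OF n]] addhom_add[OF Na] act_closed N.smult_l_distr)
  qed
qed

end

section \<open>Comparison of \<kappa>(\<sigma>, N) with the Atiyah class\<close>

context ks_split
begin

context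
  fixes F :: "('t, 'f, 'n) fres"
  assumes F: "free_resolution T N F"
begin

interpretation X: ext_res T OM N F by (simp add: ext_res_def ext_res_axioms_def OM_module N.module_axioms F)

text \<open>T over \<Lambda>, so that the results on S over \<Lambda> apply to the Atiyah
  class.\<close>

interpretation B: ks_base \<Lambda> T "h \<circ> l"
  using l h by (simp add: ks_base_def ks_base_axioms_def L.is_cring T.is_cring ring_hom_def Pi_iff)

interpretation BN: ks_mod \<Lambda> T "h \<circ> l" N by (simp add: ks_mod_def B.ks_base_axioms N.module_axioms)

abbreviation "AM \<equiv> Omega_mod \<Lambda> T (h \<circ> l) (\<lambda>t. t) N"

lemma AM_simps: "carrier AM = carrier BN.JJ" "add AM = add BN.JJ" "addhom AM C f \<longleftrightarrow> addhom BN.JJ C f"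
  by (simp_all add: Omega_mod_def tensor_right_def)

lemmas AM_linearI = B.Omega_mod_linearI[OF N.module_axioms]

lemmas at = B.atiyah_connection[OF N.module_axioms F]

text \<open>Both sides are sets of cocycles of connections with the same defect: f sends dt to
  D(\<sigma>)(t), hence dt \<otimes> n to \<open>ck t n\<close>.\<close>

lemma kappa_atiyah:
  "kappa \<Lambda> S T N l h \<sigma> F = ext_push 1 T F OM (tensor_der_map \<Lambda> S T N l h
     (lin_of_der \<Lambda> (alg (h \<circ> l) T) D0.KK (split_der \<Lambda> S T l h \<sigma>))) (atiyah \<Lambda> T N (h \<circ> l) F)"
proof -
  let ?f = "lin_of_der \<Lambda> (alg (h \<circ> l) T) D0.KK (split_der \<Lambda> S T l h \<sigma>)"
  \<comment> \<open>Derivations of T over \<Lambda> are formed for this algebra record, so the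
    coefficients must be a module over it.\<close>
  have "module (alg (h \<circ> l) T) D0.KK"
    by (rule moduleI[OF _ D0.KM.abelian_group_axioms])
      (use D0.KM.smult_closed D0.KM.smult_l_distr D0.KM.smult_r_distr D0.KM.smult_assoc1 D0.KM.smult_one T.is_cring in auto)
  note f = B.K.lin_of_der[OF this split_der_Der]
  have fl: "linear T B.OW D0.KK ?f" using linmapsD(1)[OF f(1)] by (simp add: linear_def)
  note g = tensor_der_map[OF B.OW_module fl]
  have fc: "?f w \<in> carrier D0.JJ" if "w \<in> carrier B.OW" for w using addhom_closed[OF linear_addhom[OF fl] that] by (simp add: D0.KK_simps)
  have gl: "linear T AM OM (tensor_der_map \<Lambda> S T N l h ?f)"
    by (rule AM_linearI[OF OM_module]) (use g fc act_smult(2) in \<open>auto simp: OM_simps\<close>)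
  show ?thesis unfolding at(1) kappa_connection(1)[OF F]
    by (rule ext_res.ext_push_connection[OF at(3) _ OM_module gl at(2), symmetric])
      (use f(2) g(2) BN.dS_closed in \<open>auto simp: AM_simps ck_def split_der_eq\<close>)
qed

text \<open>Both classes have the defect X(t) n, where X is the derivation of T induced by Y: from
  D(\<sigma>)(t) n by contraction with Y, and from dt \<otimes> n by contraction with X.\<close>

lemma contract_kappa:
  assumes Y: "Y \<in> Der \<Lambda> (alg l S) (alg (\<lambda>s. s) S)"
  shows "X_der \<Lambda> S T l h \<sigma> Y \<in> Der \<Lambda> (alg (h \<circ> l) T) (alg (\<lambda>t. t) T)"
    and "ext_push 1 T F N (contract S NS (lin_of_der \<Lambda> (alg l S) (alg (\<lambda>s. s) S) Y)) (kappa \<Lambda> S T N l h \<sigma> F)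
       = ext_push 1 T F N (contract T N (lin_of_der \<Lambda> (alg (h \<circ> l) T) (alg (\<lambda>t. t) T) (X_der \<Lambda> S T l h \<sigma> Y))) (atiyah \<Lambda> T N (h \<circ> l) F)"
proof -
  let ?f = "lin_of_der \<Lambda> (alg l S) (alg (\<lambda>s. s) S) Y" and ?X = "X_der \<Lambda> S T l h \<sigma> Y"
  note f = lin_of_der_scalars[OF Y]
  have "ks_mod \<Lambda> S l (alg h T)" by (simp add: ks_mod_def ks_base_axioms alg_module[OF S.is_cring T.is_cring h])
  note CT = ks_mod.contract(1)[OF this f(1)]
  have a: "addhom D0.JJ T (contract S (alg h T) ?f)" using CT by (simp add: ungr_tensor)
  have Xe: "?X t = contract S (alg h T) ?f (Ds t)" if "t \<in> carrier T" for t using that by (simp add: X_der_def split_der_eq)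
  have Xa: "addhom T T ?X" by (rule addhom_cong[OF addhom_comp[OF Ds_addhom a] Xe T.is_abelian_group])
  have Xm: "?X (t \<otimes>\<^bsub>T\<^esub> t') = t \<otimes>\<^bsub>T\<^esub> ?X t' \<oplus>\<^bsub>T\<^esub> t' \<otimes>\<^bsub>T\<^esub> ?X t" if "t \<in> carrier T" "t' \<in> carrier T" for t t'
    using that Ds_closed D0.KK_sm contract_act(2)[OF f(1) _ N.zero_closed] by (simp add: Xe Ds_mult addhom_add[OF a])
  \<comment> \<open>Inherited from D(\<sigma>), which vanishes on the image of \<Lambda>.\<close>
  have X0: "?X (h (l r) \<otimes>\<^bsub>T\<^esub> \<one>\<^bsub>T\<^esub>) = \<zero>\<^bsub>T\<^esub>" if r: "r \<in> carrier \<Lambda>" for r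
  proof -
    have hl: "h (l r) \<in> carrier T" using h_closed ring_hom_closed[OF l r] .
    have "split_der \<Lambda> S T l h \<sigma> (h (l r) \<otimes>\<^bsub>T\<^esub> \<one>\<^bsub>T\<^esub>) = \<zero>\<^bsub>D0.JJ\<^esub>"
      using split_der_Der r by (simp add: Der_def D0.KK_simps)
    then show ?thesis using addhom_zero[OF D0.JG.abelian_group_axioms T.is_abelian_group a] hl by (simp add: X_der_def)
  qed
  show X: "?X \<in> Der \<Lambda> (alg (h \<circ> l) T) (alg (\<lambda>t. t) T)"
    unfolding Der_def using addhom_closed[OF Xa] addhom_add[OF Xa] Xm X0 by (auto simp: X_der_def)
  note fX = B.lin_of_der_scalars[OF X] and g = BN.contract[OF B.lin_of_der_scalars(1)[OF X]]
  let ?fX = "lin_of_der \<Lambda> (alg (h \<circ> l) T) (alg (\<lambda>t. t) T) ?X"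
  have fc: "?fX w \<in> carrier T" if "w \<in> carrier B.OW" for w using addhom_closed[OF linear_addhom[OF fX(1)] that] by simp
  have gl: "linear T AM N (contract T N ?fX)"
    by (rule AM_linearI[OF N.module_axioms]) (use g fc in \<open>auto simp: N.smult_assoc1[symmetric] T.m_comm\<close>)
  have kl: "linear T OM N (contract S NS ?f)"
    by (rule linearI) (use M1.contract(1)[OF f(1)] contract_act(1)[OF f(1) _ N.zero_closed] in \<open>auto simp: OM_simps\<close>)
  have "ext_push 1 T F N (contract S NS ?f) (kappa \<Lambda> S T N l h \<sigma> F) = connection_cocycles T F N (\<lambda>t n. ?X t \<odot>\<^bsub>N\<^esub> n)"
    unfolding kappa_connection(1)[OF F]
    by (rule X.ext_push_connection[OF ck_closed N.module_axioms kl kappa_connection(2)[OF F]])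
      (use contract_act(3)[OF f(1)] Ds_closed Xe in \<open>auto simp: ck_def\<close>)
  moreover have "ext_push 1 T F N (contract T N ?fX) (atiyah \<Lambda> T N (h \<circ> l) F) = connection_cocycles T F N (\<lambda>t n. ?X t \<odot>\<^bsub>N\<^esub> n)"
    unfolding at(1) by (rule ext_res.ext_push_connection[OF at(3) _ N.module_axioms gl at(2)])
      (use fX(2) g(2) BN.dS_closed in \<open>auto simp: AM_simps\<close>)
  ultimately show "ext_push 1 T F N (contract S NS ?f) (kappa \<Lambda> S T N l h \<sigma> F) = ext_push 1 T F N (contract T N ?fX) (atiyah \<Lambda> T N (h \<circ> l) F)" by simp
qed

end
end

lemma ks_splitI: "ks_data \<Lambda> S T N l h ==> ks_setup \<Lambda> S l T N h"
  "ks_data \<Lambda> S T N l h ==> is_splitting \<Lambda> S T l h \<sigma> ==> ks_split \<Lambda> S l T N h \<sigma>"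
  by (simp_all add: ks_data_def ks_split_def ks_split_axioms_def ks_setup_def ks_setup_axioms_def ks_base_def ks_base_axioms_def)

text \<open>Both sides belong to connections over T whose defect is that of the target evaluated at
  mT(t) and mN(n). Naturality is thereby reduced to that of D(\<sigma>).\<close>

lemma kappa_natural:
  fixes N :: "('t, 'n) module" and N' :: "('t1, 'n1) module"
  assumes data: "ks_data \<Lambda> S T N l h" "is_splitting \<Lambda> S T l h \<sigma>" "free_resolution T N F"
    and data': "ks_data \<Lambda>' S' T' N' l' h'" "is_splitting \<Lambda>' S' T' l' h' \<sigma>'" "free_resolution T' N' F'"
    and m: "ks_morphism \<Lambda> S T N l h \<sigma> \<Lambda>' S' T' N' l' h' \<sigma>' m\<Lambda> mS mT mN"
  shows "ext_push 1 T F (restr_scalars mT (Omega_mod \<Lambda>' S' l' h' N'))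
      (tmap S' (Omega \<Lambda>' (alg l' S')) (restr_scalars h' N') (pp_map \<Lambda>' (alg l' S') mS) mN) (kappa \<Lambda> S T N l h \<sigma> F)
    = ext_pull 1 T F F' (Omega_mod \<Lambda>' S' l' h' N') mT mN (kappa \<Lambda>' S' T' N' l' h' \<sigma>' F')"
proof -
  interpret A: ks_split \<Lambda> S l T N h \<sigma> by (rule ks_splitI(2)[OF data(1,2)])
  interpret B: ks_split \<Lambda>' S' l' T' N' h' \<sigma>' by (rule ks_splitI(2)[OF data'(1,2)])
  note mm = m[unfolded ks_morphism_def]
  have mL: "m\<Lambda> \<in> ring_hom \<Lambda> \<Lambda>'" and mS: "mS \<in> ring_hom S S'" and mT: "mT \<in> ring_hom T T'"
    and ml: "\<And>x. x \<in> carrier \<Lambda> ==> mS (l x) = l' (m\<Lambda> x)" and mh: "\<And>s. s \<in> carrier S ==> mT (h s) = h' (mS s)"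
    and mN: "linear T N (restr_scalars mT N') mN" using mm by auto
  let ?p = "pp_map \<Lambda>' (alg l' S') mS"
  let ?u = "tmap S' B.OW B.NS ?p mN" and ?v = "tmap S' B.OW B.TU ?p mT" and ?w = "tmap S' B.PR B.TU ?p mT"
  have ms: "\<sigma>' (mT t) = ?w (\<sigma> t)" if "t \<in> carrier T" for t using mm that by blast
  note mc = ring_hom_closed[OF mS] ring_hom_closed[OF mT]
  have Nc: "mN n \<in> carrier N'" if "n \<in> carrier N" for n using addhom_closed[OF linear_addhom[OF mN] that] by simp
  have Nm: "mN (t \<odot>\<^bsub>N\<^esub> n) = mT t \<odot>\<^bsub>N'\<^esub> mN n" if "t \<in> carrier T" "n \<in> carrier N" for t n using linear_smult[OF mN that] by simp
  have mSa: "mS \<in> ring_hom (alg l S) (alg l' S')" using mS by (simp add: ring_hom_def)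
  have sc: "m\<Lambda> r \<in> carrier \<Lambda>' \<and> mS (r \<odot>\<^bsub>alg l S\<^esub> s) = m\<Lambda> r \<odot>\<^bsub>alg l' S'\<^esub> mS s" if "r \<in> carrier \<Lambda>" "s \<in> carrier (alg l S)" for r s
    using that ring_hom_closed[OF mL] ring_hom_mult[OF mS] ring_hom_closed[OF A.l] ml by simp
  note p0 = pp_map[OF A.K.kahler_axioms B.K.kahler_axioms mSa, of m\<Lambda>] and pw0 = pp_map_Omega[OF A.K.kahler_axioms B.K.kahler_axioms mSa, of m\<Lambda>]
  have p: "?p \<in> ring_hom A.PP B.PP" "\<And>a. a \<in> carrier S ==> ?p (A.J2 a) = B.J2 (mS a)"
    "\<And>q. q \<in> carrier A.PP ==> B.eps (?p q) = mS (A.eps q)"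
    using p0(1,3,4) sc by simp_all
  have pw: "addhom A.OW B.OW ?p" "\<And>a w. a \<in> carrier S ==> w \<in> carrier A.OW ==> ?p (a \<odot>\<^bsub>A.OW\<^esub> w) = mS a \<odot>\<^bsub>B.OW\<^esub> ?p w"
    using pw0(1,2) sc by simp_all
  have pc: "?p q \<in> carrier B.PP" if "q \<in> carrier A.PP" for q using ring_hom_closed[OF p(1) that] .
  have wc: "?p w \<in> carrier B.OW" if "w \<in> carrier A.OW" for w using addhom_closed[OF pw(1) that] .
  \<comment> \<open>The induced map of principal parts respects j2 and the augmentation, hence the
    retraction onto \<Omega>.\<close>
  have po: "B.omega_part (?p q) = ?p (A.omega_part q)" if q: "q \<in> carrier A.PP" for q
  proof -
    have "?p (q \<ominus>\<^bsub>A.PP\<^esub> A.J2 (A.eps q)) = ?p q \<ominus>\<^bsub>B.PP\<^esub> B.J2 (mS (A.eps q))"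
      using addhom_minus[OF A.K.P.is_abelian_group B.K.P.is_abelian_group ring_hom_addhom[OF p(1)] q] A.K.J_closed(2)[of "A.eps q"] A.eps_simps(1)[OF q] p(2)[of "A.eps q"] by simp
    then show ?thesis using p(3)[OF q] by (simp add: A.omega_part_def B.omega_part_def)
  qed

  have ah: "addhom A.NS B.NS mN" "addhom A.TU B.TU mT" "addhom A.PR B.PR ?p"
    using linear_addhom[OF mN] ring_hom_addhom[OF mT] ring_hom_addhom[OF p(1)] by simp_all
  \<comment> \<open>Semilinearity along mS and commutation of mT with the structure maps h and h'
    give the balance conditions for the three induced maps.\<close>
  have bu: "B.M1.jt (?p (r \<odot>\<^bsub>A.OW\<^esub> w)) (mN n) = B.M1.jt (?p w) (mN (r \<odot>\<^bsub>A.NS\<^esub> n))" if "r \<in> carrier S" "w \<in> carrier A.OW" "n \<in> carrier A.NS" for r w n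
    using that pw(2)[of r w] wc Nc Nm[of "h r" n] mc mh B.M1.JT.tens_smult[of "mS r" "?p w" "mN n"] by simp
  note u0 = tmap_addhom[OF B.M1.JT.two_modules_axioms A.M1.JT.two_modules_axioms pw(1) ah(1)]
  have u: "addhom A.M1.JJ B.M1.JJ ?u"
    "\<And>m n. m \<in> carrier A.OW ==> n \<in> carrier A.NS ==> ?u (A.M1.jt m n) = B.M1.jt (?p m) (mN n)"
    by (rule u0(1), erule (2) bu) (rule u0(2), erule (2) bu)
  have bv: "B.D0.jt (?p (r \<odot>\<^bsub>A.OW\<^esub> w)) (mT t) = B.D0.jt (?p w) (mT (r \<odot>\<^bsub>A.TU\<^esub> t))" if "r \<in> carrier S" "w \<in> carrier A.OW" "t \<in> carrier A.TU" for r w t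
    using that pw(2)[of r w] wc mc mh ring_hom_mult[OF mT, of "h r" t] B.D0.JT.tens_smult[of "mS r" "?p w" "mT t"] by simp
  note v0 = tmap_addhom[OF B.D0.JT.two_modules_axioms A.D0.JT.two_modules_axioms pw(1) ah(2)]
  have v: "addhom A.D0.JJ B.D0.JJ ?v"
    "\<And>m n. m \<in> carrier A.OW ==> n \<in> carrier A.TU ==> ?v (A.D0.jt m n) = B.D0.jt (?p m) (mT n)"
    by (rule v0(1), erule (2) bv) (rule v0(2), erule (2) bv)
  have bw: "B.D0.et (?p (r \<odot>\<^bsub>A.PR\<^esub> w)) (mT t) = B.D0.et (?p w) (mT (r \<odot>\<^bsub>A.TU\<^esub> t))" if "r \<in> carrier S" "w \<in> carrier A.PR" "t \<in> carrier A.TU" for r w t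
    using that ring_hom_mult[OF p(1), of "A.J2 r" w] p(2)[of r] A.K.J_closed(2)[of r] pc mc mh ring_hom_mult[OF mT, of "h r" t] B.D0.ET.tens_smult[of "mS r" "?p w" "mT t"] by simp
  note w0 = tmap_addhom[OF B.D0.ET.two_modules_axioms A.D0.ET.two_modules_axioms ah(3,2)]
  have w: "addhom A.D0.EE B.D0.EE ?w"
    "\<And>m n. m \<in> carrier A.PR ==> n \<in> carrier A.TU ==> ?w (A.D0.et m n) = B.D0.et (?p m) (mT n)"
    by (rule w0(1), erule (2) bw) (rule w0(2), erule (2) bw)
  have ret: "B.D0.ret (?w x) = ?v (A.D0.ret x)" if "x \<in> carrier A.D0.EE" for x
  proof (rule A.D0.ET.addhom_tensor_eqI[OF addhom_comp[OF w(1) B.D0.ret_addhom] addhom_comp[OF A.D0.ret_addhom v(1)] that])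
    fix q t assume q: "q \<in> carrier A.PR" and t: "t \<in> carrier A.TU"
    then have q': "q \<in> carrier A.PP" by simp
    have "?p q \<in> carrier B.PP" "mT t \<in> carrier B.TU" using pc[OF q'] mc(2) t by simp_all
    then show "B.D0.ret (?w (A.D0.et q t)) = ?v (A.D0.ret (A.D0.et q t))"
      unfolding w(2)[OF q t] A.D0.ret_tens[OF q' t] v(2)[OF A.omega_part(1)[OF q'] t] po[OF q', symmetric] by (rule B.D0.ret_tens)
  qed
  \<comment> \<open>The morphism respects the splittings and the coordinate \<open>ret\<close>,
    hence the derivations.\<close>
  have Ds: "B.Ds (mT t) = ?v (A.Ds t)" if t: "t \<in> carrier T" for t
    using addhom_neg[OF A.D0.JG.abelian_group_axioms B.D0.JG.abelian_group_axioms v(1) A.D0.ks_closed(3)[OF A.\<sigma>_closed[OF t]]]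
      ms[OF t] ret[OF A.\<sigma>_closed[OF t]] by (simp add: A.Ds_def B.Ds_def)
  have act: "?u (A.act y n) = B.act (?v y) (mN n)" if n: "n \<in> carrier N" and y: "y \<in> carrier A.D0.JJ" for y n
    by (rule A.D0.JT.addhom_tensor_eqI[OF addhom_comp[OF A.act_addhom[OF n] u(1)] addhom_comp[OF v(1) B.act_addhom[OF Nc[OF n]]] y])
      (use n u(2) v(2) mc wc Nc Nm in \<open>auto simp: A.act_tens B.act_tens\<close>)
  have rm: "module T (restr_scalars mT B.OM)" by (rule restr_scalars_module[OF A.T.is_cring B.OM_module mT])
  have ul: "linear T A.OM (restr_scalars mT B.OM) ?u"
  proof (rule linearI)
    show "addhom A.OM (restr_scalars mT B.OM) ?u" using u(1) by (simp add: A.OM_simps B.OM_simps)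
    fix t x assume t: "t \<in> carrier T" and "x \<in> carrier A.OM"
    then have "x \<in> carrier A.M1.JJ" by (simp add: A.OM_simps)
    then show "?u (t \<odot>\<^bsub>A.OM\<^esub> x) = t \<odot>\<^bsub>restr_scalars mT B.OM\<^esub> ?u x"
    proof (induction rule: A.M1.JT.tensor_induct)
      case (tens w n) then show ?case using t u(2) wc Nc Nm mc A.OM_tens[of t w n] B.OM_tens[of "mT t" "?p w" "mN n"] by simp
    next
      case (add x y) then show ?case using t mc A.OM_sm[of t] B.OM_sm[of "mT t"] addhom_closed[OF u(1)] by (simp add: addhom_add[OF u(1)])
    qed
  qed
  have x: "ext_res T A.OM N F" "ext_res T N N F" "ext_res T' B.OM N' F'"
    using data(3) data'(3) by (simp_all add: ext_res_def ext_res_axioms_def A.OM_module B.OM_module A.N.module_axioms B.N.module_axioms)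
  have "ext_push 1 T F (restr_scalars mT B.OM) ?u (kappa \<Lambda> S T N l h \<sigma> F) = connection_cocycles T F (restr_scalars mT B.OM) (\<lambda>t n. B.ck (mT t) (mN n))"
    unfolding A.kappa_connection(1)[OF data(3)]
    by (rule ext_res.ext_push_connection[OF x(1) A.ck_closed rm ul A.kappa_connection(2)[OF data(3)]])
      (use act Ds A.Ds_closed in \<open>auto simp: A.ck_def B.ck_def\<close>)
  also have "\<dots> = ext_pull 1 T F F' B.OM mT mN (kappa \<Lambda>' S' T' N' l' h' \<sigma>' F')"
    unfolding B.kappa_connection(1)[OF data'(3)]
    by (rule ext_pull_connection[OF mT x(2,3) mN B.kappa_connection(2)[OF data'(3)] B.ck_closed, symmetric])
  finally show ?thesis .
qed

theorem proposition12p2: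
  fixes \<Lambda> :: "'l ring" and S :: "'s ring" and T :: "'t ring" and N :: "('t, 'n) module"
    and l :: "'l \<Rightarrow> 's" and h :: "'s \<Rightarrow> 't"
    and Q :: "('s, 'q, 't) sres" and P :: "('s, 'p, 't \<times> 'n) sres"
    and R :: "('t, 'r, 't \<times> 'n) sres"
    and a :: "nat \<Rightarrow> 'q \<Rightarrow> 'p" and b :: "nat \<Rightarrow> 'p \<Rightarrow> 'r"
    and F :: "('t, 'f, 'n) fres"
  assumes data: "ks_data \<Lambda> S T N l h"
    and resolution_T: "sres_of S (ungr (alg h T)) Q" "concentrated Q"
    and resolution_Gam: "sres_of S (Gam h T N) P"
    and resolution_rel: "sres_of T (Gam (\<lambda>t. t) T N) R"
    and transitivity_a: "sres_map S Q P (\<lambda>s. s) (in0 N) a"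
    and transitivity_b: "sres_map S P R h (\<lambda>g. g) b"
    and resolution_N: "free_resolution T N F"
  shows
    \<comment> \<open>(i)\<close>
    "KS_class \<Lambda> S l (Gam h T N) P
       \<in> carrier (AQ 1 S P (Gam h T N) (ks_ker \<Lambda> S l (Gam h T N)))
     \<and> KS_class \<Lambda> S l (ungr (alg h T)) Q
       \<in> carrier (AQ 1 S Q (ungr (alg h T)) (ks_ker \<Lambda> S l (ungr (alg h T))))
     \<and> trans_i 1 S T N h Q P a (ks_ker \<Lambda> S l (ungr (alg h T))) (Omega_in0 \<Lambda> S l h T N)
          (KS_class \<Lambda> S l (Gam h T N) P)
        = KS_class \<Lambda> S l (ungr (alg h T)) Q
     \<and> (KS_class \<Lambda> S l (ungr (alg h T)) Q
          = \<one>\<^bsub>AQ 1 S Q (ungr (alg h T)) (ks_ker \<Lambda> S l (ungr (alg h T)))\<^esub> \<longrightarrow>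
        (\<exists>\<sigma>. is_splitting \<Lambda> S T l h \<sigma>) \<and>
        (\<forall>\<sigma>. is_splitting \<Lambda> S T l h \<sigma> \<longrightarrow>
          \<comment> \<open>(ii)\<close>
          kappa \<Lambda> S T N l h \<sigma> F \<in> carrier (Ext 1 T F (Omega_mod \<Lambda> S l h N))
          \<and> trans_u 1 S T N h F P R b (ks_ker \<Lambda> S l (Gam h T N)) (Omega_in1 \<Lambda> S l h T N)
               (kappa \<Lambda> S T N l h \<sigma> F)
             = KS_class \<Lambda> S l (Gam h T N) P
          \<and> bij_betw (tmap S (pp_right \<Lambda> (alg l S)) (Gam h T N) (\<lambda>p. p) (in1 T))
               (carrier (tensor S (pp_right \<Lambda> (alg l S)) (restr_scalars h N)))
               (carrier (deg1_mod \<Lambda> S T N l h \<sigma>))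
          \<and> short_exact T (Omega_mod \<Lambda> S l h N) (deg1_mod \<Lambda> S T N l h \<sigma>) N
               (deg1_incl \<Lambda> S T N l h) (deg1_proj S T N h)
          \<and> kappa \<Lambda> S T N l h \<sigma> F
             = ses_class T F (Omega_mod \<Lambda> S l h N) (deg1_mod \<Lambda> S T N l h \<sigma>)
                 (deg1_incl \<Lambda> S T N l h) (deg1_proj S T N h)
          \<and> (\<forall>(\<Lambda>' :: 'l1 ring) (S' :: 's1 ring) (T' :: 't1 ring) (N' :: ('t1, 'n1) module)
                l' h' \<sigma>' (F' :: ('t1, 'f1, 'n1) fres) m\<Lambda> mS mT mN.
               ks_data \<Lambda>' S' T' N' l' h' \<and> is_splitting \<Lambda>' S' T' l' h' \<sigma>' \<and>
               free_resolution T' N' F' \<and>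
               ks_morphism \<Lambda> S T N l h \<sigma> \<Lambda>' S' T' N' l' h' \<sigma>' m\<Lambda> mS mT mN \<longrightarrow>
               ext_push 1 T F (restr_scalars mT (Omega_mod \<Lambda>' S' l' h' N'))
                   (tmap S' (Omega \<Lambda>' (alg l' S')) (restr_scalars h' N')
                      (pp_map \<Lambda>' (alg l' S') mS) mN)
                   (kappa \<Lambda> S T N l h \<sigma> F)
                 = ext_pull 1 T F F' (Omega_mod \<Lambda>' S' l' h' N') mT mN
                     (kappa \<Lambda>' S' T' N' l' h' \<sigma>' F'))
          \<comment> \<open>(iii)\<close>
          \<and> split_der \<Lambda> S T l h \<sigma>
             \<in> Der \<Lambda> (alg (h \<circ> l) T) (ks_ker \<Lambda> S l (ungr (alg h T)))
          \<and> kappa \<Lambda> S T N l h \<sigma> F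
             = ext_push 1 T F (Omega_mod \<Lambda> S l h N)
                 (tensor_der_map \<Lambda> S T N l h
                    (lin_of_der \<Lambda> (alg (h \<circ> l) T) (ks_ker \<Lambda> S l (ungr (alg h T)))
                       (split_der \<Lambda> S T l h \<sigma>)))
                 (atiyah \<Lambda> T N (h \<circ> l) F)
          \<and> (\<forall>Y \<in> Der \<Lambda> (alg l S) (alg (\<lambda>s. s) S).
               X_der \<Lambda> S T l h \<sigma> Y \<in> Der \<Lambda> (alg (h \<circ> l) T) (alg (\<lambda>t. t) T)
               \<and> ext_push 1 T F N
                   (contract S (restr_scalars h N)
                      (lin_of_der \<Lambda> (alg l S) (alg (\<lambda>s. s) S) Y))
                   (kappa \<Lambda> S T N l h \<sigma> F)
                 = ext_push 1 T F N
                   (contract T N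
                      (lin_of_der \<Lambda> (alg (h \<circ> l) T) (alg (\<lambda>t. t) T) (X_der \<Lambda> S T l h \<sigma> Y)))
                   (atiyah \<Lambda> T N (h \<circ> l) F))))"
proof -
  interpret A: ks_setup \<Lambda> S l T N h by (rule ks_splitI(1)[OF data])
  interpret Q: ks_res \<Lambda> S l A.TU Q
    by (simp add: ks_res_def ks_res_axioms_def A.D0.ks_data_alg_axioms resolution_T)
  interpret P: ks_res \<Lambda> S l A.GG P
    by (simp add: ks_res_def ks_res_axioms_def A.D1.ks_data_alg_axioms resolution_Gam)
  note K = ks_splitI(2)[OF data]
  \<comment> \<open>\<open>kappa_def\<close> answers the clause that exhibits the representing
    sequence; exactness of that sequence comes from \<open>kappa_connection\<close>.\<close>
  note facts = P.KS_class_carrier Q.KS_class_carrier A.trans_i_KS_class[OF resolution_T resolution_Gam transitivity_a]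
    A.splitting_exists[OF resolution_T] kappa_def ks_split.kappa_carrier[OF K]
    ks_split.trans_u_kappa[OF K _ resolution_Gam resolution_rel transitivity_b] ks_split.deg1_bij[OF K, unfolded A.e1_def]
    ks_split.kappa_connection(3)[OF K] ks_split.split_der_Der[OF K] ks_split.kappa_atiyah[OF K] ks_split.contract_kappa[OF K] resolution_N
  show ?thesis
    by (intro conjI impI allI ballI) (rule facts | assumption | (elim conjE, rule kappa_natural[OF data _ resolution_N]))+
qed

end
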